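(* It holds almost surely that $\mathcal{R}(T)=\tilde{\mathcal{O}}(\sqrt{T})$; that is, almost surely there is some $\alpha>0$ with $$\limsup_{T\to\infty}\frac{\mathcal{R}(T)}{\sqrt{T}\,(\log T)^{\alpha}}<\infty .$$
   Context: Notation. $\log$ is the natural logarithm; $\mathbb{N}^*=\{1,2,\dots\}$; $\|\cdot\|$ is the Euclidean norm of vectors and the induced 2-norm of matrices; $\rho(M)$ is the spectral radius of $M$; $M^\dagger$ is the Moore–Penrose inverse. $f(T)=\mathcal{O}(g(T))$ means $\limsup_{T\to\infty}f(T)/g(T)<\infty$, and $f(T)=\tilde{\mathcal{O}}(g(T))$ means $f(T)=\mathcal{O}(g(T)(\log T)^\alpha)$ for some $\alpha>0$. System. Fix $n,m\ge 1$, $A\in\mathbb{R}^{n\times n}$, $B\in\mathbb{R}^{n\times m}$ with $(A,B)$ controllable and $\rho(A)<1$, and symmetric positive definite $Q\in\mathbb{R}^{n\times n}$, $R\in\mathbb{R}^{m\times m}$. The state evolves as $x_{k+1}=Ax_k+Bu_k+w_k$, $k\in\mathbb{N}^*$, $x_1=0$, with $w_k$ i.i.d. $\mathcal{N}(0,I_n)$. $P^*$ is the positive definite solution of the Riccati equation $P^*=A^\top P^*A-A^\top P^*B(R+B^\top P^*B)^{-1}B^\top P^*A+Q$, $K^*=-(R+B^\top P^*B)^{-1}B^\top P^*A$, and $J^*=\operatorname{tr}(P^* )$ is the optimal average cost. Controller. Let $v_k$ be i.i.d. $\mathcal{N}(0,I_m)$, independent of $\{w_k\}$. Put $z_k=[x_k^\top\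 u_k^\top]^\top$. A counter $\xi$ is initialized at $0$. At each step $k=1,2,\dots$: (i) $\hat\Theta_k=[\hat A_k\ \ \hat B_k]=\left(\sum_{t=1}^{k-2}x_{t+1}z_t^\top\right)\left(\sum_{t=1}^{k-2}z_tz_t^\top\right)^\dagger$; (ii) if $(\hat A_k,\hat B_k)$ is stabilizable, $\hat K_k$ is given by the formulas for $K^*$, $P^*$ with $(A,B)$ replaced by $(\hat A_k,\hat B_k)$; otherwise $\hat K_k=0$; (iii) $u_k^{ce}=\hat K_kx_k$; (iv) let $M_k=\log(k)$, $t_k=\lfloor\log(k)\rfloor$. If $\xi=0$: if $\max\{\|u_k^{ce}\|,\|\hat K_k\|\}>M_k$, set $\xi\leftarrow t_k$ and $u_k^{cb}=0$; else set $u_k^{cb}=u_k^{ce}$. If $\xi\ne0$: set $u_k^{cb}=0$ and $\xi\leftarrow\xi-1$; (v) $u_k^{pr}=k^{-1/4}v_k$ and the applied input is $u_k=u_k^{cb}+u_k^{pr}$. Regret. $\mathcal{R}(T)=\sum_{k=1}^T(x_k^\top Qx_k+u_k^\top Ru_k)-TJ^*$ for the closed loop under this controller. *)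

theory Defs
  imports "HOL-Probability.Probability"
begin

text \<open>
  Matrices are elements of \<open>real^'c^'r\<close>. On this type \<open>norm\<close> is the Frobenius norm and
  \<open>*\<close>, \<open>^\<close>, \<open>1\<close> act entrywise; the induced 2-norm is therefore written with \<open>onorm\<close>, products
  with \<open>**\<close>, and powers by iterating \<open>\<lambda>X. A ** X\<close>.
\<close>

definition pos_def :: "real^'n^'n \<Rightarrow> bool" where
  "pos_def S \<longleftrightarrow> transpose S = S \<and> (\<forall>x. x \<noteq> 0 \<longrightarrow> x \<bullet> (S *v x) > 0)"

definition eigenvalues :: "real^'n^'n \<Rightarrow> complex set" where
  "eigenvalues A = {c. \<exists>x::complex^'n. x \<noteq> 0 \<and> map_matrix complex_of_real A *v x = c *s x}"

definition spectral_radius :: "real^'n^'n \<Rightarrow> real" where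
  "spectral_radius A = Max (cmod ` eigenvalues A)"

text \<open>Full rank of the matrix with block columns \<open>B, A B, \<dots>, A\<^sup>n\<^sup>-\<^sup>1 B\<close>, as a column rank.\<close>

definition controllable :: "real^'n^'n \<Rightarrow> real^'m^'n \<Rightarrow> bool" where
  "controllable A B \<longleftrightarrow>
     dim {column j (((\<lambda>X. A ** X) ^^ i) B) | i j. i < CARD('n)} = CARD('n)"

definition stabilizable :: "real^'n^'n \<Rightarrow> real^'m^'n \<Rightarrow> bool" where
  "stabilizable A B \<longleftrightarrow> (\<exists>K::real^'n^'m. spectral_radius (A + B ** K) < 1)"

text \<open>The four Penrose equations determine the pseudoinverse uniquely.\<close>

definition pseudoinverse :: "real^'c^'r \<Rightarrow> real^'r^'c" where
  "pseudoinverse M = (THE X. M ** X ** M = M \<and> X ** M ** X = X \<and>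
     transpose (M ** X) = M ** X \<and> transpose (X ** M) = X ** M)"

text \<open>
  For stabilizable \<open>(A, B)\<close> and positive definite \<open>Q\<close>, \<open>R\<close> the Riccati equation has exactly one
  positive definite solution.
\<close>

definition riccati_solution ::
    "real^'n^'n \<Rightarrow> real^'m^'n \<Rightarrow> real^'n^'n \<Rightarrow> real^'m^'m \<Rightarrow> real^'n^'n" where
  "riccati_solution A B Q R = (THE P. pos_def P \<and>
     P = transpose A ** P ** A
         - transpose A ** P ** B ** matrix_inv (R + transpose B ** P ** B) ** transpose B ** P ** A
         + Q)"

definition lqr_gain ::
    "real^'n^'n \<Rightarrow> real^'m^'n \<Rightarrow> real^'n^'n \<Rightarrow> real^'m^'m \<Rightarrow> real^'n^'m" where
  "lqr_gain A B Q R = (let P = riccati_solution A B Q R in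
     - (matrix_inv (R + transpose B ** P ** B) ** transpose B ** P ** A))"

definition lqr_cost ::
    "real^'n^'n \<Rightarrow> real^'m^'n \<Rightarrow> real^'n^'n \<Rightarrow> real^'m^'m \<Rightarrow> real" where
  "lqr_cost A B Q R = trace (riccati_solution A B Q R)"

definition stack :: "real^'n \<Rightarrow> real^'m \<Rightarrow> real^('n + 'm)" where
  "stack x u = (\<chi> i. case i of Inl a \<Rightarrow> x $ a | Inr b \<Rightarrow> u $ b)"

definition outer_product :: "real^'r \<Rightarrow> real^'c \<Rightarrow> real^'c^'r" where
  "outer_product a b = (\<chi> i j. a $ i * b $ j)"

text \<open>
  Below, \<open>x\<close> and \<open>u\<close> are whole trajectories, indexed from time \<open>1\<close>. The sums are empty for
  \<open>k \<le> 2\<close>, where \<open>k - 2\<close> truncates to \<open>0\<close>.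
\<close>

definition Theta_hat ::
    "(nat \<Rightarrow> real^'n) \<Rightarrow> (nat \<Rightarrow> real^'m) \<Rightarrow> nat \<Rightarrow> real^('n + 'm)^'n" where
  "Theta_hat x u k =
     (\<Sum>t = 1..k - 2. outer_product (x (t + 1)) (stack (x t) (u t))) **
     pseudoinverse
       (\<Sum>t = 1..k - 2. outer_product (stack (x t) (u t)) (stack (x t) (u t)))"

definition A_hat :: "(nat \<Rightarrow> real^'n) \<Rightarrow> (nat \<Rightarrow> real^'m) \<Rightarrow> nat \<Rightarrow> real^'n^'n" where
  "A_hat x u k = (\<chi> i j. Theta_hat x u k $ i $ Inl j)"

definition B_hat :: "(nat \<Rightarrow> real^'n) \<Rightarrow> (nat \<Rightarrow> real^'m) \<Rightarrow> nat \<Rightarrow> real^'m^'n" where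
  "B_hat x u k = (\<chi> i j. Theta_hat x u k $ i $ Inr j)"

definition K_hat ::
    "real^'n^'n \<Rightarrow> real^'m^'m \<Rightarrow> (nat \<Rightarrow> real^'n) \<Rightarrow> (nat \<Rightarrow> real^'m) \<Rightarrow> nat \<Rightarrow> real^'n^'m" where
  "K_hat Q R x u k =
     (if stabilizable (A_hat x u k) (B_hat x u k)
      then lqr_gain (A_hat x u k) (B_hat x u k) Q R else 0)"

definition u_ce ::
    "real^'n^'n \<Rightarrow> real^'m^'m \<Rightarrow> (nat \<Rightarrow> real^'n) \<Rightarrow> (nat \<Rightarrow> real^'m) \<Rightarrow> nat \<Rightarrow> real^'m" where
  "u_ce Q R x u k = K_hat Q R x u k *v x k"

definition breaker_trips ::
    "real^'n^'n \<Rightarrow> real^'m^'m \<Rightarrow> (nat \<Rightarrow> real^'n) \<Rightarrow> (nat \<Rightarrow> real^'m) \<Rightarrow> nat \<Rightarrow> bool" where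
  "breaker_trips Q R x u k \<longleftrightarrow>
     max (norm (u_ce Q R x u k)) (onorm (\<lambda>y. K_hat Q R x u k *v y)) > ln (real k)"

text \<open>
  \<open>xi k\<close> is the value of the counter at the beginning of step \<open>k\<close>. The quantities
  \<open>u_ce Q R x u k\<close> and \<open>breaker_trips Q R x u k\<close> depend only on \<open>x 1, \<dots>, x k\<close> and
  \<open>u 1, \<dots>, u (k - 2)\<close>, so these equations determine \<open>x\<close>, \<open>u\<close>, \<open>xi\<close> recursively at all
  times \<open>k \<ge> 1\<close> from the noise \<open>w\<close> and the probing signal \<open>v\<close>.
\<close>

definition closed_loop ::
    "real^'n^'n \<Rightarrow> real^'m^'n \<Rightarrow> real^'n^'n \<Rightarrow> real^'m^'m \<Rightarrow>
     (nat \<Rightarrow> real^'n) \<Rightarrow> (nat \<Rightarrow> real^'m) \<Rightarrow>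
     (nat \<Rightarrow> real^'n) \<Rightarrow> (nat \<Rightarrow> real^'m) \<Rightarrow> (nat \<Rightarrow> nat) \<Rightarrow> bool" where
  "closed_loop A B Q R w v x u xi \<longleftrightarrow>
     x 1 = 0 \<and> xi 1 = 0 \<and>
     (\<forall>k\<ge>1.
        x (k + 1) = A *v x k + B *v u k + w k \<and>
        xi (k + 1) =
          (if xi k = 0 then (if breaker_trips Q R x u k then nat \<lfloor>ln (real k)\<rfloor> else 0)
           else xi k - 1) \<and>
        u k =
          (if xi k = 0 \<and> \<not> breaker_trips Q R x u k then u_ce Q R x u k else 0)
          + (real k powr (- 1 / 4)) *\<^sub>R v k)"

definition regret ::
    "real^'n^'n \<Rightarrow> real^'m^'n \<Rightarrow> real^'n^'n \<Rightarrow> real^'m^'m \<Rightarrow>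
     (nat \<Rightarrow> real^'n) \<Rightarrow> (nat \<Rightarrow> real^'m) \<Rightarrow> nat \<Rightarrow> real" where
  "regret A B Q R x u T =
     (\<Sum>k = 1..T. x k \<bullet> (Q *v x k) + u k \<bullet> (R *v u k)) - real T * lqr_cost A B Q R"

definition std_gaussian_density :: "real^'n \<Rightarrow> real" where
  "std_gaussian_density y = exp (- (norm y)\<^sup>2 / 2) / sqrt (2 * pi) ^ CARD('n)"

definition (in prob_space) iid_std_gaussian :: "(nat \<Rightarrow> 'a \<Rightarrow> real^'n) \<Rightarrow> bool" where
  "iid_std_gaussian w \<longleftrightarrow>
     indep_vars (\<lambda>_. borel) w {1..} \<and>
     (\<forall>k\<ge>1. distributed M lborel (w k) (\<lambda>y. ennreal (std_gaussian_density y)))"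

text \<open>
  \<open>indep_var\<close> requires both random variables to have the same type, so independence is stated for
  the generated \<open>\<sigma>\<close>-algebras.
\<close>

definition (in prob_space) indep_processes ::
    "(nat \<Rightarrow> 'a \<Rightarrow> 'b::topological_space) \<Rightarrow> (nat \<Rightarrow> 'a \<Rightarrow> 'c::topological_space) \<Rightarrow> bool" where
  "indep_processes w v \<longleftrightarrow>
     indep_set
       (sets (vimage_algebra (space M) (\<lambda>\<omega>. \<lambda>k\<in>{1..}. w k \<omega>) (Pi\<^sub>M {1..} (\<lambda>_. borel))))
       (sets (vimage_algebra (space M) (\<lambda>\<omega>. \<lambda>k\<in>{1..}. v k \<omega>) (Pi\<^sub>M {1..} (\<lambda>_. borel))))"

text \<open>\<open>f = \<O>(g)\<close> here bounds \<open>f\<close> from above only; the limsup is taken in the extended reals.\<close>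

definition big_O :: "(nat \<Rightarrow> real) \<Rightarrow> (nat \<Rightarrow> real) \<Rightarrow> bool" where
  "big_O f g \<longleftrightarrow> limsup (\<lambda>T. ereal (f T / g T)) < \<infinity>"

definition soft_O :: "(nat \<Rightarrow> real) \<Rightarrow> (nat \<Rightarrow> real) \<Rightarrow> bool" where
  "soft_O f g \<longleftrightarrow> (\<exists>\<alpha>>0. big_O f (\<lambda>T. g T * ln (real T) powr \<alpha>))"

end

theory Submission
  imports Defs "HOL-Computational_Algebra.Fundamental_Theorem_Algebra" "HOL-Real_Asymp.Real_Asymp"
begin

text \<open>
  Completing the square in the Riccati equation writes the stage cost as a telescoping term in
  \<open>P\<^sup>*\<close>, plus \<open>2 w\<^sub>k \<bullet> P\<^sup>* (A x\<^sub>k + B u\<^sub>k)\<close>, plus \<open>w\<^sub>k \<bullet> P\<^sup>* w\<^sub>k\<close>, plus a quadratic form in the input error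
  \<open>u\<^sub>k - K\<^sup>* x\<^sub>k\<close>. The two noise terms are of order \<open>sqrt T\<close> up to logarithms, so the regret is governed by
  \<open>\<Sum>k. \<parallel>u\<^sub>k - K\<^sup>* x\<^sub>k\<parallel>\<^sup>2\<close>.

  The breaker keeps all inputs, hence all states, of order \<open>ln k\<close>. Exponential supermartingales for
  fixed directions, combined with a union bound over a polynomial lattice of directions, give a
  self-normalized bound on the noise-regressor correlations that is uniform over the unit ball. The same
  bound controls the cross terms in the Gram matrix, whose smallest eigenvalue is therefore at least of
  order \<open>sqrt T / (ln T)\<^sup>2\<close> because of the probing signal and the state noise. Hence the squared estimation
  error, and by Lipschitz dependence the squared gain error, is of order \<open>(ln k)\<^sup>3 / sqrt k\<close>.
  With accurate gains the breaker trips only finitely often, so eventually \<open>u\<^sub>k\<close> is the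
  certainty-equivalent input plus the probing signal and the input errors sum to order \<open>sqrt T\<close> up to
  logarithms.
\<close>

subsection \<open>Spectral radius and decay of powers\<close>

text \<open>Accurate estimates need bounded regressors, and bounded regressors seem to need accurate
  estimates. The circle is broken by the breaker: it alone, together with stability of
  \<open>A\<close>, gives the logarithmic growth bounds, whatever the estimates are. Each almost
  sure fact is an event failing with summable probability; once a fixed list of such facts is
  granted (\<open>lqr_good_path\<close>), everything concerns one trajectory. Independence needs
  care: the regressor at time \<open>t\<close> contains \<open>u t\<close>, hence
  \<open>v t\<close>, so the past against which \<open>w t\<close> is innovative must contain the
  probing signal. It may contain all of it, the two processes being independent; the mirrored choice
  serves the cross terms with \<open>v t\<close>. Under the product law of past and innovation, a
  supermartingale step is one exchange of nonnegative integrals. Adaptedness is a second obstacle: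
  pseudoinverse and Riccati solution are definite descriptions. Both are rewritten as limits of
  explicit measurable expressions. The logarithm ends with exponent 5: three from the squared gain
  error, two from the squared state.\<close>

lemma linear_relation_exists:
  fixes f :: "nat \<Rightarrow> 'a::euclidean_space"
  shows "\<exists>a::nat \<Rightarrow> real. (\<exists>i\<le>DIM('a). a i \<noteq> 0) \<and> (\<Sum>i\<le>DIM('a). a i *\<^sub>R f i) = 0"
proof (cases "inj_on f {..DIM('a)}")
  case True
  then have "card (f ` {..DIM('a)}) = Suc DIM('a)"
    by (simp add: card_image)
  then have "dependent (f ` {..DIM('a)})"
    by (intro dependent_biggerset) auto
  then obtain u where u: "\<exists>v\<in>f ` {..DIM('a)}. u v \<noteq> 0" "(\<Sum>v\<in>f ` {..DIM('a)}. u v *\<^sub>R v) = 0"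
    by (subst (asm) dependent_finite) auto
  have "(\<Sum>i\<le>DIM('a). u (f i) *\<^sub>R f i) = 0"
    using u(2) by (simp add: sum.reindex[OF True])
  then show ?thesis
    using u(1) by (intro exI[of _ "\<lambda>i. u (f i)"]) auto
next
  case False
  \<comment> \<open>A repeated value is a relation of the sequence even if its range is
    independent.\<close>
  then obtain i j where ij: "i \<le> DIM('a)" "j \<le> DIM('a)" "i \<noteq> j" "f i = f j"
    by (auto simp: inj_on_def)
  let ?a = "\<lambda>k. (if k = i then 1 else if k = j then -1 else 0) :: real"
  have "(\<Sum>k\<le>DIM('a). ?a k *\<^sub>R f k) = (\<Sum>k\<in>{i, j}. ?a k *\<^sub>R f k)"
    by (rule sum.mono_neutral_right) (use ij in auto)
  also have "\<dots> = 0"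
    using ij by simp
  finally show ?thesis
    using ij(1) by (intro exI[of _ ?a]) auto
qed

definition poly_apply :: "complex poly \<Rightarrow> (complex^'n \<Rightarrow> complex^'n) \<Rightarrow> complex^'n \<Rightarrow> complex^'n" where
  "poly_apply p f x = (\<Sum>i\<le>degree p. coeff p i *s (f ^^ i) x)"

lemma poly_apply_bound:
  assumes "degree p \<le> n"
  shows "poly_apply p f x = (\<Sum>i\<le>n. coeff p i *s (f ^^ i) x)"
  unfolding poly_apply_def
  by (rule sum.mono_neutral_left) (use assms in \<open>auto simp: coeff_eq_0\<close>)

lemma poly_apply_linear_factor:
  fixes M :: "complex^'n^'n"
  shows "poly_apply ([:- c, 1:] * q) ((*v) M) x
     = M *v poly_apply q ((*v) M) x - c *s poly_apply q ((*v) M) x"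
proof -
  let ?f = "(*v) M" and ?n = "degree q"
  have "degree ([:- c, 1:] * q) \<le> Suc ?n"
    by (rule order.trans[OF degree_mult_le]) simp
  then have "poly_apply ([:- c, 1:] * q) ?f x
      = (\<Sum>i\<le>Suc ?n. (coeff (pCons 0 q) i - c * coeff q i) *s (?f ^^ i) x)"
    by (subst poly_apply_bound) (auto intro!: sum.cong)
  also have "\<dots> = (\<Sum>i\<le>Suc ?n. coeff (pCons 0 q) i *s (?f ^^ i) x)
      - (\<Sum>i\<le>Suc ?n. (c * coeff q i) *s (?f ^^ i) x)"
    by (simp only: vector_sub_rdistrib sum_subtractf)
  also have "(\<Sum>i\<le>Suc ?n. coeff (pCons 0 q) i *s (?f ^^ i) x)
      = (\<Sum>i\<le>?n. coeff q i *s (M *v (?f ^^ i) x))"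
    by (subst sum.atMost_Suc_shift) simp
  also have "\<dots> = M *v poly_apply q ?f x"
    by (simp add: poly_apply_def vec.linear_sum vec.linear_scale vector_scalar_commute
        vec.sum)
  also have "(\<Sum>i\<le>Suc ?n. (c * coeff q i) *s (?f ^^ i) x) = c *s poly_apply q ?f x"
    unfolding poly_apply_bound[of q "Suc ?n", OF le_SucI[OF order_refl]] vector_smult_assoc[symmetric]
    by (rule vec.scale_sum_right[symmetric])
  finally show ?thesis .
qed

text \<open>One more power of \<open>M\<close> than the real dimension of the matrix space: these
  powers are linearly dependent, and the coefficients of the relation form \<open>p\<close>.\<close>

lemma annihilating_poly_exists:
  fixes M :: "complex^'n^'n"
  shows "\<exists>p. p \<noteq> 0 \<and> (\<forall>x. poly_apply p ((*v) M) x = 0)"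
proof -
  let ?F = "\<lambda>i. (((**) M) ^^ i) (mat 1)" and ?N = "DIM(complex^'n^'n)"
  have pow: "?F i *v x = (((*v) M) ^^ i) x" for i x
    by (induction i) (auto simp: matrix_vector_mul_assoc[symmetric])
  obtain a :: "nat \<Rightarrow> real" where a: "\<exists>i\<le>?N. a i \<noteq> 0" "(\<Sum>i\<le>?N. a i *\<^sub>R ?F i) = 0"
    using linear_relation_exists[of ?F] by auto
  define p :: "complex poly" where "p = (\<Sum>i\<le>?N. monom (of_real (a i)) i)"
  have cp: "coeff p i = (if i \<le> ?N then of_real (a i) else 0)" for i
    unfolding p_def coeff_sum coeff_monom by (subst sum.delta) auto
  have "p \<noteq> 0"
    using a(1) cp by (metis coeff_0 of_real_eq_0_iff)
  moreover have "poly_apply p ((*v) M) x = 0" for x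
  proof -
    have deg: "degree p \<le> ?N"
      by (rule degree_le) (simp add: cp)
    have sc: "(r *\<^sub>R X) *v x = complex_of_real r *s (X *v x)" for r and X :: "complex^'n^'n"
      by (simp add: vec_eq_iff matrix_vector_mult_def sum_distrib_left mult.assoc scaleR_conv_of_real[symmetric] scaleR_sum_right)
    have sm: "(\<Sum>i\<le>k. a i *\<^sub>R ?F i) *v x = (\<Sum>i\<le>k. complex_of_real (a i) *s (?F i *v x))" for k
      by (induction k) (auto simp: matrix_vector_mult_add_rdistrib sc)
    have "poly_apply p ((*v) M) x = (\<Sum>i\<le>?N. complex_of_real (a i) *s (?F i *v x))"
      by (subst poly_apply_bound[OF deg]) (auto simp: cp pow intro!: sum.cong)
    also have "\<dots> = 0"
      using a(2) sm[of ?N] by simp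
    finally show ?thesis .
  qed
  ultimately show ?thesis by blast
qed

text \<open>Splits off one linear factor at a time by the fundamental theorem of algebra. Taken with
  \<open>S = {0}\<close> it produces eigenvalues; taken with the vectors whose orbit tends to 0 it
  does the work of a Jordan decomposition.\<close>

lemma poly_apply_descent:
  fixes M :: "complex^'n^'n"
  assumes scale: "\<And>c x. x \<in> S \<Longrightarrow> c *s x \<in> S"
    and closed: "\<And>c y. M *v y - c *s y \<in> S \<Longrightarrow> y \<in> S"
    and "p \<noteq> 0" "poly_apply p ((*v) M) x \<in> S"
  shows "x \<in> S"
  using assms(3,4)
proof (induction "degree p" arbitrary: p)
  case 0
  then obtain a where a: "p = [:a:]" "a \<noteq> 0"
    by (metis degree_eq_zeroE pCons_0_0)
  then have "a *s x \<in> S"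
    using 0 by (simp add: poly_apply_def)
  then have "inverse a *s (a *s x) \<in> S"
    by (rule scale)
  then show ?case
    using a by (simp add: vector_smult_assoc)
next
  case (Suc n)
  then have "\<not> constant (poly p)"
    by (simp add: constant_degree)
  then obtain c where "poly p c = 0"
    using fundamental_theorem_of_algebra by blast
  then obtain q where q: "p = [:- c, 1:] * q"
    by (auto simp: poly_eq_0_iff_dvd elim: dvdE)
  then have "q \<noteq> 0" using Suc by auto
  have "degree p = 1 + degree q"
    unfolding q using \<open>q \<noteq> 0\<close> by (subst degree_mult_eq) auto
  moreover have "poly_apply q ((*v) M) x \<in> S"
    using Suc(4) unfolding q poly_apply_linear_factor by (rule closed)
  ultimately show ?case
    using Suc \<open>q \<noteq> 0\<close> by auto
qed

abbreviation complexify :: "real^'n^'n \<Rightarrow> complex^'n^'n" where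
  "complexify A \<equiv> map_matrix complex_of_real A"

text \<open>\<open>spectral_radius\<close> is a \<open>Max\<close>, so it is meaningful only for a
  finite nonempty set. If no factor \<open>M - c\<close> had a kernel, descent with
  \<open>S = {0}\<close> would make every vector 0.\<close>

lemma eigenvalues_nonempty:
  fixes A :: "real^'n^'n"
  shows "eigenvalues A \<noteq> {}"
proof
  assume empty: "eigenvalues A = {}"
  obtain p where p: "p \<noteq> 0" "\<forall>x. poly_apply p ((*v) (complexify A)) x = 0"
    using annihilating_poly_exists[of "complexify A"] by auto
  have "axis undefined 1 \<in> {0 :: complex^'n}"
  proof (rule poly_apply_descent[OF _ _ p(1)])
    fix c y assume "complexify A *v y - c *s y \<in> {0}"
    then show "y \<in> {0}"
      using empty by (auto simp: eigenvalues_def)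
  qed (use p(2) in auto)
  then show False by simp
qed

lemma eigenvalues_finite:
  fixes A :: "real^'n^'n"
  shows "finite (eigenvalues A)"
proof -
  obtain p where p: "p \<noteq> 0" "\<forall>x. poly_apply p ((*v) (complexify A)) x = 0"
    using annihilating_poly_exists[of "complexify A"] by auto
  have "eigenvalues A \<subseteq> {c. poly p c = 0}"
  proof
    fix c assume "c \<in> eigenvalues A"
    then obtain x :: "complex^'n" where x: "x \<noteq> 0" "complexify A *v x = c *s x"
      by (auto simp: eigenvalues_def)
    have "((*v) (complexify A) ^^ i) x = (c ^ i) *s x" for i
      by (induction i) (auto simp: x vector_scalar_commute vector_smult_assoc mult.commute)
    then have "poly_apply p ((*v) (complexify A)) x = (\<Sum>i\<le>degree p. (coeff p i * c ^ i) *s x)"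
      by (simp add: poly_apply_def vector_smult_assoc)
    also have "\<dots> = poly p c *s x"
      by (simp add: poly_altdef vec.scale_sum_left)
    finally show "c \<in> {c. poly p c = 0}"
      using p x by simp
  qed
  then show ?thesis
    using poly_roots_finite[OF p(1)] finite_subset by blast
qed

lemma spectral_radius_less_iff: "spectral_radius A < r \<longleftrightarrow> (\<forall>c\<in>eigenvalues A. cmod c < r)"
  unfolding spectral_radius_def
  by (subst Max_less_iff) (auto simp: eigenvalues_finite eigenvalues_nonempty)

lemma affine_recursion_tendsto_0:
  fixes s e :: "nat \<Rightarrow> 'a::real_normed_vector"
  assumes "0 \<le> r" "r < 1" and rec: "\<And>k. norm (s (Suc k)) \<le> r * norm (s k) + e' k"
    and e: "e' \<longlonglongrightarrow> 0"
  shows "s \<longlonglongrightarrow> 0"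
proof (rule LIMSEQ_I)
  fix \<epsilon> :: real assume "\<epsilon> > 0"
  \<comment> \<open>Chosen so that \<open>\<epsilon> / 2\<close> is the fixed point of the map
    sending \<open>s\<close> to \<open>r * s + \<delta>\<close>.\<close>
  define \<delta> where "\<delta> = (1 - r) * (\<epsilon> / 2)"
  have "\<delta> > 0" using \<open>\<epsilon> > 0\<close> assms by (simp add: \<delta>_def)
  then obtain K where K: "\<And>k. k \<ge> K \<Longrightarrow> e' k < \<delta>"
    using order_tendstoD(2)[OF e \<open>\<delta> > 0\<close>] by (auto simp: eventually_sequentially)
  have step: "norm (s (K + j)) \<le> r ^ j * norm (s K) + \<epsilon> / 2" for j
  proof (induction j)
    case 0 then show ?case using \<open>\<epsilon> > 0\<close> by simp
  next
    case (Suc j)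
    have "norm (s (K + Suc j)) \<le> r * norm (s (K + j)) + e' (K + j)"
      using rec[of "K + j"] by simp
    also have "\<dots> \<le> r * (r ^ j * norm (s K) + \<epsilon> / 2) + \<delta>"
      using K[of "K + j"] Suc assms by (intro add_mono mult_left_mono) auto
    also have "\<dots> = r ^ Suc j * norm (s K) + \<epsilon> / 2"
      by (simp add: \<delta>_def field_simps)
    finally show ?case .
  qed
  have "(\<lambda>j. r ^ j * norm (s K)) \<longlonglongrightarrow> 0"
    using assms by (intro tendsto_mult_left_zero LIMSEQ_realpow_zero) auto
  then obtain J where J: "\<And>j. j \<ge> J \<Longrightarrow> r ^ j * norm (s K) < \<epsilon> / 2"
    using order_tendstoD(2)[of _ 0 sequentially "\<epsilon> / 2"] \<open>\<epsilon> > 0\<close>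
    by (auto simp: eventually_sequentially)
  show "\<exists>n0. \<forall>n\<ge>n0. norm (s n - 0) < \<epsilon>"
  proof (intro exI allI impI)
    fix n assume "n \<ge> K + J"
    then obtain j where j: "n = K + j" "j \<ge> J"
      using that[of "n - K"] by simp
    then show "norm (s n - 0) < \<epsilon>"
      using step[of j] J[of j] by simp
  qed
qed

lemma norm_vector_smult_complex: "norm (c *s (x :: complex^'n)) = cmod c * norm x"
  by (simp add: norm_vec_def L2_set_def norm_mult power_mult_distrib flip: sum_distrib_left)
     (simp add: real_sqrt_mult)

lemma linear_complex_mult_vec: "linear ((*v) (M :: complex^'n^'n))"
proof (rule linearI)
  show "M *v (r *\<^sub>R x) = r *\<^sub>R (M *v x)" for r x
    by (simp add: vec_eq_iff matrix_vector_mult_def scaleR_sum_right)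
qed (simp add: matrix_vector_right_distrib)

lemma linear_complex_smult: "linear (\<lambda>x. c *s (x :: complex^'n))"
proof (rule linearI)
  show "c *s (r *\<^sub>R x) = r *\<^sub>R (c *s x)" for r x
    by (simp add: vec_eq_iff)
qed (simp add: vector_add_ldistrib)

text \<open>By descent it suffices that \<open>M y - c y\<close> in \<open>S\<close> forces
  \<open>y\<close> in \<open>S\<close>. If \<open>c\<close> is an eigenvalue, its modulus is below 1
  and the orbit of \<open>y\<close> solves a contracting recursion with vanishing input. Otherwise
  \<open>M - c\<close> is injective, so it maps the invariant finite-dimensional subspace
  \<open>S\<close> onto itself, and the preimage of \<open>M y - c y\<close> in \<open>S\<close> can
  only be \<open>y\<close>.\<close>

lemma complex_powers_tendsto_0:
  fixes M :: "complex^'n^'n"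
  assumes ev: "\<And>c x. x \<noteq> 0 \<Longrightarrow> M *v x = c *s x \<Longrightarrow> cmod c < 1"
  shows "(\<lambda>k. ((*v) M ^^ k) x) \<longlonglongrightarrow> 0"
proof -
  define S where "S = {x. (\<lambda>k. ((*v) M ^^ k) x) \<longlonglongrightarrow> 0}"
  have powadd: "((*v) M ^^ k) (x + y) = ((*v) M ^^ k) x + ((*v) M ^^ k) y" for k x y
    by (induction k) (auto simp: matrix_vector_right_distrib)
  have powscale: "((*v) M ^^ k) (c *s x) = c *s ((*v) M ^^ k) x" for k x c
    by (induction k) (auto simp: vector_scalar_commute)
  have S0: "0 \<in> S"
  proof -
    have "((*v) M ^^ k) 0 = 0" for k by (induction k) auto
    then show ?thesis by (simp add: S_def)
  qed
  have Sadd: "x + y \<in> S" if "x \<in> S" "y \<in> S" for x y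
    using that tendsto_add[of _ 0 _ _ 0] by (fastforce simp: S_def powadd)
  have Sscale: "c *s x \<in> S" if "x \<in> S" for c x
  proof -
    have "(\<lambda>k. cmod c * norm (((*v) M ^^ k) x)) \<longlonglongrightarrow> 0"
      using that by (intro tendsto_mult_right_zero tendsto_norm_zero) (simp add: S_def)
    then show ?thesis
      by (simp add: S_def powscale tendsto_norm_zero_iff[symmetric, where f = "\<lambda>k. c *s ((*v) M ^^ k) x"]
          norm_vector_smult_complex)
  qed
  have sub: "subspace S"
  proof (rule subspaceI)
    fix r :: real and x assume "x \<in> S"
    then have "of_real r *s x \<in> S" by (rule Sscale)
    moreover have "of_real r *s x = r *\<^sub>R x"
      by (simp add: vec_eq_iff scaleR_conv_of_real[where 'a = complex])
    ultimately show "r *\<^sub>R x \<in> S" by simp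
  qed (auto intro: S0 Sadd)
  have SM: "M *v x \<in> S" if "x \<in> S" for x
  proof -
    have "((*v) M ^^ k) (M *v x) = ((*v) M ^^ Suc k) x" for k
      by (simp only: funpow_Suc_right o_apply)
    then show ?thesis
      using LIMSEQ_Suc[OF that[unfolded S_def mem_Collect_eq]] unfolding S_def by simp
  qed
  have closed: "y \<in> S" if y: "M *v y - c *s y \<in> S" for c y
  proof (cases "\<exists>x. x \<noteq> 0 \<and> M *v x = c *s x")
    case True
    then have c: "cmod c < 1" using ev by auto
    have rec: "((*v) M ^^ Suc k) y = c *s ((*v) M ^^ k) y + ((*v) M ^^ k) (M *v y - c *s y)" for k
    proof -
      have "((*v) M ^^ Suc k) y = ((*v) M ^^ k) (M *v y)"
        by (simp only: funpow_Suc_right o_apply)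
      also have "\<dots> = ((*v) M ^^ k) (c *s y + (M *v y - c *s y))" by simp
      finally show ?thesis by (simp only: powadd powscale)
    qed
    have "(\<lambda>k. ((*v) M ^^ k) y) \<longlonglongrightarrow> 0"
    proof (rule affine_recursion_tendsto_0[of "cmod c"])
      show "norm (((*v) M ^^ Suc k) y) \<le> cmod c * norm (((*v) M ^^ k) y)
          + norm (((*v) M ^^ k) (M *v y - c *s y))" for k
        unfolding rec by (rule order.trans[OF norm_triangle_ineq]) (simp add: norm_vector_smult_complex)
      show "(\<lambda>k. norm (((*v) M ^^ k) (M *v y - c *s y))) \<longlonglongrightarrow> 0"
        using y by (intro tendsto_norm_zero) (simp add: S_def)
    qed (use c in auto)
    then show ?thesis by (simp add: S_def)
  next
    case False
    let ?g = "\<lambda>x. M *v x - c *s x"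
    have lin: "linear ?g"
      by (intro linear_compose_sub linear_complex_mult_vec linear_complex_smult)
    have inj: "inj ?g"
      using False by (subst linear_injective_0[OF lin]) auto
    have "?g ` S \<subseteq> S"
    proof
      fix z assume "z \<in> ?g ` S"
      then obtain s where s: "s \<in> S" "z = M *v s + (- c) *s s"
        by (auto simp: vector_smult_lneg)
      show "z \<in> S" unfolding s(2) by (intro Sadd SM Sscale s(1))
    qed
    moreover have "dim (?g ` S) = dim S"
      by (rule dim_image_eq[OF lin]) (rule inj_on_subset[OF inj subset_UNIV])
    ultimately have "?g ` S = S"
      by (intro subspace_dim_equal[OF linear_subspace_image[OF lin sub] sub]) simp_all
    then have "?g y \<in> ?g ` S"
      by (rule ssubst) (rule y)
    then obtain y' where y': "?g y = ?g y'" "y' \<in> S"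
      by (rule imageE)
    then show ?thesis using injD[OF inj y'(1)] by simp
  qed
  obtain p where p: "p \<noteq> 0" "\<forall>x. poly_apply p ((*v) M) x = 0"
    using annihilating_poly_exists[of M] by auto
  have "x \<in> S"
    by (rule poly_apply_descent[OF Sscale closed p(1)]) (use p(2) S0 in auto)
  then show ?thesis by (simp add: S_def)
qed

lemma powers_tendsto_0:
  fixes A :: "real^'n^'n"
  assumes "spectral_radius A < 1"
  shows "(\<lambda>k. ((*v) A ^^ k) x) \<longlonglongrightarrow> 0"
proof -
  define cv :: "real^'n \<Rightarrow> complex^'n" where "cv y = (\<chi> i. complex_of_real (y $ i))" for y
  have cm: "complexify A *v cv y = cv (A *v y)" for y
    by (simp add: vec_eq_iff cv_def matrix_vector_mult_def map_matrix_def)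
  have pw: "((*v) (complexify A) ^^ k) (cv x) = cv (((*v) A ^^ k) x)" for k
    by (induction k) (auto simp: cm)
  have "(\<lambda>k. ((*v) (complexify A) ^^ k) (cv x)) \<longlonglongrightarrow> 0"
    by (rule complex_powers_tendsto_0) (use assms in \<open>auto simp: spectral_radius_less_iff eigenvalues_def\<close>)
  then have *: "(\<lambda>k. cv (((*v) A ^^ k) x)) \<longlonglongrightarrow> 0"
    by (simp only: pw)
  show ?thesis
  proof (rule vec_tendstoI)
    fix i
    have "(\<lambda>k. Re (cv (((*v) A ^^ k) x) $ i)) \<longlonglongrightarrow> Re ((0 :: complex^'n) $ i)"
      by (intro tendsto_Re tendsto_vec_nth *)
    then show "(\<lambda>k. ((*v) A ^^ k) x $ i) \<longlonglongrightarrow> 0 $ i"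
      by (simp add: cv_def)
  qed
qed

section \<open>Lyapunov criterion for the spectral radius\<close>

definition qf :: "real^'n^'n \<Rightarrow> real^'n \<Rightarrow> real" where
  "qf P x = x \<bullet> (P *v x)"

text \<open>The real and imaginary parts of an eigenvector are rotated by \<open>L\<close> and
  scaled by the modulus of \<open>c\<close>. By symmetry of \<open>P\<close> the cross terms cancel
  in the sum of the two forms, which is therefore multiplied by the squared modulus, while the
  hypothesis makes it decrease.\<close>

lemma spectral_radius_less_1_of_Lyapunov:
  fixes L P :: "real^'n^'n"
  assumes sym: "transpose P = P" and pos: "\<And>x. 0 \<le> qf P x"
    and dec: "\<And>x. x \<noteq> 0 \<Longrightarrow> qf P (L *v x) < qf P x"
  shows "spectral_radius L < 1"
  unfolding spectral_radius_less_iff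
proof
  fix c assume "c \<in> eigenvalues L"
  then obtain x :: "complex^'n" where x: "x \<noteq> 0" "complexify L *v x = c *s x"
    by (auto simp: eigenvalues_def)
  define a b :: "real^'n" where "a = (\<chi> i. Re (x $ i))" and "b = (\<chi> i. Im (x $ i))"
  have La: "L *v a = Re c *\<^sub>R a - Im c *\<^sub>R b"
  proof -
    have "(L *v a) $ i = Re ((complexify L *v x) $ i)" for i
      by (simp add: matrix_vector_mult_def map_matrix_def a_def)
    then show ?thesis by (simp add: x(2) vec_eq_iff a_def b_def)
  qed
  have Lb: "L *v b = Re c *\<^sub>R b + Im c *\<^sub>R a"
  proof -
    have "(L *v b) $ i = Im ((complexify L *v x) $ i)" for i
      by (simp add: matrix_vector_mult_def map_matrix_def b_def)
    then show ?thesis by (simp add: x(2) vec_eq_iff a_def b_def)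
  qed
  have ab: "a \<noteq> 0 \<or> b \<noteq> 0"
    using x(1) by (auto simp: a_def b_def vec_eq_iff complex_eq_iff)
  have "b \<bullet> (P *v a) = a \<bullet> (P *v b)"
    by (metis sym dot_lmul_matrix inner_commute transpose_matrix_vector)
  then have "qf P (L *v a) + qf P (L *v b) = ((Re c)\<^sup>2 + (Im c)\<^sup>2) * (qf P a + qf P b)"
    by (simp add: La Lb qf_def algebra_simps power2_eq_square)
  then have "qf P (L *v a) + qf P (L *v b) = (cmod c)\<^sup>2 * (qf P a + qf P b)"
    by (simp only: cmod_power2)
  moreover have "qf P (L *v a) + qf P (L *v b) < qf P a + qf P b"
    using ab dec[of a] dec[of b] by (cases "a = 0"; cases "b = 0") auto
  ultimately have "(cmod c)\<^sup>2 * (qf P a + qf P b) < 1 * (qf P a + qf P b)" by simp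
  then have "(cmod c)\<^sup>2 < 1"
    using pos[of a] pos[of b] by (subst (asm) mult_less_cancel_right) auto
  then show "cmod c < 1"
    by (simp add: power_less_one_iff abs_square_less_1)
qed

subsection \<open>Quadratic forms and matrix inverses\<close>

lemma inner_transpose_mult:
  fixes A :: "real^'n^'m"
  shows "x \<bullet> (transpose A *v y) = (A *v x) \<bullet> y"
  by (metis dot_lmul_matrix inner_commute transpose_matrix_vector)

lemma transpose_eq_iff_inner:
  fixes M :: "real^'n^'n"
  shows "transpose M = M \<longleftrightarrow> (\<forall>x y. x \<bullet> (M *v y) = (M *v x) \<bullet> y)"
proof
  assume "transpose M = M"
  then show "\<forall>x y. x \<bullet> (M *v y) = (M *v x) \<bullet> y"
    by (metis inner_transpose_mult)
next
  assume *: "\<forall>x y. x \<bullet> (M *v y) = (M *v x) \<bullet> y"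
  have "M $ j $ i = M $ i $ j" for i j
    using *[rule_format, of "axis j 1" "axis i 1"]
    by (simp add: matrix_vector_mult_basis column_def cart_eq_inner_axis[symmetric] inner_commute[of "axis _ _"])
  then show "transpose M = M"
    by (simp add: vec_eq_iff transpose_def)
qed

definition psd :: "real^'n^'n \<Rightarrow> bool" where
  "psd P \<longleftrightarrow> transpose P = P \<and> (\<forall>x. 0 \<le> qf P x)"

lemma psd_sym: "psd P \<Longrightarrow> x \<bullet> (P *v y) = (P *v x) \<bullet> y"
  using transpose_eq_iff_inner by (auto simp: psd_def)

lemma psd_nonneg: "psd P \<Longrightarrow> 0 \<le> qf P x"
  by (simp add: psd_def)

lemma pos_def_psd: "pos_def P \<Longrightarrow> psd P"
  unfolding psd_def pos_def_def qf_def by (metis inner_zero_left order.refl less_imp_le)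

lemma pos_def_qf: "pos_def P \<Longrightarrow> x \<noteq> 0 \<Longrightarrow> 0 < qf P x"
  by (simp add: pos_def_def qf_def)

lemma qf_zero [simp]: "qf P 0 = 0"
  by (simp add: qf_def)

lemma qf_scaleR: "qf P (c *\<^sub>R x) = c\<^sup>2 * qf P x"
  by (simp add: qf_def matrix_vector_mult_scaleR power2_eq_square)

lemma qf_add:
  assumes "transpose P = P"
  shows "qf P (x + y) = qf P x + 2 * (y \<bullet> (P *v x)) + qf P y"
  using transpose_eq_iff_inner[THEN iffD1, OF assms, rule_format, of x y]
  by (simp add: qf_def algebra_simps inner_commute)

lemma qf_diff:
  assumes "transpose P = P"
  shows "qf P (x - y) = qf P x - 2 * (y \<bullet> (P *v x)) + qf P y"
  using transpose_eq_iff_inner[THEN iffD1, OF assms, rule_format, of x y]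
  by (simp add: qf_def algebra_simps inner_commute)

lemma qf_matrix_scaleR: "qf (c *\<^sub>R P) x = c * qf P x"
  by (simp add: qf_def scaleR_matrix_vector_assoc[symmetric])

lemma norm_matrix_vector_le: "norm ((A :: real^'n^'m) *v x) \<le> onorm ((*v) A) * norm x"
  by (rule onorm) simp

lemma onorm_matrix_nonneg: "0 \<le> onorm ((*v) (A :: real^'n^'m))"
  by (rule onorm_pos_le) simp

lemma qf_le_onorm: "\<bar>qf P x\<bar> \<le> onorm ((*v) P) * (norm x)\<^sup>2"
proof -
  have "\<bar>qf P x\<bar> \<le> norm x * norm (P *v x)"
    unfolding qf_def by (rule Cauchy_Schwarz_ineq2)
  also have "\<dots> \<le> norm x * (onorm ((*v) P) * norm x)"
    by (intro mult_left_mono norm_matrix_vector_le) simp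
  finally show ?thesis by (simp add: power2_eq_square mult_ac)
qed

lemma continuous_on_qf: "continuous_on S (qf P)"
  unfolding qf_def[abs_def] by (intro continuous_intros)

lemma pos_def_lower_bound:
  fixes Q :: "real^'n^'n"
  assumes "pos_def Q"
  shows "\<exists>q>0. \<forall>x. q * (norm x)\<^sup>2 \<le> qf Q x"
proof -
  have "sphere (0 :: real^'n) 1 \<noteq> {}"
    by simp
  then obtain z where z: "z \<in> sphere 0 1" "\<And>y. y \<in> sphere 0 1 \<Longrightarrow> qf Q z \<le> qf Q y"
    using continuous_attains_inf[OF compact_sphere _ continuous_on_qf, of 0 1 Q] by blast
  have "qf Q z > 0"
    using z(1) by (intro pos_def_qf[OF assms]) auto
  moreover have "qf Q z * (norm x)\<^sup>2 \<le> qf Q x" for x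
  proof (cases "x = 0")
    case False
    then have "qf Q z \<le> qf Q (inverse (norm x) *\<^sub>R x)"
      by (intro z(2)) simp
    then show ?thesis
      using False by (simp add: qf_scaleR field_simps power2_eq_square)
  qed simp
  ultimately show ?thesis by blast
qed

text \<open>Polarization with the parallelogram law: for a symmetric matrix a bound on the form is a
  bound on the operator norm with the same constant.\<close>

lemma sym_qf_bound_imp_inner_bound:
  fixes D :: "real^'n^'n"
  assumes sym: "transpose D = D" and b: "\<And>x. \<bar>qf D x\<bar> \<le> c * (norm x)\<^sup>2"
  shows "norm (D *v x) \<le> c * norm x"
proof -
  have 1: "y \<bullet> (D *v x) \<le> c / 2 * ((norm x)\<^sup>2 + (norm y)\<^sup>2)" for x y
  proof -
    have "4 * (y \<bullet> (D *v x)) = qf D (x + y) - qf D (x - y)"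
      by (simp add: qf_add[OF sym] qf_diff[OF sym])
    also have "\<dots> \<le> c * (norm (x + y))\<^sup>2 + c * (norm (x - y))\<^sup>2"
      using b[of "x + y"] b[of "x - y"] by linarith
    also have "\<dots> = 2 * c * ((norm x)\<^sup>2 + (norm y)\<^sup>2)"
      by (simp add: power2_norm_eq_inner algebra_simps inner_commute)
    finally show ?thesis by simp
  qed
  show ?thesis
  proof (cases "x = 0 \<or> D *v x = 0")
    case True
    have "0 \<le> c"
    proof -
      have "0 \<le> c * (norm (axis undefined 1 :: real^'n))\<^sup>2"
        using b[of "axis undefined 1"] by linarith
      then show ?thesis by simp
    qed
    then show ?thesis using True by auto
  next
    case False
    \<comment> \<open>A test vector as long as \<open>x\<close> turns the mean of squares in
      \<open>1\<close> into the product of the norms.\<close>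
    let ?y = "(norm x / norm (D *v x)) *\<^sub>R (D *v x)"
    have ny: "norm ?y = norm x" using False by simp
    have "?y \<bullet> (D *v x) = norm x * norm (D *v x)"
      using False by (simp add: power2_norm_eq_inner[symmetric] power2_eq_square)
    then have "norm x * norm (D *v x) \<le> norm x * (c * norm x)"
      using 1[of ?y x] unfolding ny by (simp add: power2_eq_square algebra_simps)
    then show ?thesis using False by simp
  qed
qed

lemma sym_qf_eq_imp_eq:
  fixes P1 P2 :: "real^'n^'n"
  assumes "transpose P1 = P1" "transpose P2 = P2" "\<And>x. qf P1 x = qf P2 x"
  shows "P1 = P2"
proof -
  have sym: "transpose (P1 - P2) = P1 - P2"
    using assms(1,2) by (simp add: transpose_def vec_eq_iff)
  have "qf (P1 - P2) x = 0" for x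
    using assms(3)[of x] by (simp add: qf_def algebra_simps)
  then have "norm ((P1 - P2) *v x) \<le> 0 * norm x" for x
    by (intro sym_qf_bound_imp_inner_bound[OF sym]) simp
  then have "P1 *v x = P2 *v x" for x
    by (simp add: algebra_simps)
  then show ?thesis by (simp add: matrix_eq)
qed

section \<open>The matrix inverse as a rational function of the entries\<close>

lemma matrix_inv_both:
  assumes "invertible (A :: real^'n^'n)"
  shows "A ** matrix_inv A = mat 1" "matrix_inv A ** A = mat 1"
proof -
  have "A ** matrix_inv A = mat 1 \<and> matrix_inv A ** A = mat 1"
    using assms unfolding invertible_def matrix_inv_def by (rule someI_ex)
  then show "A ** matrix_inv A = mat 1" "matrix_inv A ** A = mat 1" by auto
qed

lemma pos_def_invertible:
  fixes G :: "real^'n^'n"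
  assumes "pos_def G"
  shows "invertible G"
  unfolding invertible_left_inverse matrix_left_invertible_ker
  using pos_def_qf[OF assms] by (metis inner_zero_right less_irrefl qf_def)

text \<open>Source of both continuity and measurability of the inverse. For a singular matrix the
  predicate inside the choice operator is unsatisfiable, so all singular matrices share one value,
  written \<open>matrix_inv 0\<close>.\<close>

lemma matrix_inv_cramer:
  fixes A :: "real^'n^'n"
  shows "matrix_inv A = (if det A = 0 then matrix_inv 0 else
    (\<chi> k j. det (\<chi> i l. if l = k then (if i = j then 1 else 0) else A $ i $ l) / det A))"
proof (cases "det A = 0")
  case True
  then have "\<not> invertible A" "\<not> invertible (0 :: real^'n^'n)"
    by (auto simp: invertible_det_nz det_0[unfolded mat_0])
  then have "matrix_inv A = matrix_inv 0"
    unfolding matrix_inv_def invertible_def by (metis (mono_tags, lifting))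
  then show ?thesis using True by simp
next
  case False
  then have inv: "invertible A" by (simp add: invertible_det_nz)
  have "matrix_inv A $ k $ j = det (\<chi> i l. if l = k then (if i = j then 1 else 0) else A $ i $ l) / det A" for k j
  proof -
    have "A *v (matrix_inv A *v axis j 1) = axis j 1"
      using matrix_inv_both[OF inv] by (simp add: matrix_vector_mul_assoc)
    then have *: "matrix_inv A *v axis j 1 = (\<chi> k. det (\<chi> i l. if l = k then axis j 1 $ i else A $ i $ l) / det A)"
      using cramer[OF False] by blast
    have "matrix_inv A $ k $ j = (matrix_inv A *v axis j 1) $ k"
      by (simp add: matrix_vector_mult_basis column_def)
    also have "\<dots> = det (\<chi> i l. if l = k then axis j 1 $ i else A $ i $ l) / det A"
      unfolding * by simp
    also have "(\<chi> i l. if l = k then axis j 1 $ i else A $ i $ l) =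
        (\<chi> i l. if l = k then (if i = j then 1 else 0) else A $ i $ l)"
      by (simp add: vec_eq_iff axis_def)
    finally show ?thesis .
  qed
  then show ?thesis using False by (simp add: vec_eq_iff)
qed

lemma continuous_on_det [continuous_intros]:
  fixes f :: "'a::topological_space \<Rightarrow> real^'n^'n"
  shows "continuous_on S f \<Longrightarrow> continuous_on S (\<lambda>x. det (f x))"
  unfolding det_def by (intro continuous_intros)

lemma continuous_on_cofactor:
  "continuous_on UNIV (\<lambda>A :: real^'n^'n. det (\<chi> i l. if l = k then (if i = j then 1 else 0) else A $ i $ l))"
proof (rule continuous_on_det)
  have "continuous_on UNIV (\<lambda>A :: real^'n^'n. if l = k then (if i = j then 1 else 0) else A $ i $ l)" for i l
    by (cases "l = k") (auto intro!: continuous_intros)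
  then show "continuous_on UNIV (\<lambda>A :: real^'n^'n. \<chi> i l. if l = k then (if i = j then 1 else 0) else A $ i $ l)"
    by (intro continuous_on_vec_lambda)
qed

lemma tendsto_matrix_inv:
  fixes A :: "real^'n^'n"
  assumes "(f \<longlongrightarrow> A) F" "invertible A"
  shows "((\<lambda>x. matrix_inv (f x)) \<longlongrightarrow> matrix_inv A) F"
proof -
  let ?c = "\<lambda>k j (A :: real^'n^'n). det (\<chi> i l. if l = k then (if i = j then 1 else 0) else A $ i $ l)"
  have dA: "det A \<noteq> 0" using assms(2) by (simp add: invertible_det_nz)
  have d: "((\<lambda>x. det (f x)) \<longlongrightarrow> det A) F"
    using continuous_on_tendsto_compose[OF continuous_on_det[OF continuous_on_id, of UNIV] assms(1)] by auto
  then have ev: "\<forall>\<^sub>F x in F. det (f x) \<noteq> 0"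
    using dA tendsto_imp_eventually_ne by blast
  have c: "((\<lambda>x. ?c k j (f x)) \<longlongrightarrow> ?c k j A) F" for k j
    by (rule continuous_on_tendsto_compose[OF continuous_on_cofactor assms(1)]) auto
  have "((\<lambda>x. \<chi> k j. ?c k j (f x) / det (f x)) \<longlongrightarrow> (\<chi> k j. ?c k j A / det A)) F"
    by (intro tendsto_vec_lambda tendsto_divide c d dA)
  moreover have "\<forall>\<^sub>F x in F. (\<chi> k j. ?c k j (f x) / det (f x)) = matrix_inv (f x)"
    using ev by eventually_elim (simp add: matrix_inv_cramer[of "f _"])
  ultimately show ?thesis
    using dA by (subst matrix_inv_cramer[of A]) (auto intro: Lim_transform_eventually)
qed

lemma tendsto_matrix_mult:
  fixes A :: "real^'n^'m" and B :: "real^'k^'n"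
  assumes "(f \<longlongrightarrow> A) F" "(g \<longlongrightarrow> B) F"
  shows "((\<lambda>x. f x ** g x) \<longlongrightarrow> A ** B) F"
  unfolding matrix_matrix_mult_def using assms
  by (intro tendsto_vec_lambda tendsto_sum tendsto_mult tendsto_vec_nth)

lemma tendsto_matrix_vector_mult:
  fixes A :: "real^'n^'m"
  assumes "(f \<longlongrightarrow> A) F" "(g \<longlongrightarrow> x) F"
  shows "((\<lambda>t. f t *v g t) \<longlongrightarrow> A *v x) F"
  unfolding matrix_vector_mult_def using assms
  by (intro tendsto_vec_lambda tendsto_sum tendsto_mult tendsto_vec_nth)

lemma tendsto_transpose:
  fixes A :: "real^'n^'m"
  assumes "(f \<longlongrightarrow> A) F"
  shows "((\<lambda>x. transpose (f x)) \<longlongrightarrow> transpose A) F"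
  unfolding transpose_def using assms
  by (intro tendsto_vec_lambda tendsto_vec_nth)

text \<open>\<open>N\<close> sums the first \<open>J\<close> iterates with weights
  \<open>1 / r ^ j\<close>, where the \<open>J\<close>-th iterate halves the norm and
  \<open>r ^ J = 1/2\<close>. Applying \<open>L\<close> shifts the sum by one, and the new last term
  is at most the dropped first one. A contraction in one step is what recursions perturbed at every
  step require; decay of the powers alone does not give it.\<close>

lemma adapted_norm_exists:
  fixes L :: "real^'n^'n"
  assumes "\<And>x. (\<lambda>k. ((*v) L ^^ k) x) \<longlonglongrightarrow> 0"
  obtains N :: "real^'n \<Rightarrow> real" and \<gamma> b where
    "0 < \<gamma>" "\<gamma> < 1" "0 < b" "\<And>x. norm x \<le> N x" "\<And>x. N x \<le> b * norm x"
    "\<And>x y. N (x + y) \<le> N x + N y" "\<And>x. N (L *v x) \<le> \<gamma> * N x"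
proof -
  have lin: "linear ((*v) L ^^ k)" for k
  proof (induction k)
    case 0 then show ?case using linear_id by (simp add: id_def)
  next
    case (Suc k)
    then show ?case using linear_compose[of "(*v) L ^^ k" "(*v) L"] by (simp add: o_def)
  qed
  have "(\<lambda>k. \<Sum>b\<in>Basis. norm (((*v) L ^^ k) b)) \<longlonglongrightarrow> (\<Sum>b\<in>(Basis :: (real^'n) set). 0)"
    by (intro tendsto_sum tendsto_norm_zero assms)
  then have "\<forall>\<^sub>F k in sequentially. (\<Sum>b\<in>Basis. norm (((*v) L ^^ k) b)) < 1/2"
    by (rule order_tendstoD) simp
  then obtain J where J: "J > 0" "(\<Sum>b\<in>Basis. norm (((*v) L ^^ J) b)) < 1/2"
    unfolding eventually_sequentially by (metis le_Suc_eq order_refl zero_less_Suc)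
  have half: "norm (((*v) L ^^ J) x) \<le> 1/2 * norm x" for x
  proof -
    have "((*v) L ^^ J) x = ((*v) L ^^ J) (\<Sum>b\<in>Basis. (x \<bullet> b) *\<^sub>R b)"
      by (simp add: euclidean_representation)
    also have "\<dots> = (\<Sum>b\<in>Basis. (x \<bullet> b) *\<^sub>R ((*v) L ^^ J) b)"
      by (simp add: linear_sum[OF lin] linear_cmul[OF lin])
    also have "norm \<dots> \<le> (\<Sum>b\<in>Basis. norm x * norm (((*v) L ^^ J) b))"
      by (rule sum_norm_le) (auto intro!: mult_right_mono Basis_le_norm)
    also have "\<dots> = norm x * (\<Sum>b\<in>Basis. norm (((*v) L ^^ J) b))"
      by (simp add: sum_distrib_left)
    also have "\<dots> \<le> norm x * (1/2)"
      using J(2) by (intro mult_left_mono) auto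
    finally show ?thesis by simp
  qed
  define r where "r = root J (1/2)"
  have r: "0 < r" "r < 1" "r ^ J = 1/2"
    using J(1) by (auto simp: r_def)
  define N where "N x = (\<Sum>j<J. norm (((*v) L ^^ j) x) / r ^ j)" for x
  have N1: "norm x \<le> N x" for x
    unfolding N_def using J(1) r(1)
    by (intro order.trans[OF _ member_le_sum[of 0]]) auto
  have N2: "N x \<le> (1 + (\<Sum>j<J. onorm ((*v) L ^^ j) / r ^ j)) * norm x" for x
  proof -
    have "N x \<le> (\<Sum>j<J. onorm ((*v) L ^^ j) * norm x / r ^ j)"
      unfolding N_def using r(1)
      by (intro sum_mono divide_right_mono onorm) (auto intro!: linear_conv_bounded_linear[THEN iffD1] lin)
    also have "\<dots> = (\<Sum>j<J. onorm ((*v) L ^^ j) / r ^ j) * norm x"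
      by (simp add: sum_distrib_right)
    finally show ?thesis
      using norm_ge_zero[of x] unfolding distrib_right by linarith
  qed
  have b0: "0 < 1 + (\<Sum>j<J. onorm ((*v) L ^^ j) / r ^ j)"
    using r(1) by (intro add_pos_nonneg sum_nonneg divide_nonneg_pos onorm_pos_le)
      (auto intro!: linear_conv_bounded_linear[THEN iffD1] lin)
  have N3: "N (x + y) \<le> N x + N y" for x y
    unfolding N_def sum.distrib[symmetric] add_divide_distrib[symmetric] using r(1)
    by (intro sum_mono divide_right_mono) (auto simp: linear_add[OF lin] intro: norm_triangle_ineq)
  have N4: "N (L *v x) \<le> r * N x" for x
  proof -
    let ?g = "\<lambda>j. norm (((*v) L ^^ j) x) / r ^ j"
    have "N (L *v x) = (\<Sum>j<J. r * ?g (Suc j))"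
      unfolding N_def using r(1)
      by (intro sum.cong refl) (simp add: funpow_swap1)
    also have "\<dots> = r * (\<Sum>j<J. ?g (Suc j))"
      by (simp add: sum_distrib_left)
    also have "(\<Sum>j<J. ?g (Suc j)) = (\<Sum>j<J. ?g j) + ?g J - ?g 0"
      using sum.lessThan_Suc_shift[of ?g J] sum.lessThan_Suc[of ?g J] by simp
    also have "\<dots> \<le> N x"
      using half[of x] by (simp add: N_def r(3))
    finally show ?thesis using r(1) by simp
  qed
  from that[OF r(1,2) b0 N1 N2 N3 N4] show thesis .
qed

subsection \<open>The Riccati equation\<close>

lemma matrix_vector_mult_uminus: "(- (X :: real^'n^'m)) *v y = - (X *v y)"
  by (simp add: vec_eq_iff matrix_vector_mult_def sum_negf)

lemma matrix_vector_mult_minus_right: "(X :: real^'n^'m) *v (- y) = - (X *v y)"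
  by (simp add: vec_eq_iff matrix_vector_mult_def sum_negf)

lemma transpose_add: "transpose (X + Y) = transpose X + transpose (Y :: real^'n^'m)"
  by (simp add: vec_eq_iff transpose_def)

lemma psd_commute: "psd P \<Longrightarrow> x \<bullet> (P *v y) = y \<bullet> (P *v x)"
  using psd_sym[of P x y] by (simp add: inner_commute)

locale lqr =
  fixes Q :: "real^'n^'n" and R :: "real^'m^'m"
  assumes Q: "pos_def Q" and R: "pos_def R"
begin

text \<open>\<open>ricG\<close>, \<open>gain\<close> and \<open>ricF\<close> take an arbitrary
  \<open>P\<close>, because value iteration and the comparison arguments evaluate them away from the
  solution.\<close>

definition ricG :: "real^'m^'n \<Rightarrow> real^'n^'n \<Rightarrow> real^'m^'m" where
  "ricG B P = R + transpose B ** P ** B"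

definition gain :: "real^'n^'n \<Rightarrow> real^'m^'n \<Rightarrow> real^'n^'n \<Rightarrow> real^'n^'m" where
  "gain A B P = - (matrix_inv (ricG B P) ** transpose B ** P ** A)"

definition ricF :: "real^'n^'n \<Rightarrow> real^'m^'n \<Rightarrow> real^'n^'n \<Rightarrow> real^'n^'n" where
  "ricF A B P = transpose A ** P ** A
     - transpose A ** P ** B ** matrix_inv (ricG B P) ** transpose B ** P ** A + Q"

lemma psd_Q: "psd Q" and psd_R: "psd R"
  using Q R by (auto intro: pos_def_psd)

lemma qf_ricG: "qf (ricG B P) u = qf R u + qf P (B *v u)"
  unfolding qf_def ricG_def
  by (simp add: matrix_vector_mult_add_rdistrib matrix_vector_mul_assoc[symmetric]
      inner_transpose_mult inner_right_distrib del: transpose_matrix_vector)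

lemma psd_ricG: "psd P \<Longrightarrow> psd (ricG B P)"
proof -
  assume P: "psd P"
  have "transpose (ricG B P) = ricG B P"
    using P psd_R by (simp add: ricG_def transpose_add matrix_transpose_mul matrix_mul_assoc psd_def)
  then show ?thesis
    using P psd_R by (simp add: psd_def qf_ricG)
qed

lemma pos_def_ricG: "psd P \<Longrightarrow> pos_def (ricG B P)"
  unfolding pos_def_def qf_def[symmetric] qf_ricG
  using psd_ricG[of P B]
  by (auto simp: psd_def[of "ricG B P"] intro!: add_pos_nonneg pos_def_qf[OF R] psd_nonneg)

lemma ricG_inv:
  assumes "psd P"
  shows "ricG B P *v (matrix_inv (ricG B P) *v h) = h"
  using matrix_inv_both(1)[OF pos_def_invertible[OF pos_def_ricG[OF assms, of B]]]
  by (simp add: matrix_vector_mul_assoc)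

lemma gain_vec:
  "gain A B P *v x = - (matrix_inv (ricG B P) *v (transpose B *v (P *v (A *v x))))"
  by (simp add: gain_def matrix_vector_mult_uminus matrix_vector_mul_assoc[symmetric] del: transpose_matrix_vector)

lemma ricG_gain:
  assumes "psd P"
  shows "ricG B P *v (gain A B P *v x) = - (transpose B *v (P *v (A *v x)))"
  unfolding gain_vec using ricG_inv[OF assms, of B]
  by (simp add: matrix_vector_mult_minus_right del: transpose_matrix_vector)

lemma inner_ricF:
  "x \<bullet> (ricF A B P *v y) = (A *v x) \<bullet> (P *v (A *v y))
     + (A *v x) \<bullet> (P *v (B *v (gain A B P *v y))) + x \<bullet> (Q *v y)"
proof -
  have "ricF A B P *v y = transpose A *v (P *v (A *v y))
      + transpose A *v (P *v (B *v (gain A B P *v y))) + Q *v y"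
    by (simp add: ricF_def gain_vec matrix_vector_mult_add_rdistrib matrix_vector_mult_diff_rdistrib
        matrix_vector_mul_assoc[symmetric] matrix_vector_mult_minus_right del: transpose_matrix_vector)
  then show ?thesis
    by (simp add: inner_right_distrib inner_transpose_mult del: transpose_matrix_vector)
qed

lemma psd_cross_gain:
  assumes "psd P"
  shows "(A *v x) \<bullet> (P *v (B *v u)) = - ((gain A B P *v x) \<bullet> (ricG B P *v u))"
proof -
  have "(gain A B P *v x) \<bullet> (ricG B P *v u) = (ricG B P *v (gain A B P *v x)) \<bullet> u"
    by (rule psd_sym[OF psd_ricG[OF assms]])
  also have "\<dots> = - (u \<bullet> (transpose B *v (P *v (A *v x))))"
    by (simp add: ricG_gain[OF assms] inner_commute del: transpose_matrix_vector)
  also have "u \<bullet> (transpose B *v (P *v (A *v x))) = (B *v u) \<bullet> (P *v (A *v x))"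
    by (rule inner_transpose_mult)
  also have "\<dots> = (A *v x) \<bullet> (P *v (B *v u))"
    by (rule psd_commute[OF assms])
  finally show ?thesis by simp
qed

text \<open>The identity behind both the Riccati theory and the regret: \<open>ricF A B P\<close> is
  the minimum over \<open>u\<close> of stage cost plus cost-to-go \<open>P\<close>, attained at the
  gain, and any other input pays exactly a quadratic form in its deviation.\<close>

lemma complete_square:
  assumes P: "psd P"
  shows "qf Q x + qf R u + qf P (A *v x + B *v u)
    = qf (ricF A B P) x + qf (ricG B P) (u - gain A B P *v x)"
proof -
  let ?k = "gain A B P *v x" and ?G = "ricG B P"
  have symG: "transpose ?G = ?G" and symP: "transpose P = P"
    using psd_ricG[OF P] P by (auto simp: psd_def)
  have F: "qf (ricF A B P) x = qf P (A *v x) + (A *v x) \<bullet> (P *v (B *v ?k)) + qf Q x"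
    unfolding qf_def[of "ricF A B P"] inner_ricF by (simp add: qf_def)
  have "qf ?G (u - ?k) = qf ?G u - 2 * (?k \<bullet> (?G *v u)) + qf ?G ?k"
    by (rule qf_diff[OF symG])
  moreover have "?k \<bullet> (?G *v u) = - ((A *v x) \<bullet> (P *v (B *v u)))"
    using psd_cross_gain[OF P, of A x B u] by simp
  moreover have "qf ?G ?k = - ((A *v x) \<bullet> (P *v (B *v ?k)))"
    using psd_cross_gain[OF P, of A x B ?k] by (simp add: qf_def)
  moreover have "qf P (A *v x + B *v u) = qf P (A *v x) + 2 * ((A *v x) \<bullet> (P *v (B *v u))) + qf P (B *v u)"
    unfolding qf_add[OF symP] by (simp add: psd_sym[OF P, of "B *v u"] inner_commute)
  ultimately show ?thesis
    by (simp add: F qf_ricG)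
qed

lemma psd_ricF:
  assumes P: "psd P"
  shows "psd (ricF A B P)"
  unfolding psd_def
proof
  show "transpose (ricF A B P) = ricF A B P"
    unfolding transpose_eq_iff_inner
  proof (intro allI)
    fix x y
    have "x \<bullet> (ricF A B P *v y) = y \<bullet> (ricF A B P *v x)"
      unfolding inner_ricF psd_cross_gain[OF P, of A _ B]
      using psd_commute[OF P, of "A *v x" "A *v y"] psd_commute[OF psd_Q, of x y]
        psd_commute[OF psd_ricG[OF P, of B], of "gain A B P *v x" "gain A B P *v y"]
      by (simp only:)
    then show "x \<bullet> (ricF A B P *v y) = (ricF A B P *v x) \<bullet> y"
      by (simp add: inner_commute)
  qed
  show "\<forall>x. 0 \<le> qf (ricF A B P) x"
  proof
    fix x
    show "0 \<le> qf (ricF A B P) x"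
      using complete_square[OF P, of x "gain A B P *v x" A B] psd_nonneg[OF psd_Q, of x]
        psd_nonneg[OF psd_R, of "gain A B P *v x"] psd_nonneg[OF P, of "A *v x + B *v (gain A B P *v x)"]
      by simp
  qed
qed

lemma qf_ricF_eq:
  assumes "psd P"
  shows "qf (ricF A B P) x = qf Q x + qf R (gain A B P *v x)
    + qf P (A *v x + B *v (gain A B P *v x))"
  using complete_square[OF assms, of x "gain A B P *v x" A B] by simp

lemma qf_ricF_le:
  assumes "psd P"
  shows "qf (ricF A B P) x \<le> qf Q x + qf R u + qf P (A *v x + B *v u)"
  unfolding complete_square[OF assms, of x u A B]
  using psd_nonneg[OF psd_ricG[OF assms, of B], of "u - gain A B P *v x"] by simp

text \<open>The minimizing input for \<open>P'\<close> is an admissible, possibly suboptimal input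
  for \<open>P\<close>.\<close>

lemma ricF_mono:
  assumes "psd P" "psd P'" "\<And>x. qf P x \<le> qf P' x"
  shows "qf (ricF A B P) x \<le> qf (ricF A B P') x"
  unfolding qf_ricF_eq[OF assms(2)]
  by (rule order.trans[OF qf_ricF_le[OF assms(1), of A B x "gain A B P' *v x"]])
    (intro add_left_mono assms(3))

section \<open>Uniqueness and existence of the Riccati solution by comparison\<close>

definition ric_sol :: "real^'n^'n \<Rightarrow> real^'m^'n \<Rightarrow> real^'n^'n \<Rightarrow> bool" where
  "ric_sol A B P \<longleftrightarrow> pos_def P \<and> P = ricF A B P"

lemma riccati_solution_THE: "riccati_solution A B Q R = (THE P. ric_sol A B P)"
  by (simp add: riccati_solution_def ric_sol_def ricF_def ricG_def)

lemma ric_sol_psd: "ric_sol A B P \<Longrightarrow> psd P"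
  by (simp add: ric_sol_def pos_def_psd)

text \<open>The decreases telescope, so the squared norms along the orbit are summable.\<close>

lemma lyapunov_powers:
  assumes "\<And>x. 0 \<le> qf S x" "\<And>x. qf S (L *v x) + qf Q x \<le> qf S x"
  shows "(\<lambda>k. ((*v) L ^^ k) x) \<longlonglongrightarrow> 0"
proof -
  obtain q where q: "q > 0" "\<And>x. q * (norm x)\<^sup>2 \<le> qf Q x"
    using pos_def_lower_bound[OF Q] by blast
  have *: "(\<Sum>j<k. q * (norm (((*v) L ^^ j) x))\<^sup>2) + qf S (((*v) L ^^ k) x) \<le> qf S x" for k
  proof (induction k)
    case (Suc k)
    then show ?case
      using assms(2)[of "((*v) L ^^ k) x"] q(2)[of "((*v) L ^^ k) x"] by simp
  qed simp
  have part: "(\<Sum>j\<le>n. q * (norm (((*v) L ^^ j) x))\<^sup>2) \<le> qf S x" for n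
    using *[of "Suc n"] assms(1)[of "((*v) L ^^ Suc n) x"] unfolding lessThan_Suc_atMost by linarith
  have "summable (\<lambda>j. q * (norm (((*v) L ^^ j) x))\<^sup>2)"
    by (rule bounded_imp_summable[OF _ part]) (use q(1) in simp)
  then have "(\<lambda>j. q * (norm (((*v) L ^^ j) x))\<^sup>2) \<longlonglongrightarrow> 0"
    by (rule summable_LIMSEQ_zero)
  then have "(\<lambda>j. inverse q * (q * (norm (((*v) L ^^ j) x))\<^sup>2)) \<longlonglongrightarrow> inverse q * 0"
    by (intro tendsto_intros)
  then have "(\<lambda>j. (norm (((*v) L ^^ j) x))\<^sup>2) \<longlonglongrightarrow> 0"
    using q(1) by (simp add: mult.assoc[symmetric])
  then have "(\<lambda>j. sqrt ((norm (((*v) L ^^ j) x))\<^sup>2)) \<longlonglongrightarrow> sqrt 0"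
    by (intro tendsto_intros)
  then show ?thesis
    by (simp add: tendsto_norm_zero_iff)
qed

lemma tendsto_qf_powers:
  assumes "(\<lambda>k. ((*v) L ^^ k) x) \<longlonglongrightarrow> 0"
  shows "(\<lambda>k. qf S (((*v) L ^^ k) x)) \<longlonglongrightarrow> 0"
  using continuous_on_tendsto_compose[OF continuous_on_qf[of UNIV S] assms] by simp

text \<open>The form of \<open>P\<close> minus that of \<open>S\<close> does not decrease along an
  orbit of the \<open>K\<close>-loop: \<open>K\<close> may be suboptimal for \<open>P\<close>, while
  \<open>S\<close> pays at least the stage cost of \<open>K\<close>. The orbit tends to 0, since
  \<open>S\<close> is itself a Lyapunov function for it. With \<open>S\<close> another solution this
  yields uniqueness; with \<open>S\<close> an inflated solution of a nearby system it yields
  perturbation bounds.\<close>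

lemma ric_sol_le_supersolution:
  assumes P: "ric_sol A B P" and S: "\<And>x. 0 \<le> qf S x"
    and super: "\<And>x. qf S (A *v x + B *v (K *v x)) + qf Q x + qf R (K *v x) \<le> qf S x"
  shows "qf P x \<le> qf S x"
proof -
  let ?L = "A + B ** K"
  have L: "?L *v x = A *v x + B *v (K *v x)" for x
    by (simp add: matrix_vector_mult_add_rdistrib matrix_vector_mul_assoc)
  have "qf S (?L *v x) + qf Q x \<le> qf S x" for x
    using super[of x] psd_nonneg[OF psd_R, of "K *v x"] by (simp add: L)
  then have lim: "(\<lambda>k. ((*v) ?L ^^ k) x) \<longlonglongrightarrow> 0"
    by (rule lyapunov_powers[OF S])
  have PF: "ricF A B P = P" using P by (simp add: ric_sol_def)
  have step: "qf P x - qf S x \<le> qf P (?L *v x) - qf S (?L *v x)" for x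
    using super[of x] qf_ricF_le[OF ric_sol_psd[OF P], of A B x "K *v x"] by (simp add: L PF)
  have "qf P x - qf S x \<le> qf P (((*v) ?L ^^ k) x) - qf S (((*v) ?L ^^ k) x)" for k
    by (induction k) (use step in \<open>auto intro: order.trans\<close>)
  moreover have "(\<lambda>k. qf P (((*v) ?L ^^ k) x) - qf S (((*v) ?L ^^ k) x)) \<longlonglongrightarrow> 0 - 0"
    by (intro tendsto_diff tendsto_qf_powers lim)
  ultimately have "qf P x - qf S x \<le> 0 - 0"
    by (intro LIMSEQ_le_const) auto
  then show ?thesis by simp
qed

lemma ric_sol_closed_loop:
  assumes P: "ric_sol A B P"
  shows "qf P (A *v x + B *v (gain A B P *v x)) + qf Q x + qf R (gain A B P *v x) = qf P x"
  using qf_ricF_eq[OF ric_sol_psd[OF P], of A B x] P by (simp add: ric_sol_def)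

lemma ric_sol_unique:
  assumes "ric_sol A B P" "ric_sol A B P'"
  shows "P = P'"
proof (rule sym_qf_eq_imp_eq)
  show "transpose P = P" "transpose P' = P'"
    using assms by (auto simp: ric_sol_def pos_def_def)
  fix x
  show "qf P x = qf P' x"
    by (intro antisym ric_sol_le_supersolution[OF assms(1) psd_nonneg[OF ric_sol_psd[OF assms(2)]]
          eq_refl[OF ric_sol_closed_loop[OF assms(2)]]]
        ric_sol_le_supersolution[OF assms(2) psd_nonneg[OF ric_sol_psd[OF assms(1)]]
          eq_refl[OF ric_sol_closed_loop[OF assms(1)]]])
qed

lemma riccati_solution_eq: "ric_sol A B P \<Longrightarrow> riccati_solution A B Q R = P"
  unfolding riccati_solution_THE using ric_sol_unique by blast

lemma lqr_gain_eq: "ric_sol A B P \<Longrightarrow> lqr_gain A B Q R = gain A B P"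
  by (simp add: lqr_gain_def Let_def riccati_solution_eq gain_def ricG_def)

lemma spectral_radius_less_1_of_supersolution:
  assumes "psd S" "\<And>x. qf S (A *v x + B *v (K *v x)) + qf Q x + qf R (K *v x) \<le> qf S x"
  shows "spectral_radius (A + B ** K) < 1"
proof (rule spectral_radius_less_1_of_Lyapunov)
  show "transpose S = S" using assms(1) by (simp add: psd_def)
  show "0 \<le> qf S x" for x using psd_nonneg[OF assms(1)] .
  show "qf S ((A + B ** K) *v x) < qf S x" if "x \<noteq> 0" for x
    using assms(2)[of x] pos_def_qf[OF Q that] psd_nonneg[OF psd_R, of "K *v x"]
    by (simp add: matrix_vector_mult_add_rdistrib matrix_vector_mul_assoc)
qed

lemma ric_sol_stabilizable: "ric_sol A B P \<Longrightarrow> stabilizable A B"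
  unfolding stabilizable_def
  using spectral_radius_less_1_of_supersolution[of P A B "gain A B P"]
    ric_sol_closed_loop ric_sol_psd by (metis order_refl)

lemma tendsto_ricF:
  assumes X: "(X \<longlongrightarrow> P) F" and P: "psd P"
  shows "((\<lambda>k. ricF A B (X k)) \<longlongrightarrow> ricF A B P) F"
proof -
  have "((\<lambda>k. ricG B (X k)) \<longlongrightarrow> ricG B P) F"
    unfolding ricG_def by (intro tendsto_intros tendsto_matrix_mult X)
  then have "((\<lambda>k. matrix_inv (ricG B (X k))) \<longlongrightarrow> matrix_inv (ricG B P)) F"
    by (intro tendsto_matrix_inv pos_def_invertible pos_def_ricG P)
  then show ?thesis
    unfolding ricF_def by (intro tendsto_add tendsto_diff tendsto_const tendsto_matrix_mult X)
qed

lemma tendsto_qf: "(X \<longlongrightarrow> P) F \<Longrightarrow> ((\<lambda>k. qf (X k) x) \<longlongrightarrow> qf P x) F"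
  unfolding qf_def by (intro tendsto_inner tendsto_const tendsto_matrix_vector_mult)

lemma psd_limit:
  assumes X: "X \<longlonglongrightarrow> P" and psd: "\<And>k. psd (X k)"
  shows "psd P"
  unfolding psd_def
proof (intro conjI allI)
  have "(\<lambda>k. transpose (X k)) \<longlonglongrightarrow> transpose P"
    by (rule tendsto_transpose[OF X])
  then have "X \<longlonglongrightarrow> transpose P"
    using psd by (simp add: psd_def)
  then show "transpose P = P"
    using X LIMSEQ_unique by blast
  show "0 \<le> qf P x" for x
    by (rule LIMSEQ_le_const[OF tendsto_qf[OF X]]) (use psd in \<open>auto simp: psd_def\<close>)
qed

lemma psd_0: "psd (0 :: real^'n^'n)"
  by (auto simp: psd_def qf_def transpose_def vec_eq_iff)

lemma value_iteration_psd: "psd P \<Longrightarrow> psd ((ricF A B ^^ k) P)"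
  by (induction k) (auto intro: psd_ricF)

text \<open>Value iteration from 0 increases by monotonicity and stays below the cost of a
  stabilizing \<open>K\<close>; the limit is a fixed point by continuity, and its definiteness comes
  from \<open>Q\<close>.\<close>

lemma ric_sol_exists:
  assumes "stabilizable A B"
  shows "\<exists>P. ric_sol A B P"
proof -
  obtain K :: "real^'n^'m" where K: "spectral_radius (A + B ** K) < 1"
    using assms by (auto simp: stabilizable_def)
  let ?L = "A + B ** K"
  have L: "?L *v x = A *v x + B *v (K *v x)" for x
    by (simp add: matrix_vector_mult_add_rdistrib matrix_vector_mul_assoc)
  obtain N \<gamma> b where N: "0 < \<gamma>" "\<gamma> < 1" "0 < b" "\<And>x. norm x \<le> N x" "\<And>x. N x \<le> b * norm x"
    "\<And>x y. N (x + y) \<le> N x + N y" "\<And>x. N (?L *v x) \<le> \<gamma> * N x"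
    by (rule adapted_norm_exists[OF powers_tendsto_0[OF K]]) blast
  define c where "c = onorm ((*v) Q) + onorm ((*v) R) * (onorm ((*v) K))\<^sup>2"
  have c0: "0 \<le> c" unfolding c_def by (intro add_nonneg_nonneg mult_nonneg_nonneg onorm_matrix_nonneg) auto
  have cost: "qf Q y + qf R (K *v y) \<le> c * (norm y)\<^sup>2" for y
  proof -
    have "qf R (K *v y) \<le> onorm ((*v) R) * (norm (K *v y))\<^sup>2"
      using qf_le_onorm[of R "K *v y"] by linarith
    also have "\<dots> \<le> onorm ((*v) R) * (onorm ((*v) K) * norm y)\<^sup>2"
      by (intro mult_left_mono power_mono norm_matrix_vector_le onorm_matrix_nonneg) auto
    finally show ?thesis
      using qf_le_onorm[of Q y] by (simp add: c_def algebra_simps power_mult_distrib)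
  qed
  define V where "V k = (ricF A B ^^ k) 0" for k
  have psdV: "psd (V k)" for k
    unfolding V_def by (rule value_iteration_psd[OF psd_0])
  have VSuc: "V (Suc k) = ricF A B (V k)" for k by (simp add: V_def)
  have mono: "qf (V k) x \<le> qf (V (Suc k)) x" for k x
  proof (induction k arbitrary: x)
    case 0
    then show ?case using psd_nonneg[OF psdV, of 1 x] by (simp add: V_def qf_def)
  next
    case (Suc k)
    show ?case
      unfolding VSuc[of "Suc k"] unfolding VSuc[of k]
      by (rule ricF_mono) (use psdV[of "Suc k"] psdV Suc in \<open>auto simp: VSuc\<close>)
  qed
  \<comment> \<open>Sums the geometric series of stage costs, at most
    \<open>c * \<gamma> ^ (2 * j)\<close> times the squared initial norm, under the stabilizing
    gain.\<close>
  have bound: "qf (V k) x \<le> c / (1 - \<gamma>\<^sup>2) * (N x)\<^sup>2" for k x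
  proof (induction k arbitrary: x)
    case 0
    then show ?case using c0 N(1,2) by (simp add: V_def qf_def abs_square_le_1 power_le_one)
  next
    case (Suc k)
    have g: "\<gamma>\<^sup>2 < 1" using N(1,2) by (simp add: abs_square_less_1)
    have N0: "0 \<le> N y" for y using N(4)[of y] norm_ge_zero order.trans by blast
    have "qf (V (Suc k)) x \<le> qf Q x + qf R (K *v x) + qf (V k) (?L *v x)"
      unfolding VSuc L by (rule qf_ricF_le[OF psdV])
    also have "\<dots> \<le> c * (norm x)\<^sup>2 + c / (1 - \<gamma>\<^sup>2) * (N (?L *v x))\<^sup>2"
      using cost Suc by (intro add_mono)
    also have "\<dots> \<le> c * (N x)\<^sup>2 + c / (1 - \<gamma>\<^sup>2) * (\<gamma> * N x)\<^sup>2"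
      using c0 g N(4,7) N0 by (intro add_mono mult_left_mono power_mono) auto
    also have "\<dots> = c / (1 - \<gamma>\<^sup>2) * (N x)\<^sup>2"
      using g by (simp add: field_simps power_mult_distrib)
    finally show ?case .
  qed
  have conv: "convergent (\<lambda>k. qf (V k) x)" for x
  proof -
    have "incseq (\<lambda>k. qf (V k) x)"
      by (rule incseq_SucI) (rule mono)
    then obtain l where "(\<lambda>k. qf (V k) x) \<longlonglongrightarrow> l"
      by (rule incseq_convergent[where B = "c / (1 - \<gamma>\<^sup>2) * (N x)\<^sup>2"]) (use bound in auto)
    then show ?thesis by (rule convergentI)
  qed
  \<comment> \<open>Polarization recovers entries from the form, so convergence of the forms gives
    convergence of the matrices.\<close>
  have entry: "2 * (V k $ i $ j) = qf (V k) (axis i 1 + axis j 1) - qf (V k) (axis i 1) - qf (V k) (axis j 1)" for k i j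
  proof -
    have "qf (V k) (axis i 1 + axis j 1) = qf (V k) (axis i 1) + 2 * (axis j 1 \<bullet> (V k *v axis i 1)) + qf (V k) (axis j 1)"
      using psdV by (intro qf_add) (simp add: psd_def)
    moreover have "axis j 1 \<bullet> (V k *v axis i 1) = axis i 1 \<bullet> (V k *v axis j 1)"
      by (subst psd_sym[OF psdV]) (rule inner_commute)
    moreover have "axis i 1 \<bullet> (V k *v axis j 1) = V k $ i $ j"
      by (simp add: matrix_vector_mult_basis column_def cart_eq_inner_axis[symmetric] inner_commute[of "axis _ _"])
    ultimately show ?thesis by simp
  qed
  have "convergent (\<lambda>k. V k $ i $ j)" for i j
  proof -
    have "convergent (\<lambda>k. 2 * (V k $ i $ j))"
      unfolding entry by (intro convergent_diff conv)
    then show ?thesis using convergent_mult_const_iff[of "2 :: real" "\<lambda>k. V k $ i $ j"] by simp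
  qed
  then obtain p where p: "\<And>i j. (\<lambda>k. V k $ i $ j) \<longlonglongrightarrow> p i j"
    unfolding convergent_def by metis
  define P where "P = (\<chi> i j. p i j)"
  have lim: "V \<longlonglongrightarrow> P"
    by (intro vec_tendstoI) (simp add: P_def p)
  have psdP: "psd P" by (rule psd_limit[OF lim psdV])
  have "(\<lambda>k. V (Suc k)) \<longlonglongrightarrow> ricF A B P"
    unfolding VSuc by (rule tendsto_ricF[OF lim psdP])
  then have PF: "P = ricF A B P"
    using LIMSEQ_Suc[OF lim] LIMSEQ_unique by blast
  have "qf P x > 0" if "x \<noteq> 0" for x
  proof -
    have "qf P x = qf (ricF A B P) x" using PF by simp
    then show ?thesis
      unfolding qf_ricF_eq[OF psdP]
      using pos_def_qf[OF Q that] psd_nonneg[OF psd_R] psd_nonneg[OF psdP]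
      by (smt (verit))
  qed
  then have "pos_def P"
    using psdP by (simp add: pos_def_def psd_def qf_def)
  then show ?thesis using PF by (auto simp: ric_sol_def)
qed

lemma stabilizable_iff_ric_sol: "stabilizable A B \<longleftrightarrow> (\<exists>P. ric_sol A B P)"
  using ric_sol_exists ric_sol_stabilizable by blast

end

subsection \<open>Lipschitz dependence of the optimal gain on the system\<close>

lemma psd_young:
  assumes P: "psd P" and s: "s > 0"
  shows "qf P (x + y) \<le> (1 + s) * qf P x + (1 + 1 / s) * qf P y"
proof -
  have sym: "transpose P = P" using P by (simp add: psd_def)
  have "0 \<le> qf P (s *\<^sub>R x - y)" by (rule psd_nonneg[OF P])
  also have "\<dots> = s * (s * qf P x - 2 * (y \<bullet> (P *v x)) + qf P y / s)"
    using s by (simp add: qf_diff[OF sym] qf_scaleR matrix_vector_mult_scaleR field_simps power2_eq_square)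
  finally have "0 \<le> s * qf P x - 2 * (y \<bullet> (P *v x)) + qf P y / s"
    using s by (simp add: zero_le_mult_iff)
  then show ?thesis
    unfolding qf_add[OF sym] by (simp add: algebra_simps)
qed

lemma psd_scaleR: "psd P \<Longrightarrow> 0 \<le> c \<Longrightarrow> psd (c *\<^sub>R P)"
  by (simp add: psd_def transpose_scalar qf_matrix_scaleR)

context lqr
begin

text \<open>The slack comes from \<open>Q\<close>: one step of the unperturbed loop lowers the form
  of \<open>P\<close> by at least \<open>q * (norm x)^2\<close>. Inflating \<open>P\<close> by
  \<open>1 + c * \<epsilon>\<close> earns \<open>c * \<epsilon>\<close> times that. The perturbed
  dynamics cost at most \<open>\<epsilon> * D * (norm x)^2\<close>, doubled by the inflation, so
  \<open>c = 2 * D / q\<close> breaks even. In \<open>D\<close>, the term \<open>p\<close> is the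
  loss in Young's inequality and the rest the displaced part of the step.\<close>

lemma supersolution_perturb:
  fixes p q \<kappa> \<epsilon> :: real
  defines "D \<equiv> p + 2 * p * (1 + \<kappa>)\<^sup>2"
  defines "c \<equiv> 2 * D / q"
  assumes P: "psd P" "\<And>x. qf P x \<le> p * (norm x)\<^sup>2"
    and q: "q > 0" "\<And>x. q * (norm x)\<^sup>2 \<le> qf Q x"
    and K: "\<And>x. norm (K *v x) \<le> \<kappa> * norm x" and "0 \<le> p" "0 \<le> \<kappa>"
    and super: "\<And>x. qf P (A *v x + B *v (K *v x)) + qf Q x + qf R (K *v x) \<le> qf P x"
    and close: "\<And>x u. norm ((A' *v x + B' *v u) - (A *v x + B *v u)) \<le> \<epsilon> * (norm x + norm u)"
    and e: "0 < \<epsilon>" "\<epsilon> \<le> 1" "c * \<epsilon> \<le> 1"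
  shows "qf ((1 + c * \<epsilon>) *\<^sub>R P) (A' *v x + B' *v (K *v x)) + qf Q x + qf R (K *v x)
    \<le> qf ((1 + c * \<epsilon>) *\<^sub>R P) x"
proof -
  define y z where "y = A *v x + B *v (K *v x)" and "z = A' *v x + B' *v (K *v x)"
  define n where "n = (norm x)\<^sup>2"
  have n0: "0 \<le> n" by (simp add: n_def)
  have D0: "0 \<le> D" unfolding D_def using assms by simp
  have c0: "0 \<le> c" unfolding c_def using D0 q(1) by simp
  have "norm (z - y) \<le> \<epsilon> * (norm x + norm (K *v x))"
    unfolding z_def y_def by (rule close)
  also have "\<dots> \<le> \<epsilon> * ((1 + \<kappa>) * norm x)"
    using K[of x] e(1) by (intro mult_left_mono) (auto simp: algebra_simps)
  finally have zy: "norm (z - y) \<le> \<epsilon> * ((1 + \<kappa>) * norm x)" .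
  have "qf P (z - y) \<le> p * (norm (z - y))\<^sup>2" by (rule P(2))
  also have "\<dots> \<le> p * (\<epsilon> * ((1 + \<kappa>) * norm x))\<^sup>2"
    using zy \<open>0 \<le> p\<close> by (intro mult_left_mono power_mono) auto
  finally have qzy: "qf P (z - y) \<le> \<epsilon>\<^sup>2 * (p * (1 + \<kappa>)\<^sup>2 * n)"
    by (simp add: n_def power_mult_distrib mult_ac)
  define a where "a = qf P y"
  have sx: "a + qf Q x + qf R (K *v x) \<le> qf P x" unfolding a_def y_def by (rule super)
  have R0: "0 \<le> qf R (K *v x)" by (rule psd_nonneg[OF psd_R])
  have aq: "a \<le> qf P x - q * n" using sx R0 q(2)[of x] by (simp add: n_def)
  have "0 \<le> q * n" using q(1) n0 by simp
  then have ap: "a \<le> p * n" using aq P(2)[of x] by (simp add: n_def)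
  have "qf P z = qf P (y + (z - y))" by simp
  also have "\<dots> \<le> (1 + \<epsilon>) * a + (1 + 1 / \<epsilon>) * qf P (z - y)"
    unfolding a_def by (rule psd_young[OF P(1) e(1)])
  also have "\<dots> \<le> (1 + \<epsilon>) * a + (1 + 1 / \<epsilon>) * (\<epsilon>\<^sup>2 * (p * (1 + \<kappa>)\<^sup>2 * n))"
    using qzy e(1) by (intro add_left_mono mult_left_mono) auto
  also have "(1 + 1 / \<epsilon>) * (\<epsilon>\<^sup>2 * (p * (1 + \<kappa>)\<^sup>2 * n)) = (\<epsilon> + 1) * \<epsilon> * (p * (1 + \<kappa>)\<^sup>2 * n)"
    using e(1) by (simp add: field_simps power2_eq_square)
  also have "\<dots> \<le> (2 * \<epsilon>) * (p * (1 + \<kappa>)\<^sup>2 * n)"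
    using e \<open>0 \<le> p\<close> n0 by (intro mult_right_mono) auto
  also have "(1 + \<epsilon>) * a + (2 * \<epsilon>) * (p * (1 + \<kappa>)\<^sup>2 * n) \<le> a + \<epsilon> * (D * n)"
  proof -
    have "\<epsilon> * a \<le> \<epsilon> * (p * n)" using ap e(1) by simp
    then show ?thesis by (simp add: D_def algebra_simps)
  qed
  finally have b: "qf P z \<le> a + \<epsilon> * (D * n)" by simp
  have cq: "c * (q * n) = 2 * (D * n)" using q(1) by (simp add: c_def)
  have cq': "c * \<epsilon> * (q * n) = 2 * (\<epsilon> * (D * n))"
  proof -
    have "c * \<epsilon> * (q * n) = \<epsilon> * (c * (q * n))" by (simp only: mult_ac)
    also have "\<dots> = \<epsilon> * (2 * (D * n))" by (simp only: cq)
    also have "\<dots> = 2 * (\<epsilon> * (D * n))" by (simp only: mult_ac)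
    finally show ?thesis .
  qed
  have "(1 + c * \<epsilon>) * qf P z \<le> (1 + c * \<epsilon>) * (a + \<epsilon> * (D * n))"
    using b c0 e(1) by (intro mult_left_mono) auto
  also have "\<dots> = a + c * \<epsilon> * a + (1 + c * \<epsilon>) * (\<epsilon> * (D * n))"
    by (simp add: algebra_simps)
  also have "\<dots> \<le> a + c * \<epsilon> * (qf P x - q * n) + 2 * (\<epsilon> * (D * n))"
    using aq c0 e D0 n0 by (intro add_mono mult_left_mono mult_right_mono) auto
  also have "\<dots> = a + c * \<epsilon> * qf P x"
    using cq' unfolding right_diff_distrib by linarith
  finally have "(1 + c * \<epsilon>) * qf P z \<le> a + c * \<epsilon> * qf P x" .
  moreover have "(1 + c * \<epsilon>) * qf P x = qf P x + c * \<epsilon> * qf P x"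
    by (simp add: distrib_right)
  ultimately have "(1 + c * \<epsilon>) * qf P z + qf Q x + qf R (K *v x) \<le> (1 + c * \<epsilon>) * qf P x"
    using sx by linarith
  then show ?thesis by (simp add: qf_matrix_scaleR z_def)
qed

text \<open>First-order optimality of the input, tested against \<open>u\<close>. Subtracting two
  such conditions compares two gains without comparing matrix inverses.\<close>

lemma gain_stationary:
  assumes P: "psd P"
  shows "u \<bullet> (R *v (gain A B P *v x)) = - ((B *v u) \<bullet> (P *v (A *v x + B *v (gain A B P *v x))))"
proof -
  let ?k = "gain A B P *v x"
  have "u \<bullet> (ricG B P *v ?k) = u \<bullet> (R *v ?k) + (B *v u) \<bullet> (P *v (B *v ?k))"
    by (simp add: ricG_def matrix_vector_mult_add_rdistrib matrix_vector_mul_assoc[symmetric]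
        inner_transpose_mult inner_right_distrib del: transpose_matrix_vector)
  moreover have "u \<bullet> (ricG B P *v ?k) = - ((B *v u) \<bullet> (P *v (A *v x)))"
    by (simp add: ricG_gain[OF P] inner_transpose_mult del: transpose_matrix_vector)
  ultimately show ?thesis
    by (simp add: matrix_vector_right_distrib inner_right_distrib)
qed

text \<open>Comparison in both directions: inflated \<open>P\<close> is a supersolution for the
  nearby system, which also gives its stabilizability, and inflated \<open>P'\<close> is one for the
  original. Hence \<open>P' - P\<close> is of order \<open>\<epsilon>\<close>, first as a form and
  then as an operator, and stationarity carries this over to the gains.\<close>

lemma lqr_gain_lipschitz:
  assumes sol: "ric_sol A B P"
  shows "\<exists>\<epsilon>0>0. \<exists>C\<ge>0. \<forall>A' B' \<epsilon>. 0 < \<epsilon> \<longrightarrow> \<epsilon> \<le> \<epsilon>0 \<longrightarrow>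
     (\<forall>x u. norm ((A' *v x + B' *v u) - (A *v x + B *v u)) \<le> \<epsilon> * (norm x + norm u)) \<longrightarrow>
     stabilizable A' B' \<and>
     (\<forall>x. norm (lqr_gain A' B' Q R *v x - lqr_gain A B Q R *v x) \<le> C * \<epsilon> * norm x)"
proof -
  have P: "psd P" using sol by (rule ric_sol_psd)
  obtain q where q: "q > 0" "\<And>x. q * (norm x)\<^sup>2 \<le> qf Q x"
    using pos_def_lower_bound[OF Q] by blast
  obtain r where r: "r > 0" "\<And>x. r * (norm x)\<^sup>2 \<le> qf R x"
    using pos_def_lower_bound[OF R] by blast
  define K where "K = gain A B P"
  define p where "p = onorm ((*v) P)"
  define \<kappa> where "\<kappa> = onorm ((*v) K)"
  \<comment> \<open>Bounds the gain of every nearby system: \<open>r * (norm (K' *v x))^2\<close> is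
    part of its cost, and that cost is at most \<open>2 * p * (norm x)^2\<close>. Accordingly
    \<open>c2\<close> is \<open>c1\<close> with \<open>2 * p\<close> and \<open>\<kappa>2\<close> in
    place of \<open>p\<close> and \<open>\<kappa>\<close>.\<close>
  define \<kappa>2 where "\<kappa>2 = sqrt (2 * p / r)"
  define c1 where "c1 = 2 * (p + 2 * p * (1 + \<kappa>)\<^sup>2) / q"
  define c2 where "c2 = 2 * (2 * p + 2 * (2 * p) * (1 + \<kappa>2)\<^sup>2) / q"
  define c3 where "c3 = (c1 + 2 * c2) * p"
  define Y where "Y = onorm ((*v) A) + onorm ((*v) B) * \<kappa>2 + (1 + \<kappa>2)"
  define b where "b = onorm ((*v) B)"
  define C0 where "C0 = 2 * p * Y + b * c3 * Y + b * p * (1 + \<kappa>2)"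
  have p0: "0 \<le> p" and k0: "0 \<le> \<kappa>" and b0: "0 \<le> b" unfolding p_def \<kappa>_def b_def by (rule onorm_matrix_nonneg)+
  have k20: "0 \<le> \<kappa>2" using p0 r(1) by (simp add: \<kappa>2_def)
  have c0: "0 \<le> c1" "0 \<le> c2" unfolding c1_def c2_def using p0 k0 k20 q(1) by auto
  have c30: "0 \<le> c3" unfolding c3_def using c0 p0 by simp
  have Y0: "0 \<le> Y" unfolding Y_def using k20 onorm_matrix_nonneg[of A] onorm_matrix_nonneg[of B] by simp
  have Pp: "qf P x \<le> p * (norm x)\<^sup>2" for x
    using qf_le_onorm[of P x] by (simp add: p_def)
  have C00: "0 \<le> C0" unfolding C0_def using p0 Y0 b0 c30 k20 by simp
  have main: "stabilizable A' B' \<and>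
     (\<forall>x. norm (lqr_gain A' B' Q R *v x - lqr_gain A B Q R *v x) \<le> C0 / r * \<epsilon> * norm x)"
    if e0: "0 < \<epsilon>" and e1: "\<epsilon> \<le> 1 / (1 + c1 + c2)"
      and close: "\<And>x u. norm ((A' *v x + B' *v u) - (A *v x + B *v u)) \<le> \<epsilon> * (norm x + norm u)"
    for A' B' \<epsilon>
  proof -
    have pos: "0 < 1 + c1 + c2" using c0 by simp
    then have "\<epsilon> * (1 + c1 + c2) \<le> 1" using e1 by (simp add: field_simps)
    moreover have "0 \<le> \<epsilon> * c1" "0 \<le> \<epsilon> * c2" using e0 c0 by auto
    ultimately have e: "\<epsilon> \<le> 1" "c1 * \<epsilon> \<le> 1" "c2 * \<epsilon> \<le> 1"
      using e0 by (auto simp: algebra_simps)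
    let ?S = "(1 + c1 * \<epsilon>) *\<^sub>R P"
    have S: "psd ?S" using P c0 e0 by (intro psd_scaleR) auto
    have super1: "qf ?S (A' *v x + B' *v (K *v x)) + qf Q x + qf R (K *v x) \<le> qf ?S x" for x
      unfolding c1_def
    proof (rule supersolution_perturb[where A = A and B = B])
      show "norm (K *v x) \<le> \<kappa> * norm x" for x
        unfolding \<kappa>_def by (rule norm_matrix_vector_le)
      show "qf P (A *v x + B *v (K *v x)) + qf Q x + qf R (K *v x) \<le> qf P x" for x
        unfolding K_def using ric_sol_closed_loop[OF sol] by simp
      show "2 * (p + 2 * p * (1 + \<kappa>)\<^sup>2) / q * \<epsilon> \<le> 1"
        using e(2) by (simp only: c1_def)
    qed (rule P Pp q p0 k0 close e0 e)+
    have stab: "stabilizable A' B'"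
      unfolding stabilizable_def using spectral_radius_less_1_of_supersolution[OF S super1] by blast
    then obtain P' where sol': "ric_sol A' B' P'" using ric_sol_exists by blast
    have P': "psd P'" using sol' by (rule ric_sol_psd)
    have le1: "qf P' x \<le> (1 + c1 * \<epsilon>) * qf P x" for x
      using ric_sol_le_supersolution[OF sol' psd_nonneg[OF S] super1] by (simp add: qf_matrix_scaleR)
    have le2: "qf P' x \<le> 2 * p * (norm x)\<^sup>2" for x
    proof -
      have "(1 + c1 * \<epsilon>) * qf P x \<le> 2 * qf P x"
        using e psd_nonneg[OF P] by (intro mult_right_mono) auto
      then show ?thesis using le1[of x] Pp[of x] by simp
    qed
    define K' where "K' = gain A' B' P'"
    have K': "norm (K' *v x) \<le> \<kappa>2 * norm x" for x
    proof -
      have "r * (norm (K' *v x))\<^sup>2 \<le> qf R (K' *v x)" by (rule r(2))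
      also have "\<dots> \<le> qf P' x"
        using ric_sol_closed_loop[OF sol', of x] psd_nonneg[OF psd_Q, of x]
          psd_nonneg[OF P', of "A' *v x + B' *v (gain A' B' P' *v x)"]
        unfolding K'_def by linarith
      also have "\<dots> \<le> 2 * p * (norm x)\<^sup>2" by (rule le2)
      finally have "(norm (K' *v x))\<^sup>2 \<le> (\<kappa>2 * norm x)\<^sup>2"
        using r(1) p0 by (simp add: \<kappa>2_def power_mult_distrib field_simps)
      then show ?thesis
        by (rule power2_le_imp_le) (use k20 in simp)
    qed
    let ?S' = "(1 + c2 * \<epsilon>) *\<^sub>R P'"
    have S': "psd ?S'" using P' c0 e0 by (intro psd_scaleR) auto
    have super2: "qf ?S' (A *v x + B *v (K' *v x)) + qf Q x + qf R (K' *v x) \<le> qf ?S' x" for x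
      unfolding c2_def
    proof (rule supersolution_perturb[where A = A' and B = B'])
      show "qf P' (A' *v x + B' *v (K' *v x)) + qf Q x + qf R (K' *v x) \<le> qf P' x" for x
        unfolding K'_def using ric_sol_closed_loop[OF sol'] by simp
      show "norm (A *v x + B *v u - (A' *v x + B' *v u)) \<le> \<epsilon> * (norm x + norm u)" for x u
        using close[of x u] by (simp add: norm_minus_commute)
      show "0 \<le> 2 * p" using p0 by simp
      show "2 * (2 * p + 2 * (2 * p) * (1 + \<kappa>2)\<^sup>2) / q * \<epsilon> \<le> 1"
        using e(3) by (simp only: c2_def)
    qed (rule P' le2 q p0 k20 K' e0 e)+
    have le3: "qf P x \<le> (1 + c2 * \<epsilon>) * qf P' x" for x
      using ric_sol_le_supersolution[OF sol psd_nonneg[OF S'] super2] by (simp add: qf_matrix_scaleR)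
    have symD: "transpose (P' - P) = P' - P"
      using P P' by (simp add: psd_def transpose_def vec_eq_iff)
    have dP: "norm ((P' - P) *v x) \<le> (c3 * \<epsilon>) * norm x" for x
    proof (rule sym_qf_bound_imp_inner_bound[OF symD])
      fix x
      have D: "qf (P' - P) x = qf P' x - qf P x" by (simp add: qf_def algebra_simps)
      have "c1 * \<epsilon> * qf P x \<le> c1 * \<epsilon> * (p * (norm x)\<^sup>2)"
        using Pp c0 e0 by (intro mult_left_mono) auto
      moreover have "c2 * \<epsilon> * qf P' x \<le> c2 * \<epsilon> * (2 * p * (norm x)\<^sup>2)"
        using le2 c0 e0 by (intro mult_left_mono) auto
      moreover have "0 \<le> c1 * \<epsilon> * (p * (norm x)\<^sup>2)" "0 \<le> c2 * \<epsilon> * (2 * p * (norm x)\<^sup>2)"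
        using c0 e0 p0 by auto
      moreover have "c3 * \<epsilon> * (norm x)\<^sup>2 = c1 * \<epsilon> * (p * (norm x)\<^sup>2) + c2 * \<epsilon> * (2 * p * (norm x)\<^sup>2)"
        by (simp add: c3_def algebra_simps)
      ultimately show "\<bar>qf (P' - P) x\<bar> \<le> c3 * \<epsilon> * (norm x)\<^sup>2"
        using le1[of x] le3[of x] unfolding D by (simp add: algebra_simps abs_le_iff)
    qed
    have normP': "norm (P' *v x) \<le> 2 * p * norm x" for x
      using P' le2 psd_nonneg[OF P'] by (intro sym_qf_bound_imp_inner_bound) (auto simp: psd_def)
    have "norm (K' *v x - K *v x) \<le> C0 / r * \<epsilon> * norm x" for x
    proof -
      define e where "e = K' *v x - K *v x"
      define y y' where "y = A *v x + B *v (K *v x)" and "y' = A' *v x + B' *v (K' *v x)"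
      define d1 d2 where "d1 = B' *v e - B *v e" and "d2 = y' - (A *v x + B *v (K' *v x))"
      have nd1: "norm d1 \<le> \<epsilon> * norm e"
        using close[of 0 e] by (simp add: d1_def)
      have nd2: "norm d2 \<le> \<epsilon> * ((1 + \<kappa>2) * norm x)"
      proof -
        have "norm d2 \<le> \<epsilon> * (norm x + norm (K' *v x))"
          unfolding d2_def y'_def by (rule close)
        also have "\<dots> \<le> \<epsilon> * ((1 + \<kappa>2) * norm x)"
          using K'[of x] e0 by (intro mult_left_mono) (auto simp: algebra_simps)
        finally show ?thesis .
      qed
      have y': "y' = y + B *v e + d2"
        by (simp add: d2_def y_def e_def matrix_vector_mult_diff_distrib)
      have ny': "norm y' \<le> Y * norm x"
      proof -
        have "y' = A *v x + B *v (K' *v x) + d2" by (simp add: d2_def)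
        then have "norm y' \<le> norm (A *v x) + norm (B *v (K' *v x)) + norm d2"
          using norm_triangle_ineq[of "A *v x + B *v (K' *v x)" d2] norm_triangle_ineq[of "A *v x" "B *v (K' *v x)"]
          by simp
        also have "\<dots> \<le> onorm ((*v) A) * norm x + onorm ((*v) B) * (\<kappa>2 * norm x) + 1 * ((1 + \<kappa>2) * norm x)"
        proof (intro add_mono norm_matrix_vector_le)
          show "norm (B *v (K' *v x)) \<le> onorm ((*v) B) * (\<kappa>2 * norm x)"
            using norm_matrix_vector_le[of B "K' *v x"] mult_left_mono[OF K'[of x] onorm_matrix_nonneg[of B]]
            by linarith
          show "norm d2 \<le> 1 * ((1 + \<kappa>2) * norm x)"
            by (rule order.trans[OF nd2]) (use k20 in \<open>intro mult_right_mono e(1) mult_nonneg_nonneg; simp\<close>)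
        qed
        finally show ?thesis by (simp add: Y_def algebra_simps)
      qed
      have nBe: "norm (B *v e) \<le> b * norm e" unfolding b_def by (rule norm_matrix_vector_le)
      \<comment> \<open>Difference of the two stationarity conditions tested against
        \<open>e\<close> itself. The part quadratic in \<open>e\<close> joins the left side as
        \<open>qf P (B *v e)\<close>, with a favourable sign; each remaining term contains one
        factor of order \<open>\<epsilon>\<close>.\<close>
      have "e \<bullet> (R *v e) = e \<bullet> (R *v (K' *v x)) - e \<bullet> (R *v (K *v x))"
        by (simp add: e_def matrix_vector_mult_diff_distrib inner_diff_right)
      also have "\<dots> = - ((B' *v e) \<bullet> (P' *v y')) + (B *v e) \<bullet> (P *v y)"
        unfolding K_def K'_def gain_stationary[OF P] gain_stationary[OF P'] y_def y'_def by simp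
      also have "(B' *v e) \<bullet> (P' *v y') = d1 \<bullet> (P' *v y') + (B *v e) \<bullet> ((P' - P) *v y') + (B *v e) \<bullet> (P *v y')"
        by (simp add: d1_def inner_diff_left matrix_vector_mult_diff_rdistrib inner_diff_right)
      also have "(B *v e) \<bullet> (P *v y') = (B *v e) \<bullet> (P *v y) + qf P (B *v e) + (B *v e) \<bullet> (P *v d2)"
        by (simp add: y' qf_def matrix_vector_right_distrib inner_right_distrib)
      finally have "e \<bullet> (R *v e) + qf P (B *v e)
          = - (d1 \<bullet> (P' *v y') + (B *v e) \<bullet> ((P' - P) *v y') + (B *v e) \<bullet> (P *v d2))"
        by simp
      moreover have "\<bar>d1 \<bullet> (P' *v y')\<bar> \<le> (\<epsilon> * norm e) * (2 * p * (Y * norm x))"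
        using nd1 normP'[of y'] ny' p0 Y0 e0
        by (intro order.trans[OF Cauchy_Schwarz_ineq2] mult_mono order.trans[OF normP'[of y']] mult_left_mono) auto
      moreover have "\<bar>(B *v e) \<bullet> ((P' - P) *v y')\<bar> \<le> (b * norm e) * (c3 * \<epsilon> * (Y * norm x))"
        using nBe ny' c30 e0 b0
        by (intro order.trans[OF Cauchy_Schwarz_ineq2] mult_mono order.trans[OF dP[of y']] mult_left_mono) auto
      moreover have "\<bar>(B *v e) \<bullet> (P *v d2)\<bar> \<le> (b * norm e) * (p * (\<epsilon> * ((1 + \<kappa>2) * norm x)))"
        using nBe nd2 p0 b0
        by (intro order.trans[OF Cauchy_Schwarz_ineq2] mult_mono
            order.trans[OF norm_matrix_vector_le[of P d2], folded p_def] mult_left_mono) auto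
      ultimately have "e \<bullet> (R *v e) + qf P (B *v e) \<le> C0 * \<epsilon> * norm x * norm e"
        by (simp add: C0_def algebra_simps abs_le_iff)
      then have "r * (norm e)\<^sup>2 \<le> C0 * \<epsilon> * norm x * norm e"
        using r(2)[of e] psd_nonneg[OF P, of "B *v e"] by (simp add: qf_def)
      then have "r * norm e \<le> C0 * \<epsilon> * norm x \<or> e = 0"
        by (auto simp: power2_eq_square mult.assoc[symmetric])
      then show ?thesis
        using r(1) C00 e0 unfolding e_def[symmetric] by (auto simp: field_simps)
    qed
    then show ?thesis
      using stab by (simp add: lqr_gain_eq[OF sol] lqr_gain_eq[OF sol'] K_def K'_def)
  qed
  show ?thesis
    by (rule exI[of _ "1 / (1 + c1 + c2)"], intro conjI exI[of _ "C0 / r"] allI impI)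
      (use c0 C00 r(1) main in auto)
qed

end

subsection \<open>Measurability of the estimated gain\<close>

lemma borel_measurable_vec_lambda [measurable (raw)]:
  fixes f :: "'i::finite \<Rightarrow> 'a \<Rightarrow> 'b::euclidean_space"
  assumes "\<And>i. f i \<in> borel_measurable M"
  shows "(\<lambda>x. \<chi> i. f i x) \<in> borel_measurable M"
proof (subst borel_measurable_euclidean_space, rule ballI)
  fix b :: "'b^'i" assume "b \<in> Basis"
  then obtain i v where b: "b = axis i v" "v \<in> Basis"
    by (auto simp: Basis_vec_def)
  have "(\<lambda>x. (\<chi> i. f i x) \<bullet> b) = (\<lambda>x. f i x \<bullet> v)"
    by (simp add: b(1) inner_axis)
  then show "(\<lambda>x. (\<chi> i. f i x) \<bullet> b) \<in> borel_measurable M"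
    using assms by simp
qed

lemma borel_measurable_vec_nth [measurable (raw)]:
  fixes f :: "'a \<Rightarrow> 'b::euclidean_space^'i"
  shows "f \<in> borel_measurable M \<Longrightarrow> (\<lambda>x. f x $ i) \<in> borel_measurable M"
  by (rule borel_measurable_continuous_on[of "\<lambda>v. v $ i"]) (intro continuous_intros)

lemma borel_measurable_matrix_mult [measurable (raw)]:
  fixes f :: "'a \<Rightarrow> real^'n^'m" and g :: "'a \<Rightarrow> real^'k^'n"
  assumes "f \<in> borel_measurable M" "g \<in> borel_measurable M"
  shows "(\<lambda>x. f x ** g x) \<in> borel_measurable M"
  unfolding matrix_matrix_mult_def
  by (intro borel_measurable_vec_lambda borel_measurable_sum borel_measurable_times borel_measurable_vec_nth assms)

lemma borel_measurable_matrix_vector_mult [measurable (raw)]: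
  fixes f :: "'a \<Rightarrow> real^'n^'m"
  assumes "f \<in> borel_measurable M" "g \<in> borel_measurable M"
  shows "(\<lambda>x. f x *v g x) \<in> borel_measurable M"
  unfolding matrix_vector_mult_def
  by (intro borel_measurable_vec_lambda borel_measurable_sum borel_measurable_times borel_measurable_vec_nth assms)

lemma borel_measurable_transpose [measurable (raw)]:
  fixes f :: "'a \<Rightarrow> real^'n^'m"
  assumes "f \<in> borel_measurable M"
  shows "(\<lambda>x. transpose (f x)) \<in> borel_measurable M"
  unfolding transpose_def
  by (intro borel_measurable_vec_lambda borel_measurable_vec_nth assms)

lemma borel_measurable_matrix_inv [measurable (raw)]:
  fixes f :: "'a \<Rightarrow> real^'n^'n"
  assumes f: "f \<in> borel_measurable M"
  shows "(\<lambda>x. matrix_inv (f x)) \<in> borel_measurable M"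
proof -
  let ?c = "\<lambda>k j (A :: real^'n^'n). det (\<chi> i l. if l = k then (if i = j then 1 else 0) else A $ i $ l)"
  have d: "(\<lambda>x. det (f x)) \<in> borel_measurable M"
    by (rule borel_measurable_continuous_on[OF continuous_on_det[OF continuous_on_id] f])
  have c: "(\<lambda>x. ?c k j (f x)) \<in> borel_measurable M" for k j
    by (rule borel_measurable_continuous_on[OF continuous_on_cofactor f])
  show ?thesis
    apply (subst matrix_inv_cramer)
    apply (rule measurable_If)
    apply simp
    apply (intro borel_measurable_vec_lambda borel_measurable_divide c d)
    using d by measurable
qed

section \<open>The pseudoinverse as a limit\<close>

definition penrose :: "real^'c^'r \<Rightarrow> real^'r^'c \<Rightarrow> bool" where
  "penrose M X \<longleftrightarrow> M ** X ** M = M \<and> X ** M ** X = X \<and>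
     transpose (M ** X) = M ** X \<and> transpose (X ** M) = X ** M"

text \<open>Tikhonov-regularized least squares: the regularized matrix is always invertible, so this
  is an explicit measurable function of \<open>M\<close>.\<close>

definition pinv_approx :: "real^'c^'r \<Rightarrow> nat \<Rightarrow> real^'r^'c" where
  "pinv_approx M k =
     matrix_inv (transpose M ** M + (1 / real (Suc k)) *\<^sub>R mat 1) ** transpose M"

text \<open>With \<open>G = transpose M ** M\<close> the Penrose equations give
  \<open>transpose M = G ** X\<close> and \<open>X = G ** Y\<close>. Since the inverse of
  \<open>G + e\<close> maps \<open>G x\<close> to \<open>x\<close> minus \<open>e\<close> times its
  value at \<open>x\<close>, using this twice leaves an error of order \<open>e\<close>. The limit
  also shows that Penrose solutions are unique.\<close>

lemma pinv_approx_tendsto: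
  assumes X: "penrose M X"
  shows "pinv_approx M \<longlonglongrightarrow> X"
proof -
  let ?G = "transpose M ** M"
  define Y where "Y = X ** transpose X ** X"
  have MG: "transpose M = ?G ** X"
  proof -
    have "?G ** X = transpose M ** transpose (M ** X)"
      using X by (simp add: penrose_def matrix_mul_assoc)
    also have "\<dots> = transpose (M ** X ** M)"
      by (simp add: matrix_transpose_mul)
    finally show ?thesis using X by (simp add: penrose_def)
  qed
  have XG: "X = ?G ** Y"
  proof -
    have "X = transpose (X ** M) ** X"
      using X by (simp add: penrose_def)
    also have "\<dots> = transpose M ** transpose X ** X"
      by (simp add: matrix_transpose_mul)
    also have "\<dots> = ?G ** Y"
      by (subst MG) (simp add: Y_def matrix_mul_assoc)
    finally show ?thesis .
  qed
  have bound: "norm ((X - pinv_approx M k) *v v) \<le> 2 * norm (Y *v v) * (1 / real (Suc k))" for k v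
  proof -
    define e where "e = 1 / real (Suc k)"
    have e: "e > 0" by (simp add: e_def)
    define H where "H = ?G + e *\<^sub>R mat 1"
    have Hv: "H *v x = ?G *v x + e *\<^sub>R x" for x
      by (simp add: H_def matrix_vector_mult_add_rdistrib scaleR_matrix_vector_assoc[symmetric])
    have qH: "x \<bullet> (H *v x) = (norm (M *v x))\<^sup>2 + e * (norm x)\<^sup>2" for x
      by (simp add: Hv inner_right_distrib matrix_vector_mul_assoc[symmetric] inner_transpose_mult
          power2_norm_eq_inner del: transpose_matrix_vector)
    have "transpose H = H"
      by (simp add: H_def transpose_add matrix_transpose_mul transpose_scalar)
    then have "pos_def H"
      using e by (auto simp: pos_def_def qH intro!: add_nonneg_pos)
    then have inv: "invertible H" by (rule pos_def_invertible)
    let ?I = "matrix_inv H"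
    have Ibound: "e * norm (?I *v x) \<le> norm x" for x
    proof -
      have "H *v (?I *v x) = x"
        using matrix_inv_both[OF inv] by (simp add: matrix_vector_mul_assoc)
      then have "e * (norm (?I *v x))\<^sup>2 \<le> (?I *v x) \<bullet> x"
        using qH[of "?I *v x"] by simp
      also have "\<dots> \<le> norm (?I *v x) * norm x" by (rule norm_cauchy_schwarz)
      finally show ?thesis
        by (cases "?I *v x = 0") (auto simp: power2_eq_square)
    qed
    have IG: "?I *v (?G *v x) = x - e *\<^sub>R (?I *v x)" for x
    proof -
      have "?I *v (H *v x) = x"
        using matrix_inv_both[OF inv] by (simp add: matrix_vector_mul_assoc)
      then have "?I *v (?G *v x) + e *\<^sub>R (?I *v x) = x"
        unfolding Hv by (simp only: matrix_vector_right_distrib matrix_vector_mult_scaleR)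
      then show ?thesis by (simp add: eq_diff_eq)
    qed
    have "pinv_approx M k *v v = ?I *v (transpose M *v v)"
      by (simp only: pinv_approx_def H_def e_def matrix_vector_mul_assoc)
    also have "transpose M *v v = ?G *v (X *v v)"
      by (subst MG) (simp only: matrix_vector_mul_assoc)
    also have "?I *v \<dots> = X *v v - e *\<^sub>R (?I *v (X *v v))" by (rule IG)
    finally have "(X - pinv_approx M k) *v v = e *\<^sub>R (?I *v (X *v v))"
      by (simp add: matrix_vector_mult_diff_rdistrib)
    also have "X *v v = ?G *v (Y *v v)"
      by (subst XG) (simp only: matrix_vector_mul_assoc)
    also have "?I *v \<dots> = Y *v v - e *\<^sub>R (?I *v (Y *v v))" by (rule IG)
    finally have "norm ((X - pinv_approx M k) *v v) = e * norm (Y *v v - e *\<^sub>R (?I *v (Y *v v)))"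
      using e by simp
    also have "\<dots> \<le> e * (norm (Y *v v) + norm (Y *v v))"
      using e Ibound[of "Y *v v"] norm_triangle_ineq4[of "Y *v v" "e *\<^sub>R (?I *v (Y *v v))"]
      by (intro mult_left_mono) auto
    finally show ?thesis by (simp add: e_def)
  qed
  have "(\<lambda>k. pinv_approx M k $ i $ j) \<longlonglongrightarrow> X $ i $ j" for i j
  proof (rule Lim_null[THEN iffD2], rule Lim_null_comparison)
    show "\<forall>\<^sub>F k in sequentially. norm (pinv_approx M k $ i $ j - X $ i $ j)
        \<le> 2 * norm (Y *v axis j 1) * (1 / real (Suc k))"
    proof (rule always_eventually, rule allI)
      fix k
      have "norm (pinv_approx M k $ i $ j - X $ i $ j) = norm (((X - pinv_approx M k) *v axis j 1) $ i)"
        by (simp add: matrix_vector_mult_basis column_def)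
      also have "\<dots> \<le> norm ((X - pinv_approx M k) *v axis j 1)"
        by (simp add: component_le_norm_cart)
      finally show "norm (pinv_approx M k $ i $ j - X $ i $ j) \<le> 2 * norm (Y *v axis j 1) * (1 / real (Suc k))"
        using bound[of k "axis j 1"] by linarith
    qed
    have "(\<lambda>k. 2 * norm (Y *v axis j 1) * (1 / real (Suc k))) \<longlonglongrightarrow> 2 * norm (Y *v axis j 1) * 0"
      by (intro tendsto_mult tendsto_const LIMSEQ_inverse_real_of_nat[unfolded inverse_eq_divide])
    then show "(\<lambda>k. 2 * norm (Y *v axis j 1) * (1 / real (Suc k))) \<longlonglongrightarrow> 0" by simp
  qed
  then show ?thesis by (intro vec_tendstoI)
qed

lemma pseudoinverse_eqI: "penrose M X \<Longrightarrow> pseudoinverse M = X"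
  unfolding pseudoinverse_def penrose_def[symmetric]
  using pinv_approx_tendsto LIMSEQ_unique by (intro the_equality) blast+

lemma pseudoinverse_invertible:
  fixes V :: "real^'n^'n"
  assumes "invertible V"
  shows "pseudoinverse V = matrix_inv V"
  by (rule pseudoinverse_eqI) (simp add: penrose_def matrix_inv_both[OF assms])

text \<open>A description without a solution has the fixed value \<open>THE X. False\<close>, so
  every branch is measurable in \<open>M\<close>.\<close>

lemma pseudoinverse_lim:
  "pseudoinverse M = (if penrose M (lim (pinv_approx M)) then lim (pinv_approx M) else (THE X. False))"
proof (cases "\<exists>X. penrose M X")
  case True
  then obtain X where X: "penrose M X" by blast
  then have "lim (pinv_approx M) = X" by (intro limI pinv_approx_tendsto)
  then show ?thesis using X pseudoinverse_eqI[OF X] by simp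
next
  case False
  then show ?thesis
    unfolding pseudoinverse_def penrose_def[symmetric] by simp
qed

lemma borel_measurable_pseudoinverse [measurable (raw)]:
  fixes f :: "'a \<Rightarrow> real^'c^'r"
  assumes [measurable]: "f \<in> borel_measurable M"
  shows "(\<lambda>x. pseudoinverse (f x)) \<in> borel_measurable M"
proof -
  have [measurable]: "(\<lambda>x. lim (pinv_approx (f x))) \<in> borel_measurable M"
    unfolding pinv_approx_def by (intro borel_measurable_lim_metric) measurable
  show ?thesis
    unfolding pseudoinverse_lim penrose_def by measurable
qed

section \<open>The Riccati solution and the gain as measurable functions of the system\<close>

lemma sym_tendsto_of_qf:
  fixes X :: "nat \<Rightarrow> real^'n^'n"
  assumes sym: "\<And>k. transpose (X k) = X k" "transpose P = P"
    and lim: "\<And>x. (\<lambda>k. qf (X k) x) \<longlonglongrightarrow> qf P x"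
  shows "X \<longlonglongrightarrow> P"
proof -
  have entry: "Z $ i $ j = (qf Z (axis i 1 + axis j 1) - qf Z (axis i 1) - qf Z (axis j 1)) / 2"
    if "transpose Z = Z" for Z :: "real^'n^'n" and i j
  proof -
    have "axis j 1 \<bullet> (Z *v axis i 1) = Z $ j $ i"
      by (simp add: matrix_vector_mult_basis column_def cart_eq_inner_axis[symmetric] inner_commute[of "axis _ _"])
    also have "\<dots> = transpose Z $ i $ j" by (simp add: transpose_def)
    finally show ?thesis using qf_add[OF that, of "axis i 1" "axis j 1"] that by simp
  qed
  have "(\<lambda>k. X k $ i $ j) \<longlonglongrightarrow> P $ i $ j" for i j
    unfolding entry[OF sym(1)] entry[OF sym(2)] by (intro tendsto_intros lim) simp
  then show ?thesis by (intro vec_tendstoI)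
qed

lemma qf_scaled_identity: "qf (c *\<^sub>R mat 1) x = c * (norm x)\<^sup>2"
  by (simp add: qf_def scaleR_matrix_vector_assoc[symmetric] power2_norm_eq_inner)

context lqr
begin

text \<open>The inner limit is value iteration started above the solution. The multiple of the
  identity must dominate a matrix not known beforehand, hence the outer limit, which is of an
  eventually constant sequence.\<close>

definition ric_lim :: "real^'n^'n \<Rightarrow> real^'m^'n \<Rightarrow> real^'n^'n" where
  "ric_lim A B = lim (\<lambda>c. lim (\<lambda>k. (ricF A B ^^ k) (real c *\<^sub>R mat 1)))"

text \<open>Monotonicity keeps the iterates above \<open>P\<close>. Playing the optimal gain of
  \<open>P\<close> bounds the excess by the initial form evaluated along the closed loop, which
  decays.\<close>

lemma value_iteration_tendsto:
  assumes sol: "ric_sol A B P" and c: "\<And>x. qf P x \<le> c * (norm x)\<^sup>2" "0 \<le> c"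
  shows "(\<lambda>k. (ricF A B ^^ k) (c *\<^sub>R mat 1)) \<longlonglongrightarrow> P"
proof -
  let ?K = "gain A B P"
  let ?L = "A + B ** ?K"
  have L: "?L *v x = A *v x + B *v (?K *v x)" for x
    by (simp add: matrix_vector_mult_add_rdistrib matrix_vector_mul_assoc)
  have P: "psd P" using sol by (rule ric_sol_psd)
  have "qf P (?L *v x) + qf Q x \<le> qf P x" for x
    using ric_sol_closed_loop[OF sol, of x] psd_nonneg[OF psd_R, of "?K *v x"] unfolding L by linarith
  then have lim: "(\<lambda>k. ((*v) ?L ^^ k) x) \<longlonglongrightarrow> 0" for x
    by (rule lyapunov_powers[OF psd_nonneg[OF P]])
  define W where "W k = (ricF A B ^^ k) (c *\<^sub>R mat 1)" for k
  have psd0: "psd (c *\<^sub>R mat 1 :: real^'n^'n)"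
    using c(2) by (simp add: psd_def transpose_scalar qf_scaled_identity)
  have psdW: "psd (W k)" for k
    unfolding W_def by (rule value_iteration_psd[OF psd0])
  have WSuc: "W (Suc k) = ricF A B (W k)" for k by (simp add: W_def)
  have PF: "ricF A B P = P" using sol by (simp add: ric_sol_def)
  have lower: "qf P x \<le> qf (W k) x" for k x
  proof (induction k arbitrary: x)
    case 0 then show ?case using c(1) by (simp add: W_def qf_scaled_identity)
  next
    case (Suc k)
    show ?case
      unfolding WSuc using ricF_mono[OF P psdW, of k A B x] Suc by (simp add: PF)
  qed
  have upper: "qf (W k) x - qf P x \<le> c * (norm (((*v) ?L ^^ k) x))\<^sup>2" for k x
  proof (induction k arbitrary: x)
    case 0 then show ?case using psd_nonneg[OF P] by (simp add: W_def qf_scaled_identity)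
  next
    case (Suc k)
    have "qf (W (Suc k)) x - qf P x \<le> qf (W k) (?L *v x) - qf P (?L *v x)"
      using qf_ricF_le[OF psdW, of A B k x "?K *v x"] ric_sol_closed_loop[OF sol, of x]
      unfolding WSuc L by linarith
    also have "\<dots> \<le> c * (norm (((*v) ?L ^^ k) (?L *v x)))\<^sup>2" by (rule Suc)
    finally show ?case by (simp add: funpow_swap1)
  qed
  have "(\<lambda>k. qf (W k) x) \<longlonglongrightarrow> qf P x" for x
  proof (rule tendsto_sandwich[of "\<lambda>_. qf P x" _ _ "\<lambda>k. qf P x + c * (norm (((*v) ?L ^^ k) x))\<^sup>2"])
    have "(\<lambda>k. c * (norm (((*v) ?L ^^ k) x))\<^sup>2) \<longlonglongrightarrow> c * (norm (0 :: real^'n))\<^sup>2"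
      by (intro tendsto_intros lim)
    then have "(\<lambda>k. qf P x + c * (norm (((*v) ?L ^^ k) x))\<^sup>2) \<longlonglongrightarrow> qf P x + c * (norm (0 :: real^'n))\<^sup>2"
      by (intro tendsto_add tendsto_const)
    then show "(\<lambda>k. qf P x + c * (norm (((*v) ?L ^^ k) x))\<^sup>2) \<longlonglongrightarrow> qf P x"
      by (simp only: norm_zero power_zero_numeral mult_zero_right add_0_right)
    show "\<forall>\<^sub>F k in sequentially. qf (W k) x \<le> qf P x + c * (norm (((*v) ?L ^^ k) x))\<^sup>2"
      using upper by (intro always_eventually allI) (simp add: diff_le_eq add.commute)
  qed (use lower in auto)
  then have "W \<longlonglongrightarrow> P"
    using psdW P by (intro sym_tendsto_of_qf) (auto simp: psd_def)
  then show ?thesis by (simp add: W_def[abs_def])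
qed

lemma ric_lim_eq:
  assumes sol: "ric_sol A B P"
  shows "ric_lim A B = P"
  unfolding ric_lim_def
proof (rule limI, rule tendsto_eventually)
  have "lim (\<lambda>k. (ricF A B ^^ k) (real c *\<^sub>R mat 1)) = P" if "c \<ge> nat \<lceil>onorm ((*v) P)\<rceil>" for c
  proof (intro limI value_iteration_tendsto[OF sol])
    fix x
    have "qf P x \<le> onorm ((*v) P) * (norm x)\<^sup>2" using qf_le_onorm[of P x] by linarith
    also have "\<dots> \<le> real c * (norm x)\<^sup>2"
      using that by (intro mult_right_mono) (auto simp: nat_le_iff ceiling_le_iff)
    finally show "qf P x \<le> real c * (norm x)\<^sup>2" .
  qed simp
  then show "\<forall>\<^sub>F c in sequentially. lim (\<lambda>k. (ricF A B ^^ k) (real c *\<^sub>R mat 1)) = P"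
    unfolding eventually_sequentially by blast
qed

text \<open>Trades strict positivity for \<open>Q \<le> P\<close> in the order of forms, a closed
  condition on \<open>P\<close>, from which measurability is read off.\<close>

lemma ric_sol_alt:
  "ric_sol A B P \<longleftrightarrow> transpose P = P \<and> (\<forall>x. qf Q x \<le> qf P x) \<and> P = ricF A B P"
proof
  assume sol: "ric_sol A B P"
  have "qf Q x \<le> qf P x" for x
    using ric_sol_closed_loop[OF sol, of x] psd_nonneg[OF psd_R, of "gain A B P *v x"]
      psd_nonneg[OF ric_sol_psd[OF sol], of "A *v x + B *v (gain A B P *v x)"] by linarith
  then show "transpose P = P \<and> (\<forall>x. qf Q x \<le> qf P x) \<and> P = ricF A B P"
    using sol by (auto simp: ric_sol_def pos_def_def)
next
  assume *: "transpose P = P \<and> (\<forall>x. qf Q x \<le> qf P x) \<and> P = ricF A B P"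
  have "0 < qf P x" if "x \<noteq> 0" for x
    using pos_def_qf[OF Q that] * by (meson less_le_trans)
  then show "ric_sol A B P"
    using * by (auto simp: ric_sol_def pos_def_def qf_def)
qed

definition ce_gain :: "real^'n^'n \<Rightarrow> real^'m^'n \<Rightarrow> real^'n^'m" where
  "ce_gain A B = (if stabilizable A B then lqr_gain A B Q R else 0)"

text \<open>Stabilizability quantifies over uncountably many gains; here it becomes the test whether
  one measurable limit solves the Riccati equation.\<close>

lemma ce_gain_ric_lim:
  "ce_gain A B = (if ric_sol A B (ric_lim A B) then gain A B (ric_lim A B) else 0)"
proof (cases "stabilizable A B")
  case True
  then obtain P where P: "ric_sol A B P" using ric_sol_exists by blast
  then show ?thesis using True by (simp add: ce_gain_def ric_lim_eq[OF P] lqr_gain_eq[OF P])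
next
  case False
  then show ?thesis by (auto simp: ce_gain_def stabilizable_iff_ric_sol)
qed

lemma borel_measurable_ricF [measurable (raw)]:
  assumes [measurable]: "f \<in> borel_measurable M" "g \<in> borel_measurable M" "h \<in> borel_measurable M"
  shows "(\<lambda>x. ricF (f x) (g x) (h x)) \<in> borel_measurable M"
  unfolding ricF_def ricG_def by measurable

lemma borel_measurable_ric_lim [measurable (raw)]:
  assumes [measurable]: "f \<in> borel_measurable M" "g \<in> borel_measurable M"
  shows "(\<lambda>x. ric_lim (f x) (g x)) \<in> borel_measurable M"
proof -
  have [measurable]: "(\<lambda>x. (ricF (f x) (g x) ^^ k) (c *\<^sub>R mat 1)) \<in> borel_measurable M" for c k
    by (induction k) simp_all
  show ?thesis
    unfolding ric_lim_def by (intro borel_measurable_lim_metric) measurable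
qed

lemma measurable_ric_sol [measurable (raw)]:
  assumes [measurable]: "f \<in> borel_measurable M" "g \<in> borel_measurable M" "h \<in> borel_measurable M"
  shows "Measurable.pred M (\<lambda>x. ric_sol (f x) (g x) (h x))"
proof -
  have "closed {P. \<forall>x. qf Q x \<le> qf P x}"
    unfolding qf_def by (intro closed_Collect_all closed_Collect_le continuous_intros)
      (simp add: matrix_vector_mult_def, intro continuous_intros)
  then have [measurable]: "{P. \<forall>x. qf Q x \<le> qf P x} \<in> sets borel" by simp
  have *: "(\<lambda>x. ric_sol (f x) (g x) (h x)) =
      (\<lambda>x. transpose (h x) = h x \<and> h x \<in> {P. \<forall>x. qf Q x \<le> qf P x} \<and> h x = ricF (f x) (g x) (h x))"
    by (simp add: ric_sol_alt)
  show ?thesis unfolding * by measurable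
qed

lemma borel_measurable_ce_gain [measurable (raw)]:
  assumes [measurable]: "f \<in> borel_measurable M" "g \<in> borel_measurable M"
  shows "(\<lambda>x. ce_gain (f x) (g x)) \<in> borel_measurable M"
  unfolding ce_gain_ric_lim gain_def ricG_def by measurable

lemma K_hat_ce_gain: "K_hat Q R x u k = ce_gain (A_hat x u k) (B_hat x u k)"
  by (simp add: K_hat_def ce_gain_def)

lemma borel_measurable_stack [measurable (raw)]:
  fixes f :: "'a \<Rightarrow> real^'k" and g :: "'a \<Rightarrow> real^'l"
  assumes "f \<in> borel_measurable M" "g \<in> borel_measurable M"
  shows "(\<lambda>x. stack (f x) (g x)) \<in> borel_measurable M"
  unfolding stack_def
proof (rule borel_measurable_vec_lambda)
  fix i :: "'k + 'l"
  show "(\<lambda>x. case i of Inl a \<Rightarrow> f x $ a | Inr b \<Rightarrow> g x $ b) \<in> borel_measurable M"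
    using assms by (cases i) (auto intro: borel_measurable_vec_nth)
qed

lemma borel_measurable_outer_product [measurable (raw)]:
  assumes [measurable]: "f \<in> borel_measurable M" "g \<in> borel_measurable M"
  shows "(\<lambda>x. outer_product (f x) (g x)) \<in> borel_measurable M"
  unfolding outer_product_def by measurable

lemma borel_measurable_K_hat:
  assumes x: "\<And>t. 1 \<le> t \<Longrightarrow> t < k \<Longrightarrow> x t \<in> borel_measurable M"
    and u: "\<And>t. 1 \<le> t \<Longrightarrow> t < k \<Longrightarrow> u t \<in> borel_measurable M"
  shows "(\<lambda>\<omega>. K_hat Q R (\<lambda>t. x t \<omega>) (\<lambda>t. u t \<omega>) k) \<in> borel_measurable M"
proof -
  have [measurable]: "(\<lambda>\<omega>. Theta_hat (\<lambda>t. x t \<omega>) (\<lambda>t. u t \<omega>) k) \<in> borel_measurable M"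
    unfolding Theta_hat_def
    by (intro borel_measurable_matrix_mult borel_measurable_sum borel_measurable_pseudoinverse
        borel_measurable_outer_product borel_measurable_stack x u) auto
  show ?thesis
    unfolding K_hat_ce_gain A_hat_def B_hat_def by measurable
qed

end

subsection \<open>Exponential moments of Gaussian vectors\<close>

lemma std_gaussian_density_nonneg: "0 \<le> std_gaussian_density y"
  by (simp add: std_gaussian_density_def)

lemma borel_measurable_std_gaussian_density [measurable]:
  "(std_gaussian_density :: real^'n \<Rightarrow> real) \<in> borel_measurable borel"
  unfolding std_gaussian_density_def[abs_def] by measurable

lemma nn_integral_normal_density:
  "\<sigma> > 0 \<Longrightarrow> (\<integral>\<^sup>+x. ennreal (normal_density \<mu> \<sigma> x) \<partial>lborel) = 1"
  using prob_space.emeasure_space_1[OF prob_space_normal_density[of \<sigma> \<mu>]]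
  by (simp add: emeasure_density)

lemma nn_integral_std_normal_exp_linear:
  "(\<integral>\<^sup>+g. ennreal (std_normal_density g) * ennreal (exp (t * g)) \<partial>lborel) = ennreal (exp (t\<^sup>2 / 2))"
proof -
  have "ennreal (std_normal_density g) * ennreal (exp (t * g))
      = ennreal (exp (t\<^sup>2 / 2)) * ennreal (normal_density t 1 g)" for g
  proof -
    have "- (g\<^sup>2 / 2) + t * g = t\<^sup>2 / 2 - (g - t)\<^sup>2 / 2"
      by (simp add: power2_eq_square field_simps)
    then have "exp (- (g\<^sup>2 / 2)) * exp (t * g) = exp (t\<^sup>2 / 2) * exp (- (g - t)\<^sup>2 / 2)"
      by (simp add: exp_add[symmetric])
    then show ?thesis
      by (simp add: normal_density_def ennreal_mult[symmetric] field_simps)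
  qed
  then show ?thesis
    by (simp add: nn_integral_cmult nn_integral_normal_density)
qed

lemma nn_integral_std_normal_exp_square:
  assumes "a < 1"
  shows "(\<integral>\<^sup>+g. ennreal (std_normal_density g) * ennreal (exp (a * g\<^sup>2 / 2)) \<partial>lborel)
    = ennreal (1 / sqrt (1 - a))"
proof -
  define \<sigma> where "\<sigma> = 1 / sqrt (1 - a)"
  have \<sigma>: "\<sigma> > 0" "\<sigma>\<^sup>2 = 1 / (1 - a)" using assms by (auto simp: \<sigma>_def power_divide)
  have "ennreal (std_normal_density g) * ennreal (exp (a * g\<^sup>2 / 2))
      = ennreal \<sigma> * ennreal (normal_density 0 \<sigma> g)" for g
  proof -
    have "- (g\<^sup>2 / 2) + a * g\<^sup>2 / 2 = - (g\<^sup>2 / (2 * \<sigma>\<^sup>2))"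
      using assms unfolding \<sigma>(2) by (simp add: field_simps)
    then have "exp (- (g\<^sup>2 / 2)) * exp (a * g\<^sup>2 / 2) = exp (- (g\<^sup>2 / (2 * \<sigma>\<^sup>2)))"
      by (simp add: exp_add[symmetric])
    moreover have "sqrt (2 * pi * \<sigma>\<^sup>2) = \<sigma> * sqrt (2 * pi)"
      using \<sigma>(1) by (simp add: real_sqrt_mult)
    ultimately have "std_normal_density g * exp (a * g\<^sup>2 / 2) = \<sigma> * normal_density 0 \<sigma> g"
      using \<sigma>(1) by (simp add: normal_density_def)
    then show ?thesis
      using \<sigma>(1) by (simp add: ennreal_mult[symmetric])
  qed
  then show ?thesis
    using \<sigma>(1) by (simp add: nn_integral_cmult nn_integral_normal_density) (simp add: \<sigma>_def)
qed

context prob_space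
begin

text \<open>Completing the square turns the exponential tilt into a translation, under which
  Lebesgue measure is invariant.\<close>

lemma gaussian_mgf:
  fixes X :: "'a \<Rightarrow> real^'n"
  assumes X: "distributed M lborel X (\<lambda>y. ennreal (std_gaussian_density y))"
  shows "(\<integral>\<^sup>+\<omega>. ennreal (exp (b \<bullet> X \<omega>)) \<partial>M) = ennreal (exp ((norm b)\<^sup>2 / 2))"
proof -
  \<comment> \<open>Normalization of the density is inherited from \<open>M\<close> having total
    mass 1.\<close>
  have one: "(\<integral>\<^sup>+y. ennreal (std_gaussian_density (y :: real^'n)) \<partial>lborel) = 1"
    using distributed_nn_integral[OF X, of "\<lambda>_. 1"] emeasure_space_1 by simp
  have "(\<integral>\<^sup>+\<omega>. ennreal (exp (b \<bullet> X \<omega>)) \<partial>M)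
      = (\<integral>\<^sup>+y. ennreal (std_gaussian_density y) * ennreal (exp (b \<bullet> y)) \<partial>lborel)"
    by (rule distributed_nn_integral[OF X, symmetric]) measurable
  also have "\<dots> = (\<integral>\<^sup>+y. ennreal (exp ((norm b)\<^sup>2 / 2)) * ennreal (std_gaussian_density (- b + y)) \<partial>lborel)"
  proof (rule nn_integral_cong)
    fix y
    have "(norm (- b + y))\<^sup>2 = (norm b)\<^sup>2 - 2 * (b \<bullet> y) + (norm y)\<^sup>2"
      by (simp add: power2_norm_eq_inner algebra_simps inner_commute)
    then have "- (norm y)\<^sup>2 / 2 + b \<bullet> y = (norm b)\<^sup>2 / 2 + - (norm (- b + y))\<^sup>2 / 2"
      by (simp add: field_simps)
    then have "exp (- (norm y)\<^sup>2 / 2) * exp (b \<bullet> y) = exp ((norm b)\<^sup>2 / 2) * exp (- (norm (- b + y))\<^sup>2 / 2)"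
      by (simp only: exp_add[symmetric])
    then have "std_gaussian_density y * exp (b \<bullet> y) = exp ((norm b)\<^sup>2 / 2) * std_gaussian_density (- b + y)"
      by (simp add: std_gaussian_density_def)
    then show "ennreal (std_gaussian_density y) * ennreal (exp (b \<bullet> y))
        = ennreal (exp ((norm b)\<^sup>2 / 2)) * ennreal (std_gaussian_density (- b + y))"
      by (simp add: ennreal_mult[symmetric] std_gaussian_density_nonneg)
  qed
  also have "\<dots> = ennreal (exp ((norm b)\<^sup>2 / 2)) * (\<integral>\<^sup>+y. ennreal (std_gaussian_density (- b + y)) \<partial>lborel)"
    by (rule nn_integral_cmult) measurable
  also have "(\<integral>\<^sup>+y. ennreal (std_gaussian_density (- b + y)) \<partial>lborel)
      = (\<integral>\<^sup>+y. ennreal (std_gaussian_density y) \<partial>distr lborel borel ((+) (- b)))"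
    by (subst nn_integral_distr) auto
  also have "\<dots> = 1"
    unfolding lborel_distr_plus by (rule one)
  finally show ?thesis by simp
qed

text \<open>An auxiliary scalar normal \<open>g\<close> linearizes the square:
  \<open>exp (l * y^2)\<close> is the mean of \<open>exp (sqrt (2 * l) * y * g)\<close>. Exchanging
  the integrals leaves the linear moment and a one-dimensional integral.\<close>

lemma gaussian_square_mgf:
  fixes X :: "'a \<Rightarrow> real^'n"
  assumes X: "distributed M lborel X (\<lambda>y. ennreal (std_gaussian_density y))"
    and l: "0 \<le> l" "2 * l * (norm b)\<^sup>2 < 1"
  shows "(\<integral>\<^sup>+\<omega>. ennreal (exp (l * (b \<bullet> X \<omega>)\<^sup>2)) \<partial>M) = ennreal (1 / sqrt (1 - 2 * l * (norm b)\<^sup>2))"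
proof -
  have [measurable]: "X \<in> borel_measurable M"
    using distributed_measurable[OF X] by simp
  define s where "s = sqrt (2 * l)"
  have s: "s\<^sup>2 = 2 * l" using l by (simp add: s_def)
  interpret lborel: sigma_finite_measure "lborel :: real measure" ..
  interpret pair_sigma_finite M "lborel :: real measure" ..
  have "(\<integral>\<^sup>+\<omega>. ennreal (exp (l * (b \<bullet> X \<omega>)\<^sup>2)) \<partial>M)
      = (\<integral>\<^sup>+\<omega>. \<integral>\<^sup>+g. ennreal (std_normal_density g) * ennreal (exp ((s * (b \<bullet> X \<omega>)) * g)) \<partial>lborel \<partial>M)"
    unfolding nn_integral_std_normal_exp_linear by (simp add: power_mult_distrib s)
  also have "\<dots> = (\<integral>\<^sup>+g. \<integral>\<^sup>+\<omega>. ennreal (std_normal_density g) * ennreal (exp ((s * (b \<bullet> X \<omega>)) * g)) \<partial>M \<partial>lborel)"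
    by (rule Fubini'[symmetric]) measurable
  also have "\<dots> = (\<integral>\<^sup>+g. ennreal (std_normal_density g) * ennreal (exp (2 * l * (norm b)\<^sup>2 * g\<^sup>2 / 2)) \<partial>lborel)"
  proof (rule nn_integral_cong)
    fix g :: real
    have "(\<integral>\<^sup>+\<omega>. ennreal (exp ((s * (b \<bullet> X \<omega>)) * g)) \<partial>M) = (\<integral>\<^sup>+\<omega>. ennreal (exp (((s * g) *\<^sub>R b) \<bullet> X \<omega>)) \<partial>M)"
      by (simp add: mult_ac)
    also have "\<dots> = ennreal (exp (2 * l * (norm b)\<^sup>2 * g\<^sup>2 / 2))"
      unfolding gaussian_mgf[OF X] by (simp add: power_mult_distrib s mult_ac)
    finally show "(\<integral>\<^sup>+\<omega>. ennreal (std_normal_density g) * ennreal (exp ((s * (b \<bullet> X \<omega>)) * g)) \<partial>M)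
        = ennreal (std_normal_density g) * ennreal (exp (2 * l * (norm b)\<^sup>2 * g\<^sup>2 / 2))"
      by (subst nn_integral_cmult) auto
  qed
  also have "\<dots> = ennreal (1 / sqrt (1 - 2 * l * (norm b)\<^sup>2))"
    using l(2) by (rule nn_integral_std_normal_exp_square)
  finally show ?thesis .
qed

lemma exp_le_quadratic: "exp z \<le> 1 + z + z\<^sup>2 * exp \<bar>z\<bar>" for z :: real
proof -
  obtain t where t: "\<bar>t\<bar> \<le> \<bar>z\<bar>" "exp z = (\<Sum>m<2. z ^ m / fact m) + exp t / fact 2 * z ^ 2"
    using Maclaurin_exp_le[of z 2] by blast
  have "exp t \<le> exp \<bar>z\<bar>" using t(1) by simp
  then have "exp t / fact 2 \<le> exp \<bar>z\<bar>"
    using exp_gt_zero[of t] unfolding fact_2 by linarith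
  then have "exp t / fact 2 * z ^ 2 \<le> exp \<bar>z\<bar> * z ^ 2"
    by (intro mult_right_mono) auto
  then show ?thesis
    unfolding t(2) by (simp add: numeral_2_eq_2 mult.commute)
qed

lemma square_le_exp:
  fixes c x :: real
  assumes "c > 0"
  shows "x\<^sup>2 \<le> 8 / c\<^sup>2 * exp (c / 2 * \<bar>x\<bar>)"
proof -
  have "0 \<le> c / 2 * \<bar>x\<bar>" using assms by simp
  then have "(c / 2 * \<bar>x\<bar>)\<^sup>2 / 2 \<le> exp (c / 2 * \<bar>x\<bar>)"
    using exp_lower_Taylor_quadratic[of "c / 2 * \<bar>x\<bar>"] by linarith
  then have "8 / c\<^sup>2 * ((c / 2 * \<bar>x\<bar>)\<^sup>2 / 2) \<le> 8 / c\<^sup>2 * exp (c / 2 * \<bar>x\<bar>)"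
    by (intro mult_left_mono) auto
  then show ?thesis using assms by (simp add: power_mult_distrib power_divide)
qed

text \<open>
  The second moment is identified from the exact exponential moments of the square: their
  derivative at \<open>0\<close>, after centring, vanishes.
\<close>

lemma gaussian_square_centred_mgf:
  fixes X :: "'a \<Rightarrow> real^'n"
  shows "\<exists>l0>0. \<exists>C\<ge>0. \<forall>X. distributed M lborel X (\<lambda>y. ennreal (std_gaussian_density y)) \<longrightarrow>
    (\<forall>l. \<bar>l\<bar> \<le> l0 \<longrightarrow>
      (\<integral>\<^sup>+\<omega>. ennreal (exp (l * ((b \<bullet> (X \<omega> :: real^'n))\<^sup>2 - (norm b)\<^sup>2) - C * l\<^sup>2)) \<partial>M) \<le> 1)"
proof -
  define \<beta> where "\<beta> = (norm b)\<^sup>2"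
  \<comment> \<open>Makes \<open>2 * c * \<beta> < 1\<close>, so that
    \<open>exp (c * (b \<bullet> X \<omega>)^2)\<close> is integrable. Half of \<open>c\<close> will
    bound the exponent \<open>l * Z\<close>, the other half absorbs the factor \<open>Z^2\<close> of
    the quadratic remainder.\<close>
  define c where "c = 1 / (4 * (1 + \<beta>))"
  have \<beta>0: "0 \<le> \<beta>" by (simp add: \<beta>_def)
  then have c: "c > 0" "2 * c * \<beta> < 1" by (auto simp: c_def field_simps)
  define I where "I = 1 / sqrt (1 - 2 * c * \<beta>)"
  have I0: "I \<ge> 0" using c by (simp add: I_def)
  define K where "K = 8 / c\<^sup>2 * exp (c * \<beta>)"
  have K0: "K \<ge> 0" by (simp add: K_def)
  have "(\<integral>\<^sup>+\<omega>. ennreal (exp (l * ((b \<bullet> X \<omega>)\<^sup>2 - \<beta>) - K * I * l\<^sup>2)) \<partial>M) \<le> 1"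
    if X: "distributed M lborel X (\<lambda>y. ennreal (std_gaussian_density y))" and l: "\<bar>l\<bar> \<le> c / 2"
    for X :: "'a \<Rightarrow> real^'n" and l
  proof -
    have [measurable]: "X \<in> borel_measurable M"
      using distributed_measurable[OF X] by simp
    define Z where "Z \<omega> = (b \<bullet> X \<omega>)\<^sup>2 - \<beta>" for \<omega>
    define E where "E \<omega> = exp (c * (b \<bullet> X \<omega>)\<^sup>2)" for \<omega>
    have [measurable]: "Z \<in> borel_measurable M" "E \<in> borel_measurable M"
      unfolding Z_def[abs_def] E_def[abs_def] by measurable
    have nnE: "(\<integral>\<^sup>+\<omega>. ennreal (E \<omega>) \<partial>M) = ennreal I"
      unfolding E_def I_def \<beta>_def using c by (intro gaussian_square_mgf[OF X]) (auto simp: \<beta>_def)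
    have E0: "0 \<le> E \<omega>" for \<omega> by (simp add: E_def)
    have intE: "integrable M E"
      by (rule integrableI_nonneg) (auto simp: nnE E0)
    have EE: "(\<integral>\<omega>. E \<omega> \<partial>M) = I"
      using nnE I0 by (subst integral_eq_nn_integral) (auto simp: E_def)
    have absZ: "\<bar>Z \<omega>\<bar> \<le> (b \<bullet> X \<omega>)\<^sup>2 + \<beta>" for \<omega>
      unfolding Z_def using \<beta>0 by (simp add: abs_le_iff)
    have ecZ: "exp (c * \<bar>Z \<omega>\<bar>) \<le> exp (c * \<beta>) * E \<omega>" for \<omega>
      unfolding E_def exp_add[symmetric] using mult_left_mono[OF absZ[of \<omega>], of c] c(1)
      by (simp add: algebra_simps)
    have quad: "exp (l * Z \<omega>) \<le> 1 + l * Z \<omega> + l\<^sup>2 * (K * E \<omega>)" if "\<bar>l\<bar> \<le> c / 2" for l \<omega>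
    proof -
      have "\<bar>l * Z \<omega>\<bar> \<le> c / 2 * \<bar>Z \<omega>\<bar>"
        using mult_right_mono[OF that, of "\<bar>Z \<omega>\<bar>"] by (simp add: abs_mult)
      then have "(l * Z \<omega>)\<^sup>2 * exp \<bar>l * Z \<omega>\<bar> \<le> (l * Z \<omega>)\<^sup>2 * exp (c / 2 * \<bar>Z \<omega>\<bar>)"
        by (intro mult_left_mono) auto
      also have "\<dots> \<le> l\<^sup>2 * ((8 / c\<^sup>2 * exp (c / 2 * \<bar>Z \<omega>\<bar>)) * exp (c / 2 * \<bar>Z \<omega>\<bar>))"
        unfolding power_mult_distrib mult.assoc[of "l\<^sup>2"]
        by (intro mult_left_mono mult_right_mono square_le_exp[OF c(1)]) simp_all
      also have "(8 / c\<^sup>2 * exp (c / 2 * \<bar>Z \<omega>\<bar>)) * exp (c / 2 * \<bar>Z \<omega>\<bar>) = 8 / c\<^sup>2 * exp (c * \<bar>Z \<omega>\<bar>)"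
        by (simp add: exp_add[symmetric])
      also have "l\<^sup>2 * (8 / c\<^sup>2 * exp (c * \<bar>Z \<omega>\<bar>)) \<le> l\<^sup>2 * (8 / c\<^sup>2 * (exp (c * \<beta>) * E \<omega>))"
        by (intro mult_left_mono ecZ) auto
      finally show ?thesis
        using exp_le_quadratic[of "l * Z \<omega>"] by (simp add: K_def mult.assoc)
    qed
    have normZ: "norm (Z \<omega>) \<le> norm (2 / c * (exp (c * \<beta>) * E \<omega>))" for \<omega>
    proof -
      have "c * \<bar>Z \<omega>\<bar> \<le> exp (c * \<bar>Z \<omega>\<bar>)"
        using exp_ge_add_one_self[of "c * \<bar>Z \<omega>\<bar>"] by linarith
      then have "c * \<bar>Z \<omega>\<bar> \<le> exp (c * \<beta>) * E \<omega>" using ecZ[of \<omega>] by linarith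
      moreover have "0 \<le> exp (c * \<beta>) * E \<omega>" by (simp add: E_def)
      ultimately have "\<bar>Z \<omega>\<bar> \<le> 2 / c * (exp (c * \<beta>) * E \<omega>)"
        using c(1) by (simp add: field_simps)
      then show ?thesis
        by (metis abs_ge_self order.trans real_norm_def)
    qed
    have intZ: "integrable M Z"
    proof (rule Bochner_Integration.integrable_bound)
      show "integrable M (\<lambda>\<omega>. 2 / c * (exp (c * \<beta>) * E \<omega>))"
        by (intro integrable_mult_right intE)
      show "AE \<omega> in M. norm (Z \<omega>) \<le> norm (2 / c * (exp (c * \<beta>) * E \<omega>))"
        by (intro AE_I2 normZ)
    qed measurable
    have intq: "integrable M (\<lambda>\<omega>. 1 + l * Z \<omega> + l\<^sup>2 * (K * E \<omega>))" for l
      by (intro Bochner_Integration.integrable_add integrable_mult_right intE intZ integrable_const)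
    have intexp: "integrable M (\<lambda>\<omega>. exp (l * Z \<omega>))" if "\<bar>l\<bar> \<le> c / 2" for l
    proof (rule Bochner_Integration.integrable_bound[OF intq[of l]])
      show "AE \<omega> in M. norm (exp (l * Z \<omega>)) \<le> norm (1 + l * Z \<omega> + l\<^sup>2 * (K * E \<omega>))"
        using quad[OF that] by (intro AE_I2) (metis abs_exp_cancel abs_ge_self order.trans real_norm_def)
    qed measurable
    define \<mu> where "\<mu> = (\<integral>\<omega>. Z \<omega> \<partial>M)"
    have qint: "(\<integral>\<omega>. 1 + l * Z \<omega> + l\<^sup>2 * (K * E \<omega>) \<partial>M) = 1 + l * \<mu> + l\<^sup>2 * (K * I)" for l
      using intZ intE EE by (simp add: \<mu>_def prob_space)
    have upper: "(\<integral>\<omega>. exp (l * Z \<omega>) \<partial>M) \<le> 1 + l * \<mu> + l\<^sup>2 * (K * I)" if "\<bar>l\<bar> \<le> c / 2" for l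
      unfolding qint[symmetric] by (intro integral_mono intexp intq quad that)
    have lower: "1 + l * \<mu> \<le> (\<integral>\<omega>. exp (l * Z \<omega>) \<partial>M)" if "\<bar>l\<bar> \<le> c / 2" for l
    proof -
      have "1 + l * \<mu> = (\<integral>\<omega>. 1 + l * Z \<omega> \<partial>M)"
        by (simp add: \<mu>_def prob_space intZ)
      also have "\<dots> \<le> (\<integral>\<omega>. exp (l * Z \<omega>) \<partial>M)"
      proof (rule integral_mono)
        show "integrable M (\<lambda>\<omega>. 1 + l * Z \<omega>)"
          using intZ by simp
        show "1 + l * Z \<omega> \<le> exp (l * Z \<omega>)" for \<omega>
          by (rule exp_ge_add_one_self)
      qed (rule intexp[OF that])
      finally show ?thesis .
    qed
    define f where "f l = exp (- l * \<beta>) / sqrt (1 - 2 * l * \<beta>)" for l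
    have feq: "(\<integral>\<omega>. exp (l * Z \<omega>) \<partial>M) = f l" if "0 \<le> l" "l \<le> c / 2" for l
    proof -
      have "2 * l * \<beta> \<le> 2 * c * \<beta>" using that c \<beta>0 by (intro mult_right_mono) auto
      then have lt: "2 * l * \<beta> < 1" using c(2) by linarith
      have "(\<integral>\<^sup>+\<omega>. ennreal (exp (l * Z \<omega>)) \<partial>M) = (\<integral>\<^sup>+\<omega>. ennreal (exp (- l * \<beta>)) * ennreal (exp (l * (b \<bullet> X \<omega>)\<^sup>2)) \<partial>M)"
        by (intro nn_integral_cong) (simp add: Z_def ennreal_mult[symmetric] exp_add[symmetric] algebra_simps)
      also have "\<dots> = ennreal (exp (- l * \<beta>)) * ennreal (1 / sqrt (1 - 2 * l * \<beta>))"
        using gaussian_square_mgf[OF X that(1), of b] lt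
        by (subst nn_integral_cmult) (auto simp: \<beta>_def)
      also have "\<dots> = ennreal (f l)"
        using lt by (simp add: f_def ennreal_mult[symmetric])
      finally show ?thesis
        using lt by (subst integral_eq_nn_integral) (auto simp: f_def)
    qed
    have "\<mu> = 0"
    proof -
      have "(f has_real_derivative 0) (at 0)"
        unfolding f_def by (auto intro!: derivative_eq_intros simp: field_simps)
      then have "((\<lambda>h. (f h - 1) / h) \<longlongrightarrow> 0) (at 0)"
        by (simp add: DERIV_def f_def)
      then have lim0: "((\<lambda>h. (f h - 1) / h) \<longlongrightarrow> 0) (at_right 0)"
        by (rule filterlim_mono) (auto simp: at_le)
      have ev: "\<forall>\<^sub>F h in at_right (0::real). 0 < h \<and> h \<le> c / 2"
        using c(1) unfolding eventually_at_right_field by (intro exI[of _ "c / 2"]) auto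
      have "((\<lambda>h. (f h - 1) / h) \<longlongrightarrow> \<mu>) (at_right 0)"
      proof (rule tendsto_sandwich[of "\<lambda>_. \<mu>" _ _ "\<lambda>h. \<mu> + h * (K * I)"])
        show "\<forall>\<^sub>F h in at_right 0. \<mu> \<le> (f h - 1) / h"
          using ev
        proof eventually_elim
          case (elim h)
          then show ?case using lower[of h] feq[of h] by (simp add: field_simps)
        qed
        show "\<forall>\<^sub>F h in at_right 0. (f h - 1) / h \<le> \<mu> + h * (K * I)"
          using ev
        proof eventually_elim
          case (elim h)
          then show ?case using upper[of h] feq[of h] by (simp add: field_simps power2_eq_square)
        qed
        have "((\<lambda>h. \<mu> + h * (K * I)) \<longlongrightarrow> \<mu> + 0 * (K * I)) (at_right 0)"
          by (intro tendsto_intros)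
        then show "((\<lambda>h. \<mu> + h * (K * I)) \<longlongrightarrow> \<mu>) (at_right 0)" by simp
      qed simp
      then show ?thesis
        using lim0 tendsto_unique trivial_limit_at_right_real by blast
    qed
    then have "(\<integral>\<omega>. exp (l * Z \<omega>) \<partial>M) \<le> 1 + K * I * l\<^sup>2"
      using upper[OF l] by (simp add: mult_ac)
    also have "\<dots> \<le> exp (K * I * l\<^sup>2)" by (rule exp_ge_add_one_self)
    finally have le: "(\<integral>\<omega>. exp (l * Z \<omega>) \<partial>M) \<le> exp (K * I * l\<^sup>2)" .
    have "(\<integral>\<^sup>+\<omega>. ennreal (exp (l * Z \<omega> - K * I * l\<^sup>2)) \<partial>M)
        = (\<integral>\<^sup>+\<omega>. ennreal (exp (- (K * I * l\<^sup>2))) * ennreal (exp (l * Z \<omega>)) \<partial>M)"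
      by (intro nn_integral_cong) (simp add: ennreal_mult[symmetric] exp_add[symmetric])
    also have "\<dots> = ennreal (exp (- (K * I * l\<^sup>2))) * ennreal (\<integral>\<omega>. exp (l * Z \<omega>) \<partial>M)"
      by (subst nn_integral_cmult) (auto simp: nn_integral_eq_integral[OF intexp[OF l]])
    also have "\<dots> \<le> ennreal (exp (- (K * I * l\<^sup>2))) * ennreal (exp (K * I * l\<^sup>2))"
      by (intro mult_left_mono ennreal_leI le) auto
    also have "\<dots> = 1" by (simp add: ennreal_mult[symmetric] exp_add[symmetric])
    finally show ?thesis by (simp add: Z_def)
  qed
  then show ?thesis
    using c(1) K0 I0 by (intro exI[of _ "c / 2"] conjI exI[of _ "K * I"]) (auto simp: \<beta>_def)
qed

end

subsection \<open>Exponential supermartingales along a Gaussian innovation\<close>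

text \<open>\<open>F t\<close> is what is known before \<open>h t\<close>, which enters only at
  \<open>F (Suc t)\<close>. Independence is a product formula on events, just what determines the
  joint law of past and innovation.\<close>

locale gaussian_innovation = prob_space M for M :: "'a measure" +
  fixes F :: "nat \<Rightarrow> 'a measure" and h :: "nat \<Rightarrow> 'a \<Rightarrow> real^'n"
  assumes space_F: "t \<ge> 1 \<Longrightarrow> space (F t) = space M"
    and sets_F: "t \<ge> 1 \<Longrightarrow> sets (F t) \<subseteq> sets M"
    and F_Suc: "t \<ge> 1 \<Longrightarrow> sets (F t) \<subseteq> sets (F (Suc t))"
    and h_adapted: "t \<ge> 1 \<Longrightarrow> h t \<in> borel_measurable (F (Suc t))"
    and h_indep: "t \<ge> 1 \<Longrightarrow> S \<in> sets (F t) \<Longrightarrow> B \<in> sets borel \<Longrightarrow>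
      prob (S \<inter> (h t -` B \<inter> space M)) = prob S * prob (h t -` B \<inter> space M)"
    and h_gauss: "t \<ge> 1 \<Longrightarrow> distributed M lborel (h t) (\<lambda>y. ennreal (std_gaussian_density y))"

context prob_space
begin

lemma exp_tail_bound:
  assumes [measurable]: "S \<in> borel_measurable M"
    and le: "(\<integral>\<^sup>+\<omega>. ennreal (exp (S \<omega>)) \<partial>M) \<le> 1"
  shows "prob {\<omega> \<in> space M. K \<le> S \<omega>} \<le> exp (- K)"
proof -
  have "{\<omega> \<in> space M. K \<le> S \<omega>} = {\<omega> \<in> space M. 1 \<le> ennreal (exp (- K)) * ennreal (exp (S \<omega>))}"
    by (auto simp: ennreal_mult[symmetric] exp_add[symmetric])
  then have "emeasure M {\<omega> \<in> space M. K \<le> S \<omega>}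
      \<le> ennreal (exp (- K)) * (\<integral>\<^sup>+\<omega>. ennreal (exp (S \<omega>)) * indicator (space M) \<omega> \<partial>M)"
    by (simp only:) (rule nn_integral_Markov_inequality, auto)
  also have "(\<integral>\<^sup>+\<omega>. ennreal (exp (S \<omega>)) * indicator (space M) \<omega> \<partial>M) = (\<integral>\<^sup>+\<omega>. ennreal (exp (S \<omega>)) \<partial>M)"
    by (intro nn_integral_cong) auto
  also have "ennreal (exp (- K)) * \<dots> \<le> ennreal (exp (- K)) * 1"
    by (intro mult_left_mono le) auto
  finally show ?thesis
    by (simp add: emeasure_eq_measure)
qed

text \<open>Union bound over at most \<open>c * T ^ k\<close> members, each exceeding the threshold
  with probability at most \<open>T\<close> to the power \<open>- (k + 2)\<close>: the total is of
  order \<open>1 / T^2\<close>, summable, and Borel-Cantelli applies.\<close>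

lemma exp_family_eventually_small:
  fixes S :: "nat \<Rightarrow> 'i \<Rightarrow> 'a \<Rightarrow> real"
  assumes fin: "\<And>T. finite (\<Lambda> T)" and card: "\<And>T. T \<ge> 1 \<Longrightarrow> real (card (\<Lambda> T)) \<le> c * real T ^ k"
    and meas: "\<And>T i. i \<in> \<Lambda> T \<Longrightarrow> S T i \<in> borel_measurable M"
    and le: "\<And>T i. T \<ge> 1 \<Longrightarrow> i \<in> \<Lambda> T \<Longrightarrow> (\<integral>\<^sup>+\<omega>. ennreal (exp (S T i \<omega>)) \<partial>M) \<le> 1"
  shows "AE \<omega> in M. \<forall>\<^sub>F T in sequentially. \<forall>i\<in>\<Lambda> T. S T i \<omega> < real (k + 2) * ln (real T)"
proof -
  define D where "D T i = {\<omega> \<in> space M. real (k + 2) * ln (real T) \<le> S T i \<omega>}" for T i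
  have D: "D T i \<in> sets M" if "i \<in> \<Lambda> T" for T i
  proof -
    have [measurable]: "S T i \<in> borel_measurable M" using meas[OF that] .
    show ?thesis unfolding D_def by measurable
  qed
  define E where "E T = (\<Union>i\<in>\<Lambda> T. D T i)" for T
  have E: "E T \<in> sets M" for T
    unfolding E_def using fin D by auto
  have bound: "prob (E T) \<le> c * (1 / (real T)\<^sup>2)" if T: "T \<ge> 1" for T
  proof -
    have "prob (E T) \<le> (\<Sum>i\<in>\<Lambda> T. prob (D T i))"
      unfolding E_def using fin D by (intro finite_measure_subadditive_finite) auto
    also have "\<dots> \<le> (\<Sum>i\<in>\<Lambda> T. exp (- (real (k + 2) * ln (real T))))"
      unfolding D_def by (intro sum_mono exp_tail_bound meas le T)
    also have "\<dots> = real (card (\<Lambda> T)) * exp (- (real (k + 2) * ln (real T)))"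
      by simp
    also have "exp (- (real (k + 2) * ln (real T))) = 1 / real T ^ (k + 2)"
    proof -
      have "exp (real (k + 2) * ln (real T)) = real T ^ (k + 2)"
        unfolding exp_of_nat_mult using T by simp
      then show ?thesis unfolding exp_minus by (simp only: inverse_eq_divide)
    qed
    also have "real (card (\<Lambda> T)) * (1 / real T ^ (k + 2)) \<le> c * real T ^ k * (1 / real T ^ (k + 2))"
      by (intro mult_right_mono card T) auto
    also have "\<dots> = c * (1 / (real T)\<^sup>2)"
      using T by (simp add: power_add power2_eq_square)
    finally show ?thesis .
  qed
  have "summable (\<lambda>T. prob (E T))"
  proof (rule summable_comparison_test_ev)
    show "\<forall>\<^sub>F T in sequentially. norm (prob (E T)) \<le> c * (1 / (real T)\<^sup>2)"
      using eventually_ge_at_top[of 1] by eventually_elim (use bound in auto)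
    show "summable (\<lambda>T. c * (1 / (real T)\<^sup>2))"
      using inverse_power_summable[of 2, where 'a = real]
      by (intro summable_mult) (simp add: inverse_eq_divide)
  qed
  then have "AE \<omega> in M. \<forall>\<^sub>F T in sequentially. \<omega> \<in> space M - E T"
    using E by (intro borel_cantelli_AE1) (auto simp: emeasure_eq_measure)
  then show ?thesis
  proof eventually_elim
    case (elim \<omega>)
    then show ?case
      by eventually_elim (auto simp: E_def D_def not_le)
  qed
qed

end

context gaussian_innovation
begin

lemma past_lift: "t \<ge> 1 \<Longrightarrow> f \<in> measurable (F t) N \<Longrightarrow> f \<in> measurable M N"
  using sets_F[of t] space_F[of t] unfolding measurable_def by auto

lemma F_mono:
  assumes "1 \<le> s" "s \<le> t"
  shows "sets (F s) \<subseteq> sets (F t)"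
  using assms(2)
proof (induction t rule: dec_induct)
  case (step n)
  then show ?case using F_Suc[of n] assms(1) by auto
qed simp

lemma past_mono: "1 \<le> s \<Longrightarrow> s \<le> t \<Longrightarrow> f \<in> measurable (F s) N \<Longrightarrow> f \<in> measurable (F t) N"
  using F_mono[of s t] space_F[of s] space_F[of t] unfolding measurable_def by auto

lemma h_measurable [measurable]: "t \<ge> 1 \<Longrightarrow> h t \<in> borel_measurable M"
  using past_lift[OF _ h_adapted[of t]] by simp

lemma distr_past_pair:
  assumes t: "t \<ge> 1" and X: "X \<in> measurable (F t) N"
  shows "distr M (N \<Otimes>\<^sub>M borel) (\<lambda>\<omega>. (X \<omega>, h t \<omega>)) = distr M N X \<Otimes>\<^sub>M distr M borel (h t)"
proof (rule sym, rule pair_measure_eqI)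
  have [measurable]: "X \<in> measurable M N" by (rule past_lift[OF t X])
  have [measurable]: "h t \<in> borel_measurable M" by (rule h_measurable[OF t])
  show "sigma_finite_measure (distr M N X)"
    by (intro prob_space_imp_sigma_finite prob_space_distr) measurable
  show "sigma_finite_measure (distr M borel (h t))"
    by (intro prob_space_imp_sigma_finite prob_space_distr) measurable
  show "sets (distr M N X \<Otimes>\<^sub>M distr M borel (h t)) = sets (distr M (N \<Otimes>\<^sub>M borel) (\<lambda>\<omega>. (X \<omega>, h t \<omega>)))"
    unfolding sets_distr by (intro sets_pair_measure_cong) auto
  fix S B assume "S \<in> sets (distr M N X)" "B \<in> sets (distr M borel (h t))"
  then have [measurable]: "S \<in> sets N" "B \<in> sets borel" by auto
  have "X -` S \<inter> space M \<in> sets (F t)"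
    using measurable_sets[OF X \<open>S \<in> sets N\<close>] by (simp add: space_F[OF t])
  then have *: "prob ((X -` S \<inter> space M) \<inter> (h t -` B \<inter> space M))
      = prob (X -` S \<inter> space M) * prob (h t -` B \<inter> space M)"
    by (rule h_indep[OF t]) simp
  have "(\<lambda>\<omega>. (X \<omega>, h t \<omega>)) -` (S \<times> B) \<inter> space M = (X -` S \<inter> space M) \<inter> (h t -` B \<inter> space M)"
    by auto
  then show "emeasure (distr M N X) S * emeasure (distr M borel (h t)) B
      = emeasure (distr M (N \<Otimes>\<^sub>M borel) (\<lambda>\<omega>. (X \<omega>, h t \<omega>))) (S \<times> B)"
    using * by (simp add: emeasure_distr emeasure_eq_measure ennreal_mult[symmetric])
qed

text \<open>The supermartingale inequality in integrated form: under the product law the innovation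
  is integrated first, with the accumulated product \<open>Z\<close> and the parameter
  \<open>p\<close> frozen. Both therefore form a single past variable.\<close>

lemma nn_integral_past_step:
  fixes Z :: "'a \<Rightarrow> ennreal" and p :: "'a \<Rightarrow> 'c::topological_space"
  assumes t: "t \<ge> 1" and Z: "Z \<in> borel_measurable (F t)" and p: "p \<in> borel_measurable (F t)"
    and d[measurable]: "(\<lambda>(a, b). d a b) \<in> borel_measurable (borel \<Otimes>\<^sub>M borel)"
    and le: "\<And>a. (\<integral>\<^sup>+\<omega>. d a (h t \<omega>) \<partial>M) \<le> (1 :: ennreal)"
  shows "(\<integral>\<^sup>+\<omega>. Z \<omega> * d (p \<omega>) (h t \<omega>) \<partial>M) \<le> (\<integral>\<^sup>+\<omega>. Z \<omega> \<partial>M)"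
proof -
  let ?N = "borel \<Otimes>\<^sub>M borel :: (ennreal \<times> 'c) measure"
  define X where "X \<omega> = (Z \<omega>, p \<omega>)" for \<omega>
  have X: "X \<in> measurable (F t) ?N"
    unfolding X_def[abs_def] using Z p by measurable
  have [measurable]: "X \<in> measurable M ?N" by (rule past_lift[OF t X])
  have [measurable]: "h t \<in> borel_measurable M" by (rule h_measurable[OF t])
  have d': "(\<lambda>b. d a b) \<in> borel_measurable borel" for a
    using measurable_compose[OF measurable_Pair1'[of a borel borel] d] by simp
  let ?f = "\<lambda>y. fst (fst y) * d (snd (fst y)) (snd y)"
  have f: "?f \<in> borel_measurable (?N \<Otimes>\<^sub>M borel)"
    using measurable_compose[OF _ d, of "\<lambda>y. (snd (fst y), snd y)" "?N \<Otimes>\<^sub>M (borel :: (real^'n) measure)"]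
    by (intro borel_measurable_times_ennreal) measurable
  interpret h: sigma_finite_measure "distr M borel (h t)"
    by (intro prob_space_imp_sigma_finite prob_space_distr) measurable
  have f': "?f \<in> borel_measurable (distr M ?N X \<Otimes>\<^sub>M distr M borel (h t))"
    using f by (simp cong: measurable_cong_sets sets_pair_measure_cong)
  have "(\<integral>\<^sup>+\<omega>. Z \<omega> * d (p \<omega>) (h t \<omega>) \<partial>M) = (\<integral>\<^sup>+\<omega>. ?f (X \<omega>, h t \<omega>) \<partial>M)"
    by (simp add: X_def)
  also have "\<dots> = (\<integral>\<^sup>+y. ?f y \<partial>distr M (?N \<Otimes>\<^sub>M borel) (\<lambda>\<omega>. (X \<omega>, h t \<omega>)))"
    by (rule nn_integral_distr[symmetric]) (use f in measurable)
  also have "\<dots> = (\<integral>\<^sup>+y. ?f y \<partial>(distr M ?N X \<Otimes>\<^sub>M distr M borel (h t)))"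
    by (subst distr_past_pair[OF t X]) rule
  also have "\<dots> = (\<integral>\<^sup>+a. \<integral>\<^sup>+b. ?f (a, b) \<partial>distr M borel (h t) \<partial>distr M ?N X)"
    by (rule h.nn_integral_fst[symmetric, OF f'])
  also have "\<dots> \<le> (\<integral>\<^sup>+a. fst a \<partial>distr M ?N X)"
  proof (rule nn_integral_mono)
    fix a :: "ennreal \<times> 'c"
    have "(\<integral>\<^sup>+b. ?f (a, b) \<partial>distr M borel (h t)) = fst a * (\<integral>\<^sup>+\<omega>. d (snd a) (h t \<omega>) \<partial>M)"
      using d' by (simp add: nn_integral_cmult nn_integral_distr)
    also have "\<dots> \<le> fst a * 1" by (intro mult_left_mono le) auto
    finally show "(\<integral>\<^sup>+b. ?f (a, b) \<partial>distr M borel (h t)) \<le> fst a" by simp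
  qed
  also have "\<dots> = (\<integral>\<^sup>+\<omega>. Z \<omega> \<partial>M)"
    by (subst nn_integral_distr) (auto simp: X_def)
  finally show ?thesis .
qed

lemma nn_integral_past_prod:
  fixes p :: "nat \<Rightarrow> 'a \<Rightarrow> 'c::topological_space"
  assumes p: "\<And>t. t \<ge> 1 \<Longrightarrow> p t \<in> borel_measurable (F t)"
    and d: "\<And>t. (\<lambda>(a, b). d t a b) \<in> borel_measurable (borel \<Otimes>\<^sub>M borel)"
    and le: "\<And>t a. t \<ge> 1 \<Longrightarrow> (\<integral>\<^sup>+\<omega>. d t a (h t \<omega>) \<partial>M) \<le> (1 :: ennreal)"
  shows "(\<integral>\<^sup>+\<omega>. (\<Prod>t = 1..T. d t (p t \<omega>) (h t \<omega>)) \<partial>M) \<le> 1"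
proof (induction T)
  case 0
  then show ?case by (simp add: emeasure_space_1)
next
  case (Suc T)
  have "(\<lambda>\<omega>. d t (p t \<omega>) (h t \<omega>)) \<in> borel_measurable (F (Suc T))" if "t \<in> {1..T}" for t
  proof -
    have 1: "p t \<in> borel_measurable (F (Suc T))"
      using that by (intro past_mono[OF _ _ p]) auto
    have 2: "h t \<in> borel_measurable (F (Suc T))"
      using that by (intro past_mono[OF _ _ h_adapted]) auto
    show ?thesis
      using measurable_compose[OF measurable_Pair[OF 1 2] d[of t]] by simp
  qed
  then have "(\<lambda>\<omega>. \<Prod>t = 1..T. d t (p t \<omega>) (h t \<omega>)) \<in> borel_measurable (F (Suc T))"
    by (intro borel_measurable_prod_ennreal)
  then have "(\<integral>\<^sup>+\<omega>. (\<Prod>t = 1..T. d t (p t \<omega>) (h t \<omega>)) * d (Suc T) (p (Suc T) \<omega>) (h (Suc T) \<omega>) \<partial>M)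
      \<le> (\<integral>\<^sup>+\<omega>. (\<Prod>t = 1..T. d t (p t \<omega>) (h t \<omega>)) \<partial>M)"
    by (intro nn_integral_past_step p d le) auto
  then show ?case using Suc by (simp add: mult.commute)
qed

lemma nn_integral_exp_past_sum:
  fixes p :: "nat \<Rightarrow> 'a \<Rightarrow> 'c::topological_space" and l :: "nat \<Rightarrow> 'c \<Rightarrow> real^'n \<Rightarrow> real"
  assumes p: "\<And>t. t \<ge> 1 \<Longrightarrow> p t \<in> borel_measurable (F t)"
    and l: "\<And>t. (\<lambda>(a, b). l t a b) \<in> borel_measurable (borel \<Otimes>\<^sub>M borel)"
    and le: "\<And>t a. t \<ge> 1 \<Longrightarrow> (\<integral>\<^sup>+\<omega>. ennreal (exp (l t a (h t \<omega>))) \<partial>M) \<le> 1"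
  shows "(\<integral>\<^sup>+\<omega>. ennreal (exp (\<Sum>t = 1..T. l t (p t \<omega>) (h t \<omega>))) \<partial>M) \<le> 1"
proof -
  have "(\<integral>\<^sup>+\<omega>. ennreal (exp (\<Sum>t = 1..T. l t (p t \<omega>) (h t \<omega>))) \<partial>M)
      = (\<integral>\<^sup>+\<omega>. (\<Prod>t = 1..T. ennreal (exp (l t (p t \<omega>) (h t \<omega>)))) \<partial>M)"
    by (simp add: exp_sum prod_ennreal)
  also have "\<dots> \<le> 1"
  proof (rule nn_integral_past_prod[where d = "\<lambda>t a b. ennreal (exp (l t a b))"])
    fix t
    have "(\<lambda>y. ennreal (exp (case y of (a, b) \<Rightarrow> l t a b))) \<in> borel_measurable (borel \<Otimes>\<^sub>M borel)"
      using l[of t] by measurable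
    then show "(\<lambda>(a, b). ennreal (exp (l t a b))) \<in> borel_measurable (borel \<Otimes>\<^sub>M borel)"
      by (simp add: case_prod_unfold)
  qed (use p le in auto)
  finally show ?thesis .
qed

lemma borel_measurable_past_sum:
  fixes p :: "nat \<Rightarrow> 'a \<Rightarrow> 'c::topological_space" and l :: "nat \<Rightarrow> 'c \<Rightarrow> real^'n \<Rightarrow> real"
  assumes p: "\<And>t. t \<ge> 1 \<Longrightarrow> p t \<in> borel_measurable (F t)"
    and l: "\<And>t. (\<lambda>(a, b). l t a b) \<in> borel_measurable (borel \<Otimes>\<^sub>M borel)"
  shows "(\<lambda>\<omega>. \<Sum>t = 1..T. l t (p t \<omega>) (h t \<omega>)) \<in> borel_measurable M"
proof (rule borel_measurable_sum)
  fix t assume "t \<in> {1..T}"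
  then have t: "t \<ge> 1" by simp
  show "(\<lambda>\<omega>. l t (p t \<omega>) (h t \<omega>)) \<in> borel_measurable M"
    using measurable_compose[OF measurable_Pair[OF past_lift[OF t p[OF t]] h_measurable[OF t]] l[of t]] by simp
qed

end

section \<open>A lattice of directions for the union bound\<close>

definition lattice_box :: "nat \<Rightarrow> (real^'d) set" where
  "lattice_box T = (\<lambda>f. \<chi> j. real_of_int (f j) / real T ^ 3) `
     (PiE UNIV (\<lambda>_. {- (int T ^ 3)..int T ^ 3}))"

lemma finite_lattice_box: "finite (lattice_box T)"
  unfolding lattice_box_def by (intro finite_imageI finite_PiE) auto

lemma card_lattice_box:
  assumes "T \<ge> 1"
  shows "real (card (lattice_box T :: (real^'d) set)) \<le> 3 ^ CARD('d) * real T ^ (3 * CARD('d))"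
proof -
  have T: "1 \<le> int T ^ 3" using assms by simp
  have "card (lattice_box T :: (real^'d) set) \<le> card (PiE (UNIV :: 'd set) (\<lambda>_. {- (int T ^ 3)..int T ^ 3}))"
    unfolding lattice_box_def by (intro card_image_le finite_PiE) auto
  also have "\<dots> = nat (2 * int T ^ 3 + 1) ^ CARD('d)"
    by (simp add: card_PiE)
  finally have "real (card (lattice_box T :: (real^'d) set)) \<le> real (nat (2 * int T ^ 3 + 1)) ^ CARD('d)"
    by (metis of_nat_le_iff of_nat_power)
  also have "\<dots> \<le> (3 * real T ^ 3) ^ CARD('d)"
  proof (intro power_mono)
    have "real (nat (2 * int T ^ 3 + 1)) = 2 * real T ^ 3 + 1"
      using T by simp
    also have "\<dots> \<le> 3 * real T ^ 3"
      using assms by simp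
    finally show "real (nat (2 * int T ^ 3 + 1)) \<le> 3 * real T ^ 3" .
  qed simp
  also have "\<dots> = 3 ^ CARD('d) * real T ^ (3 * CARD('d))"
    by (simp add: power_mult_distrib power_mult)
  finally show ?thesis .
qed

text \<open>Why the mesh is \<open>1 / T^3\<close>: with regressors and noise at most
  \<open>T\<close>, a summand changes by at most a multiple of \<open>T^2\<close> times the
  displacement of \<theta>. Hence each of the \<open>T\<close> summands moves by order
  \<open>1 / T\<close> and the whole sum by a constant.\<close>

lemma lattice_box_rounding:
  fixes p :: "nat \<Rightarrow> real^'d" and \<eta> :: "nat \<Rightarrow> real"
  assumes T: "T \<ge> 1" and bd: "\<And>t. t \<in> {1..T} \<Longrightarrow> norm (p t) \<le> real T \<and> \<bar>\<eta> t\<bar> \<le> real T"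
    and \<theta>: "norm \<theta> \<le> 1"
  shows "\<exists>\<theta>'\<in>lattice_box T. (\<Sum>t = 1..T. (\<theta> \<bullet> p t) * \<eta> t - (\<theta> \<bullet> p t)\<^sup>2 / 2)
    \<le> (\<Sum>t = 1..T. (\<theta>' \<bullet> p t) * \<eta> t - (\<theta>' \<bullet> p t)\<^sup>2 / 2)
      + real CARD('d) * (1 + (2 + real CARD('d)) / 2)"
proof -
  let ?d = "real CARD('d)"
  define N where "N = real T ^ 3"
  have T1: "1 \<le> real T" using T by simp
  have N1: "1 \<le> N" unfolding N_def using T1 by (rule one_le_power)
  define f where "f j = \<lfloor>\<theta> $ j * N\<rfloor>" for j
  define \<theta>' :: "real^'d" where "\<theta>' = (\<chi> j. real_of_int (f j) / real T ^ 3)"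
  have fb: "f j \<in> {- (int T ^ 3)..int T ^ 3}" for j
  proof -
    have "\<bar>\<theta> $ j\<bar> \<le> 1" using component_le_norm_cart[of \<theta> j] \<theta> by linarith
    then have "\<bar>\<theta> $ j * N\<bar> \<le> 1 * N" unfolding abs_mult using N1 by (intro mult_mono) auto
    then have "- N \<le> \<theta> $ j * N" "\<theta> $ j * N \<le> N" by (auto simp: abs_le_iff)
    moreover have "N = real_of_int (int T ^ 3)" by (simp add: N_def)
    ultimately show ?thesis
      unfolding f_def by (auto simp: le_floor_iff floor_le_iff)
  qed
  have mem: "\<theta>' \<in> lattice_box T"
    unfolding lattice_box_def \<theta>'_def using fb by (intro imageI) auto
  have comp: "\<bar>(\<theta> - \<theta>') $ j\<bar> \<le> 1 / N" for j
  proof -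
    have 1: "\<bar>\<theta> $ j * N - real_of_int (f j)\<bar> \<le> 1"
      unfolding f_def by linarith
    have 2: "(\<theta> - \<theta>') $ j = (\<theta> $ j * N - real_of_int (f j)) / N"
      using N1 by (simp add: \<theta>'_def N_def[symmetric] field_simps)
    show ?thesis
      unfolding 2 abs_divide using divide_right_mono[OF 1, of N] N1 by simp
  qed
  have dist: "norm (\<theta> - \<theta>') \<le> ?d / N"
  proof -
    have "norm (\<theta> - \<theta>') \<le> (\<Sum>j\<in>UNIV. \<bar>(\<theta> - \<theta>') $ j\<bar>)" by (rule norm_le_l1_cart)
    also have "\<dots> \<le> (\<Sum>j\<in>(UNIV :: 'd set). 1 / N)" by (intro sum_mono comp)
    finally show ?thesis by simp
  qed
  have step: "((\<theta> \<bullet> p t) * \<eta> t - (\<theta> \<bullet> p t)\<^sup>2 / 2) - ((\<theta>' \<bullet> p t) * \<eta> t - (\<theta>' \<bullet> p t)\<^sup>2 / 2)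
      \<le> ?d * (1 + (2 + ?d) / 2) / real T" if t: "t \<in> {1..T}" for t
  proof -
    define x x' where "x = \<theta> \<bullet> p t" and "x' = \<theta>' \<bullet> p t"
    have p: "norm (p t) \<le> real T" and e: "\<bar>\<eta> t\<bar> \<le> real T" using bd[OF t] by auto
    have x: "\<bar>x\<bar> \<le> real T"
    proof -
      have "\<bar>x\<bar> \<le> norm \<theta> * norm (p t)" unfolding x_def by (rule Cauchy_Schwarz_ineq2)
      also have "\<dots> \<le> 1 * real T" using \<theta> p by (intro mult_mono) auto
      finally show ?thesis by simp
    qed
    have xx: "\<bar>x - x'\<bar> \<le> ?d / (real T)\<^sup>2"
    proof -
      have "\<bar>x - x'\<bar> = \<bar>(\<theta> - \<theta>') \<bullet> p t\<bar>" by (simp add: x_def x'_def inner_diff_left)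
      also have "\<dots> \<le> norm (\<theta> - \<theta>') * norm (p t)" by (rule Cauchy_Schwarz_ineq2)
      also have "\<dots> \<le> ?d / N * real T" using dist p N1 by (intro mult_mono) auto
      also have "\<dots> = ?d / (real T)\<^sup>2" using T1 by (simp add: N_def power3_eq_cube power2_eq_square)
      finally show ?thesis .
    qed
    have "?d / (real T)\<^sup>2 \<le> ?d * real T"
    proof -
      have "?d * 1 \<le> ?d * (real T * (real T)\<^sup>2)"
        using T1 one_le_power[OF T1, of 2] by (intro mult_left_mono mult_ge1_I) auto
      then show ?thesis using T1 by (simp add: divide_le_eq mult.assoc)
    qed
    then have x': "\<bar>x + x'\<bar> \<le> (2 + ?d) * real T"
      using x xx unfolding distrib_right by linarith
    have "(x * \<eta> t - x\<^sup>2 / 2) - (x' * \<eta> t - x'\<^sup>2 / 2) = (x - x') * (\<eta> t - (x + x') / 2)"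
      by (simp add: power2_eq_square field_simps)
    also have "\<dots> \<le> \<bar>x - x'\<bar> * \<bar>\<eta> t - (x + x') / 2\<bar>"
      by (metis abs_ge_self abs_mult)
    also have "\<dots> \<le> ?d / (real T)\<^sup>2 * (real T + (2 + ?d) * real T / 2)"
    proof (rule mult_mono[OF xx])
      show "\<bar>\<eta> t - (x + x') / 2\<bar> \<le> real T + (2 + ?d) * real T / 2"
      proof -
        define u where "u = (2 + ?d) * real T"
        have "\<bar>x + x'\<bar> \<le> u" using x' by (simp only: u_def)
        then have "\<bar>(x + x') / 2\<bar> \<le> u / 2"
          by simp
        then have "\<bar>\<eta> t - (x + x') / 2\<bar> \<le> real T + u / 2"
          by (intro order.trans[OF abs_triangle_ineq4] add_mono e)
        then show ?thesis by (simp only: u_def)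
      qed
    qed auto
    also have "\<dots> = ?d * (1 + (2 + ?d) / 2) / real T"
      using T1 by (simp add: power2_eq_square field_simps)
    finally show ?thesis by (simp add: x_def x'_def)
  qed
  have "(\<Sum>t = 1..T. (\<theta> \<bullet> p t) * \<eta> t - (\<theta> \<bullet> p t)\<^sup>2 / 2)
      - (\<Sum>t = 1..T. (\<theta>' \<bullet> p t) * \<eta> t - (\<theta>' \<bullet> p t)\<^sup>2 / 2)
      \<le> (\<Sum>t = 1..T. ?d * (1 + (2 + ?d) / 2) / real T)"
    unfolding sum_subtractf[symmetric] by (intro sum_mono step)
  also have "\<dots> = ?d * (1 + (2 + ?d) / 2)" using T1 by simp
  finally show ?thesis using mem by (intro bexI[of _ \<theta>']) auto
qed

section \<open>Almost sure bounds for sums driven by the innovation\<close>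

context gaussian_innovation
begin

lemma nn_integral_exp_linear:
  assumes t: "t \<ge> 1"
  shows "(\<integral>\<^sup>+\<omega>. ennreal (exp (b \<bullet> h t \<omega> - (norm b)\<^sup>2 / 2)) \<partial>M) = 1"
proof -
  have [measurable]: "h t \<in> borel_measurable M" by (rule h_measurable[OF t])
  have "(\<integral>\<^sup>+\<omega>. ennreal (exp (b \<bullet> h t \<omega> - (norm b)\<^sup>2 / 2)) \<partial>M)
      = (\<integral>\<^sup>+\<omega>. ennreal (exp (- ((norm b)\<^sup>2 / 2))) * ennreal (exp (b \<bullet> h t \<omega>)) \<partial>M)"
    by (intro nn_integral_cong) (simp add: ennreal_mult[symmetric] exp_add[symmetric])
  also have "\<dots> = 1"
    by (subst nn_integral_cmult) (auto simp: gaussian_mgf[OF h_gauss[OF t]] ennreal_mult[symmetric] exp_add[symmetric])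
  finally show ?thesis .
qed

text \<open>
  A self-normalized bound that is uniform over the unit ball: for fixed \<open>\<theta>\<close> the exponential of the
  sum is a supermartingale, and polynomially many \<open>\<theta>\<close> suffice up to a bounded rounding error.
\<close>

lemma self_normalized_bound:
  fixes p :: "nat \<Rightarrow> 'a \<Rightarrow> real^'d"
  assumes p: "\<And>t. t \<ge> 1 \<Longrightarrow> p t \<in> borel_measurable (F t)"
    and bd: "AE \<omega> in M. \<forall>\<^sub>F T in sequentially. \<forall>t\<in>{1..T}. norm (p t \<omega>) \<le> real T \<and> \<bar>h t \<omega> $ i\<bar> \<le> real T"
  shows "AE \<omega> in M. \<exists>C. \<forall>\<^sub>F T in sequentially. \<forall>\<theta>. norm \<theta> \<le> 1 \<longrightarrow>
    (\<Sum>t = 1..T. (\<theta> \<bullet> p t \<omega>) * (h t \<omega> $ i) - (\<theta> \<bullet> p t \<omega>)\<^sup>2 / 2) \<le> C * ln (real T)"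
proof -
  define l :: "real^'d \<Rightarrow> nat \<Rightarrow> real^'d \<Rightarrow> real^'n \<Rightarrow> real"
    where "l \<theta> t a b = (\<theta> \<bullet> a) * (b $ i) - (\<theta> \<bullet> a)\<^sup>2 / 2" for \<theta> t a b
  have lm: "(\<lambda>(a, b). l \<theta> t a b) \<in> borel_measurable (borel \<Otimes>\<^sub>M borel)" for \<theta> t
  proof -
    have [measurable]: "(\<lambda>b :: real^'n. b $ i) \<in> borel_measurable borel"
      by (intro borel_measurable_continuous_onI continuous_intros)
    show ?thesis unfolding l_def by measurable
  qed
  have le: "(\<integral>\<^sup>+\<omega>. ennreal (exp (l \<theta> t a (h t \<omega>))) \<partial>M) \<le> 1" if "t \<ge> 1" for \<theta> t a
  proof -
    \<comment> \<open>Component \<open>i\<close> is the linear form along an axis, and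
      \<open>(\<theta> \<bullet> a)^2 / 2\<close> is exactly its logarithmic moment, so each factor
      integrates to 1.\<close>
    have eq: "l \<theta> t a (h t \<omega>) = ((\<theta> \<bullet> a) *\<^sub>R axis i 1) \<bullet> h t \<omega> - (norm ((\<theta> \<bullet> a) *\<^sub>R (axis i 1 :: real^'n)))\<^sup>2 / 2" for \<omega>
      by (simp add: l_def cart_eq_inner_axis inner_commute power_mult_distrib)
    show ?thesis
      unfolding eq nn_integral_exp_linear[OF that] by simp
  qed
  let ?c = "real CARD('d) * (1 + (2 + real CARD('d)) / 2)"
  have "AE \<omega> in M. \<forall>\<^sub>F T in sequentially. \<forall>\<theta>\<in>lattice_box T.
      (\<Sum>t = 1..T. l \<theta> t (p t \<omega>) (h t \<omega>)) < real (3 * CARD('d) + 2) * ln (real T)"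
  proof (rule exp_family_eventually_small[OF finite_lattice_box card_lattice_box])
    show "(\<lambda>\<omega>. \<Sum>t = 1..T. l \<theta> t (p t \<omega>) (h t \<omega>)) \<in> borel_measurable M" for T \<theta>
      by (rule borel_measurable_past_sum[OF p lm])
    show "(\<integral>\<^sup>+\<omega>. ennreal (exp (\<Sum>t = 1..T. l \<theta> t (p t \<omega>) (h t \<omega>))) \<partial>M) \<le> 1" for T \<theta>
      by (rule nn_integral_exp_past_sum[OF p lm le])
  qed
  then show ?thesis
    using bd
  proof eventually_elim
    case (elim \<omega>)
    have "\<forall>\<^sub>F T in sequentially. ln (real T) \<ge> 1"
      by real_asymp
    with elim have "\<forall>\<^sub>F T in sequentially. \<forall>\<theta>. norm \<theta> \<le> 1 \<longrightarrow>
      (\<Sum>t = 1..T. (\<theta> \<bullet> p t \<omega>) * (h t \<omega> $ i) - (\<theta> \<bullet> p t \<omega>)\<^sup>2 / 2)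
        \<le> (real (3 * CARD('d) + 2) + ?c) * ln (real T)"
      using eventually_ge_at_top[of 1]
    proof eventually_elim
      case (elim T)
      show ?case
      proof (intro allI impI)
        fix \<theta> :: "real^'d" assume "norm \<theta> \<le> 1"
        then obtain \<theta>' where \<theta>': "\<theta>' \<in> lattice_box T"
          "(\<Sum>t = 1..T. (\<theta> \<bullet> p t \<omega>) * (h t \<omega> $ i) - (\<theta> \<bullet> p t \<omega>)\<^sup>2 / 2)
            \<le> (\<Sum>t = 1..T. (\<theta>' \<bullet> p t \<omega>) * (h t \<omega> $ i) - (\<theta>' \<bullet> p t \<omega>)\<^sup>2 / 2) + ?c"
          using lattice_box_rounding[of T "\<lambda>t. p t \<omega>" "\<lambda>t. h t \<omega> $ i" \<theta>] elim by blast
        have "(\<Sum>t = 1..T. (\<theta>' \<bullet> p t \<omega>) * (h t \<omega> $ i) - (\<theta>' \<bullet> p t \<omega>)\<^sup>2 / 2) \<le> real (3 * CARD('d) + 2) * ln (real T)"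
          using elim \<theta>'(1) unfolding l_def by (auto intro: less_imp_le)
        moreover have "?c * 1 \<le> ?c * ln (real T)"
          using elim by (intro mult_left_mono) auto
        ultimately show "(\<Sum>t = 1..T. (\<theta> \<bullet> p t \<omega>) * (h t \<omega> $ i) - (\<theta> \<bullet> p t \<omega>)\<^sup>2 / 2)
          \<le> (real (3 * CARD('d) + 2) + ?c) * ln (real T)"
          using \<theta>'(2) unfolding distrib_right[of "real (3 * CARD('d) + 2)"] by linarith
      qed
    qed
    then show ?case by blast
  qed
qed

text \<open>The tilt \<open>l0 / \<tau> T\<close> keeps the quadratic compensator below
  \<open>C * l0^2\<close> while the threshold is \<open>2 * ln T\<close>; dividing by the tilt gives
  a deviation of order \<open>\<tau> T * ln T\<close>. Both signs give the absolute value, and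
  \<open>1 \<le> \<tau> T\<close> keeps the tilt in the range where the centred moment bound holds.
  The weights are deterministic, so the past parameter is the constant 0.\<close>

lemma weighted_square_sum_bound:
  assumes \<sigma>: "\<And>t. 0 \<le> \<sigma> t" "\<And>t. t \<ge> 1 \<Longrightarrow> \<sigma> t \<le> 1"
    and \<tau>: "\<And>T. 1 \<le> \<tau> T" "\<And>T. (\<Sum>t = 1..T. (\<sigma> t)\<^sup>2) \<le> (\<tau> T)\<^sup>2"
  shows "AE \<omega> in M. \<exists>C. \<forall>\<^sub>F T in sequentially.
    \<bar>\<Sum>t = 1..T. \<sigma> t * ((b \<bullet> h t \<omega>)\<^sup>2 - (norm b)\<^sup>2)\<bar> \<le> C * (\<tau> T * ln (real T))"
proof -
  obtain l0 C where l0: "l0 > 0" "C \<ge> 0" and mgf: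
    "\<And>X l. distributed M lborel X (\<lambda>y. ennreal (std_gaussian_density y)) \<Longrightarrow> \<bar>l\<bar> \<le> l0 \<Longrightarrow>
      (\<integral>\<^sup>+\<omega>. ennreal (exp (l * ((b \<bullet> (X \<omega> :: real^'n))\<^sup>2 - (norm b)\<^sup>2) - C * l\<^sup>2)) \<partial>M) \<le> 1"
    using gaussian_square_centred_mgf[of b] by metis
  define \<Lambda> where "\<Lambda> T = {l0 / \<tau> T, - (l0 / \<tau> T)}" for T
  have \<Lambda>: "\<bar>l\<bar> = l0 / \<tau> T" if "l \<in> \<Lambda> T" for l T
    using that l0 \<tau>(1)[of T] by (auto simp: \<Lambda>_def)
  define g :: "real \<Rightarrow> nat \<Rightarrow> real \<Rightarrow> real^'n \<Rightarrow> real"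
    where "g l t a y = (l * \<sigma> t) * ((b \<bullet> y)\<^sup>2 - (norm b)\<^sup>2) - C * (l * \<sigma> t)\<^sup>2" for l t a y
  have gm: "(\<lambda>(a, y). g l t a y) \<in> borel_measurable (borel \<Otimes>\<^sub>M borel)" for l t
    unfolding g_def by measurable
  have le: "(\<integral>\<^sup>+\<omega>. ennreal (exp (g l t a (h t \<omega>))) \<partial>M) \<le> 1" if "t \<ge> 1" "l \<in> \<Lambda> T" for l t a T
  proof -
    have "\<bar>l * \<sigma> t\<bar> \<le> l0 / \<tau> T * 1"
      unfolding abs_mult \<Lambda>[OF that(2)] using \<sigma>(1)[of t] \<sigma>(2)[OF that(1)] l0 \<tau>(1)[of T]
      by (intro mult_mono) auto
    also have "\<dots> \<le> l0" using l0 \<tau>(1)[of T] by (simp add: divide_le_eq)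
    finally show ?thesis
      unfolding g_def by (intro mgf h_gauss that(1))
  qed
  have "AE \<omega> in M. \<forall>\<^sub>F T in sequentially. \<forall>l\<in>\<Lambda> T.
      (\<Sum>t = 1..T. g l t 0 (h t \<omega>)) < real (0 + 2) * ln (real T)"
  proof (rule exp_family_eventually_small[where c = 2])
    show "real (card (\<Lambda> T)) \<le> 2 * real T ^ 0" for T
      by (simp add: \<Lambda>_def card_insert_if)
    show "(\<integral>\<^sup>+\<omega>. ennreal (exp (\<Sum>t = 1..T. g l t 0 (h t \<omega>))) \<partial>M) \<le> 1" if "l \<in> \<Lambda> T" for T l
      by (rule nn_integral_exp_past_sum[where p = "\<lambda>_ _. 0"]) (use gm le[OF _ that] in auto)
    show "(\<lambda>\<omega>. \<Sum>t = 1..T. g l t 0 (h t \<omega>)) \<in> borel_measurable M" for T l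
      by (rule borel_measurable_past_sum[where p = "\<lambda>_ _. 0"]) (use gm in auto)
  qed (simp add: \<Lambda>_def)
  then show ?thesis
  proof eventually_elim
    case (elim \<omega>)
    have "\<forall>\<^sub>F T in sequentially. ln (real T) \<ge> 1"
      by real_asymp
    with elim have "\<forall>\<^sub>F T in sequentially.
      \<bar>\<Sum>t = 1..T. \<sigma> t * ((b \<bullet> h t \<omega>)\<^sup>2 - (norm b)\<^sup>2)\<bar> \<le> (C * l0\<^sup>2 + 2) / l0 * (\<tau> T * ln (real T))"
    proof eventually_elim
      case (elim T)
      let ?W = "\<Sum>t = 1..T. \<sigma> t * ((b \<bullet> h t \<omega>)\<^sup>2 - (norm b)\<^sup>2)"
      have main: "l * ?W \<le> C * l0\<^sup>2 + 2 * ln (real T)" if "l \<in> \<Lambda> T" for l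
      proof -
        have "(\<Sum>t = 1..T. g l t 0 (h t \<omega>)) = l * ?W - C * l\<^sup>2 * (\<Sum>t = 1..T. (\<sigma> t)\<^sup>2)"
          by (simp add: g_def sum_subtractf sum_distrib_left power_mult_distrib mult.assoc)
        moreover have "C * l\<^sup>2 * (\<Sum>t = 1..T. (\<sigma> t)\<^sup>2) \<le> C * l0\<^sup>2"
        proof -
          have "l\<^sup>2 = (l0 / \<tau> T)\<^sup>2" using \<Lambda>[OF that] by (metis power2_abs)
          then have "l\<^sup>2 * (\<tau> T)\<^sup>2 = l0\<^sup>2" using \<tau>(1)[of T] by (simp add: power_divide)
          moreover have "l\<^sup>2 * (\<Sum>t = 1..T. (\<sigma> t)\<^sup>2) \<le> l\<^sup>2 * (\<tau> T)\<^sup>2"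
            by (intro mult_left_mono \<tau>(2)) auto
          ultimately show ?thesis using l0(2) by (simp add: mult.assoc mult_left_mono)
        qed
        ultimately show ?thesis using elim that by fastforce
      qed
      have "l0 / \<tau> T * ?W \<le> C * l0\<^sup>2 + 2 * ln (real T)" "- (l0 / \<tau> T) * ?W \<le> C * l0\<^sup>2 + 2 * ln (real T)"
        by (intro main; simp add: \<Lambda>_def)+
      then have "l0 / \<tau> T * \<bar>?W\<bar> \<le> C * l0\<^sup>2 + 2 * ln (real T)"
        by (auto simp: abs_if)
      also have "\<dots> \<le> (C * l0\<^sup>2 + 2) * ln (real T)"
        using mult_left_mono[OF elim(2), of "C * l0\<^sup>2"] l0 by (simp add: algebra_simps)
      finally have "\<bar>?W\<bar> \<le> (C * l0\<^sup>2 + 2) * ln (real T) * (\<tau> T / l0)"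
        using l0(1) \<tau>(1)[of T] by (simp add: field_simps)
      then show ?case by (simp add: mult_ac)
    qed
    then show ?case by blast
  qed
qed

text \<open>Polarization of the square bound in the directions of the axes and of their pairwise
  sums; for \<open>i = j\<close> such a sum has squared norm 4, which accounts for the
  indicator.\<close>

lemma weighted_covariance_bound:
  assumes \<sigma>: "\<And>t. 0 \<le> \<sigma> t" "\<And>t. t \<ge> 1 \<Longrightarrow> \<sigma> t \<le> 1"
    and \<tau>: "\<And>T. 1 \<le> \<tau> T" "\<And>T. (\<Sum>t = 1..T. (\<sigma> t)\<^sup>2) \<le> (\<tau> T)\<^sup>2"
  shows "AE \<omega> in M. \<exists>C\<ge>0. \<forall>\<^sub>F T in sequentially. \<forall>i j.
    \<bar>\<Sum>t = 1..T. \<sigma> t * (h t \<omega> $ i * h t \<omega> $ j - (if i = j then 1 else 0))\<bar> \<le> C * (\<tau> T * ln (real T))"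
proof -
  let ?W = "\<lambda>b \<omega> T. \<Sum>t = 1..T. \<sigma> t * ((b \<bullet> h t \<omega>)\<^sup>2 - (norm b)\<^sup>2)"
  have "AE \<omega> in M. \<forall>i j. \<exists>C. \<forall>\<^sub>F T in sequentially. \<bar>?W (axis i 1 + axis j 1) \<omega> T\<bar> \<le> C * (\<tau> T * ln (real T))"
    by (intro AE_all_countable[THEN iffD2] allI weighted_square_sum_bound assms)
  moreover have "AE \<omega> in M. \<forall>i. \<exists>C. \<forall>\<^sub>F T in sequentially. \<bar>?W (axis i 1) \<omega> T\<bar> \<le> C * (\<tau> T * ln (real T))"
    by (intro AE_all_countable[THEN iffD2] allI weighted_square_sum_bound assms)
  ultimately show ?thesis
  proof eventually_elim
    case (elim \<omega>)
    define C1 where "C1 i j = (SOME C. \<forall>\<^sub>F T in sequentially. \<bar>?W (axis i 1 + axis j 1) \<omega> T\<bar> \<le> C * (\<tau> T * ln (real T)))" for i j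
    define C2 where "C2 i = (SOME C. \<forall>\<^sub>F T in sequentially. \<bar>?W (axis i 1) \<omega> T\<bar> \<le> C * (\<tau> T * ln (real T)))" for i
    have C1: "\<forall>\<^sub>F T in sequentially. \<bar>?W (axis i 1 + axis j 1) \<omega> T\<bar> \<le> C1 i j * (\<tau> T * ln (real T))" for i j
      unfolding C1_def by (rule someI_ex) (rule elim(1)[rule_format])
    have C2: "\<forall>\<^sub>F T in sequentially. \<bar>?W (axis i 1) \<omega> T\<bar> \<le> C2 i * (\<tau> T * ln (real T))" for i
      unfolding C2_def by (rule someI_ex) (rule elim(2)[rule_format])
    define C where "C = (\<Sum>i\<in>UNIV. \<Sum>j\<in>UNIV. \<bar>C1 i j\<bar>) + (\<Sum>i\<in>UNIV. \<bar>C2 i\<bar>)"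
    have le1: "C1 i j \<le> (\<Sum>i\<in>UNIV. \<Sum>j\<in>UNIV. \<bar>C1 i j\<bar>)" for i j
    proof -
      have "C1 i j \<le> \<bar>C1 i j\<bar>" by simp
      also have "\<dots> \<le> (\<Sum>j\<in>UNIV. \<bar>C1 i j\<bar>)" by (rule member_le_sum) auto
      also have "\<dots> \<le> (\<Sum>i\<in>UNIV. \<Sum>j\<in>UNIV. \<bar>C1 i j\<bar>)"
        by (rule member_le_sum[of i UNIV "\<lambda>i. \<Sum>j\<in>UNIV. \<bar>C1 i j\<bar>"]) (auto intro: sum_nonneg)
      finally show ?thesis .
    qed
    have le2: "C2 i \<le> (\<Sum>i\<in>UNIV. \<bar>C2 i\<bar>)" for i
    proof -
      have "C2 i \<le> \<bar>C2 i\<bar>" by simp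
      also have "\<dots> \<le> (\<Sum>i\<in>UNIV. \<bar>C2 i\<bar>)" by (rule member_le_sum) auto
      finally show ?thesis .
    qed
    have C0: "0 \<le> (\<Sum>i\<in>UNIV. \<Sum>j\<in>UNIV. \<bar>C1 i j\<bar>)" "0 \<le> (\<Sum>i\<in>UNIV. \<bar>C2 i\<bar>)"
      by (auto intro!: sum_nonneg)
    have "\<forall>\<^sub>F T in sequentially. \<forall>i j. \<bar>?W (axis i 1 + axis j 1) \<omega> T\<bar> \<le> C1 i j * (\<tau> T * ln (real T))"
      by (intro eventually_all_finite C1)
    moreover have "\<forall>\<^sub>F T in sequentially. \<forall>i. \<bar>?W (axis i 1) \<omega> T\<bar> \<le> C2 i * (\<tau> T * ln (real T))"
      by (intro eventually_all_finite C2)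
    ultimately have "\<forall>\<^sub>F T in sequentially. \<forall>i j.
      \<bar>\<Sum>t = 1..T. \<sigma> t * (h t \<omega> $ i * h t \<omega> $ j - (if i = j then 1 else 0))\<bar> \<le> 2 * C * (\<tau> T * ln (real T))"
      using eventually_ge_at_top[of 1]
    proof eventually_elim
      case (elim T)
      show ?case
      proof (intro allI)
        fix i j
        define L where "L = \<tau> T * ln (real T)"
        have L: "0 \<le> L" unfolding L_def using elim(3) \<tau>(1)[of T] by simp
        have nax: "(norm (axis i 1 + axis j (1 :: real) :: real^'n))\<^sup>2 = 2 + 2 * (if i = j then 1 else 0)"
          by (simp add: power2_norm_eq_inner inner_add_left inner_add_right inner_axis_axis)
        have "(\<Sum>t = 1..T. \<sigma> t * (h t \<omega> $ i * h t \<omega> $ j - (if i = j then 1 else 0)))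
            = (\<Sum>t = 1..T. (\<sigma> t * (((axis i 1 + axis j 1) \<bullet> h t \<omega>)\<^sup>2 - (norm (axis i 1 + axis j (1 :: real) :: real^'n))\<^sup>2)
               - \<sigma> t * ((axis i 1 \<bullet> h t \<omega>)\<^sup>2 - (norm (axis i (1 :: real) :: real^'n))\<^sup>2)
               - \<sigma> t * ((axis j 1 \<bullet> h t \<omega>)\<^sup>2 - (norm (axis j (1 :: real) :: real^'n))\<^sup>2)) / 2)"
          unfolding nax inner_add_left inner_axis' norm_axis_1
          by (intro sum.cong refl) (simp add: power2_eq_square algebra_simps)
        also have "\<dots> = (?W (axis i 1 + axis j 1) \<omega> T - ?W (axis i 1) \<omega> T - ?W (axis j 1) \<omega> T) / 2"
          by (simp only: sum_subtractf sum_divide_distrib[symmetric])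
        finally have eq: "(\<Sum>t = 1..T. \<sigma> t * (h t \<omega> $ i * h t \<omega> $ j - (if i = j then 1 else 0))) = \<dots>" .
        have "\<bar>?W (axis i 1 + axis j 1) \<omega> T\<bar> \<le> C1 i j * L" "\<bar>?W (axis i 1) \<omega> T\<bar> \<le> C2 i * L"
          "\<bar>?W (axis j 1) \<omega> T\<bar> \<le> C2 j * L"
          using elim by (auto simp: L_def)
        moreover have "C1 i j * L \<le> C * L" "C2 i * L \<le> C * L" "C2 j * L \<le> C * L"
        proof -
          have cs: "C1 i j \<le> C" "C2 i \<le> C" "C2 j \<le> C"
            unfolding C_def using le1[of i j] le2[of i] le2[of j] C0 by linarith+
          show "C1 i j * L \<le> C * L" "C2 i * L \<le> C * L" "C2 j * L \<le> C * L"
            by (intro mult_right_mono cs L)+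
        qed
        ultimately show "\<bar>\<Sum>t = 1..T. \<sigma> t * (h t \<omega> $ i * h t \<omega> $ j - (if i = j then 1 else 0))\<bar> \<le> 2 * C * (\<tau> T * ln (real T))"
          unfolding eq L_def[symmetric] by (simp add: abs_le_iff)
      qed
    qed
    then show ?case using C0 by (intro exI[of _ "2 * C"]) (auto simp: C_def)
  qed
qed

text \<open>In a signed axis direction of length \<open>s = 2 * sqrt (ln t)\<close> the exponent
  bound reads \<open>s * y - s^2 / 2 < 2 * ln t\<close> for \<open>y\<close> a signed component,
  that is \<open>y < s\<close>. The index set is empty at time 0, where nothing is assumed about
  \<open>h\<close>.\<close>

lemma noise_bound:
  "AE \<omega> in M. \<forall>\<^sub>F t in sequentially. \<forall>i. \<bar>h t \<omega> $ i\<bar> \<le> 2 * sqrt (ln (real t))"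
proof -
  define \<Lambda> :: "nat \<Rightarrow> ('n \<times> real) set" where "\<Lambda> t = (if t = 0 then {} else UNIV \<times> {1, -1})" for t
  define b :: "nat \<Rightarrow> 'n \<times> real \<Rightarrow> real^'n" where "b t q = (snd q * (2 * sqrt (ln (real t)))) *\<^sub>R axis (fst q) 1" for t q
  have "AE \<omega> in M. \<forall>\<^sub>F t in sequentially. \<forall>q\<in>\<Lambda> t.
      b t q \<bullet> h t \<omega> - (norm (b t q))\<^sup>2 / 2 < real (0 + 2) * ln (real t)"
  proof (rule exp_family_eventually_small[where c = "2 * real CARD('n)"])
    show "real (card (\<Lambda> T)) \<le> 2 * real CARD('n) * real T ^ 0" for T
      by (simp add: \<Lambda>_def card_cartesian_product)
    show "(\<lambda>\<omega>. b t q \<bullet> h t \<omega> - (norm (b t q))\<^sup>2 / 2) \<in> borel_measurable M" if "q \<in> \<Lambda> t" for t q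
    proof -
      have "t \<ge> 1" using that by (auto simp: \<Lambda>_def split: if_splits)
      then have [measurable]: "h t \<in> borel_measurable M" by (rule h_measurable)
      show ?thesis by measurable
    qed
  qed (auto simp: \<Lambda>_def nn_integral_exp_linear)
  then show ?thesis
  proof eventually_elim
    case (elim \<omega>)
    then show ?case
      using eventually_ge_at_top[of 2]
    proof eventually_elim
      case (elim t)
      let ?s = "sqrt (ln (real t))"
      have pos: "0 < ln (real t)" using elim(2) by simp
      have main: "s * (h t \<omega> $ i) \<le> 2 * ?s" if "s \<in> {1, -1}" for i s
      proof -
        have "(i, s) \<in> \<Lambda> t" using that elim(2) by (auto simp: \<Lambda>_def)
        then have "b t (i, s) \<bullet> h t \<omega> - (norm (b t (i, s)))\<^sup>2 / 2 < 2 * ln (real t)"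
          using elim(1) by fastforce
        moreover have "(norm (b t (i, s)))\<^sup>2 = 4 * ln (real t)"
          using that pos by (auto simp: b_def power_mult_distrib)
        moreover have "b t (i, s) \<bullet> h t \<omega> = 2 * ?s * (s * h t \<omega> $ i)"
          by (simp add: b_def inner_axis')
        ultimately have "2 * ?s * (s * h t \<omega> $ i) < 2 * ?s * (2 * ?s)"
          using pos by simp
        then show ?thesis using pos by (subst (asm) mult_less_cancel_left_pos) auto
      qed
      show ?case using main[of 1] main[of "-1"] by (auto simp: abs_le_iff)
    qed
  qed
qed

end

subsection \<open>Adaptedness of the closed loop\<close>

context prob_space
begin

lemma indep_processes_commute: "indep_processes w v \<Longrightarrow> indep_processes v w"
  unfolding indep_processes_def indep_sets2_eq
proof (elim conjE, intro conjI ballI)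
  fix a b
  assume *: "\<forall>a\<in>sets (vimage_algebra (space M) (\<lambda>\<omega>. \<lambda>k\<in>{1..}. w k \<omega>) (Pi\<^sub>M {1..} (\<lambda>_. borel))).
      \<forall>b\<in>sets (vimage_algebra (space M) (\<lambda>\<omega>. \<lambda>k\<in>{1..}. v k \<omega>) (Pi\<^sub>M {1..} (\<lambda>_. borel))).
        prob (a \<inter> b) = prob a * prob b"
    and "a \<in> sets (vimage_algebra (space M) (\<lambda>\<omega>. \<lambda>k\<in>{1..}. v k \<omega>) (Pi\<^sub>M {1..} (\<lambda>_. borel)))"
      "b \<in> sets (vimage_algebra (space M) (\<lambda>\<omega>. \<lambda>k\<in>{1..}. w k \<omega>) (Pi\<^sub>M {1..} (\<lambda>_. borel)))"
  then have "prob (b \<inter> a) = prob b * prob a" by blast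
  then show "prob (a \<inter> b) = prob a * prob b"
    by (simp only: Int_commute[of a b] mult.commute[of "prob a"])
qed

definition process_events :: "(nat \<Rightarrow> 'a \<Rightarrow> 'b::topological_space) \<Rightarrow> 'a set set" where
  "process_events r = sets (vimage_algebra (space M) (\<lambda>\<omega>. \<lambda>k\<in>{1..}. r k \<omega>) (Pi\<^sub>M {1..} (\<lambda>_. borel)))"

definition preimages :: "('a \<Rightarrow> 'b::topological_space) \<Rightarrow> 'a set set" where
  "preimages f = {f -` B \<inter> space M | B. B \<in> sets borel}"

definition past_events :: "(nat \<Rightarrow> 'a \<Rightarrow> 'b::topological_space) \<Rightarrow> nat \<Rightarrow> 'a set set" where
  "past_events g t = sigma_sets (space M) (\<Union>s\<in>{1..<t}. preimages (g s))"

text \<open>The strict past of \<open>g\<close> together with the whole process \<open>r\<close>.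
  The generator consists of intersections, hence is closed under intersection, so independence can
  be checked on it.\<close>

definition past_algebra ::
    "(nat \<Rightarrow> 'a \<Rightarrow> 'b::topological_space) \<Rightarrow> (nat \<Rightarrow> 'a \<Rightarrow> 'c::topological_space) \<Rightarrow> nat \<Rightarrow> 'a measure" where
  "past_algebra g r t = sigma (space M) {a \<inter> b | a b. a \<in> past_events g t \<and> b \<in> process_events r}"

lemma preimages_process_events:
  assumes "k \<ge> 1"
  shows "preimages (r k) \<subseteq> process_events r"
proof
  let ?V = "vimage_algebra (space M) (\<lambda>\<omega>. \<lambda>k\<in>{1..}. r k \<omega>) (Pi\<^sub>M {1..} (\<lambda>_. borel))"
  fix S assume "S \<in> preimages (r k)"
  then obtain B where B: "S = r k -` B \<inter> space M" "B \<in> sets borel"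
    by (auto simp: preimages_def)
  have "(\<lambda>\<omega>. \<lambda>k\<in>{1..}. r k \<omega>) \<in> measurable ?V (Pi\<^sub>M {1..} (\<lambda>_. borel))"
    by (rule measurable_vimage_algebra1) (auto simp: space_PiM)
  then have "(\<lambda>\<omega>. (\<lambda>k\<in>{1..}. r k \<omega>) k) \<in> measurable ?V borel"
    by (rule measurable_compose[OF _ measurable_component_singleton]) (use assms in auto)
  then have "r k \<in> measurable ?V borel" using assms by simp
  from measurable_sets[OF this B(2)] show "S \<in> process_events r"
    by (simp add: process_events_def B(1) space_vimage_algebra)
qed

lemma sigma_algebra_process_events: "sigma_algebra (space M) (process_events r)"
  unfolding process_events_def by (metis sets.sigma_algebra_axioms space_vimage_algebra)

lemma past_events_process_events: "past_events g t \<subseteq> process_events g"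
  unfolding past_events_def
proof (rule sigma_algebra.sigma_sets_subset[OF sigma_algebra_process_events], rule UN_least)
  show "preimages (g s) \<subseteq> process_events g" if "s \<in> {1..<t}" for s
    by (rule preimages_process_events) (use that in simp)
qed

lemma space_in_past_events: "space M \<in> past_events g t"
  unfolding past_events_def by (rule sigma_sets_top)

lemma Int_stable_preimages: "Int_stable (preimages f)"
proof (rule Int_stableI)
  fix S T assume "S \<in> preimages f" "T \<in> preimages f"
  then obtain B C where "S = f -` B \<inter> space M" "T = f -` C \<inter> space M" "B \<in> sets borel" "C \<in> sets borel"
    by (auto simp: preimages_def)
  then have "S \<inter> T = f -` (B \<inter> C) \<inter> space M" "B \<inter> C \<in> sets borel" by auto
  then show "S \<inter> T \<in> preimages f" unfolding preimages_def by blast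
qed

lemma past_gen_subset:
  assumes "indep_processes g r"
  shows "{a \<inter> b | a b. a \<in> past_events g t \<and> b \<in> process_events r} \<subseteq> events"
  using assms past_events_process_events[of g t]
  unfolding indep_processes_def process_events_def[symmetric] indep_sets2_eq by auto

lemma sets_past_algebra:
  assumes "indep_processes g r"
  shows "sets (past_algebra g r t) = sigma_sets (space M) {a \<inter> b | a b. a \<in> past_events g t \<and> b \<in> process_events r}"
  unfolding past_algebra_def
  using past_gen_subset[OF assms, of t] sets.space_closed by (intro sets_measure_of) blast

lemma space_past_algebra [simp]: "space (past_algebra g r t) = space M"
  by (simp add: past_algebra_def space_measure_of_conv)

lemma past_algebra_measurable_other:
  assumes ind: "indep_processes g r" and "k \<ge> 1"
  shows "r k \<in> borel_measurable (past_algebra g r t)"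
proof (rule measurableI)
  fix B :: "'c set" assume "B \<in> sets borel"
  then have "r k -` B \<inter> space M \<in> process_events r"
    using preimages_process_events[OF assms(2), of r] by (auto simp: preimages_def)
  moreover have "r k -` B \<inter> space M = space M \<inter> (r k -` B \<inter> space M)" by auto
  ultimately have "r k -` B \<inter> space M \<in> {a \<inter> b | a b. a \<in> past_events g t \<and> b \<in> process_events r}"
    using space_in_past_events[of g t] by blast
  then show "r k -` B \<inter> space (past_algebra g r t) \<in> sets (past_algebra g r t)"
    by (simp add: sets_past_algebra[OF ind] sigma_sets.Basic)
qed auto

lemma past_algebra_measurable_past:
  assumes ind: "indep_processes g r" and s: "1 \<le> s" "s < t"
  shows "g s \<in> borel_measurable (past_algebra g r t)"
proof (rule measurableI)
  fix B :: "'b set" assume "B \<in> sets borel"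
  then have "g s -` B \<inter> space M \<in> past_events g t"
    unfolding past_events_def using s by (intro sigma_sets.Basic UN_I[of s]) (auto simp: preimages_def)
  moreover have "space M \<in> process_events r"
  proof -
    interpret P: sigma_algebra "space M" "process_events r" by (rule sigma_algebra_process_events)
    show ?thesis by (rule P.top)
  qed
  moreover have "g s -` B \<inter> space M = (g s -` B \<inter> space M) \<inter> space M" by auto
  ultimately have "g s -` B \<inter> space M \<in> {a \<inter> b | a b. a \<in> past_events g t \<and> b \<in> process_events r}"
    by blast
  then show "g s -` B \<inter> space (past_algebra g r t) \<in> sets (past_algebra g r t)"
    by (simp add: sets_past_algebra[OF ind] sigma_sets.Basic)
qed auto

text \<open>For \<open>a\<close> in the past of \<open>g\<close>, \<open>E\<close> generated by
  \<open>g t\<close> and \<open>b\<close> by \<open>r\<close>: independence of the processes splits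
  \<open>b\<close> off \<open>a \<inter> E\<close>, independence within \<open>g\<close> splits
  \<open>E\<close> off \<open>a\<close>, and \<open>a\<close> and \<open>b\<close> recombine. The
  generators being closed under intersection, this extends to the generated algebras.\<close>

lemma gaussian_innovation_past_algebra:
  fixes g :: "nat \<Rightarrow> 'a \<Rightarrow> real^'n" and r :: "nat \<Rightarrow> 'a \<Rightarrow> 'c::topological_space"
  assumes g: "iid_std_gaussian g" and ind: "indep_processes g r"
  shows "gaussian_innovation M (past_algebra g r) g"
proof
  fix t :: nat assume t: "t \<ge> 1"
  show "space (past_algebra g r t) = space M" by simp
  show "sets (past_algebra g r t) \<subseteq> events"
    unfolding sets_past_algebra[OF ind] by (rule sets.sigma_sets_subset[OF past_gen_subset[OF ind]])
  have mono: "past_events g t \<subseteq> past_events g (Suc t)"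
    unfolding past_events_def by (intro sigma_sets_mono' UN_mono) auto
  show "sets (past_algebra g r t) \<subseteq> sets (past_algebra g r (Suc t))"
    unfolding sets_past_algebra[OF ind] using mono by (intro sigma_sets_mono') blast
  show "g t \<in> borel_measurable (past_algebra g r (Suc t))"
    by (rule past_algebra_measurable_past[OF ind]) (use t in auto)
  show "distributed M lborel (g t) (\<lambda>y. ennreal (std_gaussian_density y))"
    using g t by (simp add: iid_std_gaussian_def)
  have iv: "indep_sets (\<lambda>i. preimages (g i)) {1..}"
    using g unfolding iid_std_gaussian_def indep_vars_def2 preimages_def by auto
  have "indep_sets (\<lambda>j. sigma_sets (space M) (\<Union>i\<in>case_bool {1..<t} {t} j. preimages (g i))) UNIV"
  proof (rule indep_sets_collect_sigma)
    have "(\<Union>j\<in>UNIV. case_bool {1..<t} {t} j) \<subseteq> {1..}"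
      using t by (auto split: bool.splits)
    then show "indep_sets (\<lambda>i. preimages (g i)) (\<Union>j\<in>UNIV. case_bool {1..<t} {t} j)"
      by (rule indep_sets_mono_index) (rule iv)
    show "disjoint_family_on (case_bool {1..<t} {t}) UNIV"
      by (auto simp: disjoint_family_on_def split: bool.splits)
  qed (rule Int_stable_preimages)
  then have *: "indep_set (past_events g t) (sigma_sets (space M) (preimages (g t)))"
    unfolding indep_set_def past_events_def
    by (rule iffD1[OF indep_sets_cong, rotated 2]) (auto split: bool.splits)
  have PV: "indep_set (process_events g) (process_events r)"
    using ind by (simp add: indep_processes_def process_events_def)
  have "indep_set {a \<inter> b | a b. a \<in> past_events g t \<and> b \<in> process_events r} (preimages (g t))"
    unfolding indep_sets2_eq
  proof (intro conjI ballI)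
    show "{a \<inter> b | a b. a \<in> past_events g t \<and> b \<in> process_events r} \<subseteq> events"
      by (rule past_gen_subset[OF ind])
    show "preimages (g t) \<subseteq> events"
      using * unfolding indep_sets2_eq by (meson order.trans sigma_sets_superset_generator)
    fix S E assume "S \<in> {a \<inter> b | a b. a \<in> past_events g t \<and> b \<in> process_events r}" and E: "E \<in> preimages (g t)"
    then obtain a b where ab: "S = a \<inter> b" "a \<in> past_events g t" "b \<in> process_events r" by auto
    have aP: "a \<in> process_events g" using ab(2) past_events_process_events by blast
    have EP: "E \<in> process_events g" using E preimages_process_events[OF t] by blast
    interpret P: sigma_algebra "space M" "process_events g" by (rule sigma_algebra_process_events)
    have aE: "a \<inter> E \<in> process_events g" using aP EP by (rule P.Int)
    have "prob (S \<inter> E) = prob ((a \<inter> E) \<inter> b)" by (simp add: ab(1) Int_ac)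
    also have "\<dots> = prob (a \<inter> E) * prob b" by (rule indep_setD[OF PV aE ab(3)])
    also have "prob (a \<inter> E) = prob a * prob E"
      by (rule indep_setD[OF * ab(2) sigma_sets.Basic[OF E]])
    also have "prob a * prob E * prob b = (prob a * prob b) * prob E" by simp
    also have "prob a * prob b = prob S"
      unfolding ab(1) by (rule indep_setD[OF PV aP ab(3), symmetric])
    finally show "prob (S \<inter> E) = prob S * prob E" .
  qed
  moreover have "Int_stable {a \<inter> b | a b. a \<in> past_events g t \<and> b \<in> process_events r}"
  proof (rule Int_stableI)
    fix S T assume "S \<in> {a \<inter> b | a b. a \<in> past_events g t \<and> b \<in> process_events r}"
      "T \<in> {a \<inter> b | a b. a \<in> past_events g t \<and> b \<in> process_events r}"
    then obtain a b a' b' where *: "S = a \<inter> b" "T = a' \<inter> b'" "a \<in> past_events g t" "a' \<in> past_events g t"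
      "b \<in> process_events r" "b' \<in> process_events r" by auto
    interpret P: sigma_algebra "space M" "process_events r" by (rule sigma_algebra_process_events)
    have "sigma_algebra (space M) (past_events g t)"
      unfolding past_events_def by (rule sigma_algebra_sigma_sets) (auto simp: preimages_def)
    then interpret W: sigma_algebra "space M" "past_events g t" .
    have "S \<inter> T = (a \<inter> a') \<inter> (b \<inter> b')" using * by auto
    moreover have "a \<inter> a' \<in> past_events g t" "b \<inter> b' \<in> process_events r"
      using * by auto
    ultimately show "S \<inter> T \<in> {a \<inter> b | a b. a \<in> past_events g t \<and> b \<in> process_events r}" by blast
  qed
  ultimately have final: "indep_set (sets (past_algebra g r t)) (sigma_sets (space M) (preimages (g t)))"
    unfolding sets_past_algebra[OF ind] by (rule indep_set_sigma_sets[OF _ _ Int_stable_preimages])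
  show "prob (S \<inter> (g t -` B \<inter> space M)) = prob S * prob (g t -` B \<inter> space M)"
    if "S \<in> sets (past_algebra g r t)" "B \<in> sets borel" for S B
    by (rule indep_setD[OF final that(1)]) (use that(2) in \<open>auto simp: preimages_def intro!: sigma_sets.Basic\<close>)
qed

end

section \<open>Measurability of the loop with respect to the past\<close>

definition u_cb ::
    "real^'n^'n \<Rightarrow> real^'m^'m \<Rightarrow> (nat \<Rightarrow> real^'n) \<Rightarrow> (nat \<Rightarrow> real^'m) \<Rightarrow> (nat \<Rightarrow> nat) \<Rightarrow> nat \<Rightarrow> real^'m" where
  "u_cb Q R x u xi k = (if xi k = 0 \<and> \<not> breaker_trips Q R x u k then u_ce Q R x u k else 0)"

lemma closed_loop_u:
  "closed_loop A B Q R w v x u xi \<Longrightarrow> k \<ge> 1 \<Longrightarrow>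
    u k = u_cb Q R x u xi k + (real k powr (- 1 / 4)) *\<^sub>R v k"
  by (simp add: closed_loop_def u_cb_def)

lemma onorm_matrix_le_iff:
  fixes K :: "real^'n^'m"
  assumes "0 \<le> l"
  shows "onorm (\<lambda>y. K *v y) \<le> l \<longleftrightarrow> (\<forall>x. norm (K *v x) \<le> l * norm x)"
  using assms onorm_le[of "(*v) K" l] norm_matrix_vector_le[of K]
  by (meson mult_right_mono norm_ge_zero order.trans)

text \<open>Expresses the operator norm threshold as a closed condition on the gain, suited to
  measurability and to checking it vector by vector.\<close>

lemma breaker_trips_iff:
  assumes "k \<ge> 1"
  shows "breaker_trips Q R x u k \<longleftrightarrow> ln (real k) < norm (u_ce Q R x u k) \<or>
    \<not> (\<forall>y. norm (K_hat Q R x u k *v y) \<le> ln (real k) * norm y)"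
proof -
  have "0 \<le> ln (real k)" using assms by simp
  then show ?thesis
    unfolding breaker_trips_def less_max_iff_disj onorm_matrix_le_iff[symmetric, OF \<open>0 \<le> ln (real k)\<close>]
    by (simp add: not_le)
qed

context lqr
begin

text \<open>Stated for any algebra that knows the noises before \<open>t\<close>, so that it serves
  both past algebras with the roles of \<open>w\<close> and \<open>v\<close> exchanged. The
  conclusion has \<open>u_cb\<close> at time \<open>t\<close> instead of \<open>u t\<close>, since
  the latter contains \<open>v t\<close>. Strong induction, because the gain at \<open>t\<close>
  depends on all earlier data.\<close>

lemma closed_loop_adapted:
  fixes x w :: "nat \<Rightarrow> 'a \<Rightarrow> real^'n" and u v :: "nat \<Rightarrow> 'a \<Rightarrow> real^'m" and xi :: "nat \<Rightarrow> 'a \<Rightarrow> nat"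
  assumes cl: "\<And>\<omega>. \<omega> \<in> space N \<Longrightarrow>
       closed_loop A B Q R (\<lambda>k. w k \<omega>) (\<lambda>k. v k \<omega>) (\<lambda>k. x k \<omega>) (\<lambda>k. u k \<omega>) (\<lambda>k. xi k \<omega>)"
    and w: "\<And>s. 1 \<le> s \<Longrightarrow> s < t \<Longrightarrow> w s \<in> borel_measurable N"
    and v: "\<And>s. 1 \<le> s \<Longrightarrow> s < t \<Longrightarrow> v s \<in> borel_measurable N"
    and t: "1 \<le> t"
  shows "x t \<in> borel_measurable N \<and> xi t \<in> measurable N (count_space UNIV) \<and>
    Measurable.pred N (\<lambda>\<omega>. breaker_trips Q R (\<lambda>k. x k \<omega>) (\<lambda>k. u k \<omega>) t) \<and>
    (\<lambda>\<omega>. u_cb Q R (\<lambda>k. x k \<omega>) (\<lambda>k. u k \<omega>) (\<lambda>k. xi k \<omega>) t) \<in> borel_measurable N"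
  using w v t
proof (induction t rule: less_induct)
  case (less t)
  have IH: "x s \<in> borel_measurable N" "xi s \<in> measurable N (count_space UNIV)"
    "Measurable.pred N (\<lambda>\<omega>. breaker_trips Q R (\<lambda>k. x k \<omega>) (\<lambda>k. u k \<omega>) s)"
    "(\<lambda>\<omega>. u_cb Q R (\<lambda>k. x k \<omega>) (\<lambda>k. u k \<omega>) (\<lambda>k. xi k \<omega>) s) \<in> borel_measurable N"
    if "1 \<le> s" "s < t" for s
    using less.IH[OF that(2)] less.prems(1,2) that by auto
  have u: "u s \<in> borel_measurable N" if s: "1 \<le> s" "s < t" for s
  proof -
    have [measurable]: "v s \<in> borel_measurable N" by (rule less.prems(2)[OF s])
    have [measurable]: "(\<lambda>\<omega>. u_cb Q R (\<lambda>k. x k \<omega>) (\<lambda>k. u k \<omega>) (\<lambda>k. xi k \<omega>) s) \<in> borel_measurable N"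
      by (rule IH(4)[OF s])
    have "(\<lambda>\<omega>. u_cb Q R (\<lambda>k. x k \<omega>) (\<lambda>k. u k \<omega>) (\<lambda>k. xi k \<omega>) s
        + (real s powr (- 1 / 4)) *\<^sub>R v s \<omega>) \<in> borel_measurable N"
      by measurable
    then show ?thesis
      by (rule measurable_cong[THEN iffD1, rotated]) (simp add: closed_loop_u[OF cl s(1)])
  qed
  have x: "x t \<in> borel_measurable N" and xi: "xi t \<in> measurable N (count_space UNIV)"
  proof -
    obtain k where k: "t = Suc k" using less.prems(3) by (cases t) auto
    then consider "t = 1" | "1 \<le> k" by (cases k) auto
    then have "x t \<in> borel_measurable N \<and> xi t \<in> measurable N (count_space UNIV)"
    proof cases
      case 1
      have "(\<lambda>_. 0 :: real^'n) \<in> borel_measurable N" "(\<lambda>_. 0 :: nat) \<in> measurable N (count_space UNIV)"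
        by auto
      moreover have "x t \<omega> = 0" "xi t \<omega> = 0" if "\<omega> \<in> space N" for \<omega>
        using cl[OF that] 1 by (auto simp: closed_loop_def)
      ultimately show ?thesis by (simp cong: measurable_cong)
    next
      case 2
      have [measurable]: "x k \<in> borel_measurable N" "u k \<in> borel_measurable N" "w k \<in> borel_measurable N"
        "xi k \<in> measurable N (count_space UNIV)"
        "Measurable.pred N (\<lambda>\<omega>. breaker_trips Q R (\<lambda>k. x k \<omega>) (\<lambda>k. u k \<omega>) k)"
        using IH[of k] u[of k] less.prems(1)[of k] k 2 by auto
      have "x t \<omega> = A *v x k \<omega> + B *v u k \<omega> + w k \<omega>"
        "xi t \<omega> = (if xi k \<omega> = 0 then (if breaker_trips Q R (\<lambda>k. x k \<omega>) (\<lambda>k. u k \<omega>) k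
            then nat \<lfloor>ln (real k)\<rfloor> else 0) else xi k \<omega> - 1)" if "\<omega> \<in> space N" for \<omega>
        using cl[OF that] k 2 by (auto simp: closed_loop_def)
      moreover have "(\<lambda>\<omega>. A *v x k \<omega> + B *v u k \<omega> + w k \<omega>) \<in> borel_measurable N"
        by measurable
      moreover have "(\<lambda>\<omega>. if xi k \<omega> = 0 then (if breaker_trips Q R (\<lambda>k. x k \<omega>) (\<lambda>k. u k \<omega>) k
            then nat \<lfloor>ln (real k)\<rfloor> else 0) else xi k \<omega> - 1) \<in> measurable N (count_space UNIV)"
        by measurable
      ultimately show ?thesis by (simp cong: measurable_cong)
    qed
    then show "x t \<in> borel_measurable N" "xi t \<in> measurable N (count_space UNIV)" by auto
  qed
  have K: "(\<lambda>\<omega>. K_hat Q R (\<lambda>k. x k \<omega>) (\<lambda>k. u k \<omega>) t) \<in> borel_measurable N"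
    by (rule borel_measurable_K_hat) (use IH u in auto)
  have ce: "(\<lambda>\<omega>. u_ce Q R (\<lambda>k. x k \<omega>) (\<lambda>k. u k \<omega>) t) \<in> borel_measurable N"
    unfolding u_ce_def by (rule borel_measurable_matrix_vector_mult[OF K x])
  have "closed {K :: real^'n^'m. \<forall>y. norm (K *v y) \<le> ln (real t) * norm y}"
    by (intro closed_Collect_all closed_Collect_le continuous_intros)
      (simp add: matrix_vector_mult_def, intro continuous_intros)
  then have [measurable]: "{K :: real^'n^'m. \<forall>y. norm (K *v y) \<le> ln (real t) * norm y} \<in> sets borel" by simp
  have trip: "Measurable.pred N (\<lambda>\<omega>. breaker_trips Q R (\<lambda>k. x k \<omega>) (\<lambda>k. u k \<omega>) t)"
  proof -
    have eq: "(\<lambda>\<omega>. breaker_trips Q R (\<lambda>k. x k \<omega>) (\<lambda>k. u k \<omega>) t) =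
        (\<lambda>\<omega>. ln (real t) < norm (u_ce Q R (\<lambda>k. x k \<omega>) (\<lambda>k. u k \<omega>) t) \<or>
           \<not> (K_hat Q R (\<lambda>k. x k \<omega>) (\<lambda>k. u k \<omega>) t \<in> {K. \<forall>y. norm (K *v y) \<le> ln (real t) * norm y}))"
      by (simp add: breaker_trips_iff[OF less.prems(3)])
    show ?thesis unfolding eq using K ce by measurable
  qed
  have "(\<lambda>\<omega>. u_cb Q R (\<lambda>k. x k \<omega>) (\<lambda>k. u k \<omega>) (\<lambda>k. xi k \<omega>) t) \<in> borel_measurable N"
    unfolding u_cb_def using xi trip ce by measurable
  then show ?case using x xi trip by blast
qed

end

subsection \<open>Growth of the closed-loop signals\<close>

text \<open>The finitely many early terms are absorbed because \<open>g\<close> tends to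
  infinity.\<close>

lemma eventually_uniform_bound:
  fixes f g :: "nat \<Rightarrow> real"
  assumes ev: "\<forall>\<^sub>F t in sequentially. f t \<le> g t"
    and mono: "\<And>s t. 1 \<le> s \<Longrightarrow> s \<le> t \<Longrightarrow> g s \<le> g t"
    and top: "filterlim g at_top sequentially"
  shows "\<forall>\<^sub>F T in sequentially. \<forall>t\<in>{1..T}. f t \<le> g T"
proof -
  obtain N where N: "\<And>t. t \<ge> N \<Longrightarrow> f t \<le> g t"
    using ev by (auto simp: eventually_sequentially)
  define m where "m = (\<Sum>t\<le>N. \<bar>f t\<bar>)"
  have m: "f t \<le> m" if "t \<le> N" for t
  proof -
    have "f t \<le> \<bar>f t\<bar>" by simp
    also have "\<dots> \<le> m" unfolding m_def by (rule member_le_sum) (use that in auto)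
    finally show ?thesis .
  qed
  have "\<forall>\<^sub>F T in sequentially. m \<le> g T"
    using top by (simp add: filterlim_at_top)
  then show ?thesis
  proof eventually_elim
    case (elim T)
    show ?case
    proof
      fix t assume t: "t \<in> {1..T}"
      show "f t \<le> g T"
      proof (cases "t \<le> N")
        case True
        then show ?thesis using m[of t] elim by linarith
      next
        case False
        then have "f t \<le> g t" using N by simp
        also have "\<dots> \<le> g T" using t by (intro mono) auto
        finally show ?thesis .
      qed
    qed
  qed
qed

lemma uniform_constant:
  fixes f :: "'j::finite \<Rightarrow> nat \<Rightarrow> 'k \<Rightarrow> real"
  assumes g: "\<forall>\<^sub>F T in sequentially. 0 \<le> g T"
    and ex: "\<And>j. \<exists>C. \<forall>\<^sub>F T in sequentially. \<forall>\<theta>. Pr \<theta> \<longrightarrow> f j T \<theta> \<le> C * g T"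
  shows "\<exists>C>0. \<forall>\<^sub>F T in sequentially. \<forall>j \<theta>. Pr \<theta> \<longrightarrow> f j T \<theta> \<le> C * g T"
proof -
  define C where "C j = (SOME C. \<forall>\<^sub>F T in sequentially. \<forall>\<theta>. Pr \<theta> \<longrightarrow> f j T \<theta> \<le> C * g T)" for j
  have C: "\<forall>\<^sub>F T in sequentially. \<forall>\<theta>. Pr \<theta> \<longrightarrow> f j T \<theta> \<le> C j * g T" for j
    unfolding C_def by (rule someI_ex) (rule ex)
  define D where "D = 1 + (\<Sum>j\<in>UNIV. \<bar>C j\<bar>)"
  have D: "C j \<le> D" for j
  proof -
    have "\<bar>C j\<bar> \<le> (\<Sum>j\<in>UNIV. \<bar>C j\<bar>)" by (rule member_le_sum) auto
    then show ?thesis by (simp add: D_def)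
  qed
  have "\<forall>\<^sub>F T in sequentially. \<forall>j. \<forall>\<theta>. Pr \<theta> \<longrightarrow> f j T \<theta> \<le> C j * g T"
    by (rule eventually_all_finite) (rule C)
  with g have "\<forall>\<^sub>F T in sequentially. \<forall>j \<theta>. Pr \<theta> \<longrightarrow> f j T \<theta> \<le> D * g T"
  proof eventually_elim
    case (elim T)
    show ?case
    proof (intro allI impI)
      fix j \<theta> assume "Pr \<theta>"
      then have "f j T \<theta> \<le> C j * g T" using elim(2) by blast
      also have "\<dots> \<le> D * g T" by (rule mult_right_mono[OF D elim(1)])
      finally show "f j T \<theta> \<le> D * g T" .
    qed
  qed
  moreover have "D > 0" unfolding D_def by (intro add_pos_nonneg sum_nonneg) auto
  ultimately show ?thesis by blast
qed

lemma contraction_growth: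
  fixes N g :: "nat \<Rightarrow> real"
  assumes \<gamma>: "0 \<le> \<gamma>" and rec: "\<And>t. t0 \<le> t \<Longrightarrow> N (Suc t) \<le> \<gamma> * N t + e * g t"
    and g: "\<And>t. t0 \<le> t \<Longrightarrow> g t \<le> g (Suc t)" "\<And>t. t0 \<le> t \<Longrightarrow> 0 \<le> g t"
    and K: "0 \<le> K" "e \<le> (1 - \<gamma>) * K" "N t0 \<le> K * g t0" and t: "t0 \<le> t"
  shows "N t \<le> K * g t"
  using t
proof (induction t rule: dec_induct)
  case base
  then show ?case by (rule K(3))
next
  case (step t)
  have "N (Suc t) \<le> \<gamma> * N t + e * g t" by (rule rec[OF step(1)])
  also have "\<dots> \<le> \<gamma> * (K * g t) + ((1 - \<gamma>) * K) * g t"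
    by (intro add_mono mult_left_mono mult_right_mono step.IH \<gamma> K(2) g(2) step(1))
  also have "\<dots> = K * g t" by (simp add: algebra_simps)
  also have "\<dots> \<le> K * g (Suc t)" by (intro mult_left_mono g(1) K(1) step(1))
  finally show ?case .
qed

lemma norm_le_components:
  fixes y :: "real^'k"
  assumes "\<And>i. \<bar>y $ i\<bar> \<le> c"
  shows "norm y \<le> real CARD('k) * c"
proof -
  have "norm y \<le> (\<Sum>i\<in>UNIV. \<bar>y $ i\<bar>)" by (rule norm_le_l1_cart)
  also have "\<dots> \<le> (\<Sum>i\<in>(UNIV :: 'k set). c)" by (intro sum_mono assms)
  finally show ?thesis by simp
qed

lemma norm_stack: "(norm (stack a b))\<^sup>2 = (norm a)\<^sup>2 + (norm b)\<^sup>2"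
  by (simp add: power2_norm_eq_inner inner_vec_def stack_def UNIV_Plus_UNIV[symmetric] sum.Plus comp_def
      del: UNIV_Plus_UNIV)

lemma inner_stack: "stack a b \<bullet> stack c d = a \<bullet> c + b \<bullet> d"
  by (simp add: inner_vec_def stack_def UNIV_Plus_UNIV[symmetric] sum.Plus comp_def
      del: UNIV_Plus_UNIV)

lemma stack_surj:
  fixes \<theta> :: "real^('n::finite + 'm::finite)"
  shows "\<exists>a b. \<theta> = stack a b"
proof -
  have "\<theta> $ i = stack (\<chi> k. \<theta> $ Inl k) (\<chi> k. \<theta> $ Inr k) $ i" for i
    by (cases i) (auto simp: stack_def)
  then show ?thesis by (metis vec_eq_iff)
qed

lemma norm_stack_le: "norm (stack a b) \<le> norm a + norm b"
  by (rule power2_le_imp_le) (simp_all add: norm_stack power2_sum)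

lemma sqrt_ln_le_ln: "1 \<le> ln t \<Longrightarrow> sqrt (ln t) \<le> ln t"
  by (rule real_le_lsqrt) (auto simp: power2_eq_square intro: mult_left_mono[of 1 "ln t" "ln t", simplified])

lemma powr_neg_le_1: "1 \<le> t \<Longrightarrow> a \<le> 0 \<Longrightarrow> real t powr a \<le> 1"
  using powr_mono[of a 0 "real t"] by simp

text \<open>A single trajectory. From here on the reasoning is deterministic, and randomness enters
  only through assumed asymptotic bounds.\<close>

locale lqr_path = lqr Q R for Q :: "real^'n^'n" and R :: "real^'m^'m" +
  fixes A :: "real^'n^'n" and B :: "real^'m^'n"
    and w x :: "nat \<Rightarrow> real^'n" and v u :: "nat \<Rightarrow> real^'m" and xi :: "nat \<Rightarrow> nat"
  assumes cl: "closed_loop A B Q R w v x u xi"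
    and A_stable: "spectral_radius A < 1"
    and w_small: "\<forall>\<^sub>F t in sequentially. \<forall>i. \<bar>w t $ i\<bar> \<le> 2 * sqrt (ln (real t))"
    and v_small: "\<forall>\<^sub>F t in sequentially. \<forall>i. \<bar>v t $ i\<bar> \<le> 2 * sqrt (ln (real t))"
begin

abbreviation "c_in \<equiv> u_cb Q R x u xi"

lemma x_Suc: "t \<ge> 1 \<Longrightarrow> x (Suc t) = A *v x t + B *v u t + w t"
  using cl by (simp add: closed_loop_def)

lemma u_eq: "t \<ge> 1 \<Longrightarrow> u t = c_in t + (real t powr (- 1 / 4)) *\<^sub>R v t"
  using closed_loop_u[OF cl] .

lemma c_in_bound:
  assumes "t \<ge> 1"
  shows "norm (c_in t) \<le> ln (real t)"
  using assms by (auto simp: u_cb_def breaker_trips_def not_less)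

lemma w_norm: "\<forall>\<^sub>F t in sequentially. norm (w t) \<le> real CARD('n) * 2 * sqrt (ln (real t))"
  using w_small by eventually_elim (use norm_le_components in \<open>force simp: mult.assoc\<close>)

lemma v_norm: "\<forall>\<^sub>F t in sequentially. norm (v t) \<le> real CARD('m) * 2 * sqrt (ln (real t))"
  using v_small by eventually_elim (use norm_le_components in \<open>force simp: mult.assoc\<close>)

lemma u_norm: "\<forall>\<^sub>F t in sequentially. norm (u t) \<le> (1 + real CARD('m) * 2) * ln (real t)"
proof -
  have "\<forall>\<^sub>F t in sequentially. 1 \<le> ln (real t)" by real_asymp
  with v_norm show ?thesis
    using eventually_ge_at_top[of 1]
  proof eventually_elim
    case (elim t)
    have "norm (u t) \<le> norm (c_in t) + norm ((real t powr (- 1 / 4)) *\<^sub>R v t)"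
      unfolding u_eq[OF elim(3)] by (rule norm_triangle_ineq)
    also have "norm ((real t powr (- 1 / 4)) *\<^sub>R v t) \<le> 1 * norm (v t)"
      unfolding norm_scaleR using elim(3) powr_neg_le_1[of t "- 1 / 4"] by (intro mult_right_mono) auto
    also have "1 * norm (v t) \<le> real CARD('m) * 2 * ln (real t)"
      unfolding mult_1 by (rule order.trans[OF elim(1) mult_left_mono[OF sqrt_ln_le_ln[OF elim(2)]]]) simp
    finally show ?case
      using c_in_bound[OF elim(3)] unfolding distrib_right by simp
  qed
qed

lemma A_powers: "(\<lambda>k. ((*v) A ^^ k) y) \<longlonglongrightarrow> 0"
  by (rule powers_tendsto_0[OF A_stable])

text \<open>The stable open loop \<open>A\<close> is driven by logarithmic inputs and noise; in its
  adapted norm this is a scalar contraction, and \<open>K\<close> dominates both its steady level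
  and the value at \<open>t0\<close>.\<close>

lemma x_norm: "\<exists>C. \<forall>\<^sub>F t in sequentially. norm (x t) \<le> C * ln (real t)"
proof -
  obtain N \<gamma> b where N: "0 < \<gamma>" "\<gamma> < 1" "0 < b" "\<And>x. norm x \<le> N x" "\<And>x. N x \<le> b * norm x"
    "\<And>x y. N (x + y) \<le> N x + N y" "\<And>x. N (A *v x) \<le> \<gamma> * N x"
    by (rule adapted_norm_exists[OF A_powers]) blast
  define e where "e = b * (onorm ((*v) B) * (1 + real CARD('m) * 2) + real CARD('n) * 2)"
  have "\<forall>\<^sub>F t in sequentially. 1 \<le> ln (real t)" by real_asymp
  with u_norm w_norm have "\<forall>\<^sub>F t in sequentially. N (x (Suc t)) \<le> \<gamma> * N (x t) + e * ln (real t) \<and> 1 \<le> ln (real t)"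
    using eventually_ge_at_top[of 1]
  proof eventually_elim
    case (elim t)
    have "N (x (Suc t)) \<le> N (A *v x t) + N (B *v u t + w t)"
      unfolding x_Suc[OF elim(4)] add.assoc by (rule N(6))
    also have "\<dots> \<le> \<gamma> * N (x t) + b * norm (B *v u t + w t)"
      by (intro add_mono N)
    also have "norm (B *v u t + w t) \<le> onorm ((*v) B) * norm (u t) + norm (w t)"
      by (intro order.trans[OF norm_triangle_ineq] add_mono norm_matrix_vector_le order_refl)
    also have "\<dots> \<le> onorm ((*v) B) * ((1 + real CARD('m) * 2) * ln (real t)) + real CARD('n) * 2 * ln (real t)"
      by (intro add_mono mult_left_mono onorm_matrix_nonneg elim(1)
          order.trans[OF elim(2) mult_left_mono[OF sqrt_ln_le_ln[OF elim(3)]]]) simp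
    finally have "N (x (Suc t)) \<le> \<gamma> * N (x t) + b * (onorm ((*v) B) * ((1 + real CARD('m) * 2) * ln (real t)) + real CARD('n) * 2 * ln (real t))"
      using N(3) by simp
    also have "\<dots> = \<gamma> * N (x t) + e * ln (real t)"
      by (simp add: e_def algebra_simps)
    finally show ?case using elim(3) by simp
  qed
  then obtain t0 where t0: "\<And>t. t \<ge> t0 \<Longrightarrow> N (x (Suc t)) \<le> \<gamma> * N (x t) + e * ln (real t)"
    "\<And>t. t \<ge> t0 \<Longrightarrow> 1 \<le> ln (real t)"
    by (auto simp: eventually_sequentially)
  define K where "K = max (e / (1 - \<gamma>)) (max 0 (N (x t0)))"
  have K: "0 \<le> K" "e \<le> (1 - \<gamma>) * K" "N (x t0) \<le> K * ln (real t0)"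
  proof -
    show "0 \<le> K" by (simp add: K_def)
    have "e = (1 - \<gamma>) * (e / (1 - \<gamma>))" using N(2) by simp
    also have "\<dots> \<le> (1 - \<gamma>) * K" using N(2) by (intro mult_left_mono) (auto simp: K_def)
    finally show "e \<le> (1 - \<gamma>) * K" .
    have "N (x t0) \<le> K * 1" by (simp add: K_def)
    also have "\<dots> \<le> K * ln (real t0)" using t0(2)[of t0] \<open>0 \<le> K\<close> by (intro mult_left_mono) auto
    finally show "N (x t0) \<le> K * ln (real t0)" .
  qed
  have pos: "0 < real t" if "t \<ge> t0" for t
    using t0(2)[OF that] by (cases t) auto
  have "N (x t) \<le> K * ln (real t)" if "t \<ge> t0" for t
  proof (rule contraction_growth[where N = "\<lambda>t. N (x t)" and g = "\<lambda>t. ln (real t)" and ?t0.0 = t0 and \<gamma> = \<gamma> and e = e])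
    show "ln (real t) \<le> ln (real (Suc t))" if "t0 \<le> t" for t
      using pos[OF that] by simp
    show "0 \<le> ln (real t)" if "t0 \<le> t" for t using t0(2)[OF that] by simp
  qed (use t0 N K that in auto)
  then have "norm (x t) \<le> K * ln (real t)" if "t \<ge> t0" for t
    using N(4)[of "x t"] that order.trans by blast
  then show ?thesis unfolding eventually_sequentially by blast
qed

lemma path_uniform_bound:
  "\<exists>C>0. \<forall>\<^sub>F T in sequentially. \<forall>t\<in>{1..T}. norm (x t) \<le> C * ln (real T) \<and> norm (u t) \<le> C * ln (real T)
     \<and> norm (w t) \<le> C * ln (real T) \<and> norm (v t) \<le> C * ln (real T) \<and> norm (c_in t) \<le> C * ln (real T)"
proof -
  obtain Cx where Cx: "\<forall>\<^sub>F t in sequentially. norm (x t) \<le> Cx * ln (real t)" using x_norm by blast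
  define C where "C = \<bar>Cx\<bar> + (1 + real CARD('m) * 2) + real CARD('n) * 2"
  have C0: "C > 0" unfolding C_def by (intro add_nonneg_pos add_pos_nonneg) auto
  have "\<forall>\<^sub>F t in sequentially. 1 \<le> ln (real t)" by real_asymp
  \<comment> \<open>Four of the five norms are below \<open>C * ln t\<close>, the controller part
    below \<open>ln t\<close>: hence \<open>4 * C + 1\<close>.\<close>
  with Cx u_norm w_norm v_norm
  have "\<forall>\<^sub>F t in sequentially. norm (x t) + norm (u t) + norm (w t) + norm (v t) + norm (c_in t) \<le> (4 * C + 1) * ln (real t)"
    using eventually_ge_at_top[of 1]
  proof eventually_elim
    case (elim t)
    have s: "sqrt (ln (real t)) \<le> ln (real t)" by (rule sqrt_ln_le_ln[OF elim(5)])
    have "Cx * ln (real t) \<le> C * ln (real t)" "(1 + real CARD('m) * 2) * ln (real t) \<le> C * ln (real t)"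
      using elim(5) by (auto intro!: mult_right_mono simp: C_def)
    moreover have "real CARD('n) * 2 * sqrt (ln (real t)) \<le> C * ln (real t)" "real CARD('m) * 2 * sqrt (ln (real t)) \<le> C * ln (real t)"
      using elim(5) s by (auto intro!: mult_mono simp: C_def)
    ultimately show ?case
      using elim(1-4) c_in_bound[OF elim(6)] unfolding distrib_right by linarith
  qed
  moreover have "filterlim (\<lambda>t. (4 * C + 1) * ln (real t)) at_top sequentially"
    by (rule filterlim_tendsto_pos_mult_at_top[OF tendsto_const]) (use C0 in \<open>simp, real_asymp\<close>)
  ultimately have "\<forall>\<^sub>F T in sequentially. \<forall>t\<in>{1..T}. norm (x t) + norm (u t) + norm (w t) + norm (v t) + norm (c_in t)
      \<le> (4 * C + 1) * ln (real T)"
    by (intro eventually_uniform_bound) (use C0 in \<open>auto intro!: mult_left_mono\<close>)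
  then have "\<forall>\<^sub>F T in sequentially. \<forall>t\<in>{1..T}. norm (x t) \<le> (4 * C + 1) * ln (real T) \<and> norm (u t) \<le> (4 * C + 1) * ln (real T)
     \<and> norm (w t) \<le> (4 * C + 1) * ln (real T) \<and> norm (v t) \<le> (4 * C + 1) * ln (real T) \<and> norm (c_in t) \<le> (4 * C + 1) * ln (real T)"
  proof eventually_elim
    case (elim T)
    show ?case
    proof (rule ballI)
      fix t assume "t \<in> {1..T}"
      then have "norm (x t) + norm (u t) + norm (w t) + norm (v t) + norm (c_in t) \<le> (4 * C + 1) * ln (real T)"
        using elim by blast
      then show "norm (x t) \<le> (4 * C + 1) * ln (real T) \<and> norm (u t) \<le> (4 * C + 1) * ln (real T)
     \<and> norm (w t) \<le> (4 * C + 1) * ln (real T) \<and> norm (v t) \<le> (4 * C + 1) * ln (real T) \<and> norm (c_in t) \<le> (4 * C + 1) * ln (real T)"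
        using norm_ge_zero[of "x t"] norm_ge_zero[of "u t"] norm_ge_zero[of "w t"] norm_ge_zero[of "v t"]
          norm_ge_zero[of "c_in t"] by linarith
    qed
  qed
  then show ?thesis using C0 by (intro exI[of _ "4 * C + 1"]) auto
qed

lemma path_linear_bound:
  assumes "0 \<le> K"
  shows "\<forall>\<^sub>F T in sequentially. \<forall>t\<in>{1..T}. K * (norm (x t) + norm (u t) + norm (w t) + norm (v t) + norm (c_in t)) \<le> real T"
proof -
  obtain C where C: "C > 0" "\<forall>\<^sub>F T in sequentially. \<forall>t\<in>{1..T}. norm (x t) \<le> C * ln (real T) \<and> norm (u t) \<le> C * ln (real T)
     \<and> norm (w t) \<le> C * ln (real T) \<and> norm (v t) \<le> C * ln (real T) \<and> norm (c_in t) \<le> C * ln (real T)"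
    using path_uniform_bound by blast
  have "(\<lambda>T. K * (5 * C) * (ln (real T) / real T)) \<longlonglongrightarrow> K * (5 * C) * 0"
    by (intro tendsto_mult tendsto_const) real_asymp
  then have "\<forall>\<^sub>F T in sequentially. K * (5 * C) * (ln (real T) / real T) < 1"
    by (rule order_tendstoD) simp
  with C(2) show ?thesis
    using eventually_ge_at_top[of 1]
  proof eventually_elim
    case (elim T)
    have le: "K * (5 * C * ln (real T)) \<le> real T"
      using elim(2,3) by (simp add: field_simps)
    show ?case
    proof
      fix t assume t: "t \<in> {1..T}"
      have "norm (x t) + norm (u t) + norm (w t) + norm (v t) + norm (c_in t) \<le> 5 * C * ln (real T)"
        using elim(1) t by fastforce
      then show "K * (norm (x t) + norm (u t) + norm (w t) + norm (v t) + norm (c_in t)) \<le> real T"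
        using mult_left_mono[OF _ assms] le order.trans by blast
    qed
  qed
qed

end

subsection \<open>Excitation of the regressors\<close>

lemma eventually_le_of_ratio:
  fixes f g :: "nat \<Rightarrow> real"
  assumes lim: "(\<lambda>T. f T / g T) \<longlonglongrightarrow> 0" and g: "\<forall>\<^sub>F T in sequentially. 0 < g T" and c: "0 < c"
  shows "\<forall>\<^sub>F T in sequentially. K * f T \<le> c * g T"
proof -
  have "(\<lambda>T. K * (f T / g T)) \<longlonglongrightarrow> K * 0" by (intro tendsto_mult tendsto_const lim)
  then have "\<forall>\<^sub>F T in sequentially. K * (f T / g T) < c"
    by (rule order_tendstoD) (use c in simp)
  with g show ?thesis
    by eventually_elim (simp add: field_simps)
qed

lemma norm_sq_sum: "(norm (b :: real^'k))\<^sup>2 = (\<Sum>j\<in>UNIV. (b $ j)\<^sup>2)"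
  unfolding power2_norm_eq_inner inner_vec_def by (simp add: power2_eq_square)

text \<open>Apply the self-normalized bound to \<open>- (b $ j) *\<^sub>R \<theta>\<close> for each
  noise coordinate and sum. Twice the cross term may then consume the energy of the regressor and a
  logarithm, but nothing of the noise energy, which is what excites the direction.\<close>

lemma cross_term_lower:
  fixes p :: "nat \<Rightarrow> real^'d" and h :: "nat \<Rightarrow> real^'k"
  assumes L: "\<And>j \<theta>. norm \<theta> \<le> 1 \<Longrightarrow> (\<Sum>t = 1..T. (\<theta> \<bullet> p t) * (h t $ j) - (\<theta> \<bullet> p t)\<^sup>2 / 2) \<le> L"
    and \<theta>: "norm \<theta> \<le> 1" and b: "norm b \<le> 1"
  shows "0 \<le> (\<Sum>t = 1..T. (\<theta> \<bullet> p t)\<^sup>2) + 2 * (\<Sum>t = 1..T. (\<theta> \<bullet> p t) * (b \<bullet> h t)) + 2 * real CARD('k) * L"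
proof -
  define S where "S j = (\<Sum>t = 1..T. (\<theta> \<bullet> p t) * (h t $ j))" for j
  define V where "V = (\<Sum>t = 1..T. (\<theta> \<bullet> p t)\<^sup>2)"
  have V0: "0 \<le> V" unfolding V_def by (intro sum_nonneg) auto
  have one: "- (b $ j * S j) - (b $ j)\<^sup>2 * (V / 2) \<le> L" for j
  proof -
    have "norm ((- (b $ j)) *\<^sub>R \<theta>) \<le> 1 * 1"
      unfolding norm_scaleR using component_le_norm_cart[of b j] b \<theta> by (intro mult_mono) auto
    then have "(\<Sum>t = 1..T. (((- (b $ j)) *\<^sub>R \<theta>) \<bullet> p t) * (h t $ j) - (((- (b $ j)) *\<^sub>R \<theta>) \<bullet> p t)\<^sup>2 / 2) \<le> L"
      by (intro L) simp
    moreover have "(\<Sum>t = 1..T. (((- (b $ j)) *\<^sub>R \<theta>) \<bullet> p t) * (h t $ j) - (((- (b $ j)) *\<^sub>R \<theta>) \<bullet> p t)\<^sup>2 / 2)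
        = - (b $ j * S j) - (b $ j)\<^sup>2 * (V / 2)"
      by (simp add: S_def V_def sum_subtractf sum_distrib_left sum_negf sum_divide_distrib power_mult_distrib mult.assoc)
    ultimately show ?thesis by simp
  qed
  have "(\<Sum>j\<in>(UNIV :: 'k set). - (b $ j * S j) - (b $ j)\<^sup>2 * (V / 2)) \<le> (\<Sum>j\<in>(UNIV :: 'k set). L)"
    by (intro sum_mono one)
  moreover have "(\<Sum>j\<in>(UNIV :: 'k set). - (b $ j * S j) - (b $ j)\<^sup>2 * (V / 2))
      = - (\<Sum>j\<in>UNIV. b $ j * S j) - (norm b)\<^sup>2 * (V / 2)"
    by (simp add: sum_subtractf sum_negf norm_sq_sum sum_distrib_right)
  moreover have "(\<Sum>j\<in>UNIV. b $ j * S j) = (\<Sum>t = 1..T. (\<theta> \<bullet> p t) * (b \<bullet> h t))"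
  proof -
    have "(\<Sum>j\<in>UNIV. b $ j * S j) = (\<Sum>j\<in>UNIV. \<Sum>t = 1..T. b $ j * ((\<theta> \<bullet> p t) * (h t $ j)))"
      by (simp add: S_def sum_distrib_left)
    also have "\<dots> = (\<Sum>t = 1..T. \<Sum>j\<in>UNIV. b $ j * ((\<theta> \<bullet> p t) * (h t $ j)))"
      by (rule sum.swap)
    also have "\<dots> = (\<Sum>t = 1..T. (\<theta> \<bullet> p t) * (b \<bullet> h t))"
      by (simp add: inner_vec_def sum_distrib_left mult_ac)
    finally show ?thesis .
  qed
  moreover have "(norm b)\<^sup>2 * (V / 2) \<le> 1 * (V / 2)"
    using b V0 by (intro mult_right_mono) (auto simp: abs_square_le_1)
  ultimately show ?thesis by (simp add: V_def)
qed

lemma weighted_square_expand: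
  fixes h :: "nat \<Rightarrow> real^'k" and M :: "'k \<Rightarrow> 'k \<Rightarrow> real"
  shows "(\<Sum>i\<in>UNIV. \<Sum>j\<in>UNIV. M i j * (\<Sum>t = 1..T. \<sigma> t * (h t $ i * h t $ j - (if i = j then 1 else 0))))
    = (\<Sum>t = 1..T. \<sigma> t * ((\<Sum>i\<in>UNIV. \<Sum>j\<in>UNIV. M i j * (h t $ i * h t $ j)) - (\<Sum>i\<in>UNIV. M i i)))"
proof -
  have "(\<Sum>i\<in>UNIV. \<Sum>j\<in>UNIV. M i j * (\<Sum>t = 1..T. \<sigma> t * (h t $ i * h t $ j - (if i = j then 1 else 0))))
      = (\<Sum>i\<in>UNIV. \<Sum>j\<in>UNIV. \<Sum>t = 1..T. M i j * (\<sigma> t * (h t $ i * h t $ j - (if i = j then 1 else 0))))"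
    by (simp only: sum_distrib_left)
  also have "\<dots> = (\<Sum>i\<in>UNIV. \<Sum>t = 1..T. \<Sum>j\<in>UNIV. M i j * (\<sigma> t * (h t $ i * h t $ j - (if i = j then 1 else 0))))"
    by (intro sum.cong refl sum.swap)
  also have "\<dots> = (\<Sum>t = 1..T. \<Sum>i\<in>UNIV. \<Sum>j\<in>UNIV. M i j * (\<sigma> t * (h t $ i * h t $ j - (if i = j then 1 else 0))))"
    by (rule sum.swap)
  also have "\<dots> = (\<Sum>t = 1..T. \<sigma> t * ((\<Sum>i\<in>UNIV. \<Sum>j\<in>UNIV. M i j * (h t $ i * h t $ j)) - (\<Sum>i\<in>UNIV. M i i)))"
  proof (intro sum.cong refl)
    fix t
    have eq: "M i j * (\<sigma> t * (h t $ i * h t $ j - (if i = j then 1 else 0)))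
        = \<sigma> t * (M i j * (h t $ i * h t $ j)) - (if i = j then \<sigma> t * M i j else 0)" for i j
      by (simp add: algebra_simps)
    have "(\<Sum>i\<in>UNIV. \<Sum>j\<in>UNIV. M i j * (\<sigma> t * (h t $ i * h t $ j - (if i = j then 1 else 0))))
        = (\<Sum>i\<in>UNIV. \<Sum>j\<in>UNIV. \<sigma> t * (M i j * (h t $ i * h t $ j)))
          - (\<Sum>i\<in>UNIV. \<Sum>j\<in>UNIV. if i = j then \<sigma> t * M i j else 0)"
      by (simp only: eq sum_subtractf)
    also have "(\<Sum>i\<in>UNIV. \<Sum>j\<in>UNIV. if i = j then \<sigma> t * M i j else 0) = (\<Sum>i\<in>UNIV. \<sigma> t * M i i)"
      by simp
    finally show "(\<Sum>i\<in>UNIV. \<Sum>j\<in>UNIV. M i j * (\<sigma> t * (h t $ i * h t $ j - (if i = j then 1 else 0))))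
        = \<sigma> t * ((\<Sum>i\<in>UNIV. \<Sum>j\<in>UNIV. M i j * (h t $ i * h t $ j)) - (\<Sum>i\<in>UNIV. M i i))"
      by (simp only: right_diff_distrib sum_distrib_left)
  qed
  finally show ?thesis .
qed

lemma weighted_square_bound:
  fixes h :: "nat \<Rightarrow> real^'k" and M :: "'k \<Rightarrow> 'k \<Rightarrow> real"
  assumes D: "\<And>i j. \<bar>\<Sum>t = 1..T. \<sigma> t * (h t $ i * h t $ j - (if i = j then 1 else 0))\<bar> \<le> D"
  shows "\<bar>\<Sum>t = 1..T. \<sigma> t * ((\<Sum>i\<in>UNIV. \<Sum>j\<in>UNIV. M i j * (h t $ i * h t $ j)) - (\<Sum>i\<in>UNIV. M i i))\<bar>
    \<le> (\<Sum>i\<in>UNIV. \<Sum>j\<in>UNIV. \<bar>M i j\<bar>) * D"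
  unfolding weighted_square_expand[symmetric] sum_distrib_right
proof (rule order.trans[OF sum_abs], rule sum_mono, rule order.trans[OF sum_abs], rule sum_mono)
  show "\<bar>M i j * (\<Sum>t = 1..T. \<sigma> t * (h t $ i * h t $ j - (if i = j then 1 else 0)))\<bar> \<le> \<bar>M i j\<bar> * D" for i j
    unfolding abs_mult by (intro mult_left_mono D) simp
qed

lemma weighted_square_lower:
  fixes h :: "nat \<Rightarrow> real^'k"
  assumes D: "\<And>i j. \<bar>\<Sum>t = 1..T. \<sigma> t * (h t $ i * h t $ j - (if i = j then 1 else 0))\<bar> \<le> D"
    and b: "norm b \<le> 1" and D0: "0 \<le> D"
  shows "(norm b)\<^sup>2 * (\<Sum>t = 1..T. \<sigma> t) - (real CARD('k))\<^sup>2 * D \<le> (\<Sum>t = 1..T. \<sigma> t * (b \<bullet> h t)\<^sup>2)"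
proof -
  have bh: "(b \<bullet> h t)\<^sup>2 = (\<Sum>i\<in>UNIV. \<Sum>j\<in>UNIV. (b $ i * b $ j) * (h t $ i * h t $ j))" for t
    by (simp add: inner_vec_def power2_eq_square sum_product mult_ac)
  have nb: "(norm b)\<^sup>2 = (\<Sum>i\<in>UNIV. b $ i * b $ i)"
    unfolding norm_sq_sum by (simp only: power2_eq_square)
  have "\<bar>\<Sum>t = 1..T. \<sigma> t * ((b \<bullet> h t)\<^sup>2 - (norm b)\<^sup>2)\<bar> \<le> (\<Sum>i\<in>UNIV. \<Sum>j\<in>UNIV. \<bar>b $ i * b $ j\<bar>) * D"
    unfolding bh nb by (rule weighted_square_bound[OF D])
  also have "\<dots> \<le> (\<Sum>i\<in>(UNIV :: 'k set). \<Sum>j\<in>(UNIV :: 'k set). 1) * D"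
  proof (intro mult_right_mono sum_mono D0)
    fix i j
    have "\<bar>b $ i * b $ j\<bar> \<le> 1 * 1"
      unfolding abs_mult using component_le_norm_cart[of b i] component_le_norm_cart[of b j] b
      by (intro mult_mono) auto
    then show "\<bar>b $ i * b $ j\<bar> \<le> 1" by simp
  qed
  also have "\<dots> = (real CARD('k))\<^sup>2 * D" by (simp add: power2_eq_square)
  finally have "\<bar>\<Sum>t = 1..T. \<sigma> t * ((b \<bullet> h t)\<^sup>2 - (norm b)\<^sup>2)\<bar> \<le> (real CARD('k))\<^sup>2 * D" .
  moreover have "(\<Sum>t = 1..T. \<sigma> t * ((b \<bullet> h t)\<^sup>2 - (norm b)\<^sup>2))
      = (\<Sum>t = 1..T. \<sigma> t * (b \<bullet> h t)\<^sup>2) - (norm b)\<^sup>2 * (\<Sum>t = 1..T. \<sigma> t)"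
    by (simp add: right_diff_distrib sum_subtractf sum_distrib_right mult.commute[of "(norm b)\<^sup>2"])
  ultimately show ?thesis by linarith
qed

lemma sum_powr_lower: "sqrt (real T) \<le> (\<Sum>t = 1..T. real t powr (- 1 / 2))"
proof (cases "T = 0")
  case False
  have "sqrt (real T) = real T * real T powr (- 1 / 2)"
    using False by (simp add: powr_half_sqrt[symmetric] powr_mult_base)
  also have "\<dots> = (\<Sum>t = 1..T. real T powr (- 1 / 2))" by simp
  also have "\<dots> \<le> (\<Sum>t = 1..T. real t powr (- 1 / 2))"
    by (intro sum_mono powr_mono2') auto
  finally show ?thesis .
qed simp

text \<open>\<open>G1\<close> will control the estimation error, \<open>G2\<close> and
  \<open>G3\<close> the cross terms with probing signal and state noise. \<open>V1\<close> and
  \<open>V2\<close> are laws of large numbers for their energies; the weight in \<open>V2\<close> is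
  the variance of the probing input, and its fluctuation is far below the mean energy, of order
  \<open>sqrt T\<close>. In \<open>G2\<close> the amplitude is attached to the regressor, so that
  the innovation stays standard.\<close>

locale lqr_good_path = lqr_path Q R A B w x v u xi
  for Q :: "real^'n^'n" and R :: "real^'m^'m" and A :: "real^'n^'n" and B :: "real^'m^'n"
    and w x :: "nat \<Rightarrow> real^'n" and v u :: "nat \<Rightarrow> real^'m" and xi :: "nat \<Rightarrow> nat" +
  assumes G1: "\<And>j. \<exists>C. \<forall>\<^sub>F T in sequentially. \<forall>\<theta>. norm \<theta> \<le> 1 \<longrightarrow>
      (\<Sum>t = 1..T. (\<theta> \<bullet> stack (x t) (u t)) * (w t $ j) - (\<theta> \<bullet> stack (x t) (u t))\<^sup>2 / 2) \<le> C * ln (real T)"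
    and G2: "\<And>j. \<exists>C. \<forall>\<^sub>F T in sequentially. \<forall>\<theta>. norm \<theta> \<le> 1 \<longrightarrow>
      (\<Sum>t = 1..T. (\<theta> \<bullet> ((real t powr (- 1 / 4)) *\<^sub>R stack (x t) (c_in t))) * (v t $ j)
        - (\<theta> \<bullet> ((real t powr (- 1 / 4)) *\<^sub>R stack (x t) (c_in t)))\<^sup>2 / 2) \<le> C * ln (real T)"
    and G3: "\<And>j. \<exists>C. \<forall>\<^sub>F T in sequentially. \<forall>\<theta>. norm \<theta> \<le> 1 \<longrightarrow>
      (\<Sum>t = 1..T. (\<theta> \<bullet> (A *v x t + B *v u t)) * (w t $ j) - (\<theta> \<bullet> (A *v x t + B *v u t))\<^sup>2 / 2) \<le> C * ln (real T)"
    and V1: "\<exists>C\<ge>0. \<forall>\<^sub>F T in sequentially. \<forall>i j.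
      \<bar>\<Sum>t = 1..T. 1 * (w t $ i * w t $ j - (if i = j then 1 else 0))\<bar> \<le> C * ((1 + sqrt (real T)) * ln (real T))"
    and V2: "\<exists>C\<ge>0. \<forall>\<^sub>F T in sequentially. \<forall>i j.
      \<bar>\<Sum>t = 1..T. real t powr (- 1 / 2) * (v t $ i * v t $ j - (if i = j then 1 else 0))\<bar>
        \<le> C * ((1 + 2 * real T powr (1 / 4)) * ln (real T))"
begin

lemma ln_eventually_nonneg: "\<forall>\<^sub>F T in sequentially. 0 \<le> ln (real T)"
  by real_asymp

text \<open>\<open>x (Suc t)\<close> is a vector independent of the current noise plus that noise.
  Expanding the square, the cross term is paid by the first energy, and the noise energy
  \<open>T\<close> survives up to order \<open>sqrt T * ln T\<close>. Half of \<open>T\<close> is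
  given up for these losses, and the shift from \<open>T\<close> to \<open>Suc T\<close> reduces the
  constant to \<open>1/4\<close>.\<close>

lemma x_gram_lower: "\<forall>\<^sub>F T in sequentially. \<forall>a. norm a = 1 \<longrightarrow> real T / 4 \<le> (\<Sum>t = 1..T. (a \<bullet> x t)\<^sup>2)"
proof -
  have "\<exists>C>0. \<forall>\<^sub>F T in sequentially. \<forall>j \<theta>. norm \<theta> \<le> 1 \<longrightarrow>
      (\<Sum>t = 1..T. (\<theta> \<bullet> (A *v x t + B *v u t)) * (w t $ j) - (\<theta> \<bullet> (A *v x t + B *v u t))\<^sup>2 / 2) \<le> C * ln (real T)"
    by (rule uniform_constant[OF ln_eventually_nonneg]) (rule G3)
  then obtain C3 where C3: "C3 > 0" "\<forall>\<^sub>F T in sequentially. \<forall>j \<theta>. norm \<theta> \<le> 1 \<longrightarrow>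
      (\<Sum>t = 1..T. (\<theta> \<bullet> (A *v x t + B *v u t)) * (w t $ j) - (\<theta> \<bullet> (A *v x t + B *v u t))\<^sup>2 / 2) \<le> C3 * ln (real T)"
    by blast
  obtain C1 where C1: "C1 \<ge> 0" "\<forall>\<^sub>F T in sequentially. \<forall>i j.
      \<bar>\<Sum>t = 1..T. 1 * (w t $ i * w t $ j - (if i = j then 1 else 0))\<bar> \<le> C1 * ((1 + sqrt (real T)) * ln (real T))"
    using V1 by blast
  define n where "n = real CARD('n)"
  have "\<forall>\<^sub>F T in sequentially. (2 * n * C3 + n\<^sup>2 * C1) * ((1 + sqrt (real T)) * ln (real T)) \<le> 1/2 * real T"
    by (rule eventually_le_of_ratio) (real_asymp, real_asymp, simp)
  with C3(2) C1(2) ln_eventually_nonneg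
  have "\<forall>\<^sub>F T in sequentially. \<forall>a. norm a = 1 \<longrightarrow> real (Suc T) / 4 \<le> (\<Sum>t = 1..Suc T. (a \<bullet> x t)\<^sup>2)"
    using eventually_ge_at_top[of 1]
  proof eventually_elim
    case (elim T)
    show ?case
    proof (intro allI impI)
      fix a :: "real^'n" assume a: "norm a = 1"
      let ?y = "\<lambda>t. A *v x t + B *v u t"
      have cross: "0 \<le> (\<Sum>t = 1..T. (a \<bullet> ?y t)\<^sup>2) + 2 * (\<Sum>t = 1..T. (a \<bullet> ?y t) * (a \<bullet> w t)) + 2 * n * (C3 * ln (real T))"
        unfolding n_def by (rule cross_term_lower) (use elim(1) a in auto)
      have quad: "(norm a)\<^sup>2 * (\<Sum>t = 1..T. 1) - n\<^sup>2 * (C1 * ((1 + sqrt (real T)) * ln (real T))) \<le> (\<Sum>t = 1..T. 1 * (a \<bullet> w t)\<^sup>2)"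
        unfolding n_def by (rule weighted_square_lower) (use elim(2,3) C1(1) a in auto)
      have "(\<Sum>t = 1..T. (a \<bullet> x (Suc t))\<^sup>2) = (\<Sum>t = 1..T. (a \<bullet> ?y t)\<^sup>2 + 2 * ((a \<bullet> ?y t) * (a \<bullet> w t)) + (a \<bullet> w t)\<^sup>2)"
        by (intro sum.cong refl) (simp add: x_Suc inner_add_right power2_eq_square algebra_simps)
      also have "\<dots> = (\<Sum>t = 1..T. (a \<bullet> ?y t)\<^sup>2) + 2 * (\<Sum>t = 1..T. (a \<bullet> ?y t) * (a \<bullet> w t)) + (\<Sum>t = 1..T. (a \<bullet> w t)\<^sup>2)"
        by (simp add: sum.distrib sum_distrib_left)
      finally have sum: "(\<Sum>t = 1..T. (a \<bullet> x (Suc t))\<^sup>2) \<ge> real T - 2 * n * (C3 * ln (real T)) - n\<^sup>2 * (C1 * ((1 + sqrt (real T)) * ln (real T)))"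
        using cross quad a by simp
      have "2 * n * (C3 * ln (real T)) \<le> 2 * n * C3 * ((1 + sqrt (real T)) * ln (real T))"
      proof -
        have "1 * ln (real T) \<le> (1 + sqrt (real T)) * ln (real T)"
          using elim(3) by (intro mult_right_mono) auto
        then have "2 * n * C3 * ln (real T) \<le> 2 * n * C3 * ((1 + sqrt (real T)) * ln (real T))"
          using C3(1) by (intro mult_left_mono) (auto simp: n_def)
        then show ?thesis by (simp add: mult.assoc)
      qed
      then have "real T / 2 \<le> (\<Sum>t = 1..T. (a \<bullet> x (Suc t))\<^sup>2)"
      proof -
        define L where "L = (1 + sqrt (real T)) * ln (real T)"
        have "(2 * n * C3 + n\<^sup>2 * C1) * L = 2 * n * C3 * L + n\<^sup>2 * (C1 * L)"
          by (simp add: algebra_simps)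
        moreover assume "2 * n * (C3 * ln (real T)) \<le> 2 * n * C3 * ((1 + sqrt (real T)) * ln (real T))"
        ultimately show ?thesis
          using sum elim(4) unfolding L_def[symmetric] by linarith
      qed
      also have "\<dots> = (\<Sum>t = 2..Suc T. (a \<bullet> x t)\<^sup>2)"
        using sum.shift_bounds_cl_Suc_ivl[of "\<lambda>t. (a \<bullet> x t)\<^sup>2" 1 T] by (simp add: numeral_2_eq_2)
      also have "\<dots> \<le> (\<Sum>t = 1..Suc T. (a \<bullet> x t)\<^sup>2)"
        by (intro sum_mono2) auto
      finally show "real (Suc T) / 4 \<le> (\<Sum>t = 1..Suc T. (a \<bullet> x t)\<^sup>2)"
        using elim(5) by simp
    qed
  qed
  then show ?thesis
    by (subst eventually_sequentially_Suc[symmetric])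
qed

text \<open>The same expansion with \<open>v\<close> as innovation: the regressor is
  \<open>stack (x t) (c_in t)\<close> plus a probing part that only \<open>b\<close> sees. The
  scaled regressors in the cross term have at most the energy of the unscaled ones, so the
  absorption still works.\<close>

lemma probing_gram_lower:
  "\<exists>C>0. \<forall>\<^sub>F T in sequentially. \<forall>a b. norm (stack a b) = 1 \<longrightarrow>
    (norm b)\<^sup>2 * sqrt (real T) - C * ((1 + 2 * real T powr (1 / 4)) * ln (real T))
      \<le> (\<Sum>t = 1..T. (stack a b \<bullet> stack (x t) (u t))\<^sup>2)"
proof -
  let ?s = "\<lambda>t. real t powr (- 1 / 4)"
  let ?p = "\<lambda>t. ?s t *\<^sub>R stack (x t) (c_in t)"
  have "\<exists>C>0. \<forall>\<^sub>F T in sequentially. \<forall>j \<theta>. norm \<theta> \<le> 1 \<longrightarrow>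
      (\<Sum>t = 1..T. (\<theta> \<bullet> ?p t) * (v t $ j) - (\<theta> \<bullet> ?p t)\<^sup>2 / 2) \<le> C * ln (real T)"
    by (rule uniform_constant[OF ln_eventually_nonneg]) (rule G2)
  then obtain C3 where C3: "C3 > 0" "\<forall>\<^sub>F T in sequentially. \<forall>j \<theta>. norm \<theta> \<le> 1 \<longrightarrow>
      (\<Sum>t = 1..T. (\<theta> \<bullet> ?p t) * (v t $ j) - (\<theta> \<bullet> ?p t)\<^sup>2 / 2) \<le> C3 * ln (real T)"
    by blast
  obtain C1 where C1: "C1 \<ge> 0" "\<forall>\<^sub>F T in sequentially. \<forall>i j.
      \<bar>\<Sum>t = 1..T. real t powr (- 1 / 2) * (v t $ i * v t $ j - (if i = j then 1 else 0))\<bar>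
        \<le> C1 * ((1 + 2 * real T powr (1 / 4)) * ln (real T))"
    using V2 by blast
  define m where "m = real CARD('m)"
  define C where "C = 2 * m * C3 + m\<^sup>2 * C1"
  have C0: "C > 0" unfolding C_def using C3(1) C1(1) by (intro add_pos_nonneg) (auto simp: m_def)
  have "\<forall>\<^sub>F T in sequentially. \<forall>a b. norm (stack a b) = 1 \<longrightarrow>
    (norm b)\<^sup>2 * sqrt (real T) - C * ((1 + 2 * real T powr (1 / 4)) * ln (real T))
      \<le> (\<Sum>t = 1..T. (stack a b \<bullet> stack (x t) (u t))\<^sup>2)"
    using C3(2) C1(2) ln_eventually_nonneg
  proof eventually_elim
    case (elim T)
    show ?case
    proof (intro allI impI)
      fix a :: "real^'n" and b :: "real^'m" assume ab: "norm (stack a b) = 1"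
      then have "(norm a)\<^sup>2 + (norm b)\<^sup>2 = 1" using norm_stack[of a b] by simp
      then have "(norm b)\<^sup>2 \<le> 1" using zero_le_power2[of "norm a"] by linarith
      then have b: "norm b \<le> 1" by (simp add: abs_square_le_1)
      define \<theta> where "\<theta> = stack a b"
      define q where "q t = \<theta> \<bullet> stack (x t) (c_in t)" for t
      define L where "L = (1 + 2 * real T powr (1 / 4)) * ln (real T)"
      have p: "\<theta> \<bullet> ?p t = ?s t * q t" for t by (simp add: q_def)
      have cross: "0 \<le> (\<Sum>t = 1..T. (\<theta> \<bullet> ?p t)\<^sup>2) + 2 * (\<Sum>t = 1..T. (\<theta> \<bullet> ?p t) * (b \<bullet> v t)) + 2 * m * (C3 * ln (real T))"
        unfolding m_def by (rule cross_term_lower) (use elim(1) ab b in \<open>auto simp: \<theta>_def\<close>)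
      have L0: "0 \<le> L" using elim(3) by (simp add: L_def)
      have quad: "(norm b)\<^sup>2 * (\<Sum>t = 1..T. real t powr (- 1 / 2)) - m\<^sup>2 * (C1 * L) \<le> (\<Sum>t = 1..T. real t powr (- 1 / 2) * (b \<bullet> v t)\<^sup>2)"
        unfolding m_def
      proof (rule weighted_square_lower)
        show "\<bar>\<Sum>t = 1..T. real t powr (- 1 / 2) * (v t $ i * v t $ j - (if i = j then 1 else 0))\<bar> \<le> C1 * L" for i j
          using elim(2) unfolding L_def by blast
      qed (use b L0 C1(1) in auto)
      have sq: "(\<theta> \<bullet> stack (x t) (u t))\<^sup>2 = (q t)\<^sup>2 + 2 * ((\<theta> \<bullet> ?p t) * (b \<bullet> v t)) + real t powr (- 1 / 2) * (b \<bullet> v t)\<^sup>2"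
        if "t \<in> {1..T}" for t
      proof -
        have t: "t \<ge> 1" using that by simp
        have "\<theta> \<bullet> stack (x t) (u t) = q t + ?s t * (b \<bullet> v t)"
          by (simp add: q_def \<theta>_def inner_stack u_eq[OF t] inner_add_right)
        moreover have "(?s t)\<^sup>2 = real t powr (- 1 / 2)"
          using t by (simp add: power2_eq_square powr_add[symmetric])
        ultimately show ?thesis
          unfolding p by (simp add: power2_sum power_mult_distrib mult_ac)
      qed
      have "(\<Sum>t = 1..T. (\<theta> \<bullet> stack (x t) (u t))\<^sup>2)
          = (\<Sum>t = 1..T. (q t)\<^sup>2 + 2 * ((\<theta> \<bullet> ?p t) * (b \<bullet> v t)) + real t powr (- 1 / 2) * (b \<bullet> v t)\<^sup>2)"
        by (intro sum.cong refl sq)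
      also have "\<dots> = (\<Sum>t = 1..T. (q t)\<^sup>2) + 2 * (\<Sum>t = 1..T. (\<theta> \<bullet> ?p t) * (b \<bullet> v t))
          + (\<Sum>t = 1..T. real t powr (- 1 / 2) * (b \<bullet> v t)\<^sup>2)"
        by (simp only: sum.distrib sum_distrib_left)
      finally have eq: "(\<Sum>t = 1..T. (\<theta> \<bullet> stack (x t) (u t))\<^sup>2) = \<dots>" .
      have "(\<Sum>t = 1..T. (\<theta> \<bullet> ?p t)\<^sup>2) \<le> (\<Sum>t = 1..T. (q t)\<^sup>2)"
      proof (rule sum_mono)
        fix t assume "t \<in> {1..T}"
        then have s: "?s t \<le> 1" by (intro powr_neg_le_1) auto
        have "(?s t * q t)\<^sup>2 = (?s t)\<^sup>2 * (q t)\<^sup>2" by (rule power_mult_distrib)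
        also have "\<dots> \<le> 1 * (q t)\<^sup>2"
          using s by (intro mult_right_mono) (auto simp: abs_square_le_1)
        finally show "(\<theta> \<bullet> ?p t)\<^sup>2 \<le> (q t)\<^sup>2" unfolding p by simp
      qed
      moreover have "(norm b)\<^sup>2 * sqrt (real T) \<le> (norm b)\<^sup>2 * (\<Sum>t = 1..T. real t powr (- 1 / 2))"
        by (intro mult_left_mono sum_powr_lower) simp
      moreover have "2 * m * (C3 * ln (real T)) \<le> 2 * m * C3 * L"
      proof -
        have "1 * ln (real T) \<le> L" unfolding L_def using elim(3) by (intro mult_right_mono) auto
        then have "2 * m * C3 * ln (real T) \<le> 2 * m * C3 * L"
          using C3(1) by (intro mult_left_mono) (auto simp: m_def)
        then show ?thesis by (simp add: mult.assoc)
      qed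
      moreover have "C * L = 2 * m * C3 * L + m\<^sup>2 * (C1 * L)"
        by (simp add: C_def algebra_simps)
      ultimately show "(norm b)\<^sup>2 * sqrt (real T) - C * ((1 + 2 * real T powr (1 / 4)) * ln (real T))
          \<le> (\<Sum>t = 1..T. (stack a b \<bullet> stack (x t) (u t))\<^sup>2)"
        using cross quad unfolding \<theta>_def[symmetric] L_def[symmetric] eq by linarith
    qed
  qed
  then show ?thesis using C0 by blast
qed

text \<open>
  Directions with a non-negligible input part are excited by the probing signal, which contributes
  order \<open>sqrt T\<close>; in the remaining directions the state noise dominates the inputs, which are only
  logarithmically large.
\<close>

lemma gram_lower:
  "\<exists>c>0. \<forall>\<^sub>F T in sequentially. \<forall>\<theta>. norm \<theta> = 1 \<longrightarrow>
    c * (sqrt (real T) / (ln (real T))\<^sup>2) \<le> (\<Sum>t = 1..T. (\<theta> \<bullet> stack (x t) (u t))\<^sup>2)"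
proof -
  obtain C where C: "C > 0" "\<forall>\<^sub>F T in sequentially. \<forall>a b. norm (stack a b) = 1 \<longrightarrow>
    (norm b)\<^sup>2 * sqrt (real T) - C * ((1 + 2 * real T powr (1 / 4)) * ln (real T))
      \<le> (\<Sum>t = 1..T. (stack a b \<bullet> stack (x t) (u t))\<^sup>2)"
    using probing_gram_lower by blast
  obtain D where D: "D > 0" "\<forall>\<^sub>F T in sequentially. \<forall>t\<in>{1..T}. norm (x t) \<le> D * ln (real T) \<and> norm (u t) \<le> D * ln (real T)
     \<and> norm (w t) \<le> D * ln (real T) \<and> norm (v t) \<le> D * ln (real T) \<and> norm (c_in t) \<le> D * ln (real T)"
    using path_uniform_bound by blast
  \<comment> \<open>Splits the directions at \<open>(norm b)^2 = \<eta> / (ln T)^2\<close>. Below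
    the threshold, inputs of size \<open>D * ln T\<close> contribute at most
    \<open>\<eta> * D^2 \<le> 1/32\<close> per step, a loss of \<open>T / 32\<close> against the
    \<open>T / 16\<close> kept from the state part.\<close>
  define \<eta> where "\<eta> = min (1/2) (1 / (32 * D\<^sup>2))"
  have \<eta>: "0 < \<eta>" "\<eta> \<le> 1/2" "\<eta> * D\<^sup>2 \<le> 1/32"
  proof -
    show "0 < \<eta>" "\<eta> \<le> 1/2" using D(1) by (auto simp: \<eta>_def)
    have "\<eta> * D\<^sup>2 \<le> 1 / (32 * D\<^sup>2) * D\<^sup>2" by (intro mult_right_mono) (auto simp: \<eta>_def)
    then show "\<eta> * D\<^sup>2 \<le> 1/32" using D(1) by simp
  qed
  have ev1: "\<forall>\<^sub>F T in sequentially. C * ((1 + 2 * real T powr (1 / 4)) * ln (real T)) \<le> (\<eta> / 2) * (sqrt (real T) / (ln (real T))\<^sup>2)"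
    by (rule eventually_le_of_ratio) (real_asymp, real_asymp, use \<eta> in simp)
  have ev2: "\<forall>\<^sub>F T in sequentially. (\<eta> / 2) * (sqrt (real T) / (ln (real T))\<^sup>2) \<le> (1/32) * real T"
    by (rule eventually_le_of_ratio) (real_asymp, real_asymp, simp)
  have "\<forall>\<^sub>F T in sequentially. 1 \<le> ln (real T)" by real_asymp
  with C(2) D(2) ev1 ev2 x_gram_lower
  have "\<forall>\<^sub>F T in sequentially. \<forall>\<theta>. norm \<theta> = 1 \<longrightarrow>
    (\<eta> / 2) * (sqrt (real T) / (ln (real T))\<^sup>2) \<le> (\<Sum>t = 1..T. (\<theta> \<bullet> stack (x t) (u t))\<^sup>2)"
  proof eventually_elim
    case (elim T)
    show ?case
    proof (intro allI impI)
      fix \<theta> :: "real^('n + 'm)" assume \<theta>: "norm \<theta> = 1"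
      obtain a :: "real^'n" and b :: "real^'m" where ab: "\<theta> = stack a b" using stack_surj by blast
      have n1: "(norm a)\<^sup>2 + (norm b)\<^sup>2 = 1" using \<theta> norm_stack[of a b] by (simp add: ab)
      show "(\<eta> / 2) * (sqrt (real T) / (ln (real T))\<^sup>2) \<le> (\<Sum>t = 1..T. (\<theta> \<bullet> stack (x t) (u t))\<^sup>2)"
      proof (cases "\<eta> / (ln (real T))\<^sup>2 \<le> (norm b)\<^sup>2")
        case True
        have "\<eta> / (ln (real T))\<^sup>2 * sqrt (real T) \<le> (norm b)\<^sup>2 * sqrt (real T)"
          by (intro mult_right_mono True) simp
        then have "\<eta> * (sqrt (real T) / (ln (real T))\<^sup>2) \<le> (norm b)\<^sup>2 * sqrt (real T)" by simp
        moreover have "(norm b)\<^sup>2 * sqrt (real T) - C * ((1 + 2 * real T powr (1 / 4)) * ln (real T))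
            \<le> (\<Sum>t = 1..T. (\<theta> \<bullet> stack (x t) (u t))\<^sup>2)"
          using elim(1) \<theta> unfolding ab by blast
        ultimately show ?thesis using elim(3) by linarith
      next
        case False
        define l where "l = (ln (real T))\<^sup>2"
        have l1: "1 \<le> l" unfolding l_def by (rule one_le_power[OF elim(6)])
        have bl: "(norm b)\<^sup>2 * l \<le> \<eta>" using False l1 unfolding l_def[symmetric] not_le by (simp add: less_divide_eq)
        have "(norm b)\<^sup>2 * 1 \<le> (norm b)\<^sup>2 * l" by (intro mult_left_mono l1) simp
        then have ahalf: "1/2 \<le> (norm a)\<^sup>2" using n1 bl \<eta>(2) by linarith
        have bu: "(b \<bullet> u t)\<^sup>2 \<le> 1/32" if "t \<in> {1..T}" for t
        proof -
          have "norm (u t) \<le> D * ln (real T)" using elim(2) that by blast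
          then have "(norm (u t))\<^sup>2 \<le> (D * ln (real T))\<^sup>2" by (intro power_mono) auto
          then have nu: "(norm (u t))\<^sup>2 \<le> D\<^sup>2 * l" by (simp add: l_def power_mult_distrib)
          have "(b \<bullet> u t)\<^sup>2 \<le> (norm b)\<^sup>2 * (norm (u t))\<^sup>2"
            using Cauchy_Schwarz_ineq2[of b "u t"] by (metis abs_ge_zero power2_abs power_mono power_mult_distrib)
          also have "\<dots> \<le> (norm b)\<^sup>2 * (D\<^sup>2 * l)" by (intro mult_left_mono nu) simp
          also have "\<dots> = ((norm b)\<^sup>2 * l) * D\<^sup>2" by simp
          also have "\<dots> \<le> \<eta> * D\<^sup>2" by (intro mult_right_mono bl) simp
          finally show ?thesis using \<eta>(3) by simp
        qed
        have half: "1/2 * (a \<bullet> x t)\<^sup>2 - 1/32 \<le> (\<theta> \<bullet> stack (x t) (u t))\<^sup>2" if "t \<in> {1..T}" for t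
        proof -
          \<comment> \<open>Half of this square is the difference of the two sides of the next
            inequality.\<close>
          have "0 \<le> ((a \<bullet> x t) + 2 * (b \<bullet> u t))\<^sup>2" by simp
          then have "1/2 * (a \<bullet> x t)\<^sup>2 - (b \<bullet> u t)\<^sup>2 \<le> ((a \<bullet> x t) + (b \<bullet> u t))\<^sup>2"
            by (simp add: power2_sum power_mult_distrib)
          then show ?thesis using bu[OF that] by (simp add: ab inner_stack)
        qed
        have a2: "(norm a)\<^sup>2 * (real T / 4) \<le> (\<Sum>t = 1..T. (a \<bullet> x t)\<^sup>2)"
        proof -
          have an: "a \<noteq> 0" using ahalf by auto
          let ?a = "inverse (norm a) *\<^sub>R a"
          have "norm ?a = 1" using an by simp
          then have "real T / 4 \<le> (\<Sum>t = 1..T. (?a \<bullet> x t)\<^sup>2)" using elim(5) by blast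
          also have "\<dots> = (inverse (norm a))\<^sup>2 * (\<Sum>t = 1..T. (a \<bullet> x t)\<^sup>2)"
            by (simp add: power_mult_distrib sum_distrib_left)
          finally have "(norm a)\<^sup>2 * (real T / 4) \<le> (norm a)\<^sup>2 * ((inverse (norm a))\<^sup>2 * (\<Sum>t = 1..T. (a \<bullet> x t)\<^sup>2))"
            by (intro mult_left_mono) auto
          also have "\<dots> = (\<Sum>t = 1..T. (a \<bullet> x t)\<^sup>2)"
            using an by (simp add: power_inverse mult.assoc[symmetric])
          finally show ?thesis by simp
        qed
        have "1/2 * (real T / 4) \<le> (norm a)\<^sup>2 * (real T / 4)" by (intro mult_right_mono ahalf) simp
        then have "real T / 8 \<le> (\<Sum>t = 1..T. (a \<bullet> x t)\<^sup>2)" using a2 by linarith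
        moreover have "(\<Sum>t = 1..T. 1/2 * (a \<bullet> x t)\<^sup>2 - 1/32) \<le> (\<Sum>t = 1..T. (\<theta> \<bullet> stack (x t) (u t))\<^sup>2)"
          by (intro sum_mono half)
        moreover have "(\<Sum>t = 1..T. 1/2 * (a \<bullet> x t)\<^sup>2 - 1/32) = 1/2 * (\<Sum>t = 1..T. (a \<bullet> x t)\<^sup>2) - real T / 32"
          by (simp add: sum_subtractf sum_distrib_left)
        ultimately show ?thesis using elim(4) by linarith
      qed
    qed
  qed
  then show ?thesis using \<eta>(1) by (intro exI[of _ "\<eta> / 2"]) auto
qed

end

subsection \<open>Convergence rate of the estimated gain\<close>

lemma outer_product_mult_vec: "outer_product a b *v y = (b \<bullet> y) *\<^sub>R a"
  by (simp add: vec_eq_iff outer_product_def matrix_vector_mult_def inner_vec_def sum_distrib_left mult_ac)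

lemma sum_matrix_mult_vec: "(\<Sum>t\<in>S. (M t :: real^'a^'b)) *v y = (\<Sum>t\<in>S. M t *v y)"
  by (induction S rule: infinite_finite_induct) (auto simp: matrix_vector_mult_add_rdistrib)

lemma matrix_mult_vec_sum: "(M :: real^'a^'b) *v (\<Sum>t\<in>S. y t) = (\<Sum>t\<in>S. M *v y t)"
  by (induction S rule: infinite_finite_induct) (auto simp: matrix_vector_right_distrib)

lemma matrix_mult_stack:
  fixes T :: "real^('a::finite + 'b::finite)^'c"
  shows "T *v stack y z = (\<chi> i j. T $ i $ Inl j) *v y + (\<chi> i j. T $ i $ Inr j) *v z"
  by (simp add: vec_eq_iff matrix_vector_mult_def stack_def UNIV_Plus_UNIV[symmetric] sum.Plus comp_def
      del: UNIV_Plus_UNIV)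

lemma qf_entries: "qf P y = (\<Sum>i\<in>UNIV. \<Sum>j\<in>UNIV. P $ i $ j * (y $ i * y $ j))"
  by (simp add: qf_def inner_vec_def matrix_vector_mult_def sum_distrib_left mult_ac)

lemma sum_inverse_sqrt_le: "(\<Sum>k = 1..T. 1 / sqrt (real k)) \<le> 2 * sqrt (real T)"
proof (induction T)
  case (Suc T)
  have "1 / sqrt (real (Suc T)) \<le> 2 * (sqrt (real (Suc T)) - sqrt (real T))"
  proof -
    have pos: "0 < sqrt (real (Suc T))" by simp
    have "2 * (sqrt (real T) * sqrt (real (Suc T))) \<le> real T + real (Suc T)"
      using sum_squares_bound[of "sqrt (real T)" "sqrt (real (Suc T))"] by simp
    then have "1 \<le> 2 * (sqrt (real (Suc T)) - sqrt (real T)) * sqrt (real (Suc T))"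
      by (simp add: left_diff_distrib algebra_simps)
    then show ?thesis using pos by (simp add: divide_le_eq)
  qed
  then show ?case using Suc by simp
qed simp

lemma sum_eventually_le:
  fixes f :: "nat \<Rightarrow> real"
  assumes ev: "\<forall>\<^sub>F k in sequentially. f k \<le> C * (ln (real k) ^ 5 / sqrt (real k))" and C: "0 \<le> C"
  shows "\<exists>C'. \<forall>\<^sub>F T in sequentially. (\<Sum>k = 1..T. f k) \<le> C' * (sqrt (real T) * ln (real T) ^ 5)"
proof -
  obtain N where N: "\<And>k. k \<ge> N \<Longrightarrow> f k \<le> C * (ln (real k) ^ 5 / sqrt (real k))"
    using ev by (auto simp: eventually_sequentially)
  define S where "S = (\<Sum>k<N. \<bar>f k\<bar>)"
  have "\<forall>\<^sub>F T in sequentially. 1 \<le> sqrt (real T) * ln (real T) ^ 5" by real_asymp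
  then have "\<forall>\<^sub>F T in sequentially. (\<Sum>k = 1..T. f k) \<le> (S + 2 * C) * (sqrt (real T) * ln (real T) ^ 5)"
    using eventually_ge_at_top[of 1]
  proof eventually_elim
    case (elim T)
    have l0: "0 \<le> ln (real T)" using elim(2) by simp
    have term_le: "f k \<le> (if k < N then \<bar>f k\<bar> else 0) + C * ln (real T) ^ 5 * (1 / sqrt (real k))" if "k \<in> {1..T}" for k
    proof -
      have lk: "0 \<le> ln (real k)" "ln (real k) \<le> ln (real T)" using that by auto
      have "C * (ln (real k) ^ 5 / sqrt (real k)) \<le> C * (ln (real T) ^ 5 / sqrt (real k))"
        using lk C by (intro mult_left_mono divide_right_mono power_mono) auto
      moreover have "0 \<le> C * (ln (real T) ^ 5 / sqrt (real k))" using C l0 by simp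
      ultimately show ?thesis using N[of k] by (cases "k < N") auto
    qed
    have "(\<Sum>k = 1..T. f k) \<le> (\<Sum>k = 1..T. (if k < N then \<bar>f k\<bar> else 0) + C * ln (real T) ^ 5 * (1 / sqrt (real k)))"
      by (intro sum_mono term_le)
    also have "\<dots> = (\<Sum>k = 1..T. if k < N then \<bar>f k\<bar> else 0) + C * ln (real T) ^ 5 * (\<Sum>k = 1..T. 1 / sqrt (real k))"
      by (simp only: sum.distrib sum_distrib_left)
    also have "(\<Sum>k = 1..T. if k < N then \<bar>f k\<bar> else 0) \<le> S"
    proof -
      have "(\<Sum>k = 1..T. if k < N then \<bar>f k\<bar> else 0) = (\<Sum>k\<in>{k \<in> {1..T}. k < N}. \<bar>f k\<bar>)"
        by (rule sum.inter_filter[symmetric]) simp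
      also have "\<dots> \<le> S" unfolding S_def by (intro sum_mono2) auto
      finally show ?thesis .
    qed
    also have "C * ln (real T) ^ 5 * (\<Sum>k = 1..T. 1 / sqrt (real k)) \<le> C * ln (real T) ^ 5 * (2 * sqrt (real T))"
      using C l0 by (intro mult_left_mono sum_inverse_sqrt_le) auto
    finally have le: "(\<Sum>k = 1..T. f k) \<le> S + C * ln (real T) ^ 5 * (2 * sqrt (real T))" by simp
    have "S * 1 \<le> S * (sqrt (real T) * ln (real T) ^ 5)"
      by (intro mult_left_mono elim(1)) (auto simp: S_def intro: sum_nonneg)
    then show ?case using le by (simp add: algebra_simps)
  qed
  then show ?thesis by blast
qed

context lqr_good_path
begin

definition Theta0 :: "real^('n + 'm)^'n" where
  "Theta0 = (\<chi> i j. case j of Inl a \<Rightarrow> A $ i $ a | Inr b \<Rightarrow> B $ i $ b)"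

abbreviation "z t \<equiv> stack (x t) (u t)"

definition gram :: "nat \<Rightarrow> real^('n + 'm)^('n + 'm)" where
  "gram T = (\<Sum>t = 1..T. outer_product (z t) (z t))"

lemma Theta0_stack: "Theta0 *v stack y s = A *v y + B *v s"
  unfolding matrix_mult_stack by (simp add: Theta0_def)

lemma Theta_hat_stack: "Theta_hat x u k *v stack y s = A_hat x u k *v y + B_hat x u k *v s"
  unfolding matrix_mult_stack A_hat_def B_hat_def by simp

lemma gram_vec: "gram T *v \<theta> = (\<Sum>t = 1..T. (\<theta> \<bullet> z t) *\<^sub>R z t)"
  by (simp add: gram_def sum_matrix_mult_vec outer_product_mult_vec inner_commute)

lemma qf_gram: "qf (gram T) \<theta> = (\<Sum>t = 1..T. (\<theta> \<bullet> z t)\<^sup>2)"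
  by (simp add: qf_def gram_vec inner_sum_right power2_eq_square)

lemma gram_sym: "transpose (gram T) = gram T"
  unfolding transpose_eq_iff_inner gram_vec
  by (simp add: inner_sum_right inner_sum_left inner_commute mult.commute)

text \<open>The normal equations evaluated at \<open>gram T *v \<theta>\<close>, which cancels the
  inverse and leaves only noise against regressors. The estimate at time \<open>k\<close> uses data
  up to \<open>k - 2\<close>, hence the index \<open>T + 2\<close>.\<close>

lemma estimation_error_vec:
  assumes "pos_def (gram T)"
  shows "(Theta_hat x u (T + 2) - Theta0) *v (gram T *v \<theta>) = (\<Sum>t = 1..T. (\<theta> \<bullet> z t) *\<^sub>R w t)"
proof -
  define X where "X = (\<Sum>t = 1..T. outer_product (x (t + 1)) (z t))"
  have inv: "invertible (gram T)" by (rule pos_def_invertible[OF assms])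
  have Th: "Theta_hat x u (T + 2) = X ** matrix_inv (gram T)"
    unfolding pseudoinverse_invertible[OF inv, symmetric] by (simp add: Theta_hat_def X_def gram_def)
  have "Theta_hat x u (T + 2) *v (gram T *v \<theta>) = X *v \<theta>"
    unfolding Th by (simp add: matrix_vector_mul_assoc matrix_mul_assoc[symmetric] matrix_inv_both[OF inv])
  also have "\<dots> = (\<Sum>t = 1..T. (\<theta> \<bullet> z t) *\<^sub>R x (t + 1))"
    by (simp add: X_def sum_matrix_mult_vec outer_product_mult_vec inner_commute)
  also have "\<dots> = (\<Sum>t = 1..T. (\<theta> \<bullet> z t) *\<^sub>R (Theta0 *v z t) + (\<theta> \<bullet> z t) *\<^sub>R w t)"
    by (intro sum.cong refl) (simp add: x_Suc Theta0_stack scaleR_add_right)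
  also have "\<dots> = Theta0 *v (gram T *v \<theta>) + (\<Sum>t = 1..T. (\<theta> \<bullet> z t) *\<^sub>R w t)"
    by (simp add: gram_vec matrix_mult_vec_sum sum.distrib matrix_vector_mult_scaleR)
  finally show ?thesis by (simp add: matrix_vector_mult_diff_rdistrib)
qed

text \<open>For a row \<open>e\<close> of the error with Gram energy \<open>W\<close>, the normal
  equations give \<open>W\<close> as the correlation of \<open>e \<bullet> z t\<close> with the
  noise. The self-normalized bound at direction \<open>s *\<^sub>R e\<close> is then a bound on
  \<open>W\<close> itself: \<open>s * W - s^2 * W / 2 \<le> C * ln T\<close>. The choice
  \<open>s = 1 / norm e\<close> first excludes \<open>norm e > 1\<close>; after that
  \<open>s = 1\<close> is admissible, and the least eigenvalue converts \<open>W\<close> into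
  \<open>(norm e)^2\<close>.\<close>

lemma estimation_rate_rows:
  "\<exists>C>0. \<forall>\<^sub>F T in sequentially. \<forall>i.
    (norm ((Theta_hat x u (T + 2) - Theta0) $ i))\<^sup>2 \<le> C * (ln (real T) ^ 3 / sqrt (real T))"
proof -
  obtain c where c: "c > 0" "\<forall>\<^sub>F T in sequentially. \<forall>\<theta>. norm \<theta> = 1 \<longrightarrow>
    c * (sqrt (real T) / (ln (real T))\<^sup>2) \<le> (\<Sum>t = 1..T. (\<theta> \<bullet> z t)\<^sup>2)"
    using gram_lower by blast
  have "\<exists>C>0. \<forall>\<^sub>F T in sequentially. \<forall>j \<theta>. norm \<theta> \<le> 1 \<longrightarrow>
      (\<Sum>t = 1..T. (\<theta> \<bullet> z t) * (w t $ j) - (\<theta> \<bullet> z t)\<^sup>2 / 2) \<le> C * ln (real T)"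
    by (rule uniform_constant[OF ln_eventually_nonneg]) (rule G1)
  then obtain C where C: "C > 0" "\<forall>\<^sub>F T in sequentially. \<forall>j \<theta>. norm \<theta> \<le> 1 \<longrightarrow>
      (\<Sum>t = 1..T. (\<theta> \<bullet> z t) * (w t $ j) - (\<theta> \<bullet> z t)\<^sup>2 / 2) \<le> C * ln (real T)"
    by blast
  have ev: "\<forall>\<^sub>F T in sequentially. (4 * C) * ln (real T) \<le> c * (sqrt (real T) / (ln (real T))\<^sup>2)"
    by (rule eventually_le_of_ratio) (real_asymp, real_asymp, use c in simp)
  have "\<forall>\<^sub>F T in sequentially. 0 < ln (real T)" by real_asymp
  with c(2) C(2) ev
  have "\<forall>\<^sub>F T in sequentially. \<forall>i.
    (norm ((Theta_hat x u (T + 2) - Theta0) $ i))\<^sup>2 \<le> 2 * C / c * (ln (real T) ^ 3 / sqrt (real T))"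
    using eventually_ge_at_top[of 1]
  proof eventually_elim
    case (elim T)
    define \<kappa> where "\<kappa> = c * (sqrt (real T) / (ln (real T))\<^sup>2)"
    have lam0: "0 < \<kappa>" using c(1) elim(4,5) by (simp add: \<kappa>_def)
    have V: "\<kappa> * (norm \<theta>)\<^sup>2 \<le> qf (gram T) \<theta>" for \<theta>
    proof (cases "\<theta> = 0")
      case False
      have n1: "norm (inverse (norm \<theta>) *\<^sub>R \<theta>) = 1" using False by simp
      have "\<kappa> \<le> (\<Sum>t = 1..T. ((inverse (norm \<theta>) *\<^sub>R \<theta>) \<bullet> z t)\<^sup>2)"
        unfolding \<kappa>_def by (rule elim(1)[rule_format, OF n1])
      also have "\<dots> = qf (gram T) (inverse (norm \<theta>) *\<^sub>R \<theta>)" by (rule qf_gram[symmetric])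
      also have "\<dots> = (inverse (norm \<theta>))\<^sup>2 * qf (gram T) \<theta>" by (rule qf_scaleR)
      finally have "\<kappa> * (norm \<theta>)\<^sup>2 \<le> ((inverse (norm \<theta>))\<^sup>2 * qf (gram T) \<theta>) * (norm \<theta>)\<^sup>2"
        by (intro mult_right_mono) auto
      also have "\<dots> = qf (gram T) \<theta>"
        using False by (simp add: power_inverse)
      finally show ?thesis .
    qed simp
    have pd: "pos_def (gram T)"
      unfolding pos_def_def qf_def[symmetric]
    proof (intro conjI allI impI gram_sym)
      fix \<theta> :: "real^('n + 'm)" assume "\<theta> \<noteq> 0"
      then have "0 < \<kappa> * (norm \<theta>)\<^sup>2" using lam0 by simp
      then show "0 < qf (gram T) \<theta>" using V[of \<theta>] by linarith
    qed
    show ?case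
    proof
      fix i
      define e where "e = (Theta_hat x u (T + 2) - Theta0) $ i"
      define W where "W = qf (gram T) e"
      have W0: "0 \<le> W" unfolding W_def qf_gram by (intro sum_nonneg) auto
      have "e \<bullet> (gram T *v e) = ((Theta_hat x u (T + 2) - Theta0) *v (gram T *v e)) $ i"
        by (simp add: matrix_mult_dot e_def)
      also have "\<dots> = (\<Sum>t = 1..T. (e \<bullet> z t) * (w t $ i))"
        unfolding estimation_error_vec[OF pd] by simp
      finally have eW: "W = (\<Sum>t = 1..T. (e \<bullet> z t) * (w t $ i))" by (simp add: W_def qf_def)
      have key: "s * W \<le> 2 * (C * ln (real T))" if s: "0 \<le> s" "s \<le> 1" "s * norm e \<le> 1" for s
      proof -
        have "norm (s *\<^sub>R e) \<le> 1" using s by simp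
        then have "(\<Sum>t = 1..T. ((s *\<^sub>R e) \<bullet> z t) * (w t $ i) - ((s *\<^sub>R e) \<bullet> z t)\<^sup>2 / 2) \<le> C * ln (real T)"
          using elim(2) by blast
        moreover have "(\<Sum>t = 1..T. ((s *\<^sub>R e) \<bullet> z t) * (w t $ i) - ((s *\<^sub>R e) \<bullet> z t)\<^sup>2 / 2) = s * W - s\<^sup>2 * (W / 2)"
        proof -
          have "(\<Sum>t = 1..T. ((s *\<^sub>R e) \<bullet> z t) * (w t $ i) - ((s *\<^sub>R e) \<bullet> z t)\<^sup>2 / 2)
              = (\<Sum>t = 1..T. s * ((e \<bullet> z t) * (w t $ i)) - s\<^sup>2 / 2 * (e \<bullet> z t)\<^sup>2)"
            by (intro sum.cong refl) (simp add: power_mult_distrib)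
          also have "\<dots> = s * (\<Sum>t = 1..T. (e \<bullet> z t) * (w t $ i)) - s\<^sup>2 / 2 * (\<Sum>t = 1..T. (e \<bullet> z t)\<^sup>2)"
            by (simp only: sum_subtractf sum_distrib_left)
          also have "\<dots> = s * W - s\<^sup>2 / 2 * W"
            unfolding eW[symmetric] qf_gram[symmetric] W_def[symmetric] ..
          finally show ?thesis by simp
        qed
        moreover have "s\<^sup>2 * (W / 2) \<le> s * (W / 2)"
          using s W0 by (intro mult_right_mono) (auto simp: power2_eq_square mult_left_le)
        ultimately show ?thesis by linarith
      qed
      have VW: "\<kappa> * (norm e)\<^sup>2 \<le> W" unfolding W_def by (rule V)
      have "norm e \<le> 1"
      proof (rule ccontr)
        assume "\<not> norm e \<le> 1"
        then have ne: "1 < norm e" by simp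
        then have e0: "e \<noteq> 0" by auto
        have "\<kappa> * norm e = inverse (norm e) * (\<kappa> * (norm e)\<^sup>2)"
          using ne by (simp add: power2_eq_square field_simps)
        also have "\<dots> \<le> inverse (norm e) * W" using ne by (intro mult_left_mono VW) auto
        also have "\<dots> \<le> 2 * (C * ln (real T))"
          using ne e0 by (intro key) (auto simp: inverse_le_1_iff)
        finally have "\<kappa> * norm e \<le> 2 * (C * ln (real T))" .
        moreover have "\<kappa> * 1 \<le> \<kappa> * norm e" using ne lam0 by (intro mult_left_mono) auto
        moreover have "4 * (C * ln (real T)) \<le> \<kappa>" using elim(3) by (simp add: \<kappa>_def)
        moreover have "0 < C * ln (real T)" using C(1) elim(4) by simp
        ultimately show False by linarith
      qed
      then have "1 * W \<le> 2 * (C * ln (real T))" by (intro key) auto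
      then have "\<kappa> * (norm e)\<^sup>2 \<le> 2 * (C * ln (real T))" using VW by linarith
      then have "(norm e)\<^sup>2 \<le> 2 * (C * ln (real T)) / \<kappa>"
        using lam0 by (simp add: le_divide_eq mult.commute)
      also have "\<dots> = 2 * C / c * (ln (real T) ^ 3 / sqrt (real T))"
        using elim(4,5) c(1) by (simp add: \<kappa>_def power3_eq_cube power2_eq_square)
      finally show "(norm ((Theta_hat x u (T + 2) - Theta0) $ i))\<^sup>2 \<le> 2 * C / c * (ln (real T) ^ 3 / sqrt (real T))"
        by (simp add: e_def)
    qed
  qed
  then show ?thesis using C(1) c(1) by (intro exI[of _ "2 * C / c"]) auto
qed

definition rate :: "nat \<Rightarrow> real" where
  "rate k = sqrt (ln (real k) ^ 3 / sqrt (real k))"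

lemma rate_tendsto: "rate \<longlonglongrightarrow> 0"
  unfolding rate_def[abs_def] by real_asymp

lemma estimation_rate:
  "\<exists>C>0. \<forall>\<^sub>F k in sequentially. \<forall>y s.
    norm ((A_hat x u k *v y + B_hat x u k *v s) - (A *v y + B *v s)) \<le> C * rate k * (norm y + norm s)"
proof -
  obtain C where C: "C > 0" "\<forall>\<^sub>F T in sequentially. \<forall>i.
    (norm ((Theta_hat x u (T + 2) - Theta0) $ i))\<^sup>2 \<le> C * (ln (real T) ^ 3 / sqrt (real T))"
    using estimation_rate_rows by blast
  have "\<forall>\<^sub>F T in sequentially. ln (real T) ^ 3 / sqrt (real T) \<le> 2 * (ln (real (T + 2)) ^ 3 / sqrt (real (T + 2)))"
    unfolding of_nat_add of_nat_numeral by real_asymp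
  with C(2) have "\<forall>\<^sub>F T in sequentially. \<forall>i.
    norm ((Theta_hat x u (T + 2) - Theta0) $ i) \<le> sqrt (2 * C) * rate (T + 2)"
  proof eventually_elim
    case (elim T)
    show ?case
    proof
      fix i
      have "(norm ((Theta_hat x u (T + 2) - Theta0) $ i))\<^sup>2 \<le> C * (ln (real T) ^ 3 / sqrt (real T))"
        using elim(1) by blast
      also have "\<dots> \<le> C * (2 * (ln (real (T + 2)) ^ 3 / sqrt (real (T + 2))))"
        using C(1) by (intro mult_left_mono elim(2)) auto
      finally have "norm ((Theta_hat x u (T + 2) - Theta0) $ i)
          \<le> sqrt (2 * C * (ln (real (T + 2)) ^ 3 / sqrt (real (T + 2))))"
        by (intro real_le_rsqrt) (simp add: mult_ac)
      then show "norm ((Theta_hat x u (T + 2) - Theta0) $ i) \<le> sqrt (2 * C) * rate (T + 2)"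
        unfolding rate_def real_sqrt_mult[symmetric] .
    qed
  qed
  then have "\<forall>\<^sub>F k in sequentially. \<forall>i. norm ((Theta_hat x u k - Theta0) $ i) \<le> sqrt (2 * C) * rate k"
    by (rule eventually_sequentially_seg[THEN iffD1])
  then have "\<forall>\<^sub>F k in sequentially. \<forall>y s.
    norm ((A_hat x u k *v y + B_hat x u k *v s) - (A *v y + B *v s))
      \<le> real CARD('n) * sqrt (2 * C) * rate k * (norm y + norm s)"
  proof eventually_elim
    case (elim k)
    show ?case
    proof (intro allI)
      fix y :: "real^'n" and s :: "real^'m"
      have eq: "(A_hat x u k *v y + B_hat x u k *v s) - (A *v y + B *v s) = (Theta_hat x u k - Theta0) *v stack y s"
        by (simp add: matrix_vector_mult_diff_rdistrib Theta0_stack Theta_hat_stack)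
      have "norm ((Theta_hat x u k - Theta0) *v stack y s) \<le> real CARD('n) * (sqrt (2 * C) * rate k * (norm y + norm s))"
      proof (rule norm_le_components)
        fix i
        have "\<bar>((Theta_hat x u k - Theta0) *v stack y s) $ i\<bar> = \<bar>((Theta_hat x u k - Theta0) $ i) \<bullet> stack y s\<bar>"
          by (simp add: matrix_mult_dot)
        also have "\<dots> \<le> norm ((Theta_hat x u k - Theta0) $ i) * norm (stack y s)"
          by (rule Cauchy_Schwarz_ineq2)
        also have "\<dots> \<le> sqrt (2 * C) * rate k * (norm y + norm s)"
          using elim norm_stack_le[of y s] norm_ge_zero order.trans by (intro mult_mono) blast+
        finally show "\<bar>((Theta_hat x u k - Theta0) *v stack y s) $ i\<bar> \<le> sqrt (2 * C) * rate k * (norm y + norm s)" .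
      qed
      then show "norm ((A_hat x u k *v y + B_hat x u k *v s) - (A *v y + B *v s))
          \<le> real CARD('n) * sqrt (2 * C) * rate k * (norm y + norm s)"
        unfolding eq by (simp add: mult.assoc)
    qed
  qed
  then show ?thesis using C(1) by (intro exI[of _ "real CARD('n) * sqrt (2 * C)"]) auto
qed

definition Pstar :: "real^'n^'n" where "Pstar = riccati_solution A B Q R"
definition Kstar :: "real^'n^'m" where "Kstar = gain A B Pstar"

lemma ric_sol_Pstar: "ric_sol A B Pstar"
proof -
  have "stabilizable A B"
    unfolding stabilizable_def
  proof
    have "B ** (0 :: real^'n^'m) = 0" by (simp add: vec_eq_iff matrix_matrix_mult_def)
    then show "spectral_radius (A + B ** (0 :: real^'n^'m)) < 1" using A_stable by simp
  qed
  then obtain P where "ric_sol A B P" using ric_sol_exists by blast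
  then show ?thesis by (simp add: Pstar_def riccati_solution_eq)
qed

lemma psd_Pstar: "psd Pstar"
  by (rule ric_sol_psd[OF ric_sol_Pstar])

abbreviation "Kh k \<equiv> K_hat Q R x u k"

lemma gain_rate:
  "\<exists>D>0. \<forall>\<^sub>F k in sequentially. \<forall>y. norm (Kh k *v y - Kstar *v y) \<le> D * rate k * norm y"
proof -
  obtain \<epsilon>0 C where C: "\<epsilon>0 > 0" "C \<ge> 0" and lip: "\<And>A' B' \<epsilon>. 0 < \<epsilon> \<Longrightarrow> \<epsilon> \<le> \<epsilon>0 \<Longrightarrow>
     (\<forall>x u. norm ((A' *v x + B' *v u) - (A *v x + B *v u)) \<le> \<epsilon> * (norm x + norm u)) \<Longrightarrow>
     stabilizable A' B' \<and>
     (\<forall>x. norm (lqr_gain A' B' Q R *v x - lqr_gain A B Q R *v x) \<le> C * \<epsilon> * norm x)"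
    using lqr_gain_lipschitz[OF ric_sol_Pstar] by metis
  obtain E where E: "E > 0" "\<forall>\<^sub>F k in sequentially. \<forall>y s.
    norm ((A_hat x u k *v y + B_hat x u k *v s) - (A *v y + B *v s)) \<le> E * rate k * (norm y + norm s)"
    using estimation_rate by blast
  have "(\<lambda>k. E * rate k) \<longlonglongrightarrow> E * 0" by (intro tendsto_mult tendsto_const rate_tendsto)
  then have ev: "\<forall>\<^sub>F k in sequentially. E * rate k < \<epsilon>0"
    by (rule order_tendstoD) (use C in simp)
  have "\<forall>\<^sub>F k in sequentially. 0 < rate k"
    unfolding rate_def by real_asymp
  with E(2) ev have "\<forall>\<^sub>F k in sequentially. \<forall>y. norm (Kh k *v y - Kstar *v y) \<le> (C * E + 1) * rate k * norm y"
  proof eventually_elim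
    case (elim k)
    have 0: "0 < E * rate k" using E(1) elim(3) by simp
    have *: "stabilizable (A_hat x u k) (B_hat x u k) \<and>
     (\<forall>y. norm (lqr_gain (A_hat x u k) (B_hat x u k) Q R *v y - lqr_gain A B Q R *v y) \<le> C * (E * rate k) * norm y)"
      by (rule lip[OF 0 _ elim(1)]) (use elim(2) in simp)
    show ?case
    proof
      fix y
      have "norm (Kh k *v y - Kstar *v y) \<le> C * (E * rate k) * norm y"
        using * by (simp add: K_hat_def Kstar_def lqr_gain_eq[OF ric_sol_Pstar])
      also have "\<dots> \<le> (C * E + 1) * rate k * norm y"
        using elim(3) by (intro mult_right_mono) (auto simp: algebra_simps)
      finally show "norm (Kh k *v y - Kstar *v y) \<le> (C * E + 1) * rate k * norm y" .
    qed
  qed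
  moreover have "C * E + 1 > 0" using C E by (simp add: add_nonneg_pos)
  ultimately show ?thesis by blast
qed

end

subsection \<open>The circuit breaker and the regret\<close>

context lqr_good_path
begin

abbreviation "trips k \<equiv> breaker_trips Q R x u k"

lemma xi_Suc:
  "k \<ge> 1 \<Longrightarrow> xi (Suc k) = (if xi k = 0 then (if trips k then nat \<lfloor>ln (real k)\<rfloor> else 0) else xi k - 1)"
  using cl by (simp add: closed_loop_def)

lemma c_in_active: "xi k = 0 \<Longrightarrow> \<not> trips k \<Longrightarrow> c_in k = Kh k *v x k"
  by (simp add: u_cb_def u_ce_def)

lemma c_in_idle: "xi k \<noteq> 0 \<or> trips k \<Longrightarrow> c_in k = 0"
  by (auto simp: u_cb_def)

definition noise_in :: "nat \<Rightarrow> real^'n" where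
  "noise_in k = B *v ((real k powr (- 1 / 4)) *\<^sub>R v k) + w k"

lemma x_Suc_noise: "k \<ge> 1 \<Longrightarrow> x (Suc k) = A *v x k + B *v c_in k + noise_in k"
  by (simp add: x_Suc u_eq noise_in_def matrix_vector_right_distrib)

lemma noise_in_bound: "\<exists>d>0. \<forall>\<^sub>F k in sequentially. norm (noise_in k) \<le> d * sqrt (ln (real k))"
proof -
  let ?d = "onorm ((*v) B) * (real CARD('m) * 2) + real CARD('n) * 2"
  have "\<forall>\<^sub>F k in sequentially. norm (noise_in k) \<le> ?d * sqrt (ln (real k))"
    using v_norm w_norm eventually_ge_at_top[of 1]
  proof eventually_elim
    case (elim k)
    have "norm ((real k powr (- 1 / 4)) *\<^sub>R v k) \<le> 1 * norm (v k)"
      unfolding norm_scaleR using elim(3) powr_neg_le_1[of k "- 1 / 4"] by (intro mult_right_mono) auto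
    then have "norm ((real k powr (- 1 / 4)) *\<^sub>R v k) \<le> real CARD('m) * 2 * sqrt (ln (real k))"
      using elim(1) by simp
    then have "norm (B *v ((real k powr (- 1 / 4)) *\<^sub>R v k)) \<le> onorm ((*v) B) * (real CARD('m) * 2 * sqrt (ln (real k)))"
      by (intro order.trans[OF norm_matrix_vector_le] mult_left_mono onorm_matrix_nonneg)
    then have "norm (noise_in k) \<le> onorm ((*v) B) * (real CARD('m) * 2 * sqrt (ln (real k))) + real CARD('n) * 2 * sqrt (ln (real k))"
      unfolding noise_in_def using elim(2) by (intro order.trans[OF norm_triangle_ineq] add_mono)
    then show ?case by (simp add: algebra_simps)
  qed
  moreover have "?d > 0" using onorm_matrix_nonneg[of B] by (intro add_nonneg_pos) auto
  ultimately show ?thesis by blast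
qed

text \<open>
  Once the gain estimates are accurate, the breaker trips at most once more: a trip lets the state
  decay to the order of the noise, that is \<open>sqrt (ln k)\<close>, and a certainty-equivalent loop started there
  stays far below the threshold \<open>ln k\<close>.
\<close>

lemma finitely_many_trips: "\<forall>\<^sub>F k in sequentially. c_in k = Kh k *v x k"
proof -
  let ?L = "A + B ** Kstar"
  have L: "?L *v y = A *v y + B *v (Kstar *v y)" for y
    by (simp add: matrix_vector_mult_add_rdistrib matrix_vector_mul_assoc)
  have "qf Pstar (?L *v y) + qf Q y \<le> qf Pstar y" for y
    using ric_sol_closed_loop[OF ric_sol_Pstar, of y] psd_nonneg[OF psd_R, of "Kstar *v y"]
    unfolding L unfolding Kstar_def by linarith
  then have L_powers: "(\<lambda>k. ((*v) ?L ^^ k) y) \<longlonglongrightarrow> 0" for y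
    by (rule lyapunov_powers[OF psd_nonneg[OF psd_Pstar]])
  obtain N \<gamma> b where N: "0 < \<gamma>" "\<gamma> < 1" "0 < b" "\<And>x. norm x \<le> N x" "\<And>x. N x \<le> b * norm x"
    "\<And>x y. N (x + y) \<le> N x + N y" "\<And>x. N (?L *v x) \<le> \<gamma> * N x"
    by (rule adapted_norm_exists[OF L_powers]) blast
  obtain M \<gamma>2 b2 where M: "0 < \<gamma>2" "\<gamma>2 < 1" "0 < b2" "\<And>x. norm x \<le> M x" "\<And>x. M x \<le> b2 * norm x"
    "\<And>x y. M (x + y) \<le> M x + M y" "\<And>x. M (A *v x) \<le> \<gamma>2 * M x"
    by (rule adapted_norm_exists[OF A_powers]) blast
  obtain D where D: "D > 0" "\<forall>\<^sub>F k in sequentially. \<forall>y. norm (Kh k *v y - Kstar *v y) \<le> D * rate k * norm y"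
    using gain_rate by blast
  obtain d where d: "d > 0" "\<forall>\<^sub>F k in sequentially. norm (noise_in k) \<le> d * sqrt (ln (real k))"
    using noise_in_bound by blast
  obtain Cx where Cx: "\<forall>\<^sub>F k in sequentially. norm (x k) \<le> Cx * ln (real k)"
    using x_norm by blast
  define \<beta> where "\<beta> = onorm ((*v) B)"
  have b0: "0 \<le> \<beta>" unfolding \<beta>_def by (rule onorm_matrix_nonneg)
  \<comment> \<open>The gain error allowed, such that the contraction factor worsens from \<gamma>
    at most to \<open>\<gamma>'\<close>, midway between \<gamma> and 1.\<close>
  define \<delta> where "\<delta> = (1 - \<gamma>) / (2 * (b * \<beta> + 1))"
  define \<gamma>' where "\<gamma>' = (1 + \<gamma>) / 2"
  have g': "0 < \<gamma>'" "\<gamma>' < 1" using N by (auto simp: \<gamma>'_def)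
  have bb: "0 < b * \<beta> + 1" using N(3) b0 by (intro add_nonneg_pos) auto
  have \<delta>: "0 < \<delta>" "\<gamma> + b * \<beta> * \<delta> \<le> \<gamma>'"
  proof -
    show d0: "0 < \<delta>" unfolding \<delta>_def using N(2) bb by simp
    have "X * ((1 - \<gamma>) / (2 * X)) = (1 - \<gamma>) / 2" if "0 < X" for X :: real
      using that by simp
    from this[OF bb] have "(b * \<beta> + 1) * \<delta> = (1 - \<gamma>) / 2" by (simp only: \<delta>_def)
    then show "\<gamma> + b * \<beta> * \<delta> \<le> \<gamma>'" using d0 by (simp add: \<gamma>'_def algebra_simps field_simps)
  qed
  define \<kappa> where "\<kappa> = onorm ((*v) Kstar) + \<delta>"
  have k0: "0 < \<kappa>" unfolding \<kappa>_def using \<delta>(1) onorm_matrix_nonneg[of Kstar] by (intro add_nonneg_pos) auto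
  \<comment> \<open>The first entry makes \<open>good\<close> invariant under the
    certainty-equivalent loop. The second is the state size left after an idle period: 1 for the
    decayed initial state, the rest for the accumulated noise, with \<open>sqrt 2\<close> because
    the logarithm may double meanwhile.\<close>
  define \<Gamma> where "\<Gamma> = max (b * d / (1 - \<gamma>')) (1 + b * (b2 * d * sqrt 2 / (1 - \<gamma>2)))"
  have \<Gamma>1: "b * d \<le> (1 - \<gamma>') * \<Gamma>"
  proof -
    have "b * d = (1 - \<gamma>') * (b * d / (1 - \<gamma>'))" using g' by simp
    also have "\<dots> \<le> (1 - \<gamma>') * \<Gamma>" using g' by (intro mult_left_mono) (auto simp: \<Gamma>_def)
    finally show ?thesis .
  qed
  have \<Gamma>2: "1 + b * (b2 * d * sqrt 2 / (1 - \<gamma>2)) \<le> \<Gamma>" by (simp add: \<Gamma>_def)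
  have \<Gamma>0: "0 < \<Gamma>"
  proof -
    have "0 \<le> b * (b2 * d * sqrt 2 / (1 - \<gamma>2))" using N M d by simp
    then show ?thesis using \<Gamma>2 by linarith
  qed
  have "(\<lambda>k. D * rate k) \<longlonglongrightarrow> D * 0" by (intro tendsto_mult tendsto_const rate_tendsto)
  then have e1: "\<forall>\<^sub>F k in sequentially. D * rate k < \<delta>"
    by (rule order_tendstoD) (use \<delta> in simp)
  have e2: "\<forall>\<^sub>F k in sequentially. \<kappa> * 1 \<le> 1 * ln (real k)"
    by (rule eventually_le_of_ratio) (real_asymp, real_asymp, simp)
  have e3: "\<forall>\<^sub>F k in sequentially. (\<kappa> * \<Gamma>) * sqrt (ln (real k)) \<le> 1 * ln (real k)"
    by (rule eventually_le_of_ratio) (real_asymp, real_asymp, simp)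
  \<comment> \<open>Idling for about \<open>ln k\<close> steps multiplies the state by
    \<open>\<gamma>2 powr ln k\<close>, a negative power of \<open>k\<close>, which beats its
    logarithmic size.\<close>
  have "ln \<gamma>2 < 0" using M by simp
  then have e4': "(\<lambda>k. ln (real k) * real k powr (ln \<gamma>2) / sqrt (ln (real k))) \<longlonglongrightarrow> 0"
    by real_asymp
  have e4: "\<forall>\<^sub>F k in sequentially. (b * (b2 * \<bar>Cx\<bar>)) * (ln (real k) * real k powr (ln \<gamma>2)) \<le> 1 * sqrt (ln (real k))"
    by (rule eventually_le_of_ratio[OF e4']) (real_asymp, simp)
  \<comment> \<open>Ensures \<open>k + ln k \<le> k^2\<close>, so that over an idle period the
    logarithm at most doubles.\<close>
  have e5: "\<forall>\<^sub>F k in sequentially. 2 * real k \<le> (real k)\<^sup>2 \<and> ln (real k) + 1 \<le> real k \<and> 1 \<le> ln (real k)"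
    by (intro eventually_conj) real_asymp+
  obtain k0 where k0: "\<And>k. k \<ge> k0 \<Longrightarrow>
      (\<forall>y. norm (Kh k *v y - Kstar *v y) \<le> D * rate k * norm y) \<and> norm (noise_in k) \<le> d * sqrt (ln (real k))
      \<and> norm (x k) \<le> Cx * ln (real k) \<and> D * rate k < \<delta> \<and> \<kappa> * 1 \<le> 1 * ln (real k)
      \<and> (\<kappa> * \<Gamma>) * sqrt (ln (real k)) \<le> 1 * ln (real k)
      \<and> (b * (b2 * \<bar>Cx\<bar>)) * (ln (real k) * real k powr (ln \<gamma>2)) \<le> 1 * sqrt (ln (real k))
      \<and> (2 * real k \<le> (real k)\<^sup>2 \<and> ln (real k) + 1 \<le> real k \<and> 1 \<le> ln (real k)) \<and> 1 \<le> k"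
    using eventually_conj[OF D(2) eventually_conj[OF d(2) eventually_conj[OF Cx eventually_conj[OF e1
      eventually_conj[OF e2 eventually_conj[OF e3 eventually_conj[OF e4 eventually_conj[OF e5 eventually_ge_at_top[of "1::nat"]]]]]]]]]
    unfolding eventually_sequentially by blast
  have Kd: "norm (Kh k *v y - Kstar *v y) \<le> \<delta> * norm y" if "k \<ge> k0" for k y
    using k0[OF that] mult_right_mono[of "D * rate k" \<delta> "norm y"] norm_ge_zero[of y]
    by (meson less_imp_le order.trans)
  have Kk: "norm (Kh k *v y) \<le> \<kappa> * norm y" if "k \<ge> k0" for k y
  proof -
    have "norm (Kh k *v y) \<le> norm (Kstar *v y) + norm (Kh k *v y - Kstar *v y)"
      by (metis add.commute diff_add_cancel norm_triangle_ineq)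
    also have "\<dots> \<le> onorm ((*v) Kstar) * norm y + \<delta> * norm y"
      by (intro add_mono norm_matrix_vector_le Kd that)
    finally show ?thesis by (simp add: \<kappa>_def distrib_right)
  qed
  have lnmono: "sqrt (ln (real k)) \<le> sqrt (ln (real (Suc k)))" if "k \<ge> k0" for k
    using k0[OF that] by simp
  \<comment> \<open>Idle counter and state at noise level: at this level the certainty-equivalent
    input is of order \<open>sqrt (ln k)\<close>, below the threshold \<open>ln k\<close>.\<close>
  define good where "good k \<longleftrightarrow> xi k = 0 \<and> N (x k) \<le> \<Gamma> * sqrt (ln (real k))" for k
  have step: "\<not> trips k \<and> good (Suc k)" if k: "k \<ge> k0" and g: "good k" for k
  proof -
    have k1: "k \<ge> 1" using k0[OF k] by blast
    have Nk: "N (x k) \<le> \<Gamma> * sqrt (ln (real k))" and xi0: "xi k = 0" using g by (auto simp: good_def)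
    have "norm (Kh k *v x k) \<le> \<kappa> * norm (x k)" by (rule Kk[OF k])
    also have "\<dots> \<le> \<kappa> * (\<Gamma> * sqrt (ln (real k)))"
      using N(4)[of "x k"] Nk \<open>0 < \<kappa>\<close> by (intro mult_left_mono) auto
    also have "\<dots> \<le> ln (real k)" using k0[OF k] by (simp add: mult.assoc)
    finally have 1: "norm (u_ce Q R x u k) \<le> ln (real k)" by (simp add: u_ce_def)
    have "norm (Kh k *v y) \<le> ln (real k) * norm y" for y
    proof -
      have "\<kappa> \<le> ln (real k)" using k0[OF k] by simp
      then show ?thesis by (intro order.trans[OF Kk[OF k]] mult_right_mono) auto
    qed
    then have nt: "\<not> trips k" unfolding breaker_trips_iff[OF k1] using 1 by auto
    have "xi (Suc k) = 0" using xi_Suc[OF k1] xi0 nt by simp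
    moreover have "N (x (Suc k)) \<le> \<Gamma> * sqrt (ln (real (Suc k)))"
    proof -
      have eq: "x (Suc k) = ?L *v x k + (B *v (Kh k *v x k - Kstar *v x k) + noise_in k)"
        unfolding x_Suc_noise[OF k1] c_in_active[OF xi0 nt] L by (simp add: matrix_vector_mult_diff_distrib)
      have "N (x (Suc k)) \<le> N (?L *v x k) + (N (B *v (Kh k *v x k - Kstar *v x k)) + N (noise_in k))"
        unfolding eq by (intro order.trans[OF N(6)] add_left_mono N(6))
      also have "\<dots> \<le> \<gamma> * N (x k) + (b * (\<beta> * (\<delta> * N (x k))) + b * (d * sqrt (ln (real k))))"
      proof (intro add_mono N(7))
        have "norm (B *v (Kh k *v x k - Kstar *v x k)) \<le> \<beta> * norm (Kh k *v x k - Kstar *v x k)"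
          unfolding \<beta>_def by (rule norm_matrix_vector_le)
        also have "\<dots> \<le> \<beta> * (\<delta> * N (x k))"
          using \<delta>(1) by (intro mult_left_mono b0 order.trans[OF Kd[OF k]] N(4)) auto
        finally show "N (B *v (Kh k *v x k - Kstar *v x k)) \<le> b * (\<beta> * (\<delta> * N (x k)))"
          using N(3) by (intro order.trans[OF N(5)] mult_left_mono) auto
        show "N (noise_in k) \<le> b * (d * sqrt (ln (real k)))"
          using N(3) k0[OF k] by (intro order.trans[OF N(5)] mult_left_mono) auto
      qed
      also have "\<dots> = (\<gamma> + b * \<beta> * \<delta>) * N (x k) + (b * d) * sqrt (ln (real k))"
        by (simp add: algebra_simps)
      also have "\<dots> \<le> \<gamma>' * (\<Gamma> * sqrt (ln (real k))) + ((1 - \<gamma>') * \<Gamma>) * sqrt (ln (real k))"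
      proof (rule add_mono)
        have "0 \<le> N (x k)" using N(4)[of "x k"] norm_ge_zero order.trans by blast
        then show "(\<gamma> + b * \<beta> * \<delta>) * N (x k) \<le> \<gamma>' * (\<Gamma> * sqrt (ln (real k)))"
          using g'(1) by (intro mult_mono[OF \<delta>(2) Nk]) auto
        show "(b * d) * sqrt (ln (real k)) \<le> ((1 - \<gamma>') * \<Gamma>) * sqrt (ln (real k))"
          using k0[OF k] by (intro mult_right_mono[OF \<Gamma>1]) auto
      qed
      also have "\<dots> = \<Gamma> * sqrt (ln (real k))" by (simp add: algebra_simps)
      also have "\<dots> \<le> \<Gamma> * sqrt (ln (real (Suc k)))" using \<Gamma>0 by (intro mult_left_mono lnmono[OF k]) auto
      finally show ?thesis .
    qed
    ultimately show ?thesis using nt by (simp add: good_def)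
  qed
  have stay: "c_in k = Kh k *v x k" if k1: "k1 \<ge> k0" "good k1" and k: "k \<ge> k1" for k k1
  proof -
    have "good k" using k
    proof (induction k rule: dec_induct)
      case base then show ?case by (rule k1(2))
    next
      case (step n)
      then show ?case using \<open>\<And>k. k \<ge> k0 \<Longrightarrow> good k \<Longrightarrow> \<not> trips k \<and> good (Suc k)\<close>[of n] k1(1) by auto
    qed
    then show ?thesis
      using step[of k] k k1(1) by (intro c_in_active) (auto simp: good_def)
  qed
  show ?thesis
  proof (cases "\<exists>k1\<ge>k0. xi k1 = 0 \<and> trips k1")
    case True
    then obtain k1 where k1: "k1 \<ge> k0" "xi k1 = 0" "trips k1" by blast
    have k1pos: "1 \<le> k1" and lk: "1 \<le> ln (real k1)" using k0[OF k1(1)] by auto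
    define \<tau> where "\<tau> = nat \<lfloor>ln (real k1)\<rfloor>"
    have \<tau>: "real \<tau> \<le> ln (real k1)" "ln (real k1) \<le> real \<tau> + 1"
      unfolding \<tau>_def using lk by linarith+
    \<comment> \<open>The counter is set at the trip and first read one step later, so the input is
      idle at \<open>k1\<close> through \<open>k1 + \<tau>\<close>. These are
      \<open>Suc \<tau>\<close> steps, at least \<open>ln k1\<close> of them, which is what the
      decay uses.\<close>
    have xi1: "xi (k1 + Suc j) = \<tau> - j" if "j \<le> \<tau>" for j
      using that
    proof (induction j)
      case 0
      then show ?case using xi_Suc[OF k1pos] k1 by (simp add: \<tau>_def)
    next
      case (Suc j)
      then have "xi (k1 + Suc j) = \<tau> - j" "\<tau> - j \<noteq> 0" by auto
      then show ?case using xi_Suc[of "k1 + Suc j"] k1pos by simp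
    qed
    have idle: "c_in (k1 + j) = 0" if "j \<le> \<tau>" for j
    proof (cases j)
      case 0
      then show ?thesis using k1(3) by (intro c_in_idle) simp
    next
      case (Suc i)
      then show ?thesis using xi1[of i] that by (intro c_in_idle) simp
    qed
    define D1 where "D1 = b2 * (d * sqrt (2 * ln (real k1)))"
    have noise: "M (noise_in (k1 + j)) \<le> D1" if "j \<le> \<tau>" for j
    proof -
      have "real (k1 + j) \<le> real k1 + ln (real k1)" using that \<tau>(1) by simp
      also have "\<dots> \<le> (real k1)\<^sup>2" using k0[OF k1(1)] by linarith
      finally have "ln (real (k1 + j)) \<le> ln ((real k1)\<^sup>2)" using k1pos by (subst ln_le_cancel_iff) auto
      then have "ln (real (k1 + j)) \<le> 2 * ln (real k1)" using k1pos by (simp add: ln_realpow)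
      then have "d * sqrt (ln (real (k1 + j))) \<le> d * sqrt (2 * ln (real k1))"
        using d(1) by (intro mult_left_mono) auto
      then have "norm (noise_in (k1 + j)) \<le> d * sqrt (2 * ln (real k1))"
        using k0[of "k1 + j"] k1(1) by fastforce
      then show ?thesis
        unfolding D1_def using M(3) by (intro order.trans[OF M(5)] mult_left_mono) auto
    qed
    have decay: "M (x (k1 + j)) \<le> \<gamma>2 ^ j * M (x k1) + D1 / (1 - \<gamma>2)" if "j \<le> Suc \<tau>" for j
      using that
    proof (induction j)
      case 0
      have "0 \<le> D1" unfolding D1_def using M(3) d(1) lk by simp
      then show ?case using M(2) by simp
    next
      case (Suc j)
      have "x (k1 + Suc j) = A *v x (k1 + j) + noise_in (k1 + j)"
        using x_Suc_noise[of "k1 + j"] idle[of j] k1pos Suc.prems by simp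
      then have "M (x (k1 + Suc j)) \<le> M (A *v x (k1 + j)) + M (noise_in (k1 + j))"
        using M(6) by simp
      also have "\<dots> \<le> \<gamma>2 * M (x (k1 + j)) + D1"
        using Suc.prems by (intro add_mono M(7) noise) auto
      also have "\<dots> \<le> \<gamma>2 * (\<gamma>2 ^ j * M (x k1) + D1 / (1 - \<gamma>2)) + D1"
        using Suc M(1) by (intro add_right_mono mult_left_mono) auto
      also have "\<dots> = \<gamma>2 ^ Suc j * M (x k1) + D1 / (1 - \<gamma>2)"
        using M(2) by (simp add: field_simps)
      finally show ?case .
    qed
    let ?k2 = "k1 + Suc \<tau>"
    have "\<gamma>2 ^ Suc \<tau> \<le> real k1 powr (ln \<gamma>2)"
    proof -
      have "\<gamma>2 ^ Suc \<tau> = \<gamma>2 powr real (Suc \<tau>)" using M(1) by (simp only: powr_realpow)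
      also have "\<dots> \<le> \<gamma>2 powr ln (real k1)"
        using M(1,2) \<tau>(2) by (intro powr_mono') auto
      also have "\<dots> = real k1 powr (ln \<gamma>2)" using M(1) k1pos by (simp add: powr_def mult.commute)
      finally show ?thesis .
    qed
    moreover have "M (x k1) \<le> b2 * (\<bar>Cx\<bar> * ln (real k1))"
    proof -
      have "norm (x k1) \<le> Cx * ln (real k1)" using k0[OF k1(1)] by blast
      also have "\<dots> \<le> \<bar>Cx\<bar> * ln (real k1)" using lk by (intro mult_right_mono) auto
      finally show ?thesis using M(3) by (intro order.trans[OF M(5)] mult_left_mono) auto
    qed
    moreover have "0 \<le> M (x k1)" using M(4)[of "x k1"] norm_ge_zero order.trans by blast
    ultimately have "\<gamma>2 ^ Suc \<tau> * M (x k1) \<le> real k1 powr (ln \<gamma>2) * (b2 * (\<bar>Cx\<bar> * ln (real k1)))"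
      by (intro mult_mono) auto
    then have "M (x ?k2) \<le> real k1 powr (ln \<gamma>2) * (b2 * (\<bar>Cx\<bar> * ln (real k1))) + D1 / (1 - \<gamma>2)"
      using decay[OF order_refl] by linarith
    then have "N (x ?k2) \<le> b * (real k1 powr (ln \<gamma>2) * (b2 * (\<bar>Cx\<bar> * ln (real k1))) + D1 / (1 - \<gamma>2))"
      using N(3) M(4)[of "x ?k2"] by (intro order.trans[OF N(5)] mult_left_mono) auto
    also have "\<dots> = (b * (b2 * \<bar>Cx\<bar>)) * (ln (real k1) * real k1 powr (ln \<gamma>2))
        + b * (b2 * d * sqrt 2 / (1 - \<gamma>2)) * sqrt (ln (real k1))"
      by (simp add: D1_def real_sqrt_mult algebra_simps)
    also have "\<dots> \<le> sqrt (ln (real k1)) + b * (b2 * d * sqrt 2 / (1 - \<gamma>2)) * sqrt (ln (real k1))"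
      using k0[OF k1(1)] by simp
    also have "\<dots> = (1 + b * (b2 * d * sqrt 2 / (1 - \<gamma>2))) * sqrt (ln (real k1))"
      by (simp add: algebra_simps)
    also have "\<dots> \<le> \<Gamma> * sqrt (ln (real k1))"
      using lk by (intro mult_right_mono \<Gamma>2) auto
    also have "\<dots> \<le> \<Gamma> * sqrt (ln (real ?k2))"
      using \<Gamma>0 k1pos by (intro mult_left_mono) auto
    finally have "good ?k2" using xi1[OF order_refl] by (simp add: good_def)
    then have "c_in k = Kh k *v x k" if "k \<ge> ?k2" for k
      using stay[of ?k2 k] k1(1) that by simp
    then show ?thesis unfolding eventually_sequentially by blast
  next
    case False
    \<comment> \<open>If no trip occurs after \<open>k0\<close>, the counter merely runs down
      (natural subtraction stops at 0), and from \<open>k0 + xi k0\<close> on the controller is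
      active.\<close>
    have xi2: "xi (k0 + j) = xi k0 - j" for j
    proof (induction j)
      case (Suc j)
      have "1 \<le> k0 + j" using k0[of k0] by simp
      moreover have "\<not> (xi (k0 + j) = 0 \<and> trips (k0 + j))" using False le_add1[of k0 j] by blast
      ultimately show ?case using Suc xi_Suc[of "k0 + j"] by auto
    qed simp
    have "c_in k = Kh k *v x k" if "k \<ge> k0 + xi k0" for k
    proof -
      define j where "j = k - k0"
      have j: "k = k0 + j" "j \<ge> xi k0" using that by (auto simp: j_def)
      then have "xi k = 0" using xi2[of j] by simp
      moreover have "\<not> (xi k = 0 \<and> trips k)" using False le_add1[of k0 j] j(1) by blast
      ultimately show ?thesis by (intro c_in_active) auto
    qed
    then show ?thesis unfolding eventually_sequentially by blast
  qed
qed

text \<open>The squared gain error \<open>(ln k)^3 / sqrt k\<close> multiplies a squared state of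
  order \<open>(ln k)^2\<close>; the probing signal adds only order
  \<open>ln k / sqrt k\<close>.\<close>

lemma input_error_rate:
  "\<exists>C\<ge>0. \<forall>\<^sub>F k in sequentially. (norm (u k - Kstar *v x k))\<^sup>2 \<le> C * (ln (real k) ^ 5 / sqrt (real k))"
proof -
  obtain D where D: "D > 0" "\<forall>\<^sub>F k in sequentially. \<forall>y. norm (Kh k *v y - Kstar *v y) \<le> D * rate k * norm y"
    using gain_rate by blast
  obtain Cx where Cx: "\<forall>\<^sub>F k in sequentially. norm (x k) \<le> Cx * ln (real k)"
    using x_norm by blast
  define m where "m = real CARD('m) * 2"
  define C where "C = 2 * (D * Cx)\<^sup>2 + 2 * m\<^sup>2"
  have "\<forall>\<^sub>F k in sequentially. 1 \<le> ln (real k)" by real_asymp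
  with D(2) Cx finitely_many_trips v_norm
  have "\<forall>\<^sub>F k in sequentially. (norm (u k - Kstar *v x k))\<^sup>2 \<le> C * (ln (real k) ^ 5 / sqrt (real k))"
    using eventually_ge_at_top[of 1]
  proof eventually_elim
    case (elim k)
    let ?s = "real k powr (- 1 / 4)"
    define l where "l = ln (real k)"
    have l1: "1 \<le> l" using elim(5) by (simp add: l_def)
    have sq: "0 < sqrt (real k)" using elim(6) by simp
    have eq: "u k - Kstar *v x k = (Kh k *v x k - Kstar *v x k) + ?s *\<^sub>R v k"
      using u_eq[OF elim(6)] elim(3) by simp
    have "norm (u k - Kstar *v x k) \<le> norm (Kh k *v x k - Kstar *v x k) + norm (?s *\<^sub>R v k)"
      unfolding eq by (rule norm_triangle_ineq)
    then have "(norm (u k - Kstar *v x k))\<^sup>2 \<le> (norm (Kh k *v x k - Kstar *v x k) + norm (?s *\<^sub>R v k))\<^sup>2"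
      by (intro power_mono) auto
    also have "\<dots> \<le> 2 * (norm (Kh k *v x k - Kstar *v x k))\<^sup>2 + 2 * (norm (?s *\<^sub>R v k))\<^sup>2"
      using sum_squares_bound[of "norm (Kh k *v x k - Kstar *v x k)" "norm (?s *\<^sub>R v k)"]
      unfolding power2_sum by linarith
    also have "(norm (Kh k *v x k - Kstar *v x k))\<^sup>2 \<le> (D * Cx)\<^sup>2 * (l ^ 5 / sqrt (real k))"
    proof -
      have r0: "0 \<le> rate k" using l1 by (simp add: rate_def l_def)
      have "norm (Kh k *v x k - Kstar *v x k) \<le> D * rate k * norm (x k)" using elim(1) by blast
      also have "\<dots> \<le> D * rate k * (Cx * l)"
        using D(1) r0 elim(2) by (intro mult_left_mono) (auto simp: l_def)
      finally have "(norm (Kh k *v x k - Kstar *v x k))\<^sup>2 \<le> (D * rate k * (Cx * l))\<^sup>2"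
        by (intro power_mono) auto
      also have "\<dots> = (D * Cx)\<^sup>2 * ((rate k)\<^sup>2 * l\<^sup>2)" by (simp add: power_mult_distrib mult_ac)
      also have "(rate k)\<^sup>2 = l ^ 3 / sqrt (real k)" using l1 by (simp add: rate_def l_def)
      also have "l ^ 3 / sqrt (real k) * l\<^sup>2 = l ^ 5 / sqrt (real k)"
        by (simp add: power_add[symmetric])
      finally show ?thesis .
    qed
    also have "(norm (?s *\<^sub>R v k))\<^sup>2 \<le> m\<^sup>2 * (l ^ 5 / sqrt (real k))"
    proof -
      have "(norm (v k))\<^sup>2 \<le> (m * sqrt l)\<^sup>2"
        using elim(4) by (intro power_mono) (auto simp: m_def l_def)
      also have "\<dots> = m\<^sup>2 * l" using l1 by (simp add: power_mult_distrib)
      also have "\<dots> \<le> m\<^sup>2 * l ^ 5"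
        using power_increasing[of 1 5 l] l1 by (intro mult_left_mono) auto
      finally have v: "(norm (v k))\<^sup>2 \<le> m\<^sup>2 * l ^ 5" .
      have "?s\<^sup>2 = 1 / sqrt (real k)"
        using elim(6) by (simp add: power2_eq_square powr_add[symmetric] powr_minus_divide powr_half_sqrt)
      then have "(norm (?s *\<^sub>R v k))\<^sup>2 = (norm (v k))\<^sup>2 / sqrt (real k)"
        by (simp add: power_mult_distrib)
      also have "\<dots> \<le> m\<^sup>2 * l ^ 5 / sqrt (real k)"
        using sq by (intro divide_right_mono v) auto
      finally show ?thesis by simp
    qed
    finally show ?case by (simp add: C_def l_def algebra_simps)
  qed
  moreover have "C \<ge> 0" by (simp add: C_def)
  ultimately show ?thesis by blast
qed

text \<open>\<open>complete_square\<close> at the Riccati fixed point, summed over time. The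
  cost-to-go telescopes from \<open>x 1 = 0\<close>, and the terminal term is discarded by its sign,
  hence an inequality.\<close>

lemma regret_decomposition:
  "regret A B Q R x u T \<le> 2 * (\<Sum>k = 1..T. w k \<bullet> (Pstar *v (A *v x k + B *v u k)))
    + (\<Sum>k = 1..T. qf Pstar (w k) - trace Pstar) + (\<Sum>k = 1..T. qf (ricG B Pstar) (u k - Kstar *v x k))"
proof -
  let ?y = "\<lambda>k. A *v x k + B *v u k"
  have F: "ricF A B Pstar = Pstar" using ric_sol_Pstar by (simp add: ric_sol_def)
  have step: "qf Q (x k) + qf R (u k) = (qf Pstar (x k) - qf Pstar (x (Suc k)))
      + (2 * (w k \<bullet> (Pstar *v ?y k)) + qf Pstar (w k) + qf (ricG B Pstar) (u k - Kstar *v x k))" if "k \<in> {1..T}" for k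
  proof -
    have "qf Pstar (x (Suc k)) = qf Pstar (?y k) + 2 * (w k \<bullet> (Pstar *v ?y k)) + qf Pstar (w k)"
      using that psd_Pstar by (simp add: x_Suc qf_add psd_def)
    then show ?thesis
      using complete_square[OF psd_Pstar, of "x k" "u k" A B] unfolding F Kstar_def by linarith
  qed
  have tele: "(\<Sum>k = 1..T. qf Pstar (x k) - qf Pstar (x (Suc k))) = qf Pstar (x 1) - qf Pstar (x (Suc T))"
    by (induction T) auto
  have x1: "x 1 = 0" using cl by (simp add: closed_loop_def)
  have "(\<Sum>k = 1..T. qf Q (x k) + qf R (u k)) = (qf Pstar (x 1) - qf Pstar (x (Suc T)))
      + (\<Sum>k = 1..T. 2 * (w k \<bullet> (Pstar *v ?y k)) + qf Pstar (w k) + qf (ricG B Pstar) (u k - Kstar *v x k))"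
    unfolding tele[symmetric] sum.distrib[symmetric] by (intro sum.cong refl step)
  also have "\<dots> \<le> (\<Sum>k = 1..T. 2 * (w k \<bullet> (Pstar *v ?y k)) + qf Pstar (w k) + qf (ricG B Pstar) (u k - Kstar *v x k))"
    using psd_nonneg[OF psd_Pstar, of "x (Suc T)"] unfolding x1 by simp
  also have "\<dots> = 2 * (\<Sum>k = 1..T. w k \<bullet> (Pstar *v ?y k)) + (\<Sum>k = 1..T. qf Pstar (w k))
      + (\<Sum>k = 1..T. qf (ricG B Pstar) (u k - Kstar *v x k))"
    by (simp only: sum.distrib sum_distrib_left)
  finally have "(\<Sum>k = 1..T. qf Q (x k) + qf R (u k)) \<le> \<dots>" .
  moreover have "(\<Sum>k = 1..T. qf Pstar (w k) - trace Pstar) = (\<Sum>k = 1..T. qf Pstar (w k)) - real T * trace Pstar"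
    by (simp add: sum_subtractf)
  ultimately show ?thesis
    unfolding regret_def lqr_cost_def Pstar_def[symmetric] qf_def[of Q, symmetric] qf_def[of R, symmetric] by linarith
qed

text \<open>The self-normalized bound is used row by row in a direction of length at most
  \<open>1 / sqrt T\<close>. The energy of the regressors is at most of order
  \<open>T * (ln T)^2\<close>, so after division by the scale both contributions are
  \<open>sqrt T\<close> up to logarithms.\<close>

lemma noise_state_cross_bound:
  "\<exists>C\<ge>0. \<forall>\<^sub>F T in sequentially. (\<Sum>k = 1..T. w k \<bullet> (Pstar *v (A *v x k + B *v u k))) \<le> C * (sqrt (real T) * ln (real T) ^ 5)"
proof -
  let ?y = "\<lambda>t. A *v x t + B *v u t"
  have "\<exists>C>0. \<forall>\<^sub>F T in sequentially. \<forall>j \<theta>. norm \<theta> \<le> 1 \<longrightarrow>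
      (\<Sum>t = 1..T. (\<theta> \<bullet> ?y t) * (w t $ j) - (\<theta> \<bullet> ?y t)\<^sup>2 / 2) \<le> C * ln (real T)"
    by (rule uniform_constant[OF ln_eventually_nonneg]) (rule G3)
  then obtain C3 where C3: "C3 > 0" "\<forall>\<^sub>F T in sequentially. \<forall>j \<theta>. norm \<theta> \<le> 1 \<longrightarrow>
      (\<Sum>t = 1..T. (\<theta> \<bullet> ?y t) * (w t $ j) - (\<theta> \<bullet> ?y t)\<^sup>2 / 2) \<le> C3 * ln (real T)"
    by blast
  obtain D where D: "D > 0" "\<forall>\<^sub>F T in sequentially. \<forall>t\<in>{1..T}. norm (x t) \<le> D * ln (real T) \<and> norm (u t) \<le> D * ln (real T)
     \<and> norm (w t) \<le> D * ln (real T) \<and> norm (v t) \<le> D * ln (real T) \<and> norm (c_in t) \<le> D * ln (real T)"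
    using path_uniform_bound by blast
  define \<alpha> where "\<alpha> = (onorm ((*v) A) + onorm ((*v) B)) * D"
  have \<alpha>0: "0 \<le> \<alpha>" unfolding \<alpha>_def using D(1) onorm_matrix_nonneg[of A] onorm_matrix_nonneg[of B] by simp
  \<comment> \<open>Not the circle constant: a bound on the rows of \<open>Pstar\<close>, kept at
    least 1 so that it may divide.\<close>
  define \<pi> where "\<pi> = 1 + norm Pstar"
  have \<pi>: "1 \<le> \<pi>" "norm (Pstar $ j) \<le> \<pi>" for j
    using Finite_Cartesian_Product.norm_nth_le[of Pstar j] by (auto simp: \<pi>_def)
  define C where "C = real CARD('n) * (C3 * \<pi> + \<pi> * \<alpha>\<^sup>2)"
  have "\<forall>\<^sub>F T in sequentially. 1 \<le> ln (real T)" by real_asymp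
  with C3(2) D(2)
  have "\<forall>\<^sub>F T in sequentially. (\<Sum>k = 1..T. w k \<bullet> (Pstar *v ?y k)) \<le> C * (sqrt (real T) * ln (real T) ^ 5)"
    using eventually_ge_at_top[of 1]
  proof eventually_elim
    case (elim T)
    define l where "l = ln (real T)"
    have l1: "1 \<le> l" using elim(3) by (simp add: l_def)
    define r where "r = sqrt (real T)"
    have r1: "1 \<le> r" "r * r = real T" using elim(4) by (auto simp: r_def)
    have ynorm: "norm (?y t) \<le> \<alpha> * l" if "t \<in> {1..T}" for t
    proof -
      have "norm (?y t) \<le> onorm ((*v) A) * norm (x t) + onorm ((*v) B) * norm (u t)"
        by (intro order.trans[OF norm_triangle_ineq] add_mono norm_matrix_vector_le)
      also have "\<dots> \<le> onorm ((*v) A) * (D * l) + onorm ((*v) B) * (D * l)"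
        using elim(2) that by (intro add_mono mult_left_mono onorm_matrix_nonneg) (auto simp: l_def)
      finally show ?thesis by (simp add: \<alpha>_def algebra_simps)
    qed
    have row: "(\<Sum>t = 1..T. w t $ j * (Pstar $ j \<bullet> ?y t)) \<le> r * l ^ 5 * (C3 * \<pi> + \<pi> * \<alpha>\<^sup>2)" for j
    proof -
      \<comment> \<open>Balances \<open>C3 * l / s\<close> against \<open>s\<close> times an energy
        of order \<open>T * l^2\<close>; the factor \<pi> keeps the direction in the unit
        ball.\<close>
      define s where "s = 1 / (r * \<pi>)"
      have s0: "0 < s" using r1 \<pi>(1) by (simp add: s_def)
      have "norm (s *\<^sub>R (Pstar $ j)) \<le> s * \<pi>" using s0 \<pi>(2)[of j] by simp
      also have "\<dots> \<le> 1" using r1 \<pi>(1) by (simp add: s_def)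
      finally have "(\<Sum>t = 1..T. ((s *\<^sub>R (Pstar $ j)) \<bullet> ?y t) * (w t $ j) - ((s *\<^sub>R (Pstar $ j)) \<bullet> ?y t)\<^sup>2 / 2) \<le> C3 * l"
        using elim(1) unfolding l_def by blast
      moreover have "(\<Sum>t = 1..T. ((s *\<^sub>R (Pstar $ j)) \<bullet> ?y t) * (w t $ j) - ((s *\<^sub>R (Pstar $ j)) \<bullet> ?y t)\<^sup>2 / 2)
          = s * (\<Sum>t = 1..T. w t $ j * (Pstar $ j \<bullet> ?y t)) - s\<^sup>2 / 2 * (\<Sum>t = 1..T. (Pstar $ j \<bullet> ?y t)\<^sup>2)"
      proof -
        have "(\<Sum>t = 1..T. ((s *\<^sub>R (Pstar $ j)) \<bullet> ?y t) * (w t $ j) - ((s *\<^sub>R (Pstar $ j)) \<bullet> ?y t)\<^sup>2 / 2)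
            = (\<Sum>t = 1..T. s * (w t $ j * (Pstar $ j \<bullet> ?y t)) - s\<^sup>2 / 2 * (Pstar $ j \<bullet> ?y t)\<^sup>2)"
          by (intro sum.cong refl) (simp only: inner_scaleR_left power_mult_distrib times_divide_eq_left mult_ac)
        then show ?thesis by (simp only: sum_subtractf sum_distrib_left)
      qed
      moreover have "(\<Sum>t = 1..T. (Pstar $ j \<bullet> ?y t)\<^sup>2) \<le> (\<Sum>t = 1..T. (\<pi> * (\<alpha> * l))\<^sup>2)"
      proof (rule sum_mono)
        fix t assume t: "t \<in> {1..T}"
        have "\<bar>Pstar $ j \<bullet> ?y t\<bar> \<le> norm (Pstar $ j) * norm (?y t)" by (rule Cauchy_Schwarz_ineq2)
        also have "\<dots> \<le> \<pi> * (\<alpha> * l)" using \<pi> by (intro mult_mono ynorm t) auto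
        finally show "(Pstar $ j \<bullet> ?y t)\<^sup>2 \<le> (\<pi> * (\<alpha> * l))\<^sup>2"
          by (metis abs_ge_zero power2_abs power_mono)
      qed
      ultimately have "s * (\<Sum>t = 1..T. w t $ j * (Pstar $ j \<bullet> ?y t)) \<le> C3 * l + s\<^sup>2 / 2 * (real T * (\<pi> * (\<alpha> * l))\<^sup>2)"
        using mult_left_mono[of "\<Sum>t = 1..T. (Pstar $ j \<bullet> ?y t)\<^sup>2" "real T * (\<pi> * (\<alpha> * l))\<^sup>2" "s\<^sup>2 / 2"] by simp
      also have "s\<^sup>2 / 2 * (real T * (\<pi> * (\<alpha> * l))\<^sup>2) = (\<alpha> * l)\<^sup>2 / 2"
        using r1 \<pi>(1) by (simp add: s_def r1(2)[symmetric] power2_eq_square)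
      finally have "(\<Sum>t = 1..T. w t $ j * (Pstar $ j \<bullet> ?y t)) \<le> (C3 * l + (\<alpha> * l)\<^sup>2 / 2) / s"
        using s0 by (simp add: le_divide_eq mult.commute)
      also have "\<dots> = (r * \<pi>) * (C3 * l + (\<alpha> * l)\<^sup>2 / 2)" by (simp add: s_def mult.commute)
      also have "\<dots> \<le> (r * \<pi>) * (C3 * l ^ 5 + \<alpha>\<^sup>2 * l ^ 5)"
      proof (intro mult_left_mono add_mono)
        show "l \<le> l ^ 5" using power_increasing[of 1 5 l] l1 by simp
        have "l\<^sup>2 \<le> l ^ 5" using power_increasing[of 2 5 l] l1 by simp
        then have "\<alpha>\<^sup>2 * l\<^sup>2 \<le> \<alpha>\<^sup>2 * l ^ 5" by (intro mult_left_mono) auto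
        moreover have "0 \<le> \<alpha>\<^sup>2 * l\<^sup>2" by simp
        ultimately show "(\<alpha> * l)\<^sup>2 / 2 \<le> \<alpha>\<^sup>2 * l ^ 5" unfolding power_mult_distrib by linarith
      qed (use C3(1) r1 \<pi>(1) in auto)
      finally show ?thesis by (simp add: algebra_simps)
    qed
    have "(\<Sum>k = 1..T. w k \<bullet> (Pstar *v ?y k)) = (\<Sum>k = 1..T. \<Sum>j\<in>UNIV. w k $ j * (Pstar $ j \<bullet> ?y k))"
      unfolding inner_vec_def[of "w _"] by (simp add: matrix_mult_dot)
    also have "\<dots> = (\<Sum>j\<in>UNIV. \<Sum>t = 1..T. w t $ j * (Pstar $ j \<bullet> ?y t))"
      by (rule sum.swap)
    also have "\<dots> \<le> (\<Sum>j\<in>(UNIV :: 'n set). r * l ^ 5 * (C3 * \<pi> + \<pi> * \<alpha>\<^sup>2))"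
      by (intro sum_mono row)
    finally show ?case by (simp add: C_def r_def l_def mult_ac)
  qed
  moreover have "C \<ge> 0" unfolding C_def using C3(1) \<pi>(1) by simp
  ultimately show ?thesis by blast
qed

text \<open>\<open>trace Pstar\<close> is the mean of \<open>qf Pstar (w k)\<close>, so this is the
  fluctuation bound \<open>V1\<close> with the entries of \<open>Pstar\<close> as coefficients. The
  higher power of the logarithm allows the constant 1.\<close>

lemma noise_energy_bound:
  "\<exists>C\<ge>0. \<forall>\<^sub>F T in sequentially. (\<Sum>k = 1..T. qf Pstar (w k) - trace Pstar) \<le> C * (sqrt (real T) * ln (real T) ^ 5)"
proof -
  obtain C1 where C1: "C1 \<ge> 0" "\<forall>\<^sub>F T in sequentially. \<forall>i j.
      \<bar>\<Sum>t = 1..T. 1 * (w t $ i * w t $ j - (if i = j then 1 else 0))\<bar> \<le> C1 * ((1 + sqrt (real T)) * ln (real T))"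
    using V1 by blast
  define S where "S = (\<Sum>i\<in>UNIV. \<Sum>j\<in>UNIV. \<bar>Pstar $ i $ j\<bar>)"
  have S0: "0 \<le> S" unfolding S_def by (intro sum_nonneg) auto
  have "\<forall>\<^sub>F T in sequentially. (S * C1) * ((1 + sqrt (real T)) * ln (real T)) \<le> 1 * (sqrt (real T) * ln (real T) ^ 5)"
    by (rule eventually_le_of_ratio) (real_asymp, real_asymp, simp)
  with C1(2) have "\<forall>\<^sub>F T in sequentially. (\<Sum>k = 1..T. qf Pstar (w k) - trace Pstar) \<le> 1 * (sqrt (real T) * ln (real T) ^ 5)"
  proof eventually_elim
    case (elim T)
    have "(\<Sum>k = 1..T. qf Pstar (w k) - trace Pstar)
        = (\<Sum>t = 1..T. 1 * ((\<Sum>i\<in>UNIV. \<Sum>j\<in>UNIV. Pstar $ i $ j * (w t $ i * w t $ j)) - (\<Sum>i\<in>UNIV. Pstar $ i $ i)))"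
      by (simp add: qf_entries trace_def)
    also have "\<dots> \<le> S * (C1 * ((1 + sqrt (real T)) * ln (real T)))"
      unfolding S_def
      by (rule order.trans[OF abs_ge_self], rule weighted_square_bound) (use elim(1) in blast)
    finally show ?case using elim(2) by (simp add: mult.assoc)
  qed
  then show ?thesis by (intro exI[of _ 1]) auto
qed

lemma regret_bound: "\<exists>C. \<forall>\<^sub>F T in sequentially. regret A B Q R x u T \<le> C * (sqrt (real T) * ln (real T) ^ 5)"
proof -
  obtain C1 where C1: "\<forall>\<^sub>F T in sequentially. (\<Sum>k = 1..T. w k \<bullet> (Pstar *v (A *v x k + B *v u k))) \<le> C1 * (sqrt (real T) * ln (real T) ^ 5)"
    using noise_state_cross_bound by blast
  obtain C2 where C2: "\<forall>\<^sub>F T in sequentially. (\<Sum>k = 1..T. qf Pstar (w k) - trace Pstar) \<le> C2 * (sqrt (real T) * ln (real T) ^ 5)"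
    using noise_energy_bound by blast
  obtain C where C: "C \<ge> 0" "\<forall>\<^sub>F k in sequentially. (norm (u k - Kstar *v x k))\<^sup>2 \<le> C * (ln (real k) ^ 5 / sqrt (real k))"
    using input_error_rate by blast
  define g where "g = onorm ((*v) (ricG B Pstar))"
  have g0: "0 \<le> g" unfolding g_def by (rule onorm_matrix_nonneg)
  have "\<forall>\<^sub>F k in sequentially. qf (ricG B Pstar) (u k - Kstar *v x k) \<le> (g * C) * (ln (real k) ^ 5 / sqrt (real k))"
    using C(2)
  proof eventually_elim
    case (elim k)
    have "qf (ricG B Pstar) (u k - Kstar *v x k) \<le> g * (norm (u k - Kstar *v x k))\<^sup>2"
      using qf_le_onorm[of "ricG B Pstar" "u k - Kstar *v x k"] by (simp add: g_def)
    also have "\<dots> \<le> g * (C * (ln (real k) ^ 5 / sqrt (real k)))" by (intro mult_left_mono elim g0)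
    finally show ?case by (simp only: mult.assoc)
  qed
  then obtain C3 where C3: "\<forall>\<^sub>F T in sequentially. (\<Sum>k = 1..T. qf (ricG B Pstar) (u k - Kstar *v x k)) \<le> C3 * (sqrt (real T) * ln (real T) ^ 5)"
    using sum_eventually_le g0 C(1) by (meson mult_nonneg_nonneg)
  have "\<forall>\<^sub>F T in sequentially. regret A B Q R x u T \<le> (2 * C1 + C2 + C3) * (sqrt (real T) * ln (real T) ^ 5)"
    using C1 C2 C3
  proof eventually_elim
    case (elim T)
    then show ?case using regret_decomposition[of T] unfolding distrib_right by linarith
  qed
  then show ?thesis by blast
qed

lemma regret_soft_O: "soft_O (regret A B Q R x u) (\<lambda>T. sqrt (real T))"
proof -
  obtain C where C: "\<forall>\<^sub>F T in sequentially. regret A B Q R x u T \<le> C * (sqrt (real T) * ln (real T) ^ 5)"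
    using regret_bound by blast
  have "\<forall>\<^sub>F T in sequentially. 0 < ln (real T)" by real_asymp
  with C have "\<forall>\<^sub>F T in sequentially. ereal (regret A B Q R x u T / (sqrt (real T) * ln (real T) powr 5)) \<le> ereal C"
    using eventually_ge_at_top[of 1]
  proof eventually_elim
    case (elim T)
    have "ln (real T) powr 5 = ln (real T) ^ 5" using elim(2) by (simp add: powr_numeral)
    moreover have "0 < sqrt (real T) * ln (real T) ^ 5" using elim by simp
    ultimately show ?case using elim(1) by (simp add: divide_le_eq)
  qed
  then have "limsup (\<lambda>T. ereal (regret A B Q R x u T / (sqrt (real T) * ln (real T) powr 5))) \<le> ereal C"
    by (rule Limsup_bounded)
  also have "ereal C < \<infinity>" by simp
  finally show ?thesis unfolding soft_O_def big_O_def by (intro exI[of _ 5]) auto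
qed

end

section \<open>From almost sure path bounds to the regret\<close>

context lqr_path
begin

text \<open>Supplies the crude bound by \<open>T\<close> under which directions may be rounded to
  the lattice.\<close>

lemma path_regressors_bound:
  "\<forall>\<^sub>F T in sequentially. \<forall>t\<in>{1..T}. norm (stack (x t) (u t)) \<le> real T
    \<and> norm ((real t powr (- 1 / 4)) *\<^sub>R stack (x t) (c_in t)) \<le> real T \<and> norm (A *v x t + B *v u t) \<le> real T
    \<and> norm (w t) \<le> real T \<and> norm (v t) \<le> real T"
proof -
  define K where "K = 1 + onorm ((*v) A) + onorm ((*v) B)"
  have K: "1 \<le> K" "onorm ((*v) A) \<le> K" "onorm ((*v) B) \<le> K"
    using onorm_matrix_nonneg[of A] onorm_matrix_nonneg[of B] by (auto simp: K_def)
  have "0 \<le> K" using K(1) by simp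
  from path_linear_bound[OF this] show ?thesis
  proof eventually_elim
    case (elim T)
    show ?case
    proof
      fix t assume t: "t \<in> {1..T}"
      have le: "K * norm (x t) + K * norm (u t) + K * norm (w t) + K * norm (v t) + K * norm (c_in t) \<le> real T"
        using elim t by (simp add: distrib_left)
      have K1: "norm y \<le> K * norm y" for y :: "'z::real_normed_vector"
        using mult_right_mono[OF K(1), of "norm y"] by simp
      have nn: "0 \<le> K * norm y" for y :: "'z::real_normed_vector"
        using \<open>0 \<le> K\<close> by simp
      have 1: "norm (stack (x t) (u t)) \<le> real T"
        using norm_stack_le[of "x t" "u t"] K1[of "x t"] K1[of "u t"] nn[of "w t"] nn[of "v t"] nn[of "c_in t"] le
        by linarith
      have "norm ((real t powr (- 1 / 4)) *\<^sub>R stack (x t) (c_in t)) \<le> 1 * norm (stack (x t) (c_in t))"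
        unfolding norm_scaleR using t powr_neg_le_1[of t "- 1 / 4"] by (intro mult_right_mono) auto
      then have 2: "norm ((real t powr (- 1 / 4)) *\<^sub>R stack (x t) (c_in t)) \<le> real T"
        using norm_stack_le[of "x t" "c_in t"] K1[of "x t"] K1[of "c_in t"] nn[of "w t"] nn[of "v t"] nn[of "u t"] le
        by linarith
      have "norm (A *v x t + B *v u t) \<le> onorm ((*v) A) * norm (x t) + onorm ((*v) B) * norm (u t)"
        by (intro order.trans[OF norm_triangle_ineq] add_mono norm_matrix_vector_le)
      also have "\<dots> \<le> K * norm (x t) + K * norm (u t)"
        by (intro add_mono mult_right_mono K) auto
      finally have 3: "norm (A *v x t + B *v u t) \<le> real T"
        using nn[of "w t"] nn[of "v t"] nn[of "c_in t"] le by linarith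
      have 4: "norm (w t) \<le> real T" "norm (v t) \<le> real T"
        using K1[of "w t"] K1[of "v t"] nn[of "x t"] nn[of "u t"] nn[of "w t"] nn[of "v t"] nn[of "c_in t"] le
        by linarith+
      show "norm (stack (x t) (u t)) \<le> real T
        \<and> norm ((real t powr (- 1 / 4)) *\<^sub>R stack (x t) (c_in t)) \<le> real T \<and> norm (A *v x t + B *v u t) \<le> real T
        \<and> norm (w t) \<le> real T \<and> norm (v t) \<le> real T"
        using 1 2 3 4 by blast
    qed
  qed
qed

end

text \<open>A generous scale: the left side grows only like \<open>ln T\<close>, but any scale well
  below \<open>sqrt T / (ln T)^3\<close> serves the excitation bound. The summand 1 secures
  \<open>1 \<le> \<tau> T\<close> for every \<open>T\<close>.\<close>

lemma sum_inverse_le_probing_scale: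
  "(\<Sum>t = 1..T. (real t powr (- 1 / 2))\<^sup>2) \<le> (1 + 2 * real T powr (1 / 4))\<^sup>2"
proof -
  have "(\<Sum>t = 1..T. (real t powr (- 1 / 2))\<^sup>2) \<le> (\<Sum>t = 1..T. 1 / sqrt (real t))"
  proof (rule sum_mono)
    fix t assume t: "t \<in> {1..T}"
    have "(real t powr (- 1 / 2))\<^sup>2 \<le> 1 * real t powr (- 1 / 2)"
      unfolding power2_eq_square using t powr_neg_le_1[of t "- 1 / 2"] by (intro mult_right_mono) auto
    also have "\<dots> = 1 / sqrt (real t)"
      using t by (simp add: powr_minus_divide powr_half_sqrt)
    finally show "(real t powr (- 1 / 2))\<^sup>2 \<le> 1 / sqrt (real t)" .
  qed
  also have "\<dots> \<le> 2 * sqrt (real T)" by (rule sum_inverse_sqrt_le)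
  also have "sqrt (real T) = (real T powr (1 / 4))\<^sup>2"
    by (simp add: power2_eq_square powr_add[symmetric] powr_half_sqrt)
  also have "2 * (real T powr (1 / 4))\<^sup>2 \<le> (1 + 2 * real T powr (1 / 4))\<^sup>2"
    by (simp add: power2_sum power_mult_distrib)
  finally show ?thesis .
qed

theorem theorem10:
  fixes A Q :: "real^'n^'n"
    and B :: "real^'m^'n"
    and R :: "real^'m^'m"
    and M :: "'a measure"
    and w x :: "nat \<Rightarrow> 'a \<Rightarrow> real^'n"
    and v u :: "nat \<Rightarrow> 'a \<Rightarrow> real^'m"
    and xi :: "nat \<Rightarrow> 'a \<Rightarrow> nat"
  assumes "prob_space M"
    and "controllable A B" and "spectral_radius A < 1"
    and "pos_def Q" and "pos_def R"
    and "prob_space.iid_std_gaussian M w"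
    and "prob_space.iid_std_gaussian M v"
    and "prob_space.indep_processes M w v"
    and "\<And>\<omega>. \<omega> \<in> space M \<Longrightarrow>
           closed_loop A B Q R (\<lambda>k. w k \<omega>) (\<lambda>k. v k \<omega>)
             (\<lambda>k. x k \<omega>) (\<lambda>k. u k \<omega>) (\<lambda>k. xi k \<omega>)"
  shows "AE \<omega> in M. soft_O (regret A B Q R (\<lambda>k. x k \<omega>) (\<lambda>k. u k \<omega>)) (\<lambda>T. sqrt (real T))"
proof -
  interpret prob_space M by fact
  interpret lqr Q R by standard fact+
  note cl = assms(9)
  note ind = assms(8) and ind' = indep_processes_commute[OF assms(8)]
  define c where "c t \<omega> = u_cb Q R (\<lambda>k. x k \<omega>) (\<lambda>k. u k \<omega>) (\<lambda>k. xi k \<omega>) t" for t \<omega>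
  interpret W: gaussian_innovation M "past_algebra w v" w
    by (rule gaussian_innovation_past_algebra[OF assms(6) ind])
  interpret V: gaussian_innovation M "past_algebra v w" v
    by (rule gaussian_innovation_past_algebra[OF assms(7) ind'])
  have xW: "x t \<in> borel_measurable (past_algebra w v t)" and cW: "c t \<in> borel_measurable (past_algebra w v t)"
    if t: "t \<ge> 1" for t
  proof -
    have "x t \<in> borel_measurable (past_algebra w v t) \<and> xi t \<in> measurable (past_algebra w v t) (count_space UNIV) \<and>
      Measurable.pred (past_algebra w v t) (\<lambda>\<omega>. breaker_trips Q R (\<lambda>k. x k \<omega>) (\<lambda>k. u k \<omega>) t) \<and>
      (\<lambda>\<omega>. u_cb Q R (\<lambda>k. x k \<omega>) (\<lambda>k. u k \<omega>) (\<lambda>k. xi k \<omega>) t) \<in> borel_measurable (past_algebra w v t)"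
    proof (rule closed_loop_adapted)
      show "closed_loop A B Q R (\<lambda>k. w k \<omega>) (\<lambda>k. v k \<omega>) (\<lambda>k. x k \<omega>) (\<lambda>k. u k \<omega>) (\<lambda>k. xi k \<omega>)"
        if "\<omega> \<in> space (past_algebra w v t)" for \<omega>
        using cl that by simp
      show "w s \<in> borel_measurable (past_algebra w v t)" if "1 \<le> s" "s < t" for s
        by (rule past_algebra_measurable_past[OF ind]) (fact that)+
      show "v s \<in> borel_measurable (past_algebra w v t)" if "1 \<le> s" "s < t" for s
        by (rule past_algebra_measurable_other[OF ind]) (fact that)+
    qed (fact t)
    then show "x t \<in> borel_measurable (past_algebra w v t)" "c t \<in> borel_measurable (past_algebra w v t)"
      by (auto simp: c_def[abs_def])
  qed
  have xV: "x t \<in> borel_measurable (past_algebra v w t)" and cV: "c t \<in> borel_measurable (past_algebra v w t)"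
    if t: "t \<ge> 1" for t
  proof -
    have "x t \<in> borel_measurable (past_algebra v w t) \<and> xi t \<in> measurable (past_algebra v w t) (count_space UNIV) \<and>
      Measurable.pred (past_algebra v w t) (\<lambda>\<omega>. breaker_trips Q R (\<lambda>k. x k \<omega>) (\<lambda>k. u k \<omega>) t) \<and>
      (\<lambda>\<omega>. u_cb Q R (\<lambda>k. x k \<omega>) (\<lambda>k. u k \<omega>) (\<lambda>k. xi k \<omega>) t) \<in> borel_measurable (past_algebra v w t)"
    proof (rule closed_loop_adapted)
      show "closed_loop A B Q R (\<lambda>k. w k \<omega>) (\<lambda>k. v k \<omega>) (\<lambda>k. x k \<omega>) (\<lambda>k. u k \<omega>) (\<lambda>k. xi k \<omega>)"
        if "\<omega> \<in> space (past_algebra v w t)" for \<omega>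
        using cl that by simp
      show "w s \<in> borel_measurable (past_algebra v w t)" if "1 \<le> s" "s < t" for s
        by (rule past_algebra_measurable_other[OF ind']) (fact that)+
      show "v s \<in> borel_measurable (past_algebra v w t)" if "1 \<le> s" "s < t" for s
        by (rule past_algebra_measurable_past[OF ind']) (fact that)+
    qed (fact t)
    then show "x t \<in> borel_measurable (past_algebra v w t)" "c t \<in> borel_measurable (past_algebra v w t)"
      by (auto simp: c_def[abs_def])
  qed
  \<comment> \<open>\<open>v t\<close> belongs to the past algebra of \<open>w\<close>, hence so
    does \<open>u t\<close>. In the past algebra of \<open>v\<close> only the controller part
    \<open>c t\<close> is available, which is why \<open>G2\<close> is formulated with it.\<close>
  have uW: "u t \<in> borel_measurable (past_algebra w v t)" if t: "t \<ge> 1" for t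
  proof -
    have [measurable]: "v t \<in> borel_measurable (past_algebra w v t)" "c t \<in> borel_measurable (past_algebra w v t)"
      using past_algebra_measurable_other[OF ind t] cW[OF t] by auto
    have "(\<lambda>\<omega>. c t \<omega> + (real t powr (- 1 / 4)) *\<^sub>R v t \<omega>) \<in> borel_measurable (past_algebra w v t)"
      by measurable
    then show ?thesis
      by (rule measurable_cong[THEN iffD1, rotated]) (simp add: closed_loop_u[OF cl t] c_def)
  qed
  \<comment> \<open>\<open>lqr_path\<close> asks only for stability and noise bounds. Its growth
    estimates provide the hypotheses of the self-normalized bounds, from which the further
    assumptions of \<open>lqr_good_path\<close> follow; hence two locales.\<close>
  have path: "AE \<omega> in M. lqr_path Q R A B (\<lambda>k. w k \<omega>) (\<lambda>k. x k \<omega>) (\<lambda>k. v k \<omega>) (\<lambda>k. u k \<omega>) (\<lambda>k. xi k \<omega>)"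
    using W.noise_bound V.noise_bound AE_space
  proof eventually_elim
    case (elim \<omega>)
    show ?case
      by unfold_locales (use cl elim assms(3) in auto)
  qed
  have bd: "AE \<omega> in M. \<forall>\<^sub>F T in sequentially. \<forall>t\<in>{1..T}. norm (stack (x t \<omega>) (u t \<omega>)) \<le> real T
    \<and> norm ((real t powr (- 1 / 4)) *\<^sub>R stack (x t \<omega>) (c t \<omega>)) \<le> real T \<and> norm (A *v x t \<omega> + B *v u t \<omega>) \<le> real T
    \<and> norm (w t \<omega>) \<le> real T \<and> norm (v t \<omega>) \<le> real T"
    using path unfolding c_def by eventually_elim (rule lqr_path.path_regressors_bound)
  have G1: "AE \<omega> in M. \<forall>j. \<exists>C. \<forall>\<^sub>F T in sequentially. \<forall>\<theta>. norm \<theta> \<le> 1 \<longrightarrow>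
      (\<Sum>t = 1..T. (\<theta> \<bullet> stack (x t \<omega>) (u t \<omega>)) * (w t \<omega> $ j) - (\<theta> \<bullet> stack (x t \<omega>) (u t \<omega>))\<^sup>2 / 2) \<le> C * ln (real T)"
  proof (rule AE_all_countable[THEN iffD2], rule allI, rule W.self_normalized_bound)
    show "(\<lambda>\<omega>. stack (x t \<omega>) (u t \<omega>)) \<in> borel_measurable (past_algebra w v t)" if "t \<ge> 1" for t
      by (intro borel_measurable_stack xW uW that)
    show "AE \<omega> in M. \<forall>\<^sub>F T in sequentially. \<forall>t\<in>{1..T}. norm (stack (x t \<omega>) (u t \<omega>)) \<le> real T \<and> \<bar>w t \<omega> $ j\<bar> \<le> real T" for j
      using bd by eventually_elim (erule eventually_mono, meson component_le_norm_cart order.trans)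
  qed
  have G2: "AE \<omega> in M. \<forall>j. \<exists>C. \<forall>\<^sub>F T in sequentially. \<forall>\<theta>. norm \<theta> \<le> 1 \<longrightarrow>
      (\<Sum>t = 1..T. (\<theta> \<bullet> ((real t powr (- 1 / 4)) *\<^sub>R stack (x t \<omega>) (c t \<omega>))) * (v t \<omega> $ j)
        - (\<theta> \<bullet> ((real t powr (- 1 / 4)) *\<^sub>R stack (x t \<omega>) (c t \<omega>)))\<^sup>2 / 2) \<le> C * ln (real T)"
  proof (rule AE_all_countable[THEN iffD2], rule allI, rule V.self_normalized_bound)
    show "(\<lambda>\<omega>. (real t powr (- 1 / 4)) *\<^sub>R stack (x t \<omega>) (c t \<omega>)) \<in> borel_measurable (past_algebra v w t)" if "t \<ge> 1" for t
      by (intro borel_measurable_scaleR borel_measurable_const borel_measurable_stack xV cV that)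
    show "AE \<omega> in M. \<forall>\<^sub>F T in sequentially. \<forall>t\<in>{1..T}.
        norm ((real t powr (- 1 / 4)) *\<^sub>R stack (x t \<omega>) (c t \<omega>)) \<le> real T \<and> \<bar>v t \<omega> $ j\<bar> \<le> real T" for j
      using bd by eventually_elim (erule eventually_mono, meson component_le_norm_cart order.trans)
  qed
  have G3: "AE \<omega> in M. \<forall>j. \<exists>C. \<forall>\<^sub>F T in sequentially. \<forall>\<theta>. norm \<theta> \<le> 1 \<longrightarrow>
      (\<Sum>t = 1..T. (\<theta> \<bullet> (A *v x t \<omega> + B *v u t \<omega>)) * (w t \<omega> $ j) - (\<theta> \<bullet> (A *v x t \<omega> + B *v u t \<omega>))\<^sup>2 / 2) \<le> C * ln (real T)"
  proof (rule AE_all_countable[THEN iffD2], rule allI, rule W.self_normalized_bound)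
    show "(\<lambda>\<omega>. A *v x t \<omega> + B *v u t \<omega>) \<in> borel_measurable (past_algebra w v t)" if "t \<ge> 1" for t
      by (intro borel_measurable_add borel_measurable_matrix_vector_mult borel_measurable_const xW uW that)
    show "AE \<omega> in M. \<forall>\<^sub>F T in sequentially. \<forall>t\<in>{1..T}. norm (A *v x t \<omega> + B *v u t \<omega>) \<le> real T \<and> \<bar>w t \<omega> $ j\<bar> \<le> real T" for j
      using bd by eventually_elim (erule eventually_mono, meson component_le_norm_cart order.trans)
  qed
  \<comment> \<open>Unit weights, with \<open>\<tau> T = 1 + sqrt T\<close>.\<close>
  have V1: "AE \<omega> in M. \<exists>C\<ge>0. \<forall>\<^sub>F T in sequentially. \<forall>i j.
      \<bar>\<Sum>t = 1..T. 1 * (w t \<omega> $ i * w t \<omega> $ j - (if i = j then 1 else 0))\<bar> \<le> C * ((1 + sqrt (real T)) * ln (real T))"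
    by (rule W.weighted_covariance_bound) (auto simp: power2_sum)
  have V2: "AE \<omega> in M. \<exists>C\<ge>0. \<forall>\<^sub>F T in sequentially. \<forall>i j.
      \<bar>\<Sum>t = 1..T. real t powr (- 1 / 2) * (v t \<omega> $ i * v t \<omega> $ j - (if i = j then 1 else 0))\<bar>
        \<le> C * ((1 + 2 * real T powr (1 / 4)) * ln (real T))"
  proof (rule V.weighted_covariance_bound)
    show "real t powr (- 1 / 2) \<le> 1" if "t \<ge> 1" for t :: nat
      by (rule powr_neg_le_1) (use that in auto)
    show "(\<Sum>t = 1..T. (real t powr (- 1 / 2))\<^sup>2) \<le> (1 + 2 * real T powr (1 / 4))\<^sup>2" for T :: nat
      by (rule sum_inverse_le_probing_scale)
  qed auto
  show ?thesis
    using path G1 G2 G3 V1 V2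
  proof eventually_elim
    case (elim \<omega>)
    have "lqr_good_path Q R A B (\<lambda>k. w k \<omega>) (\<lambda>k. x k \<omega>) (\<lambda>k. v k \<omega>) (\<lambda>k. u k \<omega>) (\<lambda>k. xi k \<omega>)"
      unfolding lqr_good_path_def lqr_good_path_axioms_def
      using elim unfolding c_def by blast
    then show ?case
      by (rule lqr_good_path.regret_soft_O)
  qed
qed

end
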